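(* Assume (O) and $\lim_{h\to0}\frac1{h^2}\inf\mathcal E^h=0$, and let $y_0\in\mathcal C^\infty(\bar\omega,\mathbb R^3)$ satisfy $(\nabla y_0)^{\mathsf T}\nabla y_0=\bar{\mathcal G}_{2\times2}$ and $((\nabla y_0)^{\mathsf T}\nabla\vec b_0)_{\mathrm{sym}}=\frac12(\bar{\mathcal G}_1)_{2\times2}$. Then $$\mathcal I_4^O(V,\mathbb S)=\frac12\int_\omega\mathcal Q_2\big(x',\mathbb S+\tfrac12\nabla V^{\mathsf T}\nabla V+B_0\big)dx'+\frac1{24}\int_\omega\mathcal Q_2\big(x',\nabla V^{\mathsf T}\nabla\vec b_0+\nabla y_0^{\mathsf T}\nabla\vec p+12B_1\big)dx'$$ $$+\frac1{1440}\int_\omega\mathcal Q_2\big(x',\nabla\vec b_0^{\mathsf T}\nabla\vec b_0+\nabla y_0^{\mathsf T}\nabla\tilde d_0-\tfrac12(\bar{\mathcal G}_2)_{2\times2}\big)dx'+\frac12\mathrm{dist}^2_{\mathcal Q_2}\big(II_{\mathrm{sym}},\mathbb E_2\big),$$ where $\mathrm{dist}^2_{\mathcal Q_2}(II_{\mathrm{sym}},\mathbb E_2)=\mathrm{dist}^2_{\mathcal Q_2}\Big(\big[\partial_j\big(\int_0^{x_3}\mathcal G_1e_3dt\big)_i\big]_{i,j=1,2,\mathrm{sym}}-\big[\langle\int_0^{x_3}\mathcal G_1e_3dt,(\Gamma^1_{ij},\Gamma^2_{ij},\Gamma^3_{ij})(x',0)\rangle\big]_{i,j=1,2}+\frac12\int_0^{x_3}(\mathcal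 G_1)_{33}dt\,[\Gamma^3_{ij}(x',0)]_{i,j=1,2}-\frac14(\mathcal G_2)_{2\times2},\ \mathbb E_2\Big)$, $B_0=\frac1{24}\nabla\vec b_0^{\mathsf T}\nabla\vec b_0-\frac14\int_{-1/2}^{1/2}(\mathcal G_2)_{2\times2}dx_3=\frac1{24}\big[\bar{\mathcal G}_{np}\Gamma^n_{i3}\Gamma^p_{j3}\big]_{i,j=1,2}-\frac14\int_{-1/2}^{1/2}(\mathcal G_2)_{2\times2}dx_3$, and $B_1=\nabla y_0^{\mathsf T}\nabla\big(\int_{-1/2}^{1/2}x_3\vec d_0dx_3\big)-\frac14\int_{-1/2}^{1/2}x_3(\mathcal G_2)_{2\times2}dx_3=-\big[\partial_jm_i\big]_{i,j=1,2}+\big[\langle m,(\Gamma^1_{ij},\Gamma^2_{ij},\Gamma^3_{ij})(x',0)\rangle\big]_{i,j=1,2}-\frac12\int_{-1/2}^{1/2}\frac{x_3^2}2(\mathcal G_1)_{33}dx_3\,[\Gamma^3_{ij}(x',0)]_{i,j=1,2}-\frac14\int_{-1/2}^{1/2}x_3(\mathcal G_2)_{2\times2}dx_3$ with $m=\int_{-1/2}^{1/2}\frac{x_3^2}2\mathcal G_1e_3dx_3$. Here $\Gamma^k_{ij}$ are the Christoffel symbols of the effective metric $\bar G$. The third term equals $\frac1{1440}\int_\omega\mathcal Q_2\big(x',[R_{i3j3}(x',0)]_{i,j=1,2}\big)dx'$ with $R$ the Riemann curvatures of $\bar G$. Moreover, if $\int_{-1/2}^{1/2}(15x_3^2-\frac94)(\mathcal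 G_2)_{2\times2}dx_3=0$ and $\frac14\int_{-1/2}^{1/2}x_3(\mathcal G_2)_{2\times2}dx_3+[\partial_jm_i]_{i,j=1,2,\mathrm{sym}}-[\langle m,(\Gamma^1_{ij},\Gamma^2_{ij},\Gamma^3_{ij})(x',0)\rangle]_{i,j=1,2}+\frac12\int_{-1/2}^{1/2}\frac{x_3^2}2(\mathcal G_1)_{33}dx_3[\Gamma^3_{ij}(x',0)]_{i,j=1,2}=0$ on $\omega$, then the sum of the first three terms equals $\frac12\int_\omega\mathcal Q_2\big(x',\mathbb S+\frac12\nabla V^{\mathsf T}\nabla V+\frac1{24}\nabla\vec b_0^{\mathsf T}\nabla\vec b_0-\frac1{48}(\bar{\mathcal G}_2)_{2\times2}\big)dx'+\frac1{24}\int_\omega\mathcal Q_2\big(x',\nabla y_0^{\mathsf T}\nabla\vec p+\nabla V^{\mathsf T}\nabla\vec b_0\big)dx'+\frac1{1440}\int_\omega\mathcal Q_2\big(x',[R_{i3j3}(x',0)]_{i,j=1,2}\big)dx'$.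
   Context: $\omega\subset\mathbb R^2$ open, bounded, connected, Lipschitz; $\Omega^h=\omega\times(-h/2,h/2)$, $\Omega=\omega\times(-1/2,1/2)$. $W:\mathbb R^{3\times3}\to[0,\infty]$ Borel with $W(RF)=W(F)$ for $R\in SO(3)$, $W=0$ on $SO(3)$, $W(F)\ge c\,\mathrm{dist}^2(F,SO(3))$ ($c>0$), $W$ finite and $\mathcal C^2$ near $SO(3)$. $\mathcal E^h(u)=\frac1h\int_{\Omega^h}W(\nabla u\,(G^h)^{-1/2})dx$. (O): $G^h(x',x_3)=\mathcal G^h(x',x_3/h)$, $\mathcal G^h(x',t)=\bar{\mathcal G}(x')+h\mathcal G_1(x',t)+\frac{h^2}2\mathcal G_2(x',t)+o(h^2)\in\mathcal C^\infty(\bar\Omega,\mathbb R^{3\times3}_{\mathrm{sym,pos}})$, $\bar{\mathcal G}\in\mathcal C^\infty(\bar\omega,\mathbb R^{3\times3}_{\mathrm{sym,pos}})$, $\mathcal G_1,\mathcal G_2\in\mathcal C^\infty(\bar\Omega,\mathbb R^{3\times3}_{\mathrm{sym}})$, $\int_{-1/2}^{1/2}\mathcal G_1dt=0$. Effective metric $\bar G=\bar{\mathcal G}+x_3\bar{\mathcal G}_1+\frac{x_3^2}2\bar{\mathcal G}_2$ with $\bar{\mathcal G}_1$ symmetric, $(\bar{\mathcal G}_1)_{2\times2}=12\int_{-1/2}^{1/2}t(\mathcal G_1)_{2\times2}dt$, $\bar{\mathcal G}_1e_3=-60\int_{-1/2}^{1/2}(2t^3-\frac t2)\mathcal G_1e_3dt$,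 $(\bar{\mathcal G}_2)_{2\times2}=30\int_{-1/2}^{1/2}(6t^2-\frac12)(\mathcal G_2)_{2\times2}dt$. $\vec b_0=(\nabla y_0)(\bar{\mathcal G}_{2\times2})^{-1}(\bar{\mathcal G}_{13},\bar{\mathcal G}_{23})^{\mathsf T}+\sqrt{\det\bar{\mathcal G}/\det\bar{\mathcal G}_{2\times2}}\,\frac{\partial_1y_0\times\partial_2y_0}{|\cdot|}$; $Q_0=[\partial_1y_0,\partial_2y_0,\vec b_0]$; $\vec d_0=Q_0^{-\mathsf T}\big(\int_0^{x_3}\mathcal G_1dt\,e_3-\frac12\int_0^{x_3}(\mathcal G_1)_{33}dt\,e_3-\frac{x_3^2}2[(\nabla\vec b_0)^{\mathsf T}\vec b_0;0]\big)$; $\tilde d_0=Q_0^{-\mathsf T}\big(\bar{\mathcal G}_1e_3-\frac12(\bar{\mathcal G}_1)_{33}e_3-[(\nabla\vec b_0)^{\mathsf T}\vec b_0;0]\big)$; $\vec p=-Q_0^{-\mathsf T}[\nabla V^{\mathsf T}\vec b_0;0]$. $\mathcal I_4^O(V,\mathbb S)=\frac12\int_\Omega\mathcal Q_2(x',I+x_3III+II)dx$ with $I=\mathbb S+\frac12\nabla V^{\mathsf T}\nabla V-\nabla y_0^{\mathsf T}\nabla\int_{-1/2}^{1/2}\vec d_0dx_3$, $III=\nabla y_0^{\mathsf T}\nabla\vec p+\nabla V^{\mathsf T}\nabla\vec b_0$, $II=\frac{x_3^2}2\nabla\vec b_0^{\mathsf T}\nabla\vec b_0+\nabla y_0^{\mathsf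 T}[\partial_1\vec d_0,\partial_2\vec d_0]-\frac14(\mathcal G_2)_{2\times2}$, for $V\in W^{2,2}(\omega,\mathbb R^3)$, $\mathbb S\in L^2(\omega,\mathbb R^{2\times2}_{\mathrm{sym}})$. $\bar A=\bar{\mathcal G}^{1/2}$, $\mathcal Q_3(F)=D^2W(Id_3)(F,F)$, $\mathcal Q_2(x',F)=\min\{\mathcal Q_3(\bar A^{-1}\tilde F\bar A^{-1}):\tilde F_{2\times2}=F\}$; $\|F\|^2_{\mathcal Q_2}=\int_\Omega\mathcal Q_2(x',F)dx$; $\mathbb E_2=\{x_3^2\mathcal F_2(x')+x_3\mathcal F_1(x')+\mathcal F_0(x'):\mathcal F_i\in L^2(\omega,\mathbb R^{2\times2}_{\mathrm{sym}})\}$, $\mathrm{dist}_{\mathcal Q_2}(F,\mathbb E_2)=\inf_{E\in\mathbb E_2}\|F-E\|_{\mathcal Q_2}$. Christoffel symbols $\Gamma^i_{kl}=\frac12\bar G^{im}(\partial_l\bar G_{mk}+\partial_k\bar G_{ml}-\partial_m\bar G_{kl})$ and Riemann curvatures $R_{iklm}=\frac12(\partial_{kl}\bar G_{im}+\partial_{im}\bar G_{kl}-\partial_{km}\bar G_{il}-\partial_{il}\bar G_{km})+\bar G_{np}(\Gamma^n_{kl}\Gamma^p_{im}-\Gamma^n_{km}\Gamma^p_{il})$ of $\bar G$. *)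

theory Defs
  imports "HOL-Analysis.Analysis"
begin

type_synonym mat3 = "real^3^3"
type_synonym mat2 = "real^2^2"

definition pd :: "'a::euclidean_space \<Rightarrow> ('a \<Rightarrow> 'b::real_normed_vector) \<Rightarrow> 'a \<Rightarrow> 'b" where
  "pd b f = (\<lambda>x. frechet_derivative f (at x) b)"

definition iter_pd :: "'a::euclidean_space list \<Rightarrow> ('a \<Rightarrow> 'b::real_normed_vector) \<Rightarrow> 'a \<Rightarrow> 'b" where
  "iter_pd bs f = foldr pd bs f"

definition Ck_on :: "nat \<Rightarrow> 'a::euclidean_space set \<Rightarrow> ('a \<Rightarrow> 'b::real_normed_vector) \<Rightarrow> bool" where
  "Ck_on k U f \<longleftrightarrow>
     (\<forall>bs. set bs \<subseteq> Basis \<longrightarrow> length bs < k \<longrightarrow> (\<forall>x\<in>U. iter_pd bs f differentiable (at x))) \<and>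
     (\<forall>bs. set bs \<subseteq> Basis \<longrightarrow> length bs = k \<longrightarrow> continuous_on U (iter_pd bs f))"

definition Cinf_on :: "'a::euclidean_space set \<Rightarrow> ('a \<Rightarrow> 'b::real_normed_vector) \<Rightarrow> bool" where
  "Cinf_on U f \<longleftrightarrow> (\<forall>k. Ck_on k U f)"

definition Cinf_closure :: "'a::euclidean_space set \<Rightarrow> ('a \<Rightarrow> 'b::real_normed_vector) \<Rightarrow> bool" where
  "Cinf_closure S f \<longleftrightarrow> (\<exists>U. open U \<and> closure S \<subseteq> U \<and> Cinf_on U f)"

definition jac :: "(real^'n \<Rightarrow> real^'m) \<Rightarrow> real^'n \<Rightarrow> real^'n^'m" where
  "jac f x = (\<chi> i j. pd (axis j 1) f x $ i)"

definition loc_int :: "(real^'n) set \<Rightarrow> (real^'n \<Rightarrow> 'b::euclidean_space) \<Rightarrow> bool" where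
  "loc_int U f \<longleftrightarrow> (\<forall>K. compact K \<and> K \<subseteq> U \<longrightarrow> integrable (lebesgue_on K) f)"

definition test_fn :: "(real^'n) set \<Rightarrow> (real^'n \<Rightarrow> real) \<Rightarrow> bool" where
  "test_fn U \<phi> \<longleftrightarrow> Cinf_on UNIV \<phi> \<and> compact (closure {x. \<phi> x \<noteq> 0}) \<and> closure {x. \<phi> x \<noteq> 0} \<subseteq> U"

definition weak_partials :: "(real^'n) set \<Rightarrow> (real^'n \<Rightarrow> 'b::euclidean_space) \<Rightarrow> ('n \<Rightarrow> real^'n \<Rightarrow> 'b) \<Rightarrow> bool" where
  "weak_partials U f Df \<longleftrightarrow> loc_int U f \<and> (\<forall>j. loc_int U (Df j)) \<and>
     (\<forall>\<phi> j. test_fn U \<phi> \<longrightarrow>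
        integral\<^sup>L (lebesgue_on U) (\<lambda>x. pd (axis j 1) \<phi> x *\<^sub>R f x)
          = - integral\<^sup>L (lebesgue_on U) (\<lambda>x. \<phi> x *\<^sub>R Df j x))"

definition L2_on :: "(real^'n) set \<Rightarrow> (real^'n \<Rightarrow> 'b::euclidean_space) \<Rightarrow> bool" where
  "L2_on U f \<longleftrightarrow> f \<in> borel_measurable (lebesgue_on U) \<and> integrable (lebesgue_on U) (\<lambda>x. norm (f x) ^ 2)"

definition W12 :: "(real^'n) set \<Rightarrow> (real^'n \<Rightarrow> 'b::euclidean_space) \<Rightarrow> ('n \<Rightarrow> real^'n \<Rightarrow> 'b) \<Rightarrow> bool" where
  "W12 U u Du \<longleftrightarrow> L2_on U u \<and> weak_partials U u Du \<and> (\<forall>j. L2_on U (Du j))"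

definition W22 :: "(real^'n) set \<Rightarrow> (real^'n \<Rightarrow> 'b::euclidean_space) \<Rightarrow> ('n \<Rightarrow> real^'n \<Rightarrow> 'b) \<Rightarrow> bool" where
  "W22 U V DV \<longleftrightarrow> W12 U V DV \<and> (\<exists>D2V. \<forall>j. W12 U (DV j) (D2V j))"

definition wgrad :: "('n \<Rightarrow> real^'n \<Rightarrow> real^'m) \<Rightarrow> real^'n \<Rightarrow> real^'n^'m" where
  "wgrad Du x = (\<chi> i j. Du j x $ i)"

definition oint :: "real \<Rightarrow> real \<Rightarrow> (real \<Rightarrow> 'b::euclidean_space) \<Rightarrow> 'b" where
  "oint a b f = (if a \<le> b then integral {a..b} f else - integral {b..a} f)"

definition symm :: "real^'n^'n \<Rightarrow> bool" where
  "symm A \<longleftrightarrow> transpose A = A"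

definition posdef :: "real^'n^'n \<Rightarrow> bool" where
  "posdef A \<longleftrightarrow> symm A \<and> (\<forall>v. v \<noteq> 0 \<longrightarrow> v \<bullet> (A *v v) > 0)"

definition symp :: "real^'n^'n \<Rightarrow> real^'n^'n" where
  "symp A = (1/2) *\<^sub>R (A + transpose A)"

definition msqrt :: "real^'n^'n \<Rightarrow> real^'n^'n" where
  "msqrt A = (THE B. posdef B \<and> B ** B = A)"

definition SO3 :: "mat3 set" where
  "SO3 = {R. rotation_matrix R}"

definition emb :: "2 \<Rightarrow> 3" where
  "emb i = (if i = 1 then 1 else 2)"

definition blk22 :: "mat3 \<Rightarrow> mat2" where
  "blk22 A = (\<chi> i j. A $ emb i $ emb j)"

definition col3 :: "mat3 \<Rightarrow> real^3" where
  "col3 A = (\<chi> i. A $ i $ 3)"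

definition ext3 :: "real^2 \<Rightarrow> real^3" where
  "ext3 v = vector [v$1, v$2, 0]"

definition pt3 :: "real^2 \<Rightarrow> real \<Rightarrow> real^3" where
  "pt3 x' t = vector [x'$1, x'$2, t]"

definition proj2 :: "real^3 \<Rightarrow> real^2" where
  "proj2 x = vector [x$1, x$2]"

definition lipschitz_domain2 :: "(real^2) set \<Rightarrow> bool" where
  "lipschitz_domain2 \<omega> \<longleftrightarrow> (\<forall>p\<in>frontier \<omega>. \<exists>r>0. \<exists>R::real^2^2. \<exists>g::real\<Rightarrow>real. \<exists>L.
      orthogonal_matrix R \<and> lipschitz_on L UNIV g \<and>
      (\<forall>x\<in>ball p r. x \<in> \<omega> \<longleftrightarrow> (R *v (x - p))$2 < g ((R *v (x - p))$1)))"

definition Omega :: "(real^2) set \<Rightarrow> (real^3) set" where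
  "Omega \<omega> = {x. proj2 x \<in> \<omega> \<and> -1/2 < x$3 \<and> x$3 < 1/2}"

definition Omega_h :: "(real^2) set \<Rightarrow> real \<Rightarrow> (real^3) set" where
  "Omega_h \<omega> h = {x. proj2 x \<in> \<omega> \<and> -h/2 < x$3 \<and> x$3 < h/2}"

text \<open>Gh h x = calligraphic G^h(x',t) with x = (x',t).  G^h(x',x3) = Gh h (x', x3/h).\<close>
definition energy :: "(mat3 \<Rightarrow> ennreal) \<Rightarrow> (real \<Rightarrow> real^3 \<Rightarrow> mat3) \<Rightarrow> (real^2) set \<Rightarrow> real
                       \<Rightarrow> (3 \<Rightarrow> real^3 \<Rightarrow> real^3) \<Rightarrow> ennreal" where
  "energy W Gh \<omega> h Du = ennreal (1/h) *
     (\<integral>\<^sup>+x\<in>Omega_h \<omega> h. W (wgrad Du x ** matrix_inv (msqrt (Gh h (pt3 (proj2 x) (x$3 / h))))) \<partial>lebesgue)"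

definition inf_energy :: "(mat3 \<Rightarrow> ennreal) \<Rightarrow> (real \<Rightarrow> real^3 \<Rightarrow> mat3) \<Rightarrow> (real^2) set \<Rightarrow> real \<Rightarrow> ennreal" where
  "inf_energy W Gh \<omega> h =
     (INF Du \<in> {Du. \<exists>u::real^3 \<Rightarrow> real^3. W12 (Omega_h \<omega> h) u Du}. energy W Gh \<omega> h Du)"

definition Q3 :: "(mat3 \<Rightarrow> ennreal) \<Rightarrow> mat3 \<Rightarrow> real" where
  "Q3 W F = (\<Sum>b\<in>Basis. \<Sum>b'\<in>Basis. (F \<bullet> b) * (F \<bullet> b') * pd b (pd b' (\<lambda>G. enn2real (W G))) (mat 1))"

definition Q2 :: "(mat3 \<Rightarrow> ennreal) \<Rightarrow> (real^2 \<Rightarrow> mat3) \<Rightarrow> real^2 \<Rightarrow> mat2 \<Rightarrow> real" where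
  "Q2 W Gbar x' F = Inf {Q3 W (matrix_inv (msqrt (Gbar x')) ** Ft ** matrix_inv (msqrt (Gbar x'))) | Ft. blk22 Ft = F}"

definition Gb1 :: "(real^3 \<Rightarrow> mat3) \<Rightarrow> real^2 \<Rightarrow> mat3" where
  "Gb1 G1 x' = (\<chi> i j.
     if i \<noteq> 3 \<and> j \<noteq> 3 then 12 * integral {-1/2..1/2} (\<lambda>t. t * G1 (pt3 x' t) $ i $ j)
     else if j = 3 then -60 * integral {-1/2..1/2} (\<lambda>t. (2*t^3 - t/2) * G1 (pt3 x' t) $ i $ 3)
     else -60 * integral {-1/2..1/2} (\<lambda>t. (2*t^3 - t/2) * G1 (pt3 x' t) $ j $ 3))"

text \<open>the prescribed 2x2 block of calligraphic G-bar_2\<close>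
definition Gb2_22 :: "(real^3 \<Rightarrow> mat3) \<Rightarrow> real^2 \<Rightarrow> mat2" where
  "Gb2_22 G2 x' = integral {-1/2..1/2} (\<lambda>t. (30 * (6*t^2 - 1/2)) *\<^sub>R blk22 (G2 (pt3 x' t)))"

definition Geff :: "(real^2 \<Rightarrow> mat3) \<Rightarrow> (real^3 \<Rightarrow> mat3) \<Rightarrow> (real^2 \<Rightarrow> mat3) \<Rightarrow> real^3 \<Rightarrow> mat3" where
  "Geff Gbar G1 Gb2 x = Gbar (proj2 x) + (x$3) *\<^sub>R Gb1 G1 (proj2 x) + ((x$3)^2/2) *\<^sub>R Gb2 (proj2 x)"

definition dG :: "(real^3 \<Rightarrow> mat3) \<Rightarrow> 3 \<Rightarrow> real^3 \<Rightarrow> mat3" where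
  "dG G l = pd (axis l 1) G"

definition Chr :: "(real^3 \<Rightarrow> mat3) \<Rightarrow> 3 \<Rightarrow> 3 \<Rightarrow> 3 \<Rightarrow> real^3 \<Rightarrow> real" where
  "Chr G i k l x = (1/2) * (\<Sum>m\<in>UNIV. matrix_inv (G x) $ i $ m *
       (dG G l x $ m $ k + dG G k x $ m $ l - dG G m x $ k $ l))"

definition Riem :: "(real^3 \<Rightarrow> mat3) \<Rightarrow> 3 \<Rightarrow> 3 \<Rightarrow> 3 \<Rightarrow> 3 \<Rightarrow> real^3 \<Rightarrow> real" where
  "Riem G i k l m x =
     (1/2) * (dG (dG G l) k x $ i $ m + dG (dG G m) i x $ k $ l
              - dG (dG G m) k x $ i $ l - dG (dG G l) i x $ k $ m)
     + (\<Sum>n\<in>UNIV. \<Sum>p\<in>UNIV. G x $ n $ p * (Chr G n k l x * Chr G p i m x - Chr G n k m x * Chr G p i l x))"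

definition Gvec :: "(real^3 \<Rightarrow> mat3) \<Rightarrow> 3 \<Rightarrow> 3 \<Rightarrow> real^2 \<Rightarrow> real^3" where
  "Gvec G i j x' = (\<chi> k. Chr G k i j (pt3 x' 0))"

definition b0 :: "(real^2 \<Rightarrow> real^3) \<Rightarrow> (real^2 \<Rightarrow> mat3) \<Rightarrow> real^2 \<Rightarrow> real^3" where
  "b0 y0 Gbar x' =
     (let d1 = pd (axis 1 1) y0 x'; d2 = pd (axis 2 1) y0 x'; c = cross3 d1 d2 in
      jac y0 x' *v (matrix_inv (blk22 (Gbar x')) *v vector [Gbar x' $ 1 $ 3, Gbar x' $ 2 $ 3])
      + sqrt (det (Gbar x') / det (blk22 (Gbar x'))) *\<^sub>R ((1 / norm c) *\<^sub>R c))"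

definition Q0 :: "(real^2 \<Rightarrow> real^3) \<Rightarrow> (real^2 \<Rightarrow> mat3) \<Rightarrow> real^2 \<Rightarrow> mat3" where
  "Q0 y0 Gbar x' = (\<chi> i j. if j = 1 then pd (axis 1 1) y0 x' $ i
                          else if j = 2 then pd (axis 2 1) y0 x' $ i else b0 y0 Gbar x' $ i)"

definition Q0mT :: "(real^2 \<Rightarrow> real^3) \<Rightarrow> (real^2 \<Rightarrow> mat3) \<Rightarrow> real^2 \<Rightarrow> mat3" where
  "Q0mT y0 Gbar x' = matrix_inv (transpose (Q0 y0 Gbar x'))"

definition d0 :: "(real^2 \<Rightarrow> real^3) \<Rightarrow> (real^2 \<Rightarrow> mat3) \<Rightarrow> (real^3 \<Rightarrow> mat3) \<Rightarrow> real^3 \<Rightarrow> real^3" where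
  "d0 y0 Gbar G1 x = (let x' = proj2 x; s = x$3 in
     Q0mT y0 Gbar x' *v
       (oint 0 s (\<lambda>t. col3 (G1 (pt3 x' t)))
        - ((1/2) * oint 0 s (\<lambda>t. G1 (pt3 x' t) $ 3 $ 3)) *\<^sub>R axis 3 1
        - (s^2/2) *\<^sub>R ext3 (transpose (jac (b0 y0 Gbar) x') *v b0 y0 Gbar x')))"

definition dt0 :: "(real^2 \<Rightarrow> real^3) \<Rightarrow> (real^2 \<Rightarrow> mat3) \<Rightarrow> (real^3 \<Rightarrow> mat3) \<Rightarrow> real^2 \<Rightarrow> real^3" where
  "dt0 y0 Gbar G1 x' =
     Q0mT y0 Gbar x' *v
       (col3 (Gb1 G1 x') - ((1/2) * Gb1 G1 x' $ 3 $ 3) *\<^sub>R axis 3 1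
        - ext3 (transpose (jac (b0 y0 Gbar) x') *v b0 y0 Gbar x'))"

definition pvec :: "(real^2 \<Rightarrow> real^3) \<Rightarrow> (real^2 \<Rightarrow> mat3) \<Rightarrow> (2 \<Rightarrow> real^2 \<Rightarrow> real^3) \<Rightarrow> real^2 \<Rightarrow> real^3" where
  "pvec y0 Gbar DV x' = - (Q0mT y0 Gbar x' *v ext3 (transpose (wgrad DV x') *v b0 y0 Gbar x'))"

text \<open>DV: weak partials of V; P: weak partials of p.\<close>
definition I4O :: "(mat3 \<Rightarrow> ennreal) \<Rightarrow> (real^2) set \<Rightarrow> (real^2 \<Rightarrow> real^3) \<Rightarrow> (real^2 \<Rightarrow> mat3)
   \<Rightarrow> (real^3 \<Rightarrow> mat3) \<Rightarrow> (real^3 \<Rightarrow> mat3) \<Rightarrow> (2 \<Rightarrow> real^2 \<Rightarrow> real^3) \<Rightarrow> (2 \<Rightarrow> real^2 \<Rightarrow> real^3)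
   \<Rightarrow> (real^2 \<Rightarrow> mat2) \<Rightarrow> real" where
  "I4O W \<omega> y0 Gbar G1 G2 DV P S =
    (let Iterm = (\<lambda>x'. S x' + (1/2) *\<^sub>R (transpose (wgrad DV x') ** wgrad DV x')
                   - transpose (jac y0 x') ** jac (\<lambda>z. integral {-1/2..1/2} (\<lambda>t. d0 y0 Gbar G1 (pt3 z t))) x');
         IIIterm = (\<lambda>x'. transpose (jac y0 x') ** wgrad P x' + transpose (wgrad DV x') ** jac (b0 y0 Gbar) x');
         IIterm = (\<lambda>x. ((x$3)^2/2) *\<^sub>R (transpose (jac (b0 y0 Gbar) (proj2 x)) ** jac (b0 y0 Gbar) (proj2 x))
                   + transpose (jac y0 (proj2 x)) ** jac (\<lambda>z. d0 y0 Gbar G1 (pt3 z (x$3))) (proj2 x)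
                   - (1/4) *\<^sub>R blk22 (G2 x))
     in (1/2) * integral\<^sup>L (lebesgue_on (Omega \<omega>))
          (\<lambda>x. Q2 W Gbar (proj2 x) (Iterm (proj2 x) + (x$3) *\<^sub>R IIIterm (proj2 x) + IIterm x)))"

definition II_sym :: "(real^2 \<Rightarrow> real^3) \<Rightarrow> (real^2 \<Rightarrow> mat3) \<Rightarrow> (real^3 \<Rightarrow> mat3) \<Rightarrow> (real^3 \<Rightarrow> mat3) \<Rightarrow> real^3 \<Rightarrow> mat2" where
  "II_sym y0 Gbar G1 G2 x = symp
     (((x$3)^2/2) *\<^sub>R (transpose (jac (b0 y0 Gbar) (proj2 x)) ** jac (b0 y0 Gbar) (proj2 x))
      + transpose (jac y0 (proj2 x)) ** jac (\<lambda>z. d0 y0 Gbar G1 (pt3 z (x$3))) (proj2 x)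
      - (1/4) *\<^sub>R blk22 (G2 x))"

definition E2 :: "(real^2) set \<Rightarrow> (real^3 \<Rightarrow> mat2) set" where
  "E2 \<omega> = {E. \<exists>F0 F1 F2. (\<forall>F\<in>{F0,F1,F2}. L2_on \<omega> F \<and> (\<forall>x\<in>\<omega>. symm (F x))) \<and>
             E = (\<lambda>x. (x$3)^2 *\<^sub>R F2 (proj2 x) + (x$3) *\<^sub>R F1 (proj2 x) + F0 (proj2 x))}"

definition normQ2 :: "(mat3 \<Rightarrow> ennreal) \<Rightarrow> (real^2 \<Rightarrow> mat3) \<Rightarrow> (real^2) set \<Rightarrow> (real^3 \<Rightarrow> mat2) \<Rightarrow> real" where
  "normQ2 W Gbar \<omega> F = sqrt (integral\<^sup>L (lebesgue_on (Omega \<omega>)) (\<lambda>x. Q2 W Gbar (proj2 x) (F x)))"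

definition distQ2 :: "(mat3 \<Rightarrow> ennreal) \<Rightarrow> (real^2 \<Rightarrow> mat3) \<Rightarrow> (real^2) set \<Rightarrow> (real^3 \<Rightarrow> mat2) \<Rightarrow> real" where
  "distQ2 W Gbar \<omega> F = Inf ((\<lambda>E. normQ2 W Gbar \<omega> (\<lambda>x. F x - E x)) ` E2 \<omega>)"

definition mvec :: "(real^3 \<Rightarrow> mat3) \<Rightarrow> real^2 \<Rightarrow> real^3" where
  "mvec G1 x' = integral {-1/2..1/2} (\<lambda>t. (t^2/2) *\<^sub>R col3 (G1 (pt3 x' t)))"

definition Gam3 :: "(real^3 \<Rightarrow> mat3) \<Rightarrow> real^2 \<Rightarrow> mat2" where
  "Gam3 G x' = (\<chi> i j. Chr G 3 (emb i) (emb j) (pt3 x' 0))"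

definition GamPair :: "(real^3 \<Rightarrow> mat3) \<Rightarrow> real^3 \<Rightarrow> real^2 \<Rightarrow> mat2" where
  "GamPair G v x' = (\<chi> i j. v \<bullet> Gvec G (emb i) (emb j) x')"

definition grad2 :: "(real^2 \<Rightarrow> real^3) \<Rightarrow> real^2 \<Rightarrow> mat2" where
  "grad2 v x' = (\<chi> i j. pd (axis j 1) v x' $ emb i)"

definition Rmat :: "(real^3 \<Rightarrow> mat3) \<Rightarrow> real^2 \<Rightarrow> mat2" where
  "Rmat G x' = (\<chi> i j. Riem G (emb i) 3 (emb j) 3 (pt3 x' 0))"

definition B0 :: "(real^2 \<Rightarrow> real^3) \<Rightarrow> (real^2 \<Rightarrow> mat3) \<Rightarrow> (real^3 \<Rightarrow> mat3) \<Rightarrow> real^2 \<Rightarrow> mat2" where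
  "B0 y0 Gbar G2 x' = (1/24) *\<^sub>R (transpose (jac (b0 y0 Gbar) x') ** jac (b0 y0 Gbar) x')
      - (1/4) *\<^sub>R integral {-1/2..1/2} (\<lambda>t. blk22 (G2 (pt3 x' t)))"

definition B1 :: "(real^2 \<Rightarrow> real^3) \<Rightarrow> (real^2 \<Rightarrow> mat3) \<Rightarrow> (real^3 \<Rightarrow> mat3) \<Rightarrow> (real^3 \<Rightarrow> mat3) \<Rightarrow> real^2 \<Rightarrow> mat2" where
  "B1 y0 Gbar G1 G2 x' = transpose (jac y0 x') ** jac (\<lambda>z. integral {-1/2..1/2} (\<lambda>t. t *\<^sub>R d0 y0 Gbar G1 (pt3 z t))) x'
      - (1/4) *\<^sub>R integral {-1/2..1/2} (\<lambda>t. t *\<^sub>R blk22 (G2 (pt3 x' t)))"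

end

theory Submission
  imports Defs
begin

text \<open>For fixed \<open>x'\<close> the integrand of the energy is a positive semidefinite quadratic form evaluated on
  \<open>I + x\<^sub>3 III + II\<close>. Expanding \<open>II\<close> along the \<open>L\<^sup>2\<close>-orthogonal Legendre polynomials
  \<open>1\<close>, \<open>x\<^sub>3\<close>, \<open>6 x\<^sub>3\<^sup>2 - 1/2\<close>, whose squared norms on the unit thickness are \<open>1\<close>, \<open>1/12\<close>, \<open>1/5\<close>, splits the energy by Pythagoras
  into three bulk terms and the squared distance of \<open>II\<close> to quadratic polynomials in \<open>x\<^sub>3\<close>. The moments of \<open>II\<close> are computed by
  integrating the primitives of \<open>G\<^sub>1\<close> by parts.

  In the frame \<open>Q\<^sub>0 = [\<partial>\<^sub>1 y\<^sub>0, \<partial>\<^sub>2 y\<^sub>0, b\<^sub>0]\<close> the Christoffel symbols of the effective metric at \<open>x\<^sub>3 = 0\<close> are the coordinates of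
  \<open>\<partial>\<^sub>i\<^sub>j y\<^sub>0\<close>, \<open>\<partial>\<^sub>i b\<^sub>0\<close> and \<open>dt0\<close>; this turns the moments into the stated tensors and the third one
  into \<open>R\<^sub>i\<^sub>3\<^sub>j\<^sub>3\<close>.

  The splitting needs all fields to be square integrable. For \<open>\<nabla>V\<^sup>T \<nabla>V\<close> this is the embedding of \<open>W\<^sup>1\<^sup>,\<^sup>2\<close> into \<open>L\<^sup>4\<close> on planar
  Lipschitz domains, proved by Gagliardo's product trick along two transversal families of segments inside the domain.\<close>

section \<open>Calculus of smooth functions\<close>

text \<open>\<open>Q2\<close> is defined as an infimum, so being a quadratic form is something to
  prove; and it is only semidefinite, because \<open>Q3\<close> vanishes on skew matrices:
  \<open>W\<close> is zero along every curve of rotations through the identity. This degeneracy is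
  also what lets \<open>II\<close> be replaced by its symmetric part. The factors come from
  normalisation. The Legendre coefficient of degree i is the i-th moment divided by
  \<open>leg_sq i\<close>. The linear term thus carries 1/2 * 1/12 = 1/24, and the quadratic one 1/2
  * 1/5 * (5/60)^2 = 1/1440, where 1/60 is the integral of (6 t^2 - 1/2) t^2/2. The number 60 in
  \<open>Gb1\<close> has the same origin. The weights of the effective metric fit this expansion: 2
  t^3 - t/2 is the primitive of 6 t^2 - 1/2 that vanishes at both faces, so integration by parts
  leaves no boundary term, while for the weight t the mean-zero condition on \<open>G1\<close>
  removes it. Each datum is smooth on a neighbourhood of its own; derivatives and inverses are taken
  on one common neighbourhood N times (-rho, rho) with rho > 1/2, on which the relevant determinants
  stay positive.\<close>

lemma pd_cong_open:
  assumes "open U" "x \<in> U" "\<And>y. y \<in> U \<Longrightarrow> f y = g y"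
  shows "pd b f x = pd b g x"
proof -
  \<comment> \<open>\<open>frechet_derivative\<close> chooses one of the derivatives at x, so both
    sides agree once the two functions have exactly the same derivatives there, whether or not any
    exist.\<close>
  have "(f has_derivative f') (at x) \<longleftrightarrow> (g has_derivative f') (at x)" for f'
    using has_derivative_transform_within_open[of f f' x UNIV U g]
      has_derivative_transform_within_open[of g f' x UNIV U f] assms by auto
  then show ?thesis by (simp add: pd_def frechet_derivative_def)
qed

lemma pd_eqI: "(f has_derivative f') (at x) \<Longrightarrow> pd b f x = f' b"
  unfolding pd_def by (metis frechet_derivative_at)

lemma differentiable_cong_open:
  assumes "open U" "x \<in> U" "\<And>y. y \<in> U \<Longrightarrow> f y = g y" "f differentiable (at x)"
  shows "g differentiable (at x)"
  using has_derivative_transform_within_open[of f _ x UNIV U g] assms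
  unfolding differentiable_def by blast

lemma iter_pd_Cons: "iter_pd (b # bs) f = pd b (iter_pd bs f)"
  and iter_pd_snoc: "iter_pd (bs @ [b]) f = iter_pd bs (pd b f)"
  and iter_pd_Nil: "iter_pd [] f = f"
  by (simp_all add: iter_pd_def)

lemma iter_pd_cong_open:
  assumes "open U" "\<And>y. y \<in> U \<Longrightarrow> f y = g y" "x \<in> U"
  shows "iter_pd bs f x = iter_pd bs g x"
  using assms(3)
proof (induction bs arbitrary: x)
  case (Cons b bs)
  show ?case unfolding iter_pd_Cons
    by (rule pd_cong_open[OF assms(1) Cons.prems]) (rule Cons.IH)
qed (simp add: iter_pd_Nil assms)

text \<open>At infinite order the continuity clause of \<open>Ck_on\<close> follows from
  differentiability of the same iterated derivative. This leaves a criterion that is checked one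
  list of directions at a time.\<close>

lemma Cinf_on_iff:
  "Cinf_on U f \<longleftrightarrow> (\<forall>bs. set bs \<subseteq> Basis \<longrightarrow> (\<forall>x\<in>U. iter_pd bs f differentiable (at x)))"
proof
  assume R: "\<forall>bs. set bs \<subseteq> Basis \<longrightarrow> (\<forall>x\<in>U. iter_pd bs f differentiable (at x))"
  then have "continuous_on U (iter_pd bs f)" if "set bs \<subseteq> Basis" for bs
    using that by (intro differentiable_imp_continuous_on differentiable_at_imp_differentiable_on) auto
  with R show "Cinf_on U f" by (auto simp: Cinf_on_def Ck_on_def)
next
  assume L: "Cinf_on U f"
  show "\<forall>bs. set bs \<subseteq> Basis \<longrightarrow> (\<forall>x\<in>U. iter_pd bs f differentiable (at x))"
  proof (intro allI impI)
    fix bs :: "'a list" assume "set bs \<subseteq> Basis"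
    then show "\<forall>x\<in>U. iter_pd bs f differentiable (at x)"
      \<comment> \<open>\<open>Ck_on k\<close> differentiates only lists of length below k, so a
        list of length n is reached through order n + 1.\<close>
      using L[unfolded Cinf_on_def, rule_format, of "Suc (length bs)"] unfolding Ck_on_def by simp
  qed
qed

text \<open>Smoothness as a greatest fixed point: it suffices to exhibit a class of differentiable
  functions that is closed under partial derivatives. The later closure properties each name such a
  class and so avoid formulas for higher derivatives. Derivatives have to match a member of the
  class on U only.\<close>

lemma Cinf_on_coinduct:
  assumes U: "open U" and P: "P f"
    and diff: "\<And>f x. P f \<Longrightarrow> x \<in> U \<Longrightarrow> f differentiable (at x)"
    and step: "\<And>f b. P f \<Longrightarrow> b \<in> Basis \<Longrightarrow> \<exists>g. P g \<and> (\<forall>x\<in>U. pd b f x = g x)"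
  shows "Cinf_on U f"
proof -
  have "\<forall>x\<in>U. iter_pd bs f differentiable (at x)" if "set bs \<subseteq> Basis" "P f" for bs f
    using that
  \<comment> \<open>The last entry of the list is the derivative taken first, so peeling from the
    right replaces f by its first derivative.\<close>
  proof (induction bs arbitrary: f rule: rev_induct)
    case Nil then show ?case using diff by (simp add: iter_pd_Nil)
  next
    case (snoc b bs)
    obtain g where g: "P g" "\<forall>x\<in>U. pd b f x = g x" using step[of f b] snoc.prems by auto
    have "\<forall>x\<in>U. iter_pd bs g differentiable (at x)" using snoc g by auto
    moreover have "iter_pd bs g y = iter_pd bs (pd b f) y" if "y \<in> U" for y
      by (rule iter_pd_cong_open[OF U _ that]) (use g in auto)
    ultimately show ?case unfolding iter_pd_snoc using differentiable_cong_open[OF U] by blast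
  qed
  with P show ?thesis by (auto simp: Cinf_on_iff)
qed

lemma Cinf_on_differentiable: "Cinf_on U f \<Longrightarrow> x \<in> U \<Longrightarrow> f differentiable (at x)"
  by (metis Cinf_on_iff empty_set empty_subsetI iter_pd_Nil)

lemma Cinf_on_pd: "Cinf_on U f \<Longrightarrow> b \<in> Basis \<Longrightarrow> Cinf_on U (pd b f)"
  unfolding Cinf_on_iff
proof (intro allI impI)
  fix bs :: "'a list"
  assume *: "\<forall>bs. set bs \<subseteq> Basis \<longrightarrow> (\<forall>x\<in>U. iter_pd bs f differentiable at x)" "b \<in> Basis" "set bs \<subseteq> Basis"
  then show "\<forall>x\<in>U. iter_pd bs (pd b f) differentiable at x"
    using *(1)[rule_format, of "bs @ [b]"] by (simp add: iter_pd_snoc)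
qed

lemma Cinf_on_continuous: "Cinf_on U f \<Longrightarrow> continuous_on U f"
  by (intro differentiable_imp_continuous_on differentiable_at_imp_differentiable_on Cinf_on_differentiable)

lemma Cinf_on_subset: "Cinf_on U f \<Longrightarrow> V \<subseteq> U \<Longrightarrow> Cinf_on V f"
  by (auto simp: Cinf_on_iff)

lemma Cinf_on_cong:
  assumes "open U" "\<And>x. x \<in> U \<Longrightarrow> f x = g x" "Cinf_on U f" shows "Cinf_on U g"
proof (unfold Cinf_on_iff, intro allI impI ballI)
  fix bs :: "'a list" and x assume "set bs \<subseteq> Basis" "x \<in> U"
  then have "iter_pd bs f differentiable at x" using assms(3) by (simp add: Cinf_on_iff)
  then show "iter_pd bs g differentiable at x"
    by (rule differentiable_cong_open[OF assms(1) \<open>x \<in> U\<close>, rotated]) (rule iter_pd_cong_open[OF assms(1,2)])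
qed

lemma Cinf_on_Un: "Cinf_on U f \<Longrightarrow> Cinf_on V f \<Longrightarrow> Cinf_on (U \<union> V) f"
  by (auto simp: Cinf_on_iff)

lemma Cinf_on_const: "open U \<Longrightarrow> Cinf_on U (\<lambda>x. c)"
  by (rule Cinf_on_coinduct[where P = "\<lambda>f. \<exists>c. f = (\<lambda>x. c)"]) (auto simp: pd_def)

lemma Cinf_on_linear:
  assumes "open U" "bounded_linear f" shows "Cinf_on U f"
proof (rule Cinf_on_coinduct[where P = "\<lambda>f. bounded_linear f \<or> (\<exists>c. f = (\<lambda>x. c))"])
  fix f :: "'a \<Rightarrow> 'b" and b :: 'a assume "bounded_linear f \<or> (\<exists>c. f = (\<lambda>x. c))"
  then show "\<exists>g. (bounded_linear g \<or> (\<exists>c. g = (\<lambda>x. c))) \<and> (\<forall>x\<in>U. pd b f x = g x)"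
  proof
    assume "bounded_linear f"
    then have "pd b f x = f b" for x by (intro pd_eqI bounded_linear_imp_has_derivative)
    then show ?thesis by auto
  qed (auto simp: pd_def)
next
  fix f :: "'a \<Rightarrow> 'b" and x :: 'a assume "bounded_linear f \<or> (\<exists>c. f = (\<lambda>x. c))"
  then show "f differentiable at x" using bounded_linear_imp_differentiable by auto
qed (use assms in auto)

lemma Cinf_on_has_derivative:
  assumes "f differentiable (at x)"
  shows "(f has_derivative (\<lambda>h. \<Sum>b\<in>Basis. (h \<bullet> b) *\<^sub>R pd b f x)) (at x)"
proof -
  have *: "(f has_derivative frechet_derivative f (at x)) (at x)"
    using assms by (simp add: frechet_derivative_works)
  then have lin: "linear (frechet_derivative f (at x))"
    by (simp add: has_derivative_bounded_linear bounded_linear.linear)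
  have "frechet_derivative f (at x) h = (\<Sum>b\<in>Basis. (h \<bullet> b) *\<^sub>R pd b f x)" for h
    unfolding pd_def
    by (subst (1) euclidean_representation[of h, symmetric])
       (simp add: linear_sum[OF lin] linear_scale[OF lin])
  then have "frechet_derivative f (at x) = (\<lambda>h. \<Sum>b\<in>Basis. (h \<bullet> b) *\<^sub>R pd b f x)" by auto
  with * show ?thesis by simp
qed

lemma pd_linear_comp:
  assumes "bounded_linear h" "f differentiable (at x)"
  shows "pd b (\<lambda>x. h (f x)) x = h (pd b f x)"
proof -
  have "((\<lambda>x. h (f x)) has_derivative (\<lambda>v. h (frechet_derivative f (at x) v))) (at x)"
    by (rule bounded_linear.has_derivative[OF assms(1)]) (use assms in \<open>simp add: frechet_derivative_works[symmetric]\<close>)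
  from pd_eqI[OF this] show ?thesis by (simp add: pd_def)
qed

lemma Cinf_on_linear_comp:
  assumes U: "open U" and h: "bounded_linear h" and f: "Cinf_on U f"
  shows "Cinf_on U (\<lambda>x. h (f x))"
proof (rule Cinf_on_coinduct[where P = "\<lambda>g. \<exists>f. Cinf_on U f \<and> g = (\<lambda>x. h (f x))", OF U])
  fix g x assume "\<exists>f. Cinf_on U f \<and> g = (\<lambda>x. h (f x))" "x \<in> U"
  then show "g differentiable at x"
    using bounded_linear_imp_differentiable[OF h] differentiable_chain_at[of _ x h]
    by (auto dest!: Cinf_on_differentiable simp: o_def)
next
  fix g and b :: 'a assume "\<exists>f. Cinf_on U f \<and> g = (\<lambda>x. h (f x))" "b \<in> Basis"
  then obtain f where f: "Cinf_on U f" "g = (\<lambda>x. h (f x))" by auto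
  then show "\<exists>ga. (\<exists>f. Cinf_on U f \<and> ga = (\<lambda>x. h (f x))) \<and> (\<forall>x\<in>U. pd b g x = ga x)"
    using Cinf_on_pd[OF f(1) \<open>b \<in> Basis\<close>] pd_linear_comp[OF h Cinf_on_differentiable[OF f(1)]]
    by (intro exI[of _ "\<lambda>x. h (pd b f x)"]) auto
qed (use f in auto)

lemma Cinf_on_componentwise:
  fixes f :: "'a::euclidean_space \<Rightarrow> 'b::euclidean_space"
  assumes U: "open U"
  shows "Cinf_on U f \<longleftrightarrow> (\<forall>c\<in>Basis. Cinf_on U (\<lambda>x. f x \<bullet> c))"
proof
  assume "Cinf_on U f" then show "\<forall>c\<in>Basis. Cinf_on U (\<lambda>x. f x \<bullet> c)"
    using Cinf_on_linear_comp[OF U bounded_linear_inner_left] by blast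
next
  have diff: "g differentiable at x" if "\<forall>c\<in>Basis. Cinf_on U (\<lambda>x. g x \<bullet> c)" "x \<in> U" for g :: "'a \<Rightarrow> 'b" and x
    using that differentiable_componentwise_within[of g x UNIV] Cinf_on_differentiable by blast
  assume R: "\<forall>c\<in>Basis. Cinf_on U (\<lambda>x. f x \<bullet> c)"
  show "Cinf_on U f"
  proof (rule Cinf_on_coinduct[where P = "\<lambda>f. \<forall>c\<in>Basis. Cinf_on U (\<lambda>x. f x \<bullet> c)", OF U])
    fix g :: "'a \<Rightarrow> 'b" and b :: 'a assume g: "\<forall>c\<in>Basis. Cinf_on U (\<lambda>x. g x \<bullet> c)" "b \<in> Basis"
    have "Cinf_on U (\<lambda>x. pd b g x \<bullet> c)" if "c \<in> Basis" for c
    proof (rule Cinf_on_cong[OF U])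
      show "Cinf_on U (pd b (\<lambda>x. g x \<bullet> c))" using g that Cinf_on_pd by blast
      show "pd b (\<lambda>x. g x \<bullet> c) x = pd b g x \<bullet> c" if "x \<in> U" for x
        using pd_linear_comp[OF bounded_linear_inner_left diff[OF g(1) that]] .
    qed
    then show "\<exists>ga. (\<forall>c\<in>Basis. Cinf_on U (\<lambda>x. ga x \<bullet> c)) \<and> (\<forall>x\<in>U. pd b g x = ga x)" by blast
  qed (use R diff in auto)
qed

lemma Cinf_on_vec_iff:
  fixes f :: "'a::euclidean_space \<Rightarrow> ('b::euclidean_space)^'n"
  assumes U: "open U"
  shows "Cinf_on U f \<longleftrightarrow> (\<forall>i. Cinf_on U (\<lambda>x. f x $ i))"
proof -
  have "Cinf_on U f \<longleftrightarrow> (\<forall>i. \<forall>c\<in>Basis. Cinf_on U (\<lambda>x. f x $ i \<bullet> c))"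
    by (subst Cinf_on_componentwise[OF U]) (auto simp: Basis_vec_def inner_axis)
  also have "\<dots> \<longleftrightarrow> (\<forall>i. Cinf_on U (\<lambda>x. f x $ i))"
    using Cinf_on_componentwise[OF U, of "\<lambda>x. f x $ i" for i] by simp
  finally show ?thesis .
qed

lemma Cinf_on_nth:
  fixes f :: "'a::euclidean_space \<Rightarrow> ('b::euclidean_space)^'n"
  shows "open U \<Longrightarrow> Cinf_on U f \<Longrightarrow> Cinf_on U (\<lambda>x. f x $ i)"
  by (simp add: Cinf_on_vec_iff)

subsection \<open>Algebra of real-valued smooth functions\<close>

text \<open>The classical flat function exp(-1/t), together with the negative powers of t that its
  derivatives produce; with all k included, the family is closed under differentiation.\<close>

definition flat_fn :: "nat \<Rightarrow> real \<Rightarrow> real" where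
  "flat_fn k t = (if t > 0 then exp (- (1/t)) / t ^ k else 0)"

lemma flat_fn_tendsto_0: "((\<lambda>t. exp (- (1/t)) / t ^ k) \<longlongrightarrow> 0) (at_right (0::real))"
proof -
  have "((\<lambda>t. (inverse t) ^ k / exp (inverse t)) \<longlongrightarrow> 0) (at_right (0::real))"
    by (rule filterlim_compose[OF tendsto_power_div_exp_0 filterlim_inverse_at_top_right])
  then show ?thesis
    by (rule Lim_transform_eventually) (simp add: exp_minus inverse_eq_divide power_divide)
qed

lemma DERIV_flat_fn:
  "(flat_fn k has_real_derivative (flat_fn (k+2) t - real k * flat_fn (k+1) t)) (at t)"
proof -
  consider "t > 0" | "t < 0" | "t = 0" by linarith
  then show ?thesis
  proof cases
    case 1
    have "((\<lambda>t. exp (- (1/t)) / t ^ k) has_real_derivative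
        exp (-(1/t)) / t^(k+2) - real k * (exp (-(1/t)) / t^(k+1))) (at t)"
      using 1 by (auto intro!: derivative_eq_intros simp: field_simps power_add)
         (cases k; simp add: field_simps power2_eq_square)
    then have "(flat_fn k has_real_derivative
        exp (-(1/t)) / t^(k+2) - real k * (exp (-(1/t)) / t^(k+1))) (at t)"
      by (rule DERIV_cong_ev[THEN iffD1, rotated 3])
         (use 1 eventually_nhds_in_open[of "{0<..}" t] in \<open>auto simp: flat_fn_def elim!: eventually_mono\<close>)
    then show ?thesis using 1 by (simp add: flat_fn_def)
  next
    case 2
    have "(flat_fn k has_real_derivative 0) (at t)"
      by (rule DERIV_cong_ev[THEN iffD1, rotated 3, OF DERIV_const[of 0]])
         (use 2 eventually_nhds_in_open[of "{..<0}" t] in \<open>auto simp: flat_fn_def elim!: eventually_mono\<close>)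
    then show ?thesis using 2 by (simp add: flat_fn_def)
  next
    case 3
    \<comment> \<open>To the right of 0 the difference quotient is again a flat function, with
      exponent \<open>Suc k\<close>; to the left it is zero.\<close>
    have "((\<lambda>h. flat_fn k h / h) \<longlongrightarrow> 0) (at 0)"
      unfolding filterlim_at_split
    proof
      show "((\<lambda>h. flat_fn k h / h) \<longlongrightarrow> 0) (at_left 0)"
        by (rule tendsto_eventually) (auto simp: flat_fn_def eventually_at_filter)
      show "((\<lambda>h. flat_fn k h / h) \<longlongrightarrow> 0) (at_right 0)"
        by (rule Lim_transform_eventually[OF flat_fn_tendsto_0[of "Suc k"]])
           (auto simp: flat_fn_def eventually_at_filter)
    qed
    then show ?thesis using 3 by (simp add: flat_fn_def DERIV_def)
  qed
qed

text \<open>Syntactic closure of the smooth functions under the operations needed later. The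
  derivative of each such expression is another one, which is exactly the hypothesis of
  \<open>Cinf_on_coinduct\<close>; a single induction therefore settles sums, products, inverses,
  roots and flat functions.\<close>

inductive smooth_gen :: "'a::euclidean_space set \<Rightarrow> ('a \<Rightarrow> real) \<Rightarrow> bool" for U where
  base: "Cinf_on U f \<Longrightarrow> smooth_gen U f"
| add: "smooth_gen U f \<Longrightarrow> smooth_gen U g \<Longrightarrow> smooth_gen U (\<lambda>x. f x + g x)"
| mult: "smooth_gen U f \<Longrightarrow> smooth_gen U g \<Longrightarrow> smooth_gen U (\<lambda>x. f x * g x)"
| inv: "smooth_gen U f \<Longrightarrow> (\<And>x. x \<in> U \<Longrightarrow> f x \<noteq> 0) \<Longrightarrow> smooth_gen U (\<lambda>x. inverse (f x))"
| sqrt: "smooth_gen U f \<Longrightarrow> (\<And>x. x \<in> U \<Longrightarrow> f x > 0) \<Longrightarrow> smooth_gen U (\<lambda>x. sqrt (f x))"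
| flat: "smooth_gen U f \<Longrightarrow> smooth_gen U (\<lambda>x. flat_fn k (f x))"

lemma pd_works: "f differentiable (at x) \<Longrightarrow> (f has_derivative (\<lambda>b. pd b f x)) (at x)"
  by (simp add: pd_def frechet_derivative_works)

lemma smooth_gen_props:
  assumes "smooth_gen U f" and U: "open U"
  shows "(\<forall>x\<in>U. f differentiable (at x)) \<and> (\<forall>b\<in>Basis. \<exists>g. smooth_gen U g \<and> (\<forall>x\<in>U. pd b f x = g x))"
  using assms(1)
proof induction
  case (base f)
  then show ?case using Cinf_on_differentiable Cinf_on_pd smooth_gen.base by blast
next
  case (add f g)
  have D: "((\<lambda>x. f x + g x) has_derivative (\<lambda>b. pd b f x + pd b g x)) (at x)" if "x \<in> U" for x
    using add that by (intro has_derivative_add pd_works) auto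
  have "\<exists>h. smooth_gen U h \<and> (\<forall>x\<in>U. pd b (\<lambda>x. f x + g x) x = h x)" if b: "b \<in> Basis" for b
  proof -
    obtain f' where "smooth_gen U f'" "\<forall>x\<in>U. pd b f x = f' x" using add.IH(1) b by blast
    moreover obtain g' where "smooth_gen U g'" "\<forall>x\<in>U. pd b g x = g' x" using add.IH(2) b by blast
    ultimately show ?thesis using D[THEN pd_eqI, of _ b]
      by (intro exI[of _ "\<lambda>x. f' x + g' x"] conjI smooth_gen.add) auto
  qed
  with D show ?case by (auto simp: differentiable_def)
next
  case (mult f g)
  have D: "((\<lambda>x. f x * g x) has_derivative (\<lambda>b. f x * pd b g x + pd b f x * g x)) (at x)" if "x \<in> U" for x
    using mult that by (intro has_derivative_mult pd_works) auto
  have "\<exists>h. smooth_gen U h \<and> (\<forall>x\<in>U. pd b (\<lambda>x. f x * g x) x = h x)" if b: "b \<in> Basis" for b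
  proof -
    obtain f' where "smooth_gen U f'" "\<forall>x\<in>U. pd b f x = f' x" using mult.IH(1) b by blast
    moreover obtain g' where "smooth_gen U g'" "\<forall>x\<in>U. pd b g x = g' x" using mult.IH(2) b by blast
    ultimately show ?thesis using D[THEN pd_eqI, of _ b] mult.hyps
      by (intro exI[of _ "\<lambda>x. f x * g' x + f' x * g x"]) (auto intro!: smooth_gen.add smooth_gen.mult)
  qed
  with D show ?case by (auto simp: differentiable_def)
next
  case (inv f)
  have D: "((\<lambda>x. inverse (f x)) has_derivative (\<lambda>b. - (inverse (f x) * pd b f x * inverse (f x)))) (at x)" if "x \<in> U" for x
    using inv that by (intro Deriv.has_derivative_inverse pd_works) auto
  have "\<exists>h. smooth_gen U h \<and> (\<forall>x\<in>U. pd b (\<lambda>x. inverse (f x)) x = h x)" if b: "b \<in> Basis" for b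
  proof -
    obtain f' where "smooth_gen U f'" "\<forall>x\<in>U. pd b f x = f' x"
      using inv.IH b by blast
    moreover have "smooth_gen U (\<lambda>x. inverse (f x))" using inv by (intro smooth_gen.inv) auto
    ultimately show ?thesis using D[THEN pd_eqI, of _ b]
      by (intro exI[of _ "\<lambda>x. -1 * ((inverse (f x) * f' x) * inverse (f x))"])
         (intro conjI smooth_gen.mult smooth_gen.base[OF Cinf_on_const] U, auto)
  qed
  with D show ?case by (auto simp: differentiable_def)
next
  case (sqrt f)
  have D: "((\<lambda>x. sqrt (f x)) has_derivative (\<lambda>b. pd b f x * (inverse (sqrt (f x)) / 2))) (at x)" if "x \<in> U" for x
    by (rule has_derivative_real_sqrt) (use sqrt that in \<open>auto intro: pd_works\<close>)
  have "\<exists>h. smooth_gen U h \<and> (\<forall>x\<in>U. pd b (\<lambda>x. sqrt (f x)) x = h x)" if b: "b \<in> Basis" for b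
  proof -
    obtain f' where "smooth_gen U f'" "\<forall>x\<in>U. pd b f x = f' x"
      using sqrt.IH b by blast
    moreover have "smooth_gen U (\<lambda>x. inverse (sqrt (f x)))"
      using sqrt by (intro smooth_gen.inv smooth_gen.sqrt) fastforce+
    ultimately show ?thesis using D[THEN pd_eqI, of _ b]
      by (intro exI[of _ "\<lambda>x. f' x * (inverse (sqrt (f x)) * (1/2))"])
         (intro conjI smooth_gen.mult smooth_gen.base[OF Cinf_on_const] U, auto)
  qed
  with D show ?case by (auto simp: differentiable_def)
next
  case (flat f k)
  have D: "((\<lambda>x. flat_fn k (f x)) has_derivative
      (\<lambda>b. (flat_fn (k+2) (f x) - real k * flat_fn (k+1) (f x)) * pd b f x)) (at x)" if "x \<in> U" for x
    using has_derivative_compose[OF pd_works DERIV_flat_fn[unfolded has_field_derivative_def, of k], of f x] flat that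
    by auto
  have "\<exists>h. smooth_gen U h \<and> (\<forall>x\<in>U. pd b (\<lambda>x. flat_fn k (f x)) x = h x)" if b: "b \<in> Basis" for b
  proof -
    obtain f' where "smooth_gen U f'" "\<forall>x\<in>U. pd b f x = f' x"
      using flat.IH b by blast
    then show ?thesis using D[THEN pd_eqI, of _ b] flat.hyps
      by (intro exI[of _ "\<lambda>x. (flat_fn (k+2) (f x) + (- real k) * flat_fn (k+1) (f x)) * f' x"])
         (intro conjI smooth_gen.add smooth_gen.mult smooth_gen.flat smooth_gen.base[OF Cinf_on_const] U, auto)
  qed
  with D show ?case by (auto simp: differentiable_def)
qed

lemma smooth_gen_Cinf: "open U \<Longrightarrow> smooth_gen U f \<Longrightarrow> Cinf_on U f"
  by (rule Cinf_on_coinduct[where P = "smooth_gen U"]) (use smooth_gen_props in blast)+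

context fixes U :: "'a::euclidean_space set" assumes U: "open U" begin

lemma Cinf_on_add: "Cinf_on U f \<Longrightarrow> Cinf_on U g \<Longrightarrow> Cinf_on U (\<lambda>x. f x + g x :: real)"
  and Cinf_on_mult: "Cinf_on U f \<Longrightarrow> Cinf_on U g \<Longrightarrow> Cinf_on U (\<lambda>x. f x * g x :: real)"
  and Cinf_on_inverse: "Cinf_on U f \<Longrightarrow> (\<And>x. x \<in> U \<Longrightarrow> f x \<noteq> 0) \<Longrightarrow> Cinf_on U (\<lambda>x. inverse (f x) :: real)"
  and Cinf_on_sqrt: "Cinf_on U f \<Longrightarrow> (\<And>x. x \<in> U \<Longrightarrow> f x > 0) \<Longrightarrow> Cinf_on U (\<lambda>x. sqrt (f x))"
  and Cinf_on_flat: "Cinf_on U f \<Longrightarrow> Cinf_on U (\<lambda>x. flat_fn k (f x))"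
  by (auto intro!: smooth_gen_Cinf[OF U] intro: smooth_gen.intros)

lemma Cinf_on_uminus: "Cinf_on U f \<Longrightarrow> Cinf_on U (\<lambda>x. - f x :: real)"
  using Cinf_on_mult[OF Cinf_on_const[OF U, of "-1"]] by simp

lemma Cinf_on_diff: "Cinf_on U f \<Longrightarrow> Cinf_on U g \<Longrightarrow> Cinf_on U (\<lambda>x. f x - g x :: real)"
  using Cinf_on_add[OF _ Cinf_on_uminus] by fastforce

lemma Cinf_on_divide: "Cinf_on U f \<Longrightarrow> Cinf_on U g \<Longrightarrow> (\<And>x. x \<in> U \<Longrightarrow> g x \<noteq> 0) \<Longrightarrow> Cinf_on U (\<lambda>x. f x / g x :: real)"
  unfolding divide_inverse by (intro Cinf_on_mult Cinf_on_inverse)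

lemma Cinf_on_power: "Cinf_on U f \<Longrightarrow> Cinf_on U (\<lambda>x. f x ^ n :: real)"
  by (induction n) (auto intro: Cinf_on_mult Cinf_on_const[OF U])

lemma Cinf_on_sum: "(\<And>i. i \<in> I \<Longrightarrow> Cinf_on U (f i)) \<Longrightarrow> Cinf_on U (\<lambda>x. \<Sum>i\<in>I. f i x :: real)"
  by (induction I rule: infinite_finite_induct) (auto intro: Cinf_on_add Cinf_on_const[OF U])

lemma Cinf_on_prod: "(\<And>i. i \<in> I \<Longrightarrow> Cinf_on U (f i)) \<Longrightarrow> Cinf_on U (\<lambda>x. \<Prod>i\<in>I. f i x :: real)"
  by (induction I rule: infinite_finite_induct) (auto intro: Cinf_on_mult Cinf_on_const[OF U])

lemma Cinf_on_det:
  fixes A :: "'a \<Rightarrow> real^'n^'n"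
  assumes "\<And>i j. Cinf_on U (\<lambda>x. A x $ i $ j)" shows "Cinf_on U (\<lambda>x. det (A x))"
  unfolding det_def by (intro Cinf_on_sum Cinf_on_mult Cinf_on_const U Cinf_on_prod assms)

end

lemma matrix_inv_mult:
  fixes A :: "real^'n^'n" assumes "det A \<noteq> 0"
  shows "A ** matrix_inv A = mat 1" "matrix_inv A ** A = mat 1"
proof -
  have "\<exists>B. A ** B = mat 1 \<and> B ** A = mat 1" using assms by (simp add: invertible_det_nz[symmetric] invertible_def)
  from someI_ex[OF this] show "A ** matrix_inv A = mat 1" "matrix_inv A ** A = mat 1"
    by (auto simp: matrix_inv_def)
qed

text \<open>Cramer's rule makes the entries of the inverse rational in those of A, from which
  smoothness and continuity of inversion are read off.\<close>

lemma matrix_inv_cramer: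
  fixes A :: "real^'n^'n" assumes "det A \<noteq> 0"
  shows "matrix_inv A $ i $ j = det (\<chi> k l. if l = i then (if k = j then 1 else 0) else A $ k $ l) / det A"
proof -
  have "A *v (matrix_inv A *v axis j 1) = axis j 1"
    using assms by (simp add: matrix_vector_mul_assoc matrix_inv_mult)
  then have "matrix_inv A *v axis j 1 =
      (\<chi> k. det (\<chi> i l. if l = k then axis j 1 $ i else A $ i $ l) / det A)"
    using cramer[OF assms] by blast
  then have "(matrix_inv A *v axis j 1) $ i = det (\<chi> k l. if l = i then axis j 1 $ k else A $ k $ l) / det A"
    by simp
  moreover have "(matrix_inv A *v axis j 1) $ i = matrix_inv A $ i $ j"
    by (simp add: matrix_vector_mult_basis column_def)
  moreover have "axis j (1::real) $ k = (if k = j then 1 else 0)" for k by (simp add: axis_def)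
  ultimately show ?thesis by (simp cong: if_cong)
qed

lemma Cinf_on_matrix_inv:
  fixes A :: "'a::euclidean_space \<Rightarrow> real^'n^'n"
  assumes U: "open U" and A: "\<And>i j. Cinf_on U (\<lambda>x. A x $ i $ j)" "\<And>x. x \<in> U \<Longrightarrow> det (A x) \<noteq> 0"
  shows "Cinf_on U (\<lambda>x. matrix_inv (A x) $ i $ j)"
proof (rule Cinf_on_cong[OF U])
  show "Cinf_on U (\<lambda>x. det (\<chi> k l. if l = i then (if k = j then 1 else 0) else A x $ k $ l) / det (A x))"
  proof (intro Cinf_on_divide Cinf_on_det U assms)
    show "Cinf_on U (\<lambda>x. (\<chi> k l. if l = i then (if k = j then 1 else 0) else A x $ k $ l) $ k $ l)" for k l
      by (cases "l = i"; cases "k = j") (auto intro: A Cinf_on_const U)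
  qed
qed (simp add: matrix_inv_cramer[OF A(2)])

subsection \<open>Composition, parameter integrals and mixed derivatives\<close>

text \<open>The chain rule turns a composition with \<alpha> into a sum of products of smooth
  functions on U with further compositions. Sums and products of both kinds hence form a class
  closed under derivatives.\<close>

inductive comp_gen :: "'a::euclidean_space set \<Rightarrow> 'c::euclidean_space set \<Rightarrow> ('a \<Rightarrow> 'c) \<Rightarrow> ('a \<Rightarrow> real) \<Rightarrow> bool"
  for U V \<alpha> where
  base: "Cinf_on U f \<Longrightarrow> comp_gen U V \<alpha> f"
| comp: "Cinf_on V g \<Longrightarrow> comp_gen U V \<alpha> (\<lambda>x. g (\<alpha> x))"
| add: "comp_gen U V \<alpha> f \<Longrightarrow> comp_gen U V \<alpha> g \<Longrightarrow> comp_gen U V \<alpha> (\<lambda>x. f x + g x)"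
| mult: "comp_gen U V \<alpha> f \<Longrightarrow> comp_gen U V \<alpha> g \<Longrightarrow> comp_gen U V \<alpha> (\<lambda>x. f x * g x)"

lemma comp_gen_sum:
  assumes "open U" "finite I" "\<And>i. i \<in> I \<Longrightarrow> comp_gen U V \<alpha> (f i)"
  shows "comp_gen U V \<alpha> (\<lambda>x. \<Sum>i\<in>I. f i x)"
  using assms(2,3)
proof induction
  case empty show ?case by (simp add: comp_gen.base Cinf_on_const assms(1))
next
  case (insert a F)
  then have "comp_gen U V \<alpha> (\<lambda>x. f a x + (\<Sum>i\<in>F. f i x))" by (intro comp_gen.add) auto
  with insert show ?case by simp
qed

lemma has_derivative_comp_pd:
  assumes "f differentiable (at (\<alpha> x))" "(\<alpha> has_derivative \<alpha>') (at x)"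
  shows "((\<lambda>x. f (\<alpha> x)) has_derivative (\<lambda>b. \<Sum>c\<in>Basis. (\<alpha>' b \<bullet> c) *\<^sub>R pd c f (\<alpha> x))) (at x)"
  using has_derivative_compose[OF assms(2) Cinf_on_has_derivative[OF assms(1)]] .

lemma comp_gen_props:
  assumes "comp_gen U V \<alpha> f" and U: "open U" and V: "open V" and a: "Cinf_on U \<alpha>" "\<And>x. x \<in> U \<Longrightarrow> \<alpha> x \<in> V"
  shows "(\<forall>x\<in>U. f differentiable (at x)) \<and> (\<forall>b\<in>Basis. \<exists>g. comp_gen U V \<alpha> g \<and> (\<forall>x\<in>U. pd b f x = g x))"
  using assms(1)
proof induction
  case (base f)
  then show ?case using Cinf_on_differentiable Cinf_on_pd comp_gen.base by blast
next
  case (comp f)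
  have D: "((\<lambda>x. f (\<alpha> x)) has_derivative (\<lambda>b. \<Sum>c\<in>Basis. (pd b \<alpha> x \<bullet> c) *\<^sub>R pd c f (\<alpha> x))) (at x)" if "x \<in> U" for x
    using that comp a by (intro has_derivative_comp_pd pd_works) (auto intro: Cinf_on_differentiable)
  have "\<exists>h. comp_gen U V \<alpha> h \<and> (\<forall>x\<in>U. pd b (\<lambda>x. f (\<alpha> x)) x = h x)" if "b \<in> Basis" for b
  proof (intro exI conjI ballI)
    show "comp_gen U V \<alpha> (\<lambda>x. \<Sum>c\<in>Basis. (pd b \<alpha> x \<bullet> c) * pd c f (\<alpha> x))"
      using comp that Cinf_on_pd[OF a(1) that] Cinf_on_componentwise[OF U, of "pd b \<alpha>"]
      by (intro comp_gen_sum[OF U] comp_gen.mult comp_gen.comp comp_gen.base) (auto intro: Cinf_on_pd)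
  qed (use D[THEN pd_eqI, of _ b] in auto)
  with D show ?case by (auto simp: differentiable_def)
next
  case (add f g)
  have D: "((\<lambda>x. f x + g x) has_derivative (\<lambda>b. pd b f x + pd b g x)) (at x)" if "x \<in> U" for x
    using add that by (intro has_derivative_add pd_works) auto
  have "\<exists>h. comp_gen U V \<alpha> h \<and> (\<forall>x\<in>U. pd b (\<lambda>x. f x + g x) x = h x)" if b: "b \<in> Basis" for b
  proof -
    obtain f' where "comp_gen U V \<alpha> f'" "\<forall>x\<in>U. pd b f x = f' x" using add.IH(1) b by blast
    moreover obtain g' where "comp_gen U V \<alpha> g'" "\<forall>x\<in>U. pd b g x = g' x" using add.IH(2) b by blast
    ultimately show ?thesis using D[THEN pd_eqI, of _ b]
      by (intro exI[of _ "\<lambda>x. f' x + g' x"] conjI comp_gen.add) auto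
  qed
  with D show ?case by (auto simp: differentiable_def)
next
  case (mult f g)
  have D: "((\<lambda>x. f x * g x) has_derivative (\<lambda>b. f x * pd b g x + pd b f x * g x)) (at x)" if "x \<in> U" for x
    using mult that by (intro has_derivative_mult pd_works) auto
  have "\<exists>h. comp_gen U V \<alpha> h \<and> (\<forall>x\<in>U. pd b (\<lambda>x. f x * g x) x = h x)" if b: "b \<in> Basis" for b
  proof -
    obtain f' where "comp_gen U V \<alpha> f'" "\<forall>x\<in>U. pd b f x = f' x" using mult.IH(1) b by blast
    moreover obtain g' where "comp_gen U V \<alpha> g'" "\<forall>x\<in>U. pd b g x = g' x" using mult.IH(2) b by blast
    ultimately show ?thesis using D[THEN pd_eqI, of _ b] mult.hyps
      by (intro exI[of _ "\<lambda>x. f x * g' x + f' x * g x"]) (auto intro!: comp_gen.add comp_gen.mult)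
  qed
  with D show ?case by (auto simp: differentiable_def)
qed

lemma Cinf_on_compose:
  fixes f :: "'c::euclidean_space \<Rightarrow> 'b::euclidean_space"
  assumes U: "open U" and V: "open V" and a: "Cinf_on U \<alpha>" "\<And>x. x \<in> U \<Longrightarrow> \<alpha> x \<in> V" and f: "Cinf_on V f"
  shows "Cinf_on U (\<lambda>x. f (\<alpha> x))"
proof -
  have "Cinf_on U (\<lambda>x. f (\<alpha> x) \<bullet> c)" if "c \<in> Basis" for c
  proof (rule Cinf_on_coinduct[where P = "comp_gen U V \<alpha>", OF U])
    show "comp_gen U V \<alpha> (\<lambda>x. f (\<alpha> x) \<bullet> c)"
      using f that V by (intro comp_gen.comp) (auto simp: Cinf_on_componentwise[of V f])
  qed (use comp_gen_props[OF _ U V a] in blast)+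
  then show ?thesis using Cinf_on_componentwise[OF U] by blast
qed

text \<open>In the intended use the derivative \<open>L t\<close> of \<open>\<alpha> t\<close> does
  not depend on x. The chain rule factors are then functions of t alone and can be absorbed into the
  weight k, so that integrals of this shape are closed under differentiation.\<close>

inductive param_gen :: "'a::euclidean_space set \<Rightarrow> 'c::euclidean_space set \<Rightarrow> real \<Rightarrow> real \<Rightarrow> (real \<Rightarrow> 'a \<Rightarrow> 'c) \<Rightarrow> ('a \<Rightarrow> real) \<Rightarrow> bool"
  for U V l r \<alpha> where
  base: "continuous_on {l..r} k \<Longrightarrow> Cinf_on V f \<Longrightarrow>
     param_gen U V l r \<alpha> (\<lambda>x. integral {l..r} (\<lambda>t. k t * f (\<alpha> t x)))"
| zero: "param_gen U V l r \<alpha> (\<lambda>x. 0)"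
| add: "param_gen U V l r \<alpha> f \<Longrightarrow> param_gen U V l r \<alpha> g \<Longrightarrow> param_gen U V l r \<alpha> (\<lambda>x. f x + g x)"

lemma param_gen_sum:
  assumes "finite I" "\<And>i. i \<in> I \<Longrightarrow> param_gen U V l r \<alpha> (f i)"
  shows "param_gen U V l r \<alpha> (\<lambda>x. \<Sum>i\<in>I. f i x)"
  using assms
proof induction
  case empty show ?case by (simp add: param_gen.zero)
next
  case (insert a F)
  then have "param_gen U V l r \<alpha> (\<lambda>x. f a x + (\<Sum>i\<in>F. f i x))" by (intro param_gen.add) auto
  with insert show ?case by simp
qed

text \<open>\<open>leibniz_rule\<close> wants the derivative as a bounded linear map depending
  continuously on (x, t). Written out in basis directions, this reduces to continuity of the real
  functions \<open>D b x t\<close>.\<close>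

lemma has_derivative_param_integral:
  fixes f :: "'c::euclidean_space \<Rightarrow> real" and \<alpha> :: "real \<Rightarrow> 'a::euclidean_space \<Rightarrow> 'c"
  assumes U: "open U" and V: "open V"
    and inV: "\<And>x t. x \<in> U \<Longrightarrow> t \<in> {l..r} \<Longrightarrow> \<alpha> t x \<in> V"
    and der: "\<And>x t. x \<in> U \<Longrightarrow> t \<in> {l..r} \<Longrightarrow> (\<alpha> t has_derivative L t) (at x)"
    and cont: "continuous_on (U \<times> {l..r}) (\<lambda>(x,t). \<alpha> t x)"
    and contL: "\<And>b c. b \<in> Basis \<Longrightarrow> c \<in> Basis \<Longrightarrow> continuous_on {l..r} (\<lambda>t. L t b \<bullet> c)"
    and k: "continuous_on {l..r} k" and f: "Cinf_on V f" and x0: "x0 \<in> U"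
  shows "((\<lambda>x. integral {l..r} (\<lambda>t. k t * f (\<alpha> t x))) has_derivative
     (\<lambda>h. \<Sum>b\<in>Basis. (h \<bullet> b) * (\<Sum>c\<in>Basis. integral {l..r} (\<lambda>t. (k t * (L t b \<bullet> c)) * pd c f (\<alpha> t x0))))) (at x0)"
proof -
  obtain e where e: "e > 0" "ball x0 e \<subseteq> U" using U x0 openE by blast
  define D where "D = (\<lambda>b x t. \<Sum>c\<in>Basis. (k t * (L t b \<bullet> c)) * pd c f (\<alpha> t x))"
  define fx where "fx = (\<lambda>x t. Blinfun (\<lambda>h. \<Sum>b\<in>Basis. (h \<bullet> b) * D b x t))"
  have fx: "blinfun_apply (fx x t) = (\<lambda>h. \<Sum>b\<in>Basis. (h \<bullet> b) * D b x t)" for x t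
    unfolding fx_def by (rule bounded_linear_Blinfun_apply) (intro bounded_linear_sum bounded_linear_mult_const bounded_linear_inner_left)
  have contg: "continuous_on (U \<times> {l..r}) (\<lambda>(x,t). g (\<alpha> t x))" if "Cinf_on V g" for g :: "'c \<Rightarrow> real"
    using continuous_on_compose2[OF Cinf_on_continuous[OF that] cont] inV by (force simp: case_prod_unfold)
  have contg': "continuous_on (ball x0 e \<times> {l..r}) (\<lambda>p. g (\<alpha> (snd p) (fst p)))" if "Cinf_on V g" for g :: "'c \<Rightarrow> real"
    using continuous_on_subset[OF contg[OF that], of "ball x0 e \<times> {l..r}"] e by (auto simp: case_prod_unfold)
  have contgt: "continuous_on {l..r} (\<lambda>t. g (\<alpha> t x))" if "Cinf_on V g" "x \<in> U" for g :: "'c \<Rightarrow> real" and x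
  proof -
    have "continuous_on {l..r} (\<lambda>t. (x,t))" by (intro continuous_intros)
    from continuous_on_compose2[OF contg[OF that(1)] this] that show ?thesis by force
  qed
  have contk: "continuous_on (ball x0 e \<times> {l..r}) (\<lambda>p. k (snd p))"
    by (rule continuous_on_compose2[OF k]) (auto intro!: continuous_intros)
  have contL': "continuous_on (ball x0 e \<times> {l..r}) (\<lambda>p. L (snd p) b \<bullet> c)" if "b \<in> Basis" "c \<in> Basis" for b c
    by (rule continuous_on_compose2[OF contL[OF that]]) (auto intro!: continuous_intros)
  have "((\<lambda>x. integral (cbox l r) (\<lambda>t. k t * f (\<alpha> t x))) has_derivative integral (cbox l r) (fx x0)) (at x0 within ball x0 e)"
  proof (rule leibniz_rule)
    fix x t assume "x \<in> ball x0 e" and t: "t \<in> cbox l r"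
    then have x: "x \<in> U" using e by auto
    have "((\<lambda>x. f (\<alpha> t x)) has_derivative (\<lambda>b. \<Sum>c\<in>Basis. (L t b \<bullet> c) *\<^sub>R pd c f (\<alpha> t x))) (at x)"
      using x t by (intro has_derivative_comp_pd der Cinf_on_differentiable[OF f] inV) auto
    then have "((\<lambda>x. k t * f (\<alpha> t x)) has_derivative (\<lambda>b. k t * (\<Sum>c\<in>Basis. (L t b \<bullet> c) *\<^sub>R pd c f (\<alpha> t x)))) (at x)"
      by (rule has_derivative_mult_right)
    moreover have "k t * (\<Sum>c\<in>Basis. (L t h \<bullet> c) *\<^sub>R pd c f (\<alpha> t x)) = (\<Sum>b\<in>Basis. (h \<bullet> b) * D b x t)" for h
    proof -
      have lin: "linear (L t)" using der[OF x] t has_derivative_linear by fastforce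
      have "L t h = (\<Sum>b\<in>Basis. (h \<bullet> b) *\<^sub>R L t b)"
        by (subst (1) euclidean_representation[of h, symmetric]) (simp add: linear_sum[OF lin] linear_scale[OF lin])
      then have "k t * (\<Sum>c\<in>Basis. (L t h \<bullet> c) *\<^sub>R pd c f (\<alpha> t x)) =
         (\<Sum>c\<in>Basis. \<Sum>b\<in>Basis. (h \<bullet> b) * (k t * (L t b \<bullet> c) * pd c f (\<alpha> t x)))"
        by (simp add: inner_sum_left sum_distrib_left sum_distrib_right mult_ac)
      then show ?thesis unfolding D_def by (subst (asm) sum.swap) (simp add: sum_distrib_left)
    qed
    ultimately show "((\<lambda>x. k t * f (\<alpha> t x)) has_derivative blinfun_apply (fx x t)) (at x within ball x0 e)"
      unfolding fx by (auto intro: has_derivative_at_withinI)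
  next
    fix x assume "x \<in> ball x0 e"
    then show "(\<lambda>t. k t * f (\<alpha> t x)) integrable_on cbox l r"
      using e by (intro integrable_continuous) (auto intro!: continuous_intros k contgt f)
  next
    show "continuous_on (ball x0 e \<times> cbox l r) (\<lambda>(x, t). fx x t)"
    proof (rule continuous_on_blinfun_componentwise)
      fix i :: 'a assume i: "i \<in> Basis"
      have eq: "blinfun_apply (case p of (x, t) \<Rightarrow> fx x t) i = D i (fst p) (snd p)" for p
        by (auto simp: fx i inner_Basis if_distrib if_distribR sum.delta' split: prod.splits cong: if_cong)
      show "continuous_on (ball x0 e \<times> cbox l r) (\<lambda>p. blinfun_apply (case p of (x, t) \<Rightarrow> fx x t) i)"
        unfolding eq D_def using i
        by (auto intro!: continuous_intros contk contL' contg' Cinf_on_pd f)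
    qed
  qed (use e in auto)
  then have *: "((\<lambda>x. integral {l..r} (\<lambda>t. k t * f (\<alpha> t x))) has_derivative integral {l..r} (fx x0)) (at x0)"
    using e at_within_open[of x0 "ball x0 e"] by auto
  have contD: "continuous_on {l..r} (\<lambda>t. D b x0 t)" if "b \<in> Basis" for b
    unfolding D_def using that by (auto intro!: continuous_intros k contL contgt Cinf_on_pd f x0)
  have "fx x0 integrable_on {l..r}"
  proof -
    have "continuous_on {l..r} (fx x0)"
    proof (rule continuous_on_blinfun_componentwise)
      fix i :: 'a assume i: "i \<in> Basis"
      have eq: "blinfun_apply (fx x0 t) i = D i x0 t" for t
        by (auto simp: fx i inner_Basis if_distrib if_distribR sum.delta' cong: if_cong)
      show "continuous_on {l..r} (\<lambda>t. blinfun_apply (fx x0 t) i)"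
        unfolding eq using contD i by auto
    qed
    then show ?thesis by (rule integrable_continuous_interval)
  qed
  then have i1: "blinfun_apply (integral {l..r} (fx x0)) h = integral {l..r} (\<lambda>t. \<Sum>b\<in>Basis. (h \<bullet> b) * D b x0 t)" for h
    by (subst blinfun_apply_integral) (auto simp: fx)
  have i2: "integral {l..r} (\<lambda>t. \<Sum>b\<in>Basis. (h \<bullet> b) * D b x0 t) = (\<Sum>b\<in>Basis. (h \<bullet> b) * integral {l..r} (D b x0))" for h
    using contD by (subst integral_sum) (auto intro!: integrable_continuous_interval continuous_intros)
  have i3: "integral {l..r} (D b x0) = (\<Sum>c\<in>Basis. integral {l..r} (\<lambda>t. (k t * (L t b \<bullet> c)) * pd c f (\<alpha> t x0)))"
    if "b \<in> Basis" for b
    unfolding D_def using that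
    by (subst integral_sum) (auto intro!: integrable_continuous_interval continuous_intros k contL contgt Cinf_on_pd f x0)
  have "blinfun_apply (integral {l..r} (fx x0)) = (\<lambda>h. \<Sum>b\<in>Basis. (h \<bullet> b) * (\<Sum>c\<in>Basis. integral {l..r} (\<lambda>t. (k t * (L t b \<bullet> c)) * pd c f (\<alpha> t x0))))"
    unfolding i1 i2 by (auto simp: i3 cong: sum.cong)
  with * show ?thesis by simp
qed

context
  fixes U :: "'a::euclidean_space set" and V :: "'c::euclidean_space set" and l r :: real and \<alpha> :: "real \<Rightarrow> 'a \<Rightarrow> 'c"
    and L :: "real \<Rightarrow> 'a \<Rightarrow> 'c"
  assumes U: "open U" and V: "open V"
    and inV: "\<And>x t. x \<in> U \<Longrightarrow> t \<in> {l..r} \<Longrightarrow> \<alpha> t x \<in> V"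
    and der: "\<And>x t. x \<in> U \<Longrightarrow> t \<in> {l..r} \<Longrightarrow> (\<alpha> t has_derivative L t) (at x)"
    and cont: "continuous_on (U \<times> {l..r}) (\<lambda>(x,t). \<alpha> t x)"
    and contL: "\<And>b c. b \<in> Basis \<Longrightarrow> c \<in> Basis \<Longrightarrow> continuous_on {l..r} (\<lambda>t. L t b \<bullet> c)"
begin

lemma pd_param_integral:
  assumes "continuous_on {l..r} k" "Cinf_on V f" "x \<in> U" "b \<in> Basis"
  shows "pd b (\<lambda>x. integral {l..r} (\<lambda>t. k t * f (\<alpha> t x))) x =
    (\<Sum>c\<in>Basis. integral {l..r} (\<lambda>t. (k t * (L t b \<bullet> c)) * pd c f (\<alpha> t x)))"
  using pd_eqI[OF has_derivative_param_integral[OF U V inV der cont contL assms(1-3)], of b] assms(4)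
  by (simp add: inner_Basis if_distrib if_distribR sum.delta' cong: if_cong)

lemma param_gen_props:
  assumes "param_gen U V l r \<alpha> f"
  shows "(\<forall>x\<in>U. f differentiable (at x)) \<and> (\<forall>b\<in>Basis. \<exists>g. param_gen U V l r \<alpha> g \<and> (\<forall>x\<in>U. pd b f x = g x))"
  using assms
proof induction
  case (base k f)
  have "\<exists>g. param_gen U V l r \<alpha> g \<and> (\<forall>x\<in>U. pd b (\<lambda>x. integral {l..r} (\<lambda>t. k t * f (\<alpha> t x))) x = g x)" if "b \<in> Basis" for b
    using base that pd_param_integral
    by (intro exI[of _ "\<lambda>x. \<Sum>c\<in>Basis. integral {l..r} (\<lambda>t. (k t * (L t b \<bullet> c)) * pd c f (\<alpha> t x))"] conjI param_gen_sum
        param_gen.base continuous_intros contL Cinf_on_pd) auto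
  then show ?case using has_derivative_param_integral[OF U V inV der cont contL base]
    by (auto simp: differentiable_def)
next
  case zero
  then show ?case by (auto simp: pd_def intro: param_gen.zero)
next
  case (add f g)
  have D: "((\<lambda>x. f x + g x) has_derivative (\<lambda>b. pd b f x + pd b g x)) (at x)" if "x \<in> U" for x
    using add that by (intro has_derivative_add pd_works) auto
  have "\<exists>h. param_gen U V l r \<alpha> h \<and> (\<forall>x\<in>U. pd b (\<lambda>x. f x + g x) x = h x)" if b: "b \<in> Basis" for b
  proof -
    obtain f' where "param_gen U V l r \<alpha> f'" "\<forall>x\<in>U. pd b f x = f' x" using add.IH(1) b by blast
    moreover obtain g' where "param_gen U V l r \<alpha> g'" "\<forall>x\<in>U. pd b g x = g' x" using add.IH(2) b by blast
    ultimately show ?thesis using D[THEN pd_eqI, of _ b]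
      by (intro exI[of _ "\<lambda>x. f' x + g' x"] conjI param_gen.add) auto
  qed
  with D show ?case by (auto simp: differentiable_def)
qed

lemma Cinf_on_param_integral:
  fixes f :: "'c \<Rightarrow> real"
  assumes "continuous_on {l..r} k" "Cinf_on V f"
  shows "Cinf_on U (\<lambda>x. integral {l..r} (\<lambda>t. k t * f (\<alpha> t x)))"
  by (rule Cinf_on_coinduct[where P = "param_gen U V l r \<alpha>", OF U])
     (use param_gen.base[OF assms] param_gen_props in blast)+

end

text \<open>Two uses of the mean value theorem: in direction b, for the increment of f in direction
  c, and in direction c, for the derivative in direction b. The left side is symmetric in b and c
  while the right side is not; this is the source of the commutation of mixed derivatives.\<close>

lemma second_difference_eq:
  fixes f :: "'a::euclidean_space \<Rightarrow> real"
  assumes f: "Cinf_on (ball x (2 * d)) f" and b: "b \<in> Basis" "c \<in> Basis" and d: "d > 0"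
  shows "\<exists>y\<in>ball x (2 * d). f (x + (d/2) *\<^sub>R b + (d/2) *\<^sub>R c) - f (x + (d/2) *\<^sub>R b) - f (x + (d/2) *\<^sub>R c) + f x = (d/2)^2 * pd c (pd b f) y"
proof -
  define t where "t = d/2"
  have t: "t > 0" using d by (simp add: t_def)
  have inb: "x + r *\<^sub>R b + s *\<^sub>R c \<in> ball x (2 * d)" if "0 \<le> r" "r \<le> t" "0 \<le> s" "s \<le> t" for r s
  proof -
    have "norm (r *\<^sub>R b + s *\<^sub>R c) \<le> r + s"
      using norm_triangle_ineq[of "r *\<^sub>R b" "s *\<^sub>R c"] b that by simp
    also have "\<dots> < 2 * d" using that d by (simp add: t_def)
    finally have "dist (x + (r *\<^sub>R b + s *\<^sub>R c)) x < 2 * d" by (simp add: dist_norm)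
    then show ?thesis by (simp add: dist_commute add.assoc)
  qed
  have D1: "((\<lambda>r. g (x + r *\<^sub>R b + s *\<^sub>R c)) has_real_derivative pd b g (x + r *\<^sub>R b + s *\<^sub>R c)) (at r)"
    if "Cinf_on (ball x (2 * d)) g" "0 \<le> r" "r \<le> t" "0 \<le> s" "s \<le> t" for g :: "'a \<Rightarrow> real" and r s
  proof -
    have "((\<lambda>r. x + r *\<^sub>R b + s *\<^sub>R c) has_derivative (\<lambda>h. h *\<^sub>R b)) (at r)" by (auto intro!: derivative_eq_intros)
    from has_derivative_compose[OF this pd_works[OF Cinf_on_differentiable[OF that(1) inb]]] that
    have "((\<lambda>r. g (x + r *\<^sub>R b + s *\<^sub>R c)) has_derivative (\<lambda>h. pd (h *\<^sub>R b) g (x + r *\<^sub>R b + s *\<^sub>R c))) (at r)" by auto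
    moreover have "pd (h *\<^sub>R b) g (x + r *\<^sub>R b + s *\<^sub>R c) = pd b g (x + r *\<^sub>R b + s *\<^sub>R c) * h" for h
      using linear_scale[OF has_derivative_linear[OF pd_works[OF Cinf_on_differentiable[OF that(1) inb]]]] that
      by (simp add: mult.commute)
    ultimately show ?thesis by (simp add: has_field_derivative_def)
  qed
  have D2: "((\<lambda>s. g (x + r *\<^sub>R b + s *\<^sub>R c)) has_real_derivative pd c g (x + r *\<^sub>R b + s *\<^sub>R c)) (at s)"
    if "Cinf_on (ball x (2 * d)) g" "0 \<le> r" "r \<le> t" "0 \<le> s" "s \<le> t" for g :: "'a \<Rightarrow> real" and r s
  proof -
    have "((\<lambda>s. x + r *\<^sub>R b + s *\<^sub>R c) has_derivative (\<lambda>h. h *\<^sub>R c)) (at s)" by (auto intro!: derivative_eq_intros)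
    from has_derivative_compose[OF this pd_works[OF Cinf_on_differentiable[OF that(1) inb]]] that
    have "((\<lambda>s. g (x + r *\<^sub>R b + s *\<^sub>R c)) has_derivative (\<lambda>h. pd (h *\<^sub>R c) g (x + r *\<^sub>R b + s *\<^sub>R c))) (at s)" by auto
    moreover have "pd (h *\<^sub>R c) g (x + r *\<^sub>R b + s *\<^sub>R c) = pd c g (x + r *\<^sub>R b + s *\<^sub>R c) * h" for h
      using linear_scale[OF has_derivative_linear[OF pd_works[OF Cinf_on_differentiable[OF that(1) inb]]]] that
      by (simp add: mult.commute)
    ultimately show ?thesis by (simp add: has_field_derivative_def)
  qed
  define p where "p r = f (x + r *\<^sub>R b + t *\<^sub>R c) - f (x + r *\<^sub>R b + 0 *\<^sub>R c)" for r
  have "\<exists>z>0. z < t \<and> p t - p 0 = (t - 0) * (pd b f (x + z *\<^sub>R b + t *\<^sub>R c) - pd b f (x + z *\<^sub>R b + 0 *\<^sub>R c))"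
    by (rule MVT2[OF t]) (unfold p_def, intro DERIV_diff D1 f; use t in auto)
  then obtain r where r: "0 < r" "r < t" "p t - p 0 = t * (pd b f (x + r *\<^sub>R b + t *\<^sub>R c) - pd b f (x + r *\<^sub>R b + 0 *\<^sub>R c))"
    by auto
  have "\<exists>z>0. z < t \<and> pd b f (x + r *\<^sub>R b + t *\<^sub>R c) - pd b f (x + r *\<^sub>R b + 0 *\<^sub>R c) = (t - 0) * pd c (pd b f) (x + r *\<^sub>R b + z *\<^sub>R c)"
    by (rule MVT2[OF t]) (intro D2 Cinf_on_pd f b; use r in auto)
  then obtain s where s: "0 < s" "s < t" "pd b f (x + r *\<^sub>R b + t *\<^sub>R c) - pd b f (x + r *\<^sub>R b + 0 *\<^sub>R c) = t * pd c (pd b f) (x + r *\<^sub>R b + s *\<^sub>R c)"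
    by auto
  have "p t - p 0 = t^2 * pd c (pd b f) (x + r *\<^sub>R b + s *\<^sub>R c)" using r s by (simp add: power2_eq_square)
  moreover have "x + r *\<^sub>R b + s *\<^sub>R c \<in> ball x (2 * d)" using inb r s by auto
  ultimately show ?thesis unfolding p_def t_def[symmetric] by (intro bexI) auto
qed

text \<open>Both mixed derivatives, taken at two points near x, equal the same second difference
  quotient. If they differed at x, continuity would keep them apart on a small ball.\<close>

lemma pd_commute_real:
  fixes f :: "'a::euclidean_space \<Rightarrow> real"
  assumes U: "open U" "x \<in> U" and f: "Cinf_on U f" and b: "b \<in> Basis" "c \<in> Basis"
  shows "pd b (pd c f) x = pd c (pd b f) x"
proof (rule ccontr)
  assume ne: "pd b (pd c f) x \<noteq> pd c (pd b f) x"
  define \<epsilon> where "\<epsilon> = \<bar>pd b (pd c f) x - pd c (pd b f) x\<bar> / 2"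
  have e: "\<epsilon> > 0" using ne by (simp add: \<epsilon>_def)
  have "isCont (pd b (pd c f)) x" "isCont (pd c (pd b f)) x"
    using f b U by (auto intro!: differentiable_imp_continuous_within Cinf_on_differentiable[where U=U] Cinf_on_pd)
  then obtain d1 d2 where d: "d1 > 0" "\<And>y. dist x y < d1 \<Longrightarrow> dist (pd b (pd c f) x) (pd b (pd c f) y) < \<epsilon>"
     "d2 > 0" "\<And>y. dist x y < d2 \<Longrightarrow> dist (pd c (pd b f) x) (pd c (pd b f) y) < \<epsilon>"
    using e unfolding continuous_at_eps_delta by (metis dist_commute)
  obtain d3 where d3: "d3 > 0" "ball x d3 \<subseteq> U" using U openE by blast
  define d where "d = min d1 (min d2 d3) / 2"
  have dd: "d > 0" "2 * d \<le> d1" "2 * d \<le> d2" "2 * d \<le> d3" using d d3 by (auto simp: d_def)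
  have sm: "Cinf_on (ball x (2 * d)) f" using f d3 dd by (meson Cinf_on_subset subset_ball order_trans)
  obtain y where y: "y \<in> ball x (2 * d)" "f (x + (d/2) *\<^sub>R b + (d/2) *\<^sub>R c) - f (x + (d/2) *\<^sub>R b) - f (x + (d/2) *\<^sub>R c) + f x = (d/2)^2 * pd c (pd b f) y"
    using second_difference_eq[OF sm b dd(1)] by blast
  obtain z where z: "z \<in> ball x (2 * d)" "f (x + (d/2) *\<^sub>R c + (d/2) *\<^sub>R b) - f (x + (d/2) *\<^sub>R c) - f (x + (d/2) *\<^sub>R b) + f x = (d/2)^2 * pd b (pd c f) z"
    using second_difference_eq[OF sm b(2) b(1) dd(1)] by blast
  have "(d/2)^2 * pd c (pd b f) y = (d/2)^2 * pd b (pd c f) z" using y(2) z(2) by (simp add: algebra_simps)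
  then have "pd c (pd b f) y = pd b (pd c f) z" using dd by simp
  moreover have "dist (pd b (pd c f) x) (pd b (pd c f) z) < \<epsilon>" "dist (pd c (pd b f) x) (pd c (pd b f) y) < \<epsilon>"
    using d y z dd by auto
  ultimately show False unfolding \<epsilon>_def dist_real_def by (smt (verit) field_sum_of_halves)
qed

lemma pd_nth:
  fixes f :: "'a::euclidean_space \<Rightarrow> ('b::euclidean_space)^'n"
  shows "f differentiable (at x) \<Longrightarrow> pd b (\<lambda>x. f x $ i) x = pd b f x $ i"
  using pd_linear_comp[OF bounded_linear_vec_nth] .

lemma Cinf_on_inner:
  fixes f g :: "'a::euclidean_space \<Rightarrow> real^'n"
  assumes "open U" "\<And>i. Cinf_on U (\<lambda>x. f x $ i)" "\<And>i. Cinf_on U (\<lambda>x. g x $ i)" shows "Cinf_on U (\<lambda>x. f x \<bullet> g x)"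
  unfolding inner_vec_def inner_real_def by (intro Cinf_on_sum Cinf_on_mult assms)

section \<open>Test functions and weak derivatives\<close>

text \<open>A smooth product bump for the box (a, b). Each factor is exp(-1/(n c)) with c > 0 inside
  the box, which tends to 1 as n grows, and it is 0 where c <= 0; the bumps thus approximate the
  indicator of the box.\<close>

definition bump :: "nat \<Rightarrow> real^'n \<Rightarrow> real^'n \<Rightarrow> real^'n \<Rightarrow> real" where
  "bump n a b x = (\<Prod>i\<in>UNIV. flat_fn 0 (real n * ((x $ i - a $ i) * (b $ i - x $ i))))"

lemma Cinf_on_bump: "Cinf_on UNIV (bump n a b)"
proof -
  have "Cinf_on UNIV (\<lambda>x::real^'n. x $ i)" for i
    by (intro Cinf_on_linear open_UNIV bounded_linear_vec_nth)
  then show ?thesis unfolding bump_def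
    by (intro Cinf_on_prod Cinf_on_flat Cinf_on_mult Cinf_on_diff Cinf_on_const open_UNIV)
qed

lemma flat_fn_0_bounds: "0 \<le> flat_fn 0 t" "flat_fn 0 t \<le> 1"
  by (auto simp: flat_fn_def)

lemma bump_bounds: "0 \<le> bump n a b x" "bump n a b x \<le> 1"
  unfolding bump_def by (auto intro!: prod_nonneg prod_le_1 flat_fn_0_bounds)

lemma bump_outside:
  assumes "\<And>i. a $ i < b $ i" "x \<notin> box a b" shows "bump n a b x = 0"
proof -
  obtain i where i: "x $ i \<le> a $ i \<or> b $ i \<le> x $ i"
    using assms(2) by (auto simp: mem_box_cart not_less)
  have "(x $ i - a $ i) * (b $ i - x $ i) \<le> 0"
    using i assms(1)[of i] by (auto simp: mult_le_0_iff)
  then have "flat_fn 0 (real n * ((x $ i - a $ i) * (b $ i - x $ i))) = 0"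
    by (simp add: flat_fn_def mult_le_0_iff not_less)
  then show ?thesis unfolding bump_def by (intro prod_zero) auto
qed

lemma bump_tendsto:
  fixes a b :: "real^'n"
  assumes "\<And>i. a $ i < b $ i"
  shows "(\<lambda>n. bump (Suc n) a b x) \<longlonglongrightarrow> indicator (box a b) x"
proof (cases "x \<in> box a b")
  case True
  have lim: "(\<lambda>n. flat_fn 0 (real (Suc n) * ((x $ i - a $ i) * (b $ i - x $ i)))) \<longlonglongrightarrow> 1" for i
  proof -
    define c where "c = (x $ i - a $ i) * (b $ i - x $ i)"
    have c: "c > 0" using True by (auto simp: mem_box_cart c_def)
    have "(\<lambda>n. exp (- (1 / c) * inverse (real (Suc n)))) \<longlonglongrightarrow> exp (-(1/c) * 0)"
      by (intro tendsto_intros LIMSEQ_inverse_real_of_nat)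
    moreover have "exp (- (1 / c) * inverse (real (Suc n))) = flat_fn 0 (real (Suc n) * c)" for n
    proof -
      have "real (Suc n) * c > 0" using c by simp
      then show ?thesis unfolding flat_fn_def by (simp add: divide_inverse del: of_nat_Suc)
    qed
    ultimately show ?thesis by (simp add: c_def del: of_nat_Suc)
  qed
  have "(\<lambda>n. bump (Suc n) a b x) \<longlonglongrightarrow> (\<Prod>i\<in>(UNIV::'n set). 1)"
    unfolding bump_def by (rule Limits.tendsto_prod, rule lim)
  then show ?thesis using True by simp
qed (use bump_outside[OF assms] in auto)

lemma bump_support:
  assumes "\<And>i. a $ i < b $ i" shows "closure {x. bump n a b x \<noteq> 0} \<subseteq> cbox a b"
  using bump_outside[OF assms] box_subset_cbox by (intro closure_minimal) blast+

lemma test_fn_bump: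
  assumes "\<And>i. a $ i < b $ i" "cbox a b \<subseteq> D" shows "test_fn D (bump n a b)"
  unfolding test_fn_def using bump_support[OF assms(1)] assms(2) Cinf_on_bump
  by (meson bounded_cbox bounded_subset closed_closure compact_eq_bounded_closed order_trans)

text \<open>Boxes are stable under intersection and generate the Borel sets. By Dynkin's argument
  the integral of h vanishes on every Borel set, so h and 0 are densities of the same signed
  measure.\<close>

lemma box_integrals_zero_AE:
  fixes h :: "'a::euclidean_space \<Rightarrow> real"
  assumes h: "integrable lborel h" and z: "\<And>a b. (LINT x:box a b|lborel. h x) = 0"
  shows "AE x in lborel. h x = 0"
proof (rule density_unique_real[OF h integrable_zero])
  have set_int: "set_integrable lborel A h" if "A \<in> sets borel" for A
    using h that unfolding set_integrable_def by (intro integrable_mult_indicator) auto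
  have lim: "(\<lambda>n. LINT x:box (- (real n *\<^sub>R One)) (real n *\<^sub>R One)|lborel. h x) \<longlonglongrightarrow> integral\<^sup>L lborel h"
    unfolding set_lebesgue_integral_def
  proof (rule integral_dominated_convergence[where w = "\<lambda>x. norm (h x)"])
    show "AE x in lborel. (\<lambda>n. indicator (box (- (real n *\<^sub>R One)) (real n *\<^sub>R One)) x *\<^sub>R h x) \<longlonglongrightarrow> h x"
    proof (intro AE_I2 tendsto_eventually)
      fix x :: 'a
      have "x \<in> (\<Union>n. box (- (real n *\<^sub>R One)) (real n *\<^sub>R One))" using UN_box_eq_UNIV by auto
      then obtain n where n: "x \<in> box (- (real n *\<^sub>R One)) (real n *\<^sub>R One)" by blast
      then have "x \<in> box (- (real m *\<^sub>R One)) (real m *\<^sub>R One)" if "m \<ge> n" for m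
        using that by (fastforce simp: mem_box)
      then show "\<forall>\<^sub>F m in sequentially. indicator (box (- (real m *\<^sub>R One)) (real m *\<^sub>R One)) x *\<^sub>R h x = h x"
        by (auto simp: eventually_sequentially intro!: exI[of _ n])
    qed
  qed (use h in \<open>auto simp: indicator_def\<close>)
  \<comment> \<open>The complement step of the induction below needs the integral over the whole
    space, obtained by exhausting it with boxes.\<close>
  have total: "integral\<^sup>L lborel h = 0" using LIMSEQ_unique[OF lim] z by (simp add: LIMSEQ_const_iff)
  fix A :: "'a set" assume "A \<in> sets lborel"
  then have A: "A \<in> sigma_sets UNIV (range (\<lambda>(a,b). box a b))" by (simp add: borel_eq_box)
  have "box a b \<inter> box c d \<in> range (\<lambda>(a,b). box a b)" for a b c d :: 'a
    unfolding box_Int_box by auto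
  then have st: "Int_stable (range (\<lambda>(a,b). box a b :: 'a set))"
    by (auto simp: Int_stable_def)
  have "(LINT x:A|lborel. h x) = 0"
    using st Pow_UNIV[THEN equalityD2, THEN subset_trans[OF subset_UNIV]] A
  proof (induction rule: sigma_sets_induct_disjoint)
    case (compl A)
    then have "A \<in> sets borel" by (simp add: borel_eq_box)
    then have "(LINT x:UNIV|lborel. h x) = (LINT x:A|lborel. h x) + (LINT x:UNIV - A|lborel. h x)"
      by (subst set_integral_Un[symmetric]) (auto intro!: set_int)
    then show ?case using compl total by (simp add: set_lebesgue_integral_def)
  next
    case (union A)
    then have A: "A i \<in> sets borel" for i by (auto simp: borel_eq_box)
    have "(LINT x:(\<Union>i. A i)|lborel. h x) = (\<Sum>i. LINT x:A i|lborel. h x)"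
      using union(1) A by (intro lebesgue_integral_countable_add set_int) (auto simp: disjoint_family_on_def)
    then show ?case using union by simp
  qed (use z in \<open>auto simp: set_lebesgue_integral_def\<close>)
  then show "(LINT x:A|lborel. h x) = (LINT x:A|lborel. 0)" by simp
qed

text \<open>Lets a function measurable for the completed measure be replaced by a Borel one, for
  which translations, images and product measures of \<open>lborel\<close> are at hand.\<close>

lemma integrable_lebesgue_borel_version:
  fixes h :: "'a::euclidean_space \<Rightarrow> real"
  assumes "integrable lebesgue h"
  obtains h' where "integrable lborel h'" "AE x in lborel. h x = h' x"
proof -
  obtain h' where h': "h' \<in> borel_measurable lborel" "AE x in lborel. h x = h' x"
    using completion_ex_borel_measurable_real borel_measurable_integrable[OF assms] by blast
  have "integrable lebesgue h'"
    by (rule integrable_cong_AE_imp[OF assms]) (use h' in \<open>auto intro: AE_completion measurable_completion simp: eq_commute\<close>)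
  with h' show ?thesis using that by (simp add: integrable_completion)
qed

text \<open>Fundamental lemma of the calculus of variations, needing only the functions \<open>bump\<close>.\<close>
lemma bump_integral_zero_AE:
  fixes h :: "real^'n \<Rightarrow> real"
  assumes D: "open D" and int: "\<And>a b. cbox a b \<subseteq> D \<Longrightarrow> integrable (lebesgue_on (cbox a b)) h"
    and zero: "\<And>n a b. (\<And>i. a $ i < b $ i) \<Longrightarrow> cbox a b \<subseteq> D \<Longrightarrow> integral\<^sup>L lebesgue (\<lambda>x. bump (Suc n) a b x * h x) = 0"
  shows "AE x in lebesgue. x \<in> D \<longrightarrow> h x = 0"
proof -
  have intL: "integrable lebesgue (\<lambda>x. indicator (cbox a b) x * h x)" if "cbox a b \<subseteq> D" for a b
    using int[OF that] integrable_restrict_space[of "cbox a b" lebesgue h] by simp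
  have box0: "(\<integral>x. indicator (box a b) x * h x \<partial>lebesgue) = 0" if ab: "\<And>i. a $ i < b $ i" "cbox a b \<subseteq> D" for a b
  proof -
    have eqb: "bump (Suc n) a b x * h x = bump (Suc n) a b x * (indicator (cbox a b) x * h x)" for n x
      using bump_outside[OF ab(1), of _ "Suc n"] box_subset_cbox[of a b] by (cases "x \<in> box a b") (auto simp: indicator_def)
    have "(\<lambda>n. \<integral>x. bump (Suc n) a b x * h x \<partial>lebesgue) \<longlonglongrightarrow> (\<integral>x. indicator (box a b) x * (indicator (cbox a b) x * h x) \<partial>lebesgue)"
      unfolding eqb
    proof (rule integral_dominated_convergence[where w = "\<lambda>x. norm (indicator (cbox a b) x * h x)"])
      show "(\<lambda>x. bump (Suc n) a b x * (indicator (cbox a b) x * h x)) \<in> borel_measurable lebesgue" for n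
        using Cinf_on_continuous[OF Cinf_on_bump[of "Suc n" a b]] intL[OF ab(2)]
        by (intro borel_measurable_times[of "bump (Suc n) a b"]) (auto intro!: measurable_completion borel_measurable_continuous_onI dest: borel_measurable_integrable)
      show "(\<lambda>x. indicator (box a b) x * (indicator (cbox a b) x * h x)) \<in> borel_measurable lebesgue"
        using intL[OF ab(2)] by (intro borel_measurable_times[of "indicator (box a b)"] borel_measurable_indicator) (auto dest: borel_measurable_integrable)
      show "AE x in lebesgue. (\<lambda>n. bump (Suc n) a b x * (indicator (cbox a b) x * h x)) \<longlonglongrightarrow> indicator (box a b) x * (indicator (cbox a b) x * h x)"
        by (intro AE_I2 tendsto_mult bump_tendsto ab tendsto_const)
      show "AE x in lebesgue. norm (bump (Suc n) a b x * (indicator (cbox a b) x * h x)) \<le> norm (indicator (cbox a b) x * h x)" for n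
        using bump_bounds[of "Suc n" a b] by (intro AE_I2) (simp add: abs_mult mult_left_le_one_le)
    qed (use intL[OF ab(2)] in auto)
    moreover have "(\<lambda>n. \<integral>x. bump (Suc n) a b x * h x \<partial>lebesgue) = (\<lambda>n. 0)" using zero ab by auto
    ultimately have "(\<integral>x. indicator (box a b) x * (indicator (cbox a b) x * h x) \<partial>lebesgue) = 0"
      by (simp add: LIMSEQ_const_iff)
    moreover have "(\<lambda>x. indicator (box a b) x * (indicator (cbox a b) x * h x)) = (\<lambda>x. indicator (box a b) x * h x)"
      using box_subset_cbox[of a b] by (intro ext) (auto simp: indicator_def)
    ultimately show ?thesis by simp
  qed
  have AEbox: "AE x in lebesgue. x \<in> box c d \<longrightarrow> h x = 0" if cd: "cbox c d \<subseteq> D" for c d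
  proof -
    have "integrable lebesgue (\<lambda>x. indicator (box c d) x *\<^sub>R (indicator (cbox c d) x * h x))"
      by (intro integrable_mult_indicator intL cd) auto
    moreover have "(\<lambda>x. indicator (box c d) x *\<^sub>R (indicator (cbox c d) x * h x)) = (\<lambda>x. indicator (box c d) x * h x)"
      using box_subset_cbox[of c d] by (intro ext) (auto simp: indicator_def)
    ultimately have "integrable lebesgue (\<lambda>x. indicator (box c d) x * h x)" by simp
    then obtain h' where h': "integrable lborel h'" "AE x in lborel. indicator (box c d) x * h x = h' x"
      using integrable_lebesgue_borel_version by blast
    have "(LINT x:box a b|lborel. h' x) = 0" for a b
    proof -
      obtain p q where pq: "box a b \<inter> box c d = box p q" using box_Int_box[of a b c d] by (rule that)
      have "(LINT x:box a b|lborel. h' x) = (LINT x:box a b|lebesgue. h' x)"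
        using h' unfolding set_lebesgue_integral_def by (subst integral_completion) auto
      also have "\<dots> = (\<integral>x. indicator (box p q) x * h x \<partial>lebesgue)"
        unfolding set_lebesgue_integral_def
      proof (rule integral_cong_AE)
        have "AE x in lebesgue. indicator (box c d) x * h x = h' x" using h' AE_completion by blast
        then show "AE x in lebesgue. indicator (box a b) x *\<^sub>R h' x = indicator (box p q) x * h x"
        proof eventually_elim
          case (elim x)
          have "indicator (box p q) x = (indicator (box a b) x * indicator (box c d) x :: real)"
            by (simp add: pq[symmetric] indicator_inter_arith)
          then show ?case using elim[symmetric] by simp
        qed
        have "(\<lambda>x. indicator (box a b) x * (indicator (box c d) x * h x)) \<in> borel_measurable lebesgue"
          using \<open>integrable lebesgue (\<lambda>x. indicator (box c d) x * h x)\<close>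
          by (intro borel_measurable_times[of "indicator (box a b)"] borel_measurable_indicator) (auto dest: borel_measurable_integrable)
        moreover have "(\<lambda>x. indicator (box a b) x * (indicator (box c d) x * h x)) = (\<lambda>x. indicator (box p q) x * h x)"
          using pq by (intro ext) (auto simp: indicator_def)
        ultimately show "(\<lambda>x. indicator (box p q) x * h x) \<in> borel_measurable lebesgue" by simp
      qed (use h' in \<open>auto intro!: measurable_completion borel_measurable_scaleR dest: borel_measurable_integrable\<close>)
      also have "\<dots> = 0"
      proof (cases "box p q = {}")
        case False
        then have lt: "\<And>i. p $ i < q $ i" by (metis interval_eq_empty_cart(1) not_less)
        have "cbox p q = closure (box p q)" using False by (simp add: closure_box)
        also have "\<dots> \<subseteq> closure (box c d)" using pq by (intro closure_mono) auto
        also have "\<dots> \<subseteq> cbox c d" using box_subset_cbox by (intro closure_minimal) auto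
        finally show ?thesis using box0[of p q] lt cd by auto
      qed simp
      finally show ?thesis .
    qed
    then have "AE x in lborel. h' x = 0" by (rule box_integrals_zero_AE[OF h'(1)])
    then have "AE x in lborel. x \<in> box c d \<longrightarrow> h x = 0"
      using h'(2) by eventually_elim (auto simp: indicator_def split: if_splits)
    then show ?thesis by (rule AE_completion)
  qed
  \<comment> \<open>The previous step gives one null set per box. By Lindelof countably many boxes
    with closure in D already cover D, so the null sets can be joined.\<close>
  have cnt: "\<exists>\<B>. countable \<B> \<and> \<B> \<subseteq> {(c,d). cbox c d \<subseteq> D} \<and> D \<subseteq> (\<Union>(c,d)\<in>\<B>. box c d)"
  proof -
    have "\<exists>c d. x \<in> box c d \<and> cbox c d \<subseteq> D" if "x \<in> D" for x
    proof -
      obtain e where e: "e > 0" "cball x e \<subseteq> D" using D \<open>x \<in> D\<close> open_contains_cball by blast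
      obtain c d where "x \<in> box c d" "cbox c d \<subseteq> cball x e"
      proof -
        obtain a b where "x \<in> box a b" "box a b \<subseteq> ball x e"
          using rational_boxes[OF e(1), of x] by blast
        moreover then have "cbox a b \<subseteq> cball x e"
          by (metis closure_ball[OF e(1)] closure_box closure_mono empty_iff)
        ultimately show ?thesis using that by blast
      qed
      with e show ?thesis by blast
    qed
    then have "\<Union>((\<lambda>(c,d). box c d) ` {(c,d). cbox c d \<subseteq> D}) = D"
      using box_subset_cbox by fastforce
    then obtain \<F> where F: "\<F> \<subseteq> (\<lambda>(c,d). box c d) ` {(c,d). cbox c d \<subseteq> D}" "countable \<F>" "\<Union>\<F> = D"
      using Lindelof[of "(\<lambda>(c,d). box c d) ` {(c,d). cbox c d \<subseteq> D}"] by (metis (no_types, lifting) image_iff open_box case_prod_unfold)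
    obtain \<B> where "\<B> \<subseteq> {(c,d). cbox c d \<subseteq> D}" "countable \<B>" "\<F> = (\<lambda>(c,d). box c d) ` \<B>"
      using countable_subset_image[of \<F>] F by metis
    with F show ?thesis by blast
  qed
  then obtain \<B> where B: "countable \<B>" "\<B> \<subseteq> {(c,d). cbox c d \<subseteq> D}" "D \<subseteq> (\<Union>(c,d)\<in>\<B>. box c d)" by blast
  have "AE x in lebesgue. \<forall>p\<in>\<B>. x \<in> box (fst p) (snd p) \<longrightarrow> h x = 0"
    using B AEbox by (subst AE_ball_countable) auto
  then show ?thesis by eventually_elim (use B(3) in force)
qed

section \<open>Weak derivatives: uniqueness, product rule, linear images\<close>

lemma test_fn_zero: "test_fn U \<phi> \<Longrightarrow> x \<notin> closure {x. \<phi> x \<noteq> 0} \<Longrightarrow> \<phi> x = 0"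
  using closure_subset[of "{x. \<phi> x \<noteq> 0}"] by auto

lemma pd_test_fn_zero:
  assumes "x \<notin> closure {x. \<phi> x \<noteq> 0}" shows "pd b \<phi> x = 0"
proof -
  have "pd b \<phi> x = pd b (\<lambda>x. 0) x"
    by (rule pd_cong_open[of "- closure {x. \<phi> x \<noteq> 0}"])
       (use assms closure_subset[of "{x. \<phi> x \<noteq> 0}"] in auto)
  then show ?thesis by (simp add: pd_def)
qed

lemma integrable_compact_support:
  fixes f :: "real^'n \<Rightarrow> 'b::euclidean_space" and \<phi> :: "real^'n \<Rightarrow> real"
  assumes U: "open U" and K: "compact K" "K \<subseteq> U" and phi: "continuous_on U \<phi>" "\<And>x. x \<notin> K \<Longrightarrow> \<phi> x = 0"
    and f: "loc_int U f"
  shows "integrable lebesgue (\<lambda>x. \<phi> x *\<^sub>R f x)"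
    and "integrable (lebesgue_on U) (\<lambda>x. \<phi> x *\<^sub>R f x)"
    and "integral\<^sup>L (lebesgue_on U) (\<lambda>x. \<phi> x *\<^sub>R f x) = integral\<^sup>L lebesgue (\<lambda>x. \<phi> x *\<^sub>R f x)"
proof -
  have Kl: "K \<in> sets lebesgue" "U \<in> sets lebesgue" using K U by (auto simp: compact_imp_closed)
  have "compact (\<phi> ` K)" using K phi by (meson compact_continuous_image continuous_on_subset)
  then obtain B where B: "\<And>x. x \<in> K \<Longrightarrow> norm (\<phi> x) \<le> B"
    using compact_imp_bounded by (metis bounded_iff image_eqI)
  have fK: "integrable (lebesgue_on K) f" using f K by (auto simp: loc_int_def)
  have "integrable (lebesgue_on K) (\<lambda>x. \<phi> x *\<^sub>R f x)"
  proof (rule Bochner_Integration.integrable_bound[of _ "\<lambda>x. B * norm (f x)"])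
    show "(\<lambda>x. \<phi> x *\<^sub>R f x) \<in> borel_measurable (lebesgue_on K)"
      using fK Kl continuous_on_subset[OF phi(1) K(2)] borel_measurable_integrable
      by (intro borel_measurable_scaleR[OF continuous_imp_measurable_on_sets_lebesgue]) auto
    show "AE x in lebesgue_on K. norm (\<phi> x *\<^sub>R f x) \<le> norm (B * norm (f x))"
      using B by (intro AE_I2) (force simp: abs_mult intro!: mult_right_mono order_trans[OF B])
  qed (use fK in auto)
  then have "integrable lebesgue (\<lambda>x. indicator K x *\<^sub>R (\<phi> x *\<^sub>R f x))"
    using integrable_restrict_space[of K lebesgue "\<lambda>x. \<phi> x *\<^sub>R f x"] Kl by simp
  moreover have "(\<lambda>x. indicator K x *\<^sub>R (\<phi> x *\<^sub>R f x)) = (\<lambda>x. \<phi> x *\<^sub>R f x)"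
    using phi by (intro ext) (auto simp: indicator_def)
  ultimately show i: "integrable lebesgue (\<lambda>x. \<phi> x *\<^sub>R f x)" by simp
  have eq: "(\<lambda>x. indicator U x *\<^sub>R (\<phi> x *\<^sub>R f x)) = (\<lambda>x. \<phi> x *\<^sub>R f x)"
    using phi K by (intro ext) (auto simp: indicator_def)
  show "integrable (lebesgue_on U) (\<lambda>x. \<phi> x *\<^sub>R f x)"
    using integrable_restrict_space[of U lebesgue "\<lambda>x. \<phi> x *\<^sub>R f x"] Kl eq i by simp
  show "integral\<^sup>L (lebesgue_on U) (\<lambda>x. \<phi> x *\<^sub>R f x) = integral\<^sup>L lebesgue (\<lambda>x. \<phi> x *\<^sub>R f x)"
    using integral_restrict_space[of U lebesgue "\<lambda>x. \<phi> x *\<^sub>R f x"] Kl eq by simp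
qed

lemma test_fn_cont: "test_fn U \<phi> \<Longrightarrow> continuous_on V \<phi>" "test_fn U \<phi> \<Longrightarrow> b \<in> Basis \<Longrightarrow> continuous_on V (pd b \<phi>)"
  unfolding test_fn_def by (meson Cinf_on_continuous Cinf_on_pd continuous_on_subset subset_UNIV)+

lemma test_fn_integrable:
  fixes f :: "real^'n \<Rightarrow> 'b::euclidean_space"
  assumes "open U" "test_fn U \<phi>" "loc_int U f"
  shows "integrable (lebesgue_on U) (\<lambda>x. \<phi> x *\<^sub>R f x)"
    "integrable (lebesgue_on U) (\<lambda>x. pd (axis j 1) \<phi> x *\<^sub>R f x)"
    "integral\<^sup>L (lebesgue_on U) (\<lambda>x. \<phi> x *\<^sub>R f x) = integral\<^sup>L lebesgue (\<lambda>x. \<phi> x *\<^sub>R f x)"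
proof -
  have K: "compact (closure {x. \<phi> x \<noteq> 0})" "closure {x. \<phi> x \<noteq> 0} \<subseteq> U"
    using assms(2) by (auto simp: test_fn_def)
  have ax: "axis j (1::real) \<in> Basis" by (simp add: axis_in_Basis_iff)
  note i = integrable_compact_support[OF assms(1) K test_fn_cont(1)[OF assms(2)] test_fn_zero[OF assms(2)] assms(3)]
  note i' = integrable_compact_support[OF assms(1) K test_fn_cont(2)[OF assms(2) ax] pd_test_fn_zero assms(3)]
  show "integrable (lebesgue_on U) (\<lambda>x. \<phi> x *\<^sub>R f x)"
    "integrable (lebesgue_on U) (\<lambda>x. pd (axis j 1) \<phi> x *\<^sub>R f x)"
    "integral\<^sup>L (lebesgue_on U) (\<lambda>x. \<phi> x *\<^sub>R f x) = integral\<^sup>L lebesgue (\<lambda>x. \<phi> x *\<^sub>R f x)"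
    by (rule i i' | assumption)+
qed

text \<open>The difference of two candidates integrates to zero against every bump, so the
  fundamental lemma applies. It serves to identify an arbitrary weak gradient \<open>P\<close> of
  \<open>pvec\<close> with the one computed by the product rule.\<close>

lemma weak_partials_unique:
  fixes f :: "real^'n \<Rightarrow> real"
  assumes U: "open U" and A: "weak_partials U f A" and B: "weak_partials U f B"
  shows "AE x in lebesgue. x \<in> U \<longrightarrow> A j x = B j x"
proof -
  have "AE x in lebesgue. x \<in> U \<longrightarrow> A j x - B j x = 0"
  proof (rule bump_integral_zero_AE[OF U])
    show "integrable (lebesgue_on (cbox a b)) (\<lambda>x. A j x - B j x)" if "cbox a b \<subseteq> U" for a b
      using A B that by (auto simp: weak_partials_def loc_int_def)
    fix n and a b :: "real^'n" assume "\<And>i. a $ i < b $ i" "cbox a b \<subseteq> U"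
    then have t: "test_fn U (bump (Suc n) a b)" by (rule test_fn_bump)
    have li: "loc_int U (A j)" "loc_int U (B j)" "loc_int U (\<lambda>x. A j x - B j x)"
      using A B by (auto simp: weak_partials_def loc_int_def)
    note i = test_fn_integrable[OF U t li(1)] test_fn_integrable[OF U t li(2)] test_fn_integrable[OF U t li(3)]
    have "integral\<^sup>L lebesgue (\<lambda>x. bump (Suc n) a b x * (A j x - B j x)) =
       integral\<^sup>L (lebesgue_on U) (\<lambda>x. bump (Suc n) a b x * A j x - bump (Suc n) a b x * B j x)"
      using i by (simp add: right_diff_distrib)
    also have "\<dots> = integral\<^sup>L (lebesgue_on U) (\<lambda>x. bump (Suc n) a b x * A j x) - integral\<^sup>L (lebesgue_on U) (\<lambda>x. bump (Suc n) a b x * B j x)"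
      using i by (intro Bochner_Integration.integral_diff) auto
    also have "\<dots> = 0"
    proof -
      have "integral\<^sup>L (lebesgue_on U) (\<lambda>x. pd (axis j 1) (bump (Suc n) a b) x *\<^sub>R f x)
          = - integral\<^sup>L (lebesgue_on U) (\<lambda>x. bump (Suc n) a b x *\<^sub>R A j x)"
        "integral\<^sup>L (lebesgue_on U) (\<lambda>x. pd (axis j 1) (bump (Suc n) a b) x *\<^sub>R f x)
          = - integral\<^sup>L (lebesgue_on U) (\<lambda>x. bump (Suc n) a b x *\<^sub>R B j x)"
        using A B t unfolding weak_partials_def by blast+
      then show ?thesis by simp
    qed
    finally show "integral\<^sup>L lebesgue (\<lambda>x. bump (Suc n) a b x * (A j x - B j x)) = 0" .
  qed
  then show ?thesis by simp
qed

lemma loc_int_mult: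
  fixes f :: "real^'n \<Rightarrow> real"
  assumes T: "continuous_on U T" and f: "loc_int U f"
  shows "loc_int U (\<lambda>x. T x * f x)"
  unfolding loc_int_def
proof (intro allI impI)
  fix K assume K: "compact K \<and> K \<subseteq> U"
  have "compact (T ` K)" using K T by (meson compact_continuous_image continuous_on_subset)
  then obtain B where B: "\<And>x. x \<in> K \<Longrightarrow> norm (T x) \<le> B"
    using compact_imp_bounded by (metis bounded_iff image_eqI)
  have fK: "integrable (lebesgue_on K) f" using f K by (auto simp: loc_int_def)
  show "integrable (lebesgue_on K) (\<lambda>x. T x * f x)"
  proof (rule Bochner_Integration.integrable_bound[of _ "\<lambda>x. B * norm (f x)"])
    show "(\<lambda>x. T x * f x) \<in> borel_measurable (lebesgue_on K)"
      using fK K continuous_on_subset[OF T] borel_measurable_integrable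
      by (intro borel_measurable_times[OF continuous_imp_measurable_on_sets_lebesgue]) (auto simp: compact_imp_closed)
    show "AE x in lebesgue_on K. norm (T x * f x) \<le> norm (B * norm (f x))"
      using B by (intro AE_I2) (force simp: abs_mult intro!: mult_right_mono order_trans[OF B])
  qed (use fK in auto)
qed

text \<open>Testing f with the product of the test function and T moves one derivative onto T by the
  classical product rule.\<close>

lemma weak_partials_mult:
  fixes f :: "real^'n \<Rightarrow> real"
  assumes U: "open U" and T: "Cinf_on U T" and f: "weak_partials U f Df"
  shows "weak_partials U (\<lambda>x. T x * f x) (\<lambda>j x. pd (axis j 1) T x * f x + T x * Df j x)"
proof -
  have ax: "axis j (1::real) \<in> Basis" for j :: 'n by (simp add: axis_in_Basis_iff)
  have Tc: "continuous_on U T" "continuous_on U (pd (axis j 1) T)" for j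
    using Cinf_on_continuous Cinf_on_pd[OF T ax] T by blast+
  have li: "loc_int U (\<lambda>x. T x * f x)" "loc_int U (\<lambda>x. pd (axis j 1) T x * f x)" "loc_int U (\<lambda>x. T x * Df j x)"
     "loc_int U f" "loc_int U (Df j)" for j
    using f Tc by (auto intro!: loc_int_mult simp: weak_partials_def)
  then have li2: "loc_int U (\<lambda>x. pd (axis j 1) T x * f x + T x * Df j x)" for j
    by (simp add: loc_int_def)
  have main: "integral\<^sup>L (lebesgue_on U) (\<lambda>x. pd (axis j 1) \<phi> x *\<^sub>R (T x * f x))
          = - integral\<^sup>L (lebesgue_on U) (\<lambda>x. \<phi> x *\<^sub>R (pd (axis j 1) T x * f x + T x * Df j x))"
    if t: "test_fn U \<phi>" for \<phi> j
  proof -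
    let ?K = "closure {x. \<phi> x \<noteq> 0}"
    have K: "compact ?K" "?K \<subseteq> U" "Cinf_on UNIV \<phi>" using t by (auto simp: test_fn_def)
    \<comment> \<open>T is smooth on U alone, while a test function lives on the whole space.
      Cutting the product off outside U keeps it smooth, because \<phi> vanishes off a compact
      subset of U and the two open sets U and the complement of that subset cover
      everything.\<close>
    define \<psi> where "\<psi> = (\<lambda>x. if x \<in> U then \<phi> x * T x else 0)"
    have z: "\<phi> x = 0" if "x \<notin> ?K" for x using test_fn_zero[OF t that] .
    have "Cinf_on U \<psi>"
      by (rule Cinf_on_cong[OF U, of "\<lambda>x. \<phi> x * T x"])
         (simp_all add: \<psi>_def Cinf_on_mult[OF U Cinf_on_subset[OF K(3) subset_UNIV] T])
    moreover have "Cinf_on (- ?K) \<psi>"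
    proof -
      have o: "open (- ?K)" by (simp add: open_Compl)
      have "0 = \<psi> x" if "x \<in> - ?K" for x
        using z[OF ComplD[OF that]] unfolding \<psi>_def by (metis mult_zero_left)
      then show ?thesis by (rule Cinf_on_cong[OF o _ Cinf_on_const[OF o]])
    qed
    moreover have "U \<union> - ?K = UNIV" using K by auto
    ultimately have "Cinf_on UNIV \<psi>" using Cinf_on_Un by metis
    moreover have cl: "closure {x. \<psi> x \<noteq> 0} \<subseteq> ?K" by (intro closure_mono) (auto simp: \<psi>_def)
    ultimately have t2: "test_fn U \<psi>" unfolding test_fn_def using K
      by (meson bounded_subset closed_closure compact_eq_bounded_closed order_trans)
    have pd: "pd (axis j 1) \<psi> x = pd (axis j 1) \<phi> x * T x + \<phi> x * pd (axis j 1) T x" if "x \<in> U" for x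
    proof -
      have "pd (axis j 1) \<psi> x = pd (axis j 1) (\<lambda>x. \<phi> x * T x) x"
        by (rule pd_cong_open[OF U that]) (simp add: \<psi>_def)
      also have "\<dots> = \<phi> x * pd (axis j 1) T x + pd (axis j 1) \<phi> x * T x"
        using that by (intro pd_eqI has_derivative_mult pd_works Cinf_on_differentiable[OF K(3)] Cinf_on_differentiable[OF T]) auto
      finally show ?thesis by simp
    qed
    have "integral\<^sup>L (lebesgue_on U) (\<lambda>x. pd (axis j 1) \<psi> x *\<^sub>R f x) = - integral\<^sup>L (lebesgue_on U) (\<lambda>x. \<psi> x *\<^sub>R Df j x)"
      using f t2 unfolding weak_partials_def by blast
    moreover have "integral\<^sup>L (lebesgue_on U) (\<lambda>x. pd (axis j 1) \<psi> x *\<^sub>R f x) =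
        integral\<^sup>L (lebesgue_on U) (\<lambda>x. pd (axis j 1) \<phi> x *\<^sub>R (T x * f x) + \<phi> x *\<^sub>R (pd (axis j 1) T x * f x))"
      by (intro Bochner_Integration.integral_cong) (auto simp: pd algebra_simps)
    moreover have "\<dots> = integral\<^sup>L (lebesgue_on U) (\<lambda>x. pd (axis j 1) \<phi> x *\<^sub>R (T x * f x)) + integral\<^sup>L (lebesgue_on U) (\<lambda>x. \<phi> x *\<^sub>R (pd (axis j 1) T x * f x))"
      by (intro Bochner_Integration.integral_add test_fn_integrable U t li)
    moreover have "integral\<^sup>L (lebesgue_on U) (\<lambda>x. \<psi> x *\<^sub>R Df j x) = integral\<^sup>L (lebesgue_on U) (\<lambda>x. \<phi> x *\<^sub>R (T x * Df j x))"
      by (intro Bochner_Integration.integral_cong) (auto simp: \<psi>_def algebra_simps)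
    moreover have "integral\<^sup>L (lebesgue_on U) (\<lambda>x. \<phi> x *\<^sub>R (pd (axis j 1) T x * f x + T x * Df j x)) =
       integral\<^sup>L (lebesgue_on U) (\<lambda>x. \<phi> x *\<^sub>R (pd (axis j 1) T x * f x)) + integral\<^sup>L (lebesgue_on U) (\<lambda>x. \<phi> x *\<^sub>R (T x * Df j x))"
      unfolding scaleR_add_right by (intro Bochner_Integration.integral_add test_fn_integrable U t li)
    ultimately show ?thesis by simp
  qed
  show ?thesis unfolding weak_partials_def using li li2 main by blast
qed

lemma weak_partials_zero: "weak_partials U (\<lambda>x. 0) (\<lambda>j x. 0)"
  by (simp add: weak_partials_def loc_int_def)

lemma weak_partials_add:
  fixes f g :: "real^'n \<Rightarrow> real"
  assumes U: "open U" and f: "weak_partials U f Df" and g: "weak_partials U g Dg"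
  shows "weak_partials U (\<lambda>x. f x + g x) (\<lambda>j x. Df j x + Dg j x)"
proof -
  have li: "loc_int U f" "loc_int U g" "loc_int U (Df j)" "loc_int U (Dg j)" for j
    using f g by (auto simp: weak_partials_def)
  have "integral\<^sup>L (lebesgue_on U) (\<lambda>x. pd (axis j 1) \<phi> x *\<^sub>R (f x + g x))
          = - integral\<^sup>L (lebesgue_on U) (\<lambda>x. \<phi> x *\<^sub>R (Df j x + Dg j x))" if t: "test_fn U \<phi>" for \<phi> j
  proof -
    have "integral\<^sup>L (lebesgue_on U) (\<lambda>x. pd (axis j 1) \<phi> x *\<^sub>R (f x + g x)) =
      integral\<^sup>L (lebesgue_on U) (\<lambda>x. pd (axis j 1) \<phi> x *\<^sub>R f x) + integral\<^sup>L (lebesgue_on U) (\<lambda>x. pd (axis j 1) \<phi> x *\<^sub>R g x)"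
      unfolding scaleR_add_right by (intro Bochner_Integration.integral_add test_fn_integrable U t li)
    moreover have "integral\<^sup>L (lebesgue_on U) (\<lambda>x. \<phi> x *\<^sub>R (Df j x + Dg j x)) =
      integral\<^sup>L (lebesgue_on U) (\<lambda>x. \<phi> x *\<^sub>R Df j x) + integral\<^sup>L (lebesgue_on U) (\<lambda>x. \<phi> x *\<^sub>R Dg j x)"
      unfolding scaleR_add_right by (intro Bochner_Integration.integral_add test_fn_integrable U t li)
    ultimately show ?thesis using f g t unfolding weak_partials_def by simp
  qed
  with li show ?thesis by (auto simp: weak_partials_def loc_int_def)
qed

lemma weak_partials_sum:
  fixes f :: "'i \<Rightarrow> real^'n \<Rightarrow> real"
  assumes U: "open U" and "finite I" "\<And>i. i \<in> I \<Longrightarrow> weak_partials U (f i) (Df i)"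
  shows "weak_partials U (\<lambda>x. \<Sum>i\<in>I. f i x) (\<lambda>j x. \<Sum>i\<in>I. Df i j x)"
  using assms(2,3)
proof induction
  case empty show ?case by (simp add: weak_partials_zero)
next
  case (insert a F)
  have "weak_partials U (\<lambda>x. f a x + (\<Sum>i\<in>F. f i x)) (\<lambda>j x. Df a j x + (\<Sum>i\<in>F. Df i j x))"
    using insert by (intro weak_partials_add U) auto
  with insert show ?case by simp
qed

lemma loc_int_linear:
  assumes "bounded_linear h" "loc_int U f" shows "loc_int U (\<lambda>x. h (f x))"
  using assms unfolding loc_int_def by (auto intro: integrable_bounded_linear)

lemma weak_partials_linear:
  fixes f :: "real^'n \<Rightarrow> 'b::euclidean_space" and h :: "'b \<Rightarrow> real"
  assumes U: "open U" and f: "weak_partials U f Df" and h: "bounded_linear h"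
  shows "weak_partials U (\<lambda>x. h (f x)) (\<lambda>j x. h (Df j x))"
proof -
  have li: "loc_int U f" "loc_int U (Df j)" for j
    using f by (auto simp: weak_partials_def)
  have "integral\<^sup>L (lebesgue_on U) (\<lambda>x. pd (axis j 1) \<phi> x *\<^sub>R h (f x))
          = - integral\<^sup>L (lebesgue_on U) (\<lambda>x. \<phi> x *\<^sub>R h (Df j x))" if t: "test_fn U \<phi>" for \<phi> j
  proof -
    have "integral\<^sup>L (lebesgue_on U) (\<lambda>x. h (pd (axis j 1) \<phi> x *\<^sub>R f x)) = h (integral\<^sup>L (lebesgue_on U) (\<lambda>x. pd (axis j 1) \<phi> x *\<^sub>R f x))"
      by (intro integral_bounded_linear h test_fn_integrable U t li)
    moreover have "integral\<^sup>L (lebesgue_on U) (\<lambda>x. h (\<phi> x *\<^sub>R Df j x)) = h (integral\<^sup>L (lebesgue_on U) (\<lambda>x. \<phi> x *\<^sub>R Df j x))"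
      by (intro integral_bounded_linear h test_fn_integrable U t li)
    moreover have "integral\<^sup>L (lebesgue_on U) (\<lambda>x. pd (axis j 1) \<phi> x *\<^sub>R f x) = - integral\<^sup>L (lebesgue_on U) (\<lambda>x. \<phi> x *\<^sub>R Df j x)"
      using f t by (simp add: weak_partials_def)
    ultimately show ?thesis
      using linear_scale[OF bounded_linear.linear[OF h]] linear_neg[OF bounded_linear.linear[OF h]] by simp
  qed
  with li show ?thesis by (auto simp: weak_partials_def intro: loc_int_linear[OF h])
qed

section \<open>Coordinates and translations of Lebesgue measure\<close>

lemma prod_Basis_cart: "(\<Prod>b\<in>(Basis :: (real^'n) set). f b) = (\<Prod>i\<in>UNIV. f (axis i 1))"
proof -
  have 1: "(Basis :: (real^'n) set) = (\<lambda>i. axis i 1) ` UNIV" by (auto simp: Basis_vec_def)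
  have 2: "inj (\<lambda>i. axis i (1::real) :: real^'n)" by (auto simp: inj_on_def axis_eq_axis)
  show ?thesis unfolding 1 by (simp add: prod.reindex[OF 2])
qed

lemma continuous_vector2: "continuous_on S f \<Longrightarrow> continuous_on S g \<Longrightarrow> continuous_on S (\<lambda>x. vector [f x, g x] :: real^2)"
proof -
  assume "continuous_on S f" "continuous_on S g"
  then have "continuous_on S (\<lambda>x. if i = 1 then f x else g x)" for i :: 2 by (cases "i = 1") auto
  then have "continuous_on S (\<lambda>x. \<chi> i. if i = 1 then f x else g x :: real^2)"
    by (rule continuous_on_vec_lambda)
  moreover have "vector [f x, g x] = (\<chi> i. if i = 1 then f x else g x :: real^2)" for x
    by (simp add: vec_eq_iff forall_2)
  ultimately show ?thesis by simp
qed

lemma continuous_vector3: "continuous_on S f \<Longrightarrow> continuous_on S g \<Longrightarrow> continuous_on S h \<Longrightarrow> continuous_on S (\<lambda>x. vector [f x, g x, h x] :: real^3)"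
proof -
  assume "continuous_on S f" "continuous_on S g" "continuous_on S h"
  then have "continuous_on S (\<lambda>x. if i = 1 then f x else if i = 2 then g x else h x)" for i :: 3
    by (cases "i = 1"; cases "i = 2") auto
  then have "continuous_on S (\<lambda>x. \<chi> i. if i = 1 then f x else if i = 2 then g x else h x :: real^3)"
    by (rule continuous_on_vec_lambda)
  moreover have "vector [f x, g x, h x] = (\<chi> i. if i = 1 then f x else if i = 2 then g x else h x :: real^3)" for x
    by (simp add: vec_eq_iff forall_3)
  ultimately show ?thesis by simp
qed

lemma continuous_vec_nth: "continuous_on S f \<Longrightarrow> continuous_on S (\<lambda>x. f x $ i :: real)"
  by (rule continuous_on_compose2[OF linear_continuous_on[OF bounded_linear_vec_nth]]) auto

text \<open>Lebesgue measure is determined by its values on boxes; matching them with a product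
  transports Tonelli's theorem to vectors.\<close>

lemma lborel_vec2: "(lborel :: (real^2) measure) = distr (lborel \<Otimes>\<^sub>M lborel) borel (\<lambda>(x,y). vector [x,y])"
proof (rule lborel_eqI)
  fix l u :: "real^2" assume lu: "\<And>b. b \<in> Basis \<Longrightarrow> l \<bullet> b \<le> u \<bullet> b"
  have m: "(\<lambda>(x,y). vector [x,y] :: real^2) \<in> borel_measurable (lborel \<Otimes>\<^sub>M lborel)"
    unfolding lborel_prod by (simp add: case_prod_unfold)
      (intro borel_measurable_continuous_onI continuous_vector2 continuous_intros)
  have le: "l $ i \<le> u $ i" for i using lu[of "axis i 1"] by (simp add: inner_axis axis_in_Basis_iff)
  have "emeasure (distr (lborel \<Otimes>\<^sub>M lborel) borel (\<lambda>(x,y). vector [x,y])) (box l u) =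
     emeasure (lborel \<Otimes>\<^sub>M lborel) (box (l$1) (u$1) \<times> box (l$2) (u$2))"
    by (subst emeasure_distr[OF m]) (auto simp: space_pair_measure mem_box_cart forall_2 intro!: arg_cong2[of _ _ _ _ emeasure])
  also have "\<dots> = ennreal (u$1 - l$1) * ennreal (u$2 - l$2)"
    by (subst lborel.emeasure_pair_measure_Times) (auto simp: le box_real)
  also have "\<dots> = ennreal (\<Prod>b\<in>Basis. (u - l) \<bullet> b)"
    by (subst prod_Basis_cart) (simp add: inner_axis UNIV_2 ennreal_mult le)
  finally show "emeasure (distr (lborel \<Otimes>\<^sub>M lborel) borel (\<lambda>(x,y). vector [x,y])) (box l u) = ennreal (\<Prod>b\<in>Basis. (u - l) \<bullet> b)" .
qed simp

lemma nn_integral_vec2: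
  fixes F :: "real^2 \<Rightarrow> ennreal" assumes [measurable]: "F \<in> borel_measurable borel"
  shows "(\<integral>\<^sup>+z. F z \<partial>lborel) = (\<integral>\<^sup>+x. \<integral>\<^sup>+y. F (vector [x,y]) \<partial>lborel \<partial>lborel)"
proof -
  have m[measurable]: "(\<lambda>(x,y). vector [x,y] :: real^2) \<in> borel_measurable (lborel \<Otimes>\<^sub>M lborel)"
    unfolding lborel_prod by (simp add: case_prod_unfold)
      (intro borel_measurable_continuous_onI continuous_vector2 continuous_intros)
  have "(\<integral>\<^sup>+z. F z \<partial>lborel) = (\<integral>\<^sup>+p. F (case p of (x,y) \<Rightarrow> vector [x,y]) \<partial>(lborel \<Otimes>\<^sub>M lborel))"
    by (subst lborel_vec2, subst nn_integral_distr) auto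
  also have "\<dots> = (\<integral>\<^sup>+x. \<integral>\<^sup>+y. F (vector [x,y]) \<partial>lborel \<partial>lborel)"
    by (subst lborel.nn_integral_fst[symmetric]) auto
  finally show ?thesis .
qed

lemma nn_integral_translate:
  fixes F :: "'a::euclidean_space \<Rightarrow> ennreal" assumes [measurable]: "F \<in> borel_measurable borel"
  shows "(\<integral>\<^sup>+z. F (z + c) \<partial>lborel) = (\<integral>\<^sup>+z. F z \<partial>lborel)"
proof -
  have "(\<integral>\<^sup>+z. F z \<partial>lborel) = (\<integral>\<^sup>+z. F z \<partial>distr lborel borel ((+) c))" by (simp add: lborel_distr_plus)
  also have "\<dots> = (\<integral>\<^sup>+z. F (c + z) \<partial>lborel)" by (subst nn_integral_distr) auto
  finally show ?thesis by (simp add: add.commute)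
qed

lemma integrable_translate:
  fixes f :: "'a::euclidean_space \<Rightarrow> real" assumes "integrable lborel f"
  shows "integrable lborel (\<lambda>z. f (z + c))"
  using assms integrable_distr[of "(+) c" lborel borel f] by (simp add: lborel_distr_plus add.commute)

lemma integral_translate:
  fixes f :: "'a::euclidean_space \<Rightarrow> real" assumes [measurable]: "f \<in> borel_measurable borel"
  shows "integral\<^sup>L lborel (\<lambda>z. f (z + c)) = integral\<^sup>L lborel f"
  using integral_distr[of "(+) c" lborel borel f] by (simp add: lborel_distr_plus add.commute)

text \<open>The change of variables z = s a + t b as two one-dimensional substitutions: the second
  coordinate at fixed first coordinate, with factor |k|, and the first coordinate at fixed t, with
  factor |a_1|.\<close>

lemma nn_integral_oblique_aux:
  fixes F :: "real^2 \<Rightarrow> ennreal" assumes [measurable]: "F \<in> borel_measurable borel" and a: "a $ 1 \<noteq> 0"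
    and d: "a $ 1 * b $ 2 - a $ 2 * b $ 1 \<noteq> 0"
  shows "(\<integral>\<^sup>+z. F z \<partial>lborel) = ennreal \<bar>a $ 1 * b $ 2 - a $ 2 * b $ 1\<bar> * (\<integral>\<^sup>+s. \<integral>\<^sup>+t. F (s *\<^sub>R a + t *\<^sub>R b) \<partial>lborel \<partial>lborel)"
proof -
  \<comment> \<open>The second coordinate of b after subtracting the multiple of a that cancels the
    first one; k times a_1 is the determinant.\<close>
  define k where "k = b$2 - b$1 * a$2 / a$1"
  have k: "k \<noteq> 0" using d a by (auto simp: k_def field_simps)
  have m1[measurable]: "(\<lambda>(x,y). vector [x,y] :: real^2) \<in> borel_measurable (lborel \<Otimes>\<^sub>M lborel)"
    unfolding lborel_prod by (simp add: case_prod_unfold)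
      (intro borel_measurable_continuous_onI continuous_vector2 continuous_intros)
  have m2[measurable]: "(\<lambda>y. vector [x,y] :: real^2) \<in> borel_measurable borel" for x
    by (intro borel_measurable_continuous_onI continuous_vector2 continuous_intros)
  have m3[measurable]: "(\<lambda>(t,x). F (vector [x, x * a$2/a$1 + k * t])) \<in> borel_measurable (lborel \<Otimes>\<^sub>M lborel)"
  proof -
    have "(\<lambda>p. vector [snd p, snd p * a$2/a$1 + k * fst p] :: real^2) \<in> borel_measurable (lborel \<Otimes>\<^sub>M lborel)"
      unfolding lborel_prod using a by (simp) (intro borel_measurable_continuous_onI continuous_vector2 continuous_intros; auto)
    from measurable_compose[OF this assms(1)] show ?thesis by (simp add: case_prod_unfold)
  qed
  have "(\<integral>\<^sup>+z. F z \<partial>lborel) = (\<integral>\<^sup>+x. \<integral>\<^sup>+y. F (vector [x,y]) \<partial>lborel \<partial>lborel)" by (rule nn_integral_vec2) simp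
  also have "\<dots> = (\<integral>\<^sup>+x. ennreal \<bar>k\<bar> * (\<integral>\<^sup>+t. F (vector [x, x * a$2/a$1 + k * t]) \<partial>lborel) \<partial>lborel)"
    by (intro nn_integral_cong) (subst nn_integral_real_affine[OF _ k], auto)
  also have "\<dots> = ennreal \<bar>k\<bar> * (\<integral>\<^sup>+x. (\<integral>\<^sup>+t. F (vector [x, x * a$2/a$1 + k * t]) \<partial>lborel) \<partial>lborel)"
    using lborel.borel_measurable_nn_integral_fst[OF measurable_pair_swap[OF m3]]
    by (intro nn_integral_cmult) (simp add: case_prod_unfold)
  also have "(\<integral>\<^sup>+x. (\<integral>\<^sup>+t. F (vector [x, x * a$2/a$1 + k * t]) \<partial>lborel) \<partial>lborel) =
     (\<integral>\<^sup>+t. (\<integral>\<^sup>+x. F (vector [x, x * a$2/a$1 + k * t]) \<partial>lborel) \<partial>lborel)"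
    using lborel_pair.Fubini'[OF m3] by simp
  also have "\<dots> = (\<integral>\<^sup>+t. ennreal \<bar>a$1\<bar> * (\<integral>\<^sup>+s. F (s *\<^sub>R a + t *\<^sub>R b) \<partial>lborel) \<partial>lborel)"
  proof (intro nn_integral_cong)
    fix t
    have [measurable]: "(\<lambda>x. F (vector [x, x * a$2/a$1 + k * t])) \<in> borel_measurable borel"
      using measurable_Pair2[OF m3, of t] by simp
    have eq: "vector [t * b$1 + a$1 * s, (t * b$1 + a$1 * s) * a$2/a$1 + k * t] = s *\<^sub>R a + t *\<^sub>R b" for s
      using a by (simp add: vec_eq_iff forall_2 k_def field_simps)
    show "(\<integral>\<^sup>+x. F (vector [x, x * a$2/a$1 + k * t]) \<partial>lborel) = ennreal \<bar>a$1\<bar> * (\<integral>\<^sup>+s. F (s *\<^sub>R a + t *\<^sub>R b) \<partial>lborel)"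
      by (subst nn_integral_real_affine[OF _ a, of _ "t * b$1"]) (auto simp: eq)
  qed
  also have "\<dots> = ennreal \<bar>a$1\<bar> * (\<integral>\<^sup>+t. (\<integral>\<^sup>+s. F (s *\<^sub>R a + t *\<^sub>R b) \<partial>lborel) \<partial>lborel)"
    by (intro nn_integral_cmult) measurable
  also have "(\<integral>\<^sup>+t. (\<integral>\<^sup>+s. F (s *\<^sub>R a + t *\<^sub>R b) \<partial>lborel) \<partial>lborel) = (\<integral>\<^sup>+s. (\<integral>\<^sup>+t. F (s *\<^sub>R a + t *\<^sub>R b) \<partial>lborel) \<partial>lborel)"
    by (rule lborel_pair.Fubini') measurable
  finally have "(\<integral>\<^sup>+z. F z \<partial>lborel) = ennreal (\<bar>k\<bar> * \<bar>a$1\<bar>) * (\<integral>\<^sup>+s. (\<integral>\<^sup>+t. F (s *\<^sub>R a + t *\<^sub>R b) \<partial>lborel) \<partial>lborel)"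
    by (simp add: ennreal_mult mult.assoc)
  moreover have "k * a$1 = a $ 1 * b $ 2 - a $ 2 * b $ 1" using a by (simp add: k_def field_simps)
  then have "\<bar>k\<bar> * \<bar>a$1\<bar> = \<bar>a $ 1 * b $ 2 - a $ 2 * b $ 1\<bar>" by (simp flip: abs_mult)
  ultimately show ?thesis by simp
qed

lemma nn_integral_oblique:
  fixes F :: "real^2 \<Rightarrow> ennreal" assumes [measurable]: "F \<in> borel_measurable borel"
    and d: "a $ 1 * b $ 2 - a $ 2 * b $ 1 \<noteq> 0"
  shows "(\<integral>\<^sup>+z. F z \<partial>lborel) = ennreal \<bar>a $ 1 * b $ 2 - a $ 2 * b $ 1\<bar> * (\<integral>\<^sup>+s. \<integral>\<^sup>+t. F (s *\<^sub>R a + t *\<^sub>R b) \<partial>lborel \<partial>lborel)"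
proof (cases "a $ 1 = 0")
  case False
  then show ?thesis using nn_integral_oblique_aux assms by blast
next
  case True
  with d have b: "b $ 1 \<noteq> 0" by auto
  have "(\<integral>\<^sup>+z. F z \<partial>lborel) = ennreal \<bar>b $ 1 * a $ 2 - b $ 2 * a $ 1\<bar> * (\<integral>\<^sup>+s. \<integral>\<^sup>+t. F (s *\<^sub>R b + t *\<^sub>R a) \<partial>lborel \<partial>lborel)"
    by (rule nn_integral_oblique_aux) (use b d in \<open>auto simp: algebra_simps\<close>)
  also have "(\<integral>\<^sup>+s. \<integral>\<^sup>+t. F (s *\<^sub>R b + t *\<^sub>R a) \<partial>lborel \<partial>lborel) = (\<integral>\<^sup>+t. \<integral>\<^sup>+s. F (s *\<^sub>R b + t *\<^sub>R a) \<partial>lborel \<partial>lborel)"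
    by (rule lborel_pair.Fubini') measurable
  also have "\<bar>b $ 1 * a $ 2 - b $ 2 * a $ 1\<bar> = \<bar>a $ 1 * b $ 2 - a $ 2 * b $ 1\<bar>"
    by (metis abs_minus_commute mult.commute)
  finally show ?thesis by (simp add: add.commute)
qed

text \<open>Gagliardo's product trick: \<open>F (z + s e\<^sub>1) F (z + t e\<^sub>2)\<close> integrates to a multiple of \<open>(\<integral> F)\<^sup>2\<close>.\<close>
lemma nn_integral_two_lines_finite:
  fixes F :: "real^2 \<Rightarrow> ennreal" assumes [measurable]: "F \<in> borel_measurable borel"
    and d: "a $ 1 * b $ 2 - a $ 2 * b $ 1 \<noteq> 0" and fin: "(\<integral>\<^sup>+z. F z \<partial>lborel) < \<infinity>"
  shows "(\<integral>\<^sup>+z. (\<integral>\<^sup>+s. F (z + s *\<^sub>R a) \<partial>lborel) * (\<integral>\<^sup>+t. F (z + t *\<^sub>R b) \<partial>lborel) \<partial>lborel) < \<infinity>"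
proof -
  let ?I = "\<integral>\<^sup>+z. F z \<partial>lborel"
  \<comment> \<open>For fixed z the points z - s a + t b sweep the plane with constant Jacobian, so
    this double integral is bounded independently of z by the total mass of F.\<close>
  have Jle: "(\<integral>\<^sup>+s. \<integral>\<^sup>+t. F (z + (s *\<^sub>R (-a) + t *\<^sub>R b)) \<partial>lborel \<partial>lborel) \<le> ennreal (1 / \<bar>a $ 1 * b $ 2 - a $ 2 * b $ 1\<bar>) * ?I" for z
  proof -
    define J where "J = (\<integral>\<^sup>+s. \<integral>\<^sup>+t. F (z + (s *\<^sub>R (-a) + t *\<^sub>R b)) \<partial>lborel \<partial>lborel)"
    have "?I = (\<integral>\<^sup>+w. F (w + z) \<partial>lborel)" by (rule nn_integral_translate[symmetric]) simp
    also have "\<dots> = ennreal \<bar>(-a) $ 1 * b $ 2 - (-a) $ 2 * b $ 1\<bar> * J"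
      unfolding J_def by (subst nn_integral_oblique[where a="-a" and b=b]) (use d in \<open>auto simp: algebra_simps\<close>)
    also have "\<bar>(-a) $ 1 * b $ 2 - (-a) $ 2 * b $ 1\<bar> = \<bar>a $ 1 * b $ 2 - a $ 2 * b $ 1\<bar>" by simp
    finally have I: "?I = ennreal \<bar>a $ 1 * b $ 2 - a $ 2 * b $ 1\<bar> * J" .
    have "ennreal (1 / D) * (ennreal D * J) = J" if "D > 0" for D
      using that by (simp add: mult.assoc[symmetric] flip: ennreal_mult')
    with I d show ?thesis unfolding J_def by simp
  qed
  have "(\<integral>\<^sup>+z. (\<integral>\<^sup>+s. F (z + s *\<^sub>R a) \<partial>lborel) * (\<integral>\<^sup>+t. F (z + t *\<^sub>R b) \<partial>lborel) \<partial>lborel) =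
     (\<integral>\<^sup>+z. (\<integral>\<^sup>+s. \<integral>\<^sup>+t. F (z + s *\<^sub>R a) * F (z + t *\<^sub>R b) \<partial>lborel \<partial>lborel) \<partial>lborel)"
    by (subst nn_integral_multc[symmetric], measurable) (subst nn_integral_cmult[symmetric], measurable)
  also have "\<dots> = (\<integral>\<^sup>+s. (\<integral>\<^sup>+z. \<integral>\<^sup>+t. F (z + s *\<^sub>R a) * F (z + t *\<^sub>R b) \<partial>lborel \<partial>lborel) \<partial>lborel)"
    by (rule lborel_pair.Fubini') measurable
  \<comment> \<open>Translating z by -s a frees the first factor from s; the second one then runs
    over the whole plane as s and t vary.\<close>
  also have "\<dots> = (\<integral>\<^sup>+s. (\<integral>\<^sup>+z. \<integral>\<^sup>+t. F z * F (z + (s *\<^sub>R (-a) + t *\<^sub>R b)) \<partial>lborel \<partial>lborel) \<partial>lborel)"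
  proof (rule nn_integral_cong)
    fix s :: real
    have "(\<integral>\<^sup>+z. \<integral>\<^sup>+t. F (z + s *\<^sub>R a) * F ((z + s *\<^sub>R a) + (s *\<^sub>R (-a) + t *\<^sub>R b)) \<partial>lborel \<partial>lborel) =
      (\<integral>\<^sup>+z. \<integral>\<^sup>+t. F z * F (z + (s *\<^sub>R (-a) + t *\<^sub>R b)) \<partial>lborel \<partial>lborel)"
      by (rule nn_integral_translate) measurable
    then show "(\<integral>\<^sup>+z. \<integral>\<^sup>+t. F (z + s *\<^sub>R a) * F (z + t *\<^sub>R b) \<partial>lborel \<partial>lborel) =
      (\<integral>\<^sup>+z. \<integral>\<^sup>+t. F z * F (z + (s *\<^sub>R (-a) + t *\<^sub>R b)) \<partial>lborel \<partial>lborel)"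
      by (simp add: algebra_simps)
  qed
  also have "\<dots> = (\<integral>\<^sup>+z. (\<integral>\<^sup>+s. \<integral>\<^sup>+t. F z * F (z + (s *\<^sub>R (-a) + t *\<^sub>R b)) \<partial>lborel \<partial>lborel) \<partial>lborel)"
    by (rule lborel_pair.Fubini') measurable
  also have "\<dots> = (\<integral>\<^sup>+z. F z * (\<integral>\<^sup>+s. \<integral>\<^sup>+t. F (z + (s *\<^sub>R (-a) + t *\<^sub>R b)) \<partial>lborel \<partial>lborel) \<partial>lborel)"
    by (subst nn_integral_cmult, measurable, subst nn_integral_cmult) measurable
  also have "\<dots> \<le> (\<integral>\<^sup>+z. F z * (ennreal (1 / \<bar>a $ 1 * b $ 2 - a $ 2 * b $ 1\<bar>) * ?I) \<partial>lborel)"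
    by (intro nn_integral_mono mult_left_mono Jle) auto
  also have "\<dots> = ?I * (ennreal (1 / \<bar>a $ 1 * b $ 2 - a $ 2 * b $ 1\<bar>) * ?I)"
    by (rule nn_integral_multc) measurable
  also have "\<dots> < \<infinity>" using fin by (simp add: ennreal_mult_less_top)
  finally show ?thesis .
qed

section \<open>The Sobolev embedding into \<open>L\<^sup>4\<close> on planar Lipschitz domains\<close>

lemma bump_shift: "bump n (a + c) (b + c) z = bump n a b (z - c)"
  by (simp add: bump_def algebra_simps)

lemma pd_shift:
  assumes "f differentiable (at (z - c))" shows "pd b (\<lambda>z. f (z - c)) z = pd b f (z - c)"
proof -
  have "((\<lambda>z. z - c) has_derivative (\<lambda>h. h)) (at z)" by (auto intro!: derivative_eq_intros)
  from has_derivative_compose[OF this pd_works[OF assms]] show ?thesis by (rule pd_eqI)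
qed

text \<open>For smooth u with directional derivative g along e this is the integral over
  [0, \<delta>] of the s-derivative of -(\<delta> - s) u(z + s e), whose only surviving boundary
  value is \<delta> u(z). Here g is a weak derivative, expressed by the hypothesis on translated
  bumps, so the identity is tested with bumps and concluded by the fundamental lemma.\<close>

lemma line_average_AE:
  fixes u g :: "real^'n \<Rightarrow> real"
  assumes u: "integrable lborel u" and g: "integrable lborel g" and D: "open D" and d: "0 < \<delta>"
    and W: "\<And>n a b s. (\<And>i. a $ i < b $ i) \<Longrightarrow> cbox a b \<subseteq> D \<Longrightarrow> 0 \<le> s \<Longrightarrow> s \<le> \<delta> \<Longrightarrow>
     (\<integral>z. bump (Suc n) a b (z - s *\<^sub>R e) * g z \<partial>lborel) =
     - (\<integral>z. (\<Sum>j\<in>UNIV. e $ j * pd (axis j 1) (bump (Suc n) a b) (z - s *\<^sub>R e)) * u z \<partial>lborel)"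
  shows "AE z in lebesgue. z \<in> D \<longrightarrow> \<delta> * u z = (\<integral>s. indicator {0..\<delta>} s * (u (z + s *\<^sub>R e) - (\<delta> - s) * g (z + s *\<^sub>R e)) \<partial>lborel)"
proof -
  have [measurable]: "u \<in> borel_measurable borel" "g \<in> borel_measurable borel"
    using u g by (auto dest: borel_measurable_integrable)
  define k where "k = (\<lambda>s z. indicator {0..\<delta>} s * (u (z + s *\<^sub>R e) - (\<delta> - s) * g (z + s *\<^sub>R e)))"
  have km[measurable]: "(\<lambda>(s,z). k s z) \<in> borel_measurable (lborel \<Otimes>\<^sub>M lborel)"
    unfolding k_def by measurable
  have kz: "integrable lborel (\<lambda>z. k s z)" for s
    unfolding k_def using integrable_translate[OF u] integrable_translate[OF g] by auto
  have ind: "integrable lborel (\<lambda>s. indicator {0..\<delta>} s * c)" for c :: real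
    using d by (intro integrable_mult_left integrable_real_indicator) auto
  have kint: "integrable (lborel \<Otimes>\<^sub>M lborel) (\<lambda>(s,z). k s z)"
  proof (rule lborel_pair.Fubini_integrable)
    show "integrable lborel (\<lambda>s. \<integral>z. norm (case (s, z) of (s, z) \<Rightarrow> k s z) \<partial>lborel)"
    proof (rule Bochner_Integration.integrable_bound[of _ "\<lambda>s. indicator {0..\<delta>} s * ((\<integral>z. \<bar>u z\<bar> \<partial>lborel) + \<delta> * (\<integral>z. \<bar>g z\<bar> \<partial>lborel))"])
      show "AE s in lborel. norm (\<integral>z. norm (case (s, z) of (s, z) \<Rightarrow> k s z) \<partial>lborel) \<le> norm (indicator {0..\<delta>} s * ((\<integral>z. \<bar>u z\<bar> \<partial>lborel) + \<delta> * (\<integral>z. \<bar>g z\<bar> \<partial>lborel)))"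
      proof (rule AE_I2)
        fix s
        show "norm (\<integral>z. norm (case (s, z) of (s, z) \<Rightarrow> k s z) \<partial>lborel) \<le> norm (indicator {0..\<delta>} s * ((\<integral>z. \<bar>u z\<bar> \<partial>lborel) + \<delta> * (\<integral>z. \<bar>g z\<bar> \<partial>lborel)))"
        proof (cases "s \<in> {0..\<delta>}")
          case True
          have "(\<integral>z. \<bar>k s z\<bar> \<partial>lborel) \<le> (\<integral>z. \<bar>u (z + s *\<^sub>R e)\<bar> + \<delta> * \<bar>g (z + s *\<^sub>R e)\<bar> \<partial>lborel)"
          proof (rule integral_mono)
            show "integrable lborel (\<lambda>z. \<bar>u (z + s *\<^sub>R e)\<bar> + \<delta> * \<bar>g (z + s *\<^sub>R e)\<bar>)"
              using integrable_translate[OF u] integrable_translate[OF g] by auto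
            show "\<bar>k s z\<bar> \<le> \<bar>u (z + s *\<^sub>R e)\<bar> + \<delta> * \<bar>g (z + s *\<^sub>R e)\<bar>" for z
            proof -
              have "\<bar>k s z\<bar> \<le> \<bar>u (z + s *\<^sub>R e)\<bar> + \<bar>\<delta> - s\<bar> * \<bar>g (z + s *\<^sub>R e)\<bar>"
                using True abs_triangle_ineq4[of "u (z + s *\<^sub>R e)" "(\<delta> - s) * g (z + s *\<^sub>R e)"]
                by (simp add: k_def abs_mult)
              also have "\<bar>\<delta> - s\<bar> * \<bar>g (z + s *\<^sub>R e)\<bar> \<le> \<delta> * \<bar>g (z + s *\<^sub>R e)\<bar>"
                using True by (intro mult_right_mono) auto
              finally show ?thesis by simp
            qed
          qed (use kz in auto)
          also have "\<dots> = (\<integral>z. \<bar>u (z + s *\<^sub>R e)\<bar> \<partial>lborel) + (\<integral>z. \<delta> * \<bar>g (z + s *\<^sub>R e)\<bar> \<partial>lborel)"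
            using integrable_translate[OF u] integrable_translate[OF g] by (intro Bochner_Integration.integral_add) auto
          also have "\<dots> = (\<integral>z. \<bar>u z\<bar> \<partial>lborel) + \<delta> * (\<integral>z. \<bar>g z\<bar> \<partial>lborel)"
            using integral_translate[of "\<lambda>z. \<bar>u z\<bar>"] integral_translate[of "\<lambda>z. \<bar>g z\<bar>"] by simp
          finally show ?thesis using True by simp
        qed (simp add: k_def)
      qed
    qed (use ind in auto)
    show "AE s in lborel. integrable lborel (\<lambda>z. case (s, z) of (s, z) \<Rightarrow> k s z)" using kz by auto
  qed auto
  define K where "K = (\<lambda>z. \<delta> * u z - (\<integral>s. k s z \<partial>lborel))"
  have Kint: "integrable lborel K"
    unfolding K_def using u lborel_pair.integrable_snd[OF kint] by auto
  have [measurable]: "K \<in> borel_measurable borel" using Kint by (auto dest: borel_measurable_integrable)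
  have "AE z in lebesgue. z \<in> D \<longrightarrow> K z = 0"
  proof (rule bump_integral_zero_AE[OF D])
    fix a b :: "real^'n"
    have "integrable lebesgue (\<lambda>z. indicator (cbox a b) z *\<^sub>R K z)"
      using Kint by (intro integrable_mult_indicator) (auto simp: integrable_completion)
    then show "integrable (lebesgue_on (cbox a b)) K"
      using integrable_restrict_space[of "cbox a b" lebesgue K] by simp
  next
    fix n and a b :: "real^'n" assume ab: "\<And>i. a $ i < b $ i" "cbox a b \<subseteq> D"
    define \<phi> where "\<phi> = bump (Suc n) a b"
    define \<phi>' where "\<phi>' = (\<lambda>z. \<Sum>j\<in>UNIV. e $ j * pd (axis j 1) \<phi> z)"
    have sm: "Cinf_on UNIV \<phi>" unfolding \<phi>_def by (rule Cinf_on_bump)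
    have c\<phi>: "continuous_on UNIV \<phi>" using Cinf_on_continuous[OF sm] .
    have cpd: "continuous_on UNIV (pd (axis j 1) \<phi>)" for j
      by (rule Cinf_on_continuous[OF Cinf_on_pd[OF sm]]) (simp add: axis_in_Basis_iff)
    have c\<phi>': "continuous_on UNIV \<phi>'" unfolding \<phi>'_def by (intro continuous_intros cpd)
    have [measurable]: "\<phi> \<in> borel_measurable borel" "\<phi>' \<in> borel_measurable borel"
      using c\<phi> c\<phi>' by (auto intro: borel_measurable_continuous_onI)
    have b1: "\<bar>\<phi> z\<bar> \<le> 1" for z using bump_bounds[of "Suc n" a b z] by (simp add: \<phi>_def)
    obtain B where B: "\<And>z. \<bar>\<phi>' z\<bar> \<le> B"
    proof -
      have "compact (\<phi>' ` cbox a b)" using c\<phi>' by (intro compact_continuous_image) (auto intro: continuous_on_subset)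
      then obtain C where C: "\<And>z. z \<in> cbox a b \<Longrightarrow> \<bar>\<phi>' z\<bar> \<le> C"
        using compact_imp_bounded[of "\<phi>' ` cbox a b"] unfolding bounded_iff by auto
      have "\<phi>' z = 0" if "z \<notin> cbox a b" for z
      proof -
        have "pd (axis j 1) \<phi> z = 0" for j
          by (rule pd_test_fn_zero) (use bump_support[OF ab(1), of "Suc n"] that in \<open>auto simp: \<phi>_def\<close>)
        then show ?thesis by (simp add: \<phi>'_def)
      qed
      then have "\<bar>\<phi>' z\<bar> \<le> max C 0" for z using C[of z] by (cases "z \<in> cbox a b") auto
      then show ?thesis using that by blast
    qed
    have B0: "B \<ge> 0" using B[of 0] by linarith
    have shift_int: "integrable lborel (\<lambda>z. \<phi> (z - s *\<^sub>R e) * u z)" "integrable lborel (\<lambda>z. \<phi>' (z - s *\<^sub>R e) * u z)"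
       "integrable lborel (\<lambda>z. \<phi> z * u (z + s *\<^sub>R e))" "integrable lborel (\<lambda>z. \<phi> z * g (z + s *\<^sub>R e))" for s
    proof -
      show "integrable lborel (\<lambda>z. \<phi> (z - s *\<^sub>R e) * u z)"
        by (rule Bochner_Integration.integrable_bound[OF u]) (use b1 in \<open>auto simp: abs_mult intro!: mult_left_le_one_le\<close>)
      show "integrable lborel (\<lambda>z. \<phi>' (z - s *\<^sub>R e) * u z)"
        by (rule Bochner_Integration.integrable_bound[OF integrable_mult_right[OF u, of B]])
           (use B B0 in \<open>auto simp: abs_mult intro!: mult_right_mono\<close>)
      show "integrable lborel (\<lambda>z. \<phi> z * u (z + s *\<^sub>R e))"
        by (rule Bochner_Integration.integrable_bound[OF integrable_translate[OF u, of "s *\<^sub>R e"]]) (use b1 in \<open>auto simp: abs_mult intro!: mult_left_le_one_le\<close>)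
      show "integrable lborel (\<lambda>z. \<phi> z * g (z + s *\<^sub>R e))"
        by (rule Bochner_Integration.integrable_bound[OF integrable_translate[OF g, of "s *\<^sub>R e"]]) (use b1 in \<open>auto simp: abs_mult intro!: mult_left_le_one_le\<close>)
    qed
    define m where "m = (\<lambda>s z. indicator {0..\<delta>} s * (\<phi> (z - s *\<^sub>R e) + (\<delta> - s) * \<phi>' (z - s *\<^sub>R e)) * u z)"
    have \<phi>kint: "integrable (lborel \<Otimes>\<^sub>M lborel) (\<lambda>(s,z). \<phi> z * k s z)"
      by (rule Bochner_Integration.integrable_bound[OF kint])
         (use b1 in \<open>auto simp: abs_mult split_beta intro!: mult_left_le_one_le\<close>)
    have uint: "integrable (lborel \<Otimes>\<^sub>M lborel) (\<lambda>(s::real,z). indicator {0..\<delta>} s * u z)"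
    proof (rule lborel_pair.Fubini_integrable)
      have eq: "(\<integral>z. norm (case (s, z) of (s, z) \<Rightarrow> indicator {0..\<delta>} s * u z) \<partial>lborel) = indicator {0..\<delta>} s * (\<integral>z. \<bar>u z\<bar> \<partial>lborel)" for s :: real
        by (simp add: abs_mult)
      show "integrable lborel (\<lambda>s. \<integral>z. norm (case (s, z) of (s, z) \<Rightarrow> indicator {0..\<delta>} s * u z) \<partial>lborel)"
        unfolding eq by (rule ind)
    qed (use u in auto)
    have mint: "integrable (lborel \<Otimes>\<^sub>M lborel) (\<lambda>(s,z). m s z)"
    proof (rule Bochner_Integration.integrable_bound[OF integrable_mult_right[OF uint, of "1 + \<delta> * B"]])
      show "(\<lambda>(s, z). m s z) \<in> borel_measurable (lborel \<Otimes>\<^sub>M lborel)" unfolding m_def by measurable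
      have "\<bar>m s z\<bar> \<le> (1 + \<delta> * B) * \<bar>indicator {0..\<delta>} s * u z\<bar>" for s z
      proof (cases "s \<in> {0..\<delta>}")
        case True
        have "\<bar>(\<delta> - s) * \<phi>' (z - s *\<^sub>R e)\<bar> \<le> \<delta> * B"
          unfolding abs_mult using True B B0 by (intro mult_mono) auto
        then have "\<bar>\<phi> (z - s *\<^sub>R e) + (\<delta> - s) * \<phi>' (z - s *\<^sub>R e)\<bar> \<le> 1 + \<delta> * B"
          using b1[of "z - s *\<^sub>R e"] by linarith
        then have "\<bar>\<phi> (z - s *\<^sub>R e) + (\<delta> - s) * \<phi>' (z - s *\<^sub>R e)\<bar> * \<bar>u z\<bar> \<le> (1 + \<delta> * B) * \<bar>u z\<bar>"
          by (rule mult_right_mono) simp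
        then show ?thesis using True by (simp add: m_def abs_mult)
      qed (simp add: m_def)
      then show "AE x in lborel \<Otimes>\<^sub>M lborel. norm (case x of (s, z) \<Rightarrow> m s z) \<le> norm ((1 + \<delta> * B) * (case x of (s, z) \<Rightarrow> indicator {0..\<delta>} s * u z))"
        using B0 d by (intro AE_I2) (auto simp: abs_mult split_beta)
    qed
    \<comment> \<open>For fixed s the translation is moved onto the bump, and the weak derivative g
      is traded for the classical derivative of the bump.\<close>
    have inner: "(\<integral>z. \<phi> z * k s z \<partial>lborel) = (\<integral>z. m s z \<partial>lborel)" for s
    proof (cases "s \<in> {0..\<delta>}")
      case True
      have "(\<integral>z. \<phi> z * k s z \<partial>lborel) = (\<integral>z. \<phi> z * u (z + s *\<^sub>R e) - (\<delta> - s) * (\<phi> z * g (z + s *\<^sub>R e)) \<partial>lborel)"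
        using True by (intro Bochner_Integration.integral_cong) (auto simp: k_def algebra_simps)
      also have "\<dots> = (\<integral>z. \<phi> z * u (z + s *\<^sub>R e) \<partial>lborel) - (\<delta> - s) * (\<integral>z. \<phi> z * g (z + s *\<^sub>R e) \<partial>lborel)"
        using shift_int by simp
      also have "(\<integral>z. \<phi> z * u (z + s *\<^sub>R e) \<partial>lborel) = (\<integral>z. \<phi> (z - s *\<^sub>R e) * u z \<partial>lborel)"
        using integral_translate[of "\<lambda>z. \<phi> (z - s *\<^sub>R e) * u z" "s *\<^sub>R e"] by simp
      also have "(\<integral>z. \<phi> z * g (z + s *\<^sub>R e) \<partial>lborel) = (\<integral>z. \<phi> (z - s *\<^sub>R e) * g z \<partial>lborel)"
        using integral_translate[of "\<lambda>z. \<phi> (z - s *\<^sub>R e) * g z" "s *\<^sub>R e"] by simp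
      also have "\<dots> = - (\<integral>z. \<phi>' (z - s *\<^sub>R e) * u z \<partial>lborel)"
        unfolding \<phi>_def \<phi>'_def using True by (intro W ab) auto
      also have "(\<integral>z. \<phi> (z - s *\<^sub>R e) * u z \<partial>lborel) - (\<delta> - s) * - (\<integral>z. \<phi>' (z - s *\<^sub>R e) * u z \<partial>lborel)
         = (\<integral>z. \<phi> (z - s *\<^sub>R e) * u z + (\<delta> - s) * (\<phi>' (z - s *\<^sub>R e) * u z) \<partial>lborel)"
        using shift_int by simp
      also have "\<dots> = (\<integral>z. m s z \<partial>lborel)"
        using True by (intro Bochner_Integration.integral_cong) (auto simp: m_def algebra_simps)
      finally show ?thesis .
    qed (simp add: k_def m_def)
    \<comment> \<open>With z fixed, the bump is smooth along the segment and the integrand is the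
      s-derivative of -(\<delta> - s) \<phi>(z - s e); the fundamental theorem leaves the value at s
      = 0.\<close>
    have ftc: "(\<integral>s. m s z \<partial>lborel) = \<delta> * \<phi> z * u z" for z
    proof -
      have "(\<integral>s. (\<phi> (z - s *\<^sub>R e) + (\<delta> - s) * \<phi>' (z - s *\<^sub>R e)) * indicator {0..\<delta>} s \<partial>lborel) =
         - (\<delta> - \<delta>) * \<phi> (z - \<delta> *\<^sub>R e) - (- (\<delta> - 0) * \<phi> (z - 0 *\<^sub>R e))"
      proof (rule integral_FTC_Icc_real)
        show "((\<lambda>s. - (\<delta> - s) * \<phi> (z - s *\<^sub>R e)) has_real_derivative \<phi> (z - s *\<^sub>R e) + (\<delta> - s) * \<phi>' (z - s *\<^sub>R e)) (at s)" for s
        proof -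
          have *: "((\<lambda>s. z - s *\<^sub>R e) has_derivative (\<lambda>h. - (h *\<^sub>R e))) (at s)" by (auto intro!: derivative_eq_intros)
          have lin: "linear (\<lambda>b. pd b \<phi> (z - s *\<^sub>R e))"
            using has_derivative_linear[OF pd_works[OF Cinf_on_differentiable[OF sm]]] by auto
          have "pd e \<phi> w = \<phi>' w" if "linear (\<lambda>b. pd b \<phi> w)" for w
          proof -
            have "e = (\<Sum>j\<in>UNIV. e $ j *\<^sub>R axis j 1)" by (simp add: basis_expansion flip: scalar_mult_eq_scaleR)
            then have "pd e \<phi> w = pd (\<Sum>j\<in>UNIV. e $ j *\<^sub>R axis j 1) \<phi> w"
              by (rule arg_cong[where f = "\<lambda>b. pd b \<phi> w"])
            also have "\<dots> = \<phi>' w" by (simp add: \<phi>'_def linear_sum[OF that] linear_scale[OF that])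
            finally show ?thesis .
          qed
          with lin have pe: "pd (- (h *\<^sub>R e)) \<phi> (z - s *\<^sub>R e) = - \<phi>' (z - s *\<^sub>R e) * h" for h
            using linear_neg[OF lin] linear_scale[OF lin] by simp
          have "((\<lambda>s. \<phi> (z - s *\<^sub>R e)) has_derivative (\<lambda>h. pd (- (h *\<^sub>R e)) \<phi> (z - s *\<^sub>R e))) (at s)"
            using has_derivative_compose[OF * pd_works[OF Cinf_on_differentiable[OF sm]]] by auto
          then have "((\<lambda>s. \<phi> (z - s *\<^sub>R e)) has_real_derivative (- \<phi>' (z - s *\<^sub>R e))) (at s)"
            unfolding pe has_field_derivative_def .
          then show ?thesis by (auto intro!: derivative_eq_intros simp: algebra_simps)
        qed
        show "isCont (\<lambda>s. \<phi> (z - s *\<^sub>R e) + (\<delta> - s) * \<phi>' (z - s *\<^sub>R e)) s" for s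
        proof -
          have "continuous_on UNIV (\<lambda>s. \<phi> (z - s *\<^sub>R e) + (\<delta> - s) * \<phi>' (z - s *\<^sub>R e))"
            by (intro continuous_intros continuous_on_compose2[OF c\<phi>] continuous_on_compose2[OF c\<phi>']) auto
          then show ?thesis by (simp add: continuous_on_eq_continuous_at)
        qed
      qed (use d in auto)
      moreover have "(\<integral>s. m s z \<partial>lborel) = (\<integral>s. (\<phi> (z - s *\<^sub>R e) + (\<delta> - s) * \<phi>' (z - s *\<^sub>R e)) * indicator {0..\<delta>} s \<partial>lborel) * u z"
        unfolding m_def by (subst integral_mult_left_zero[symmetric]) (simp add: mult.commute)
      ultimately show ?thesis by simp
    qed
    have uphi: "integrable lborel (\<lambda>z. \<phi> z * u z)" using shift_int(1)[of 0] by simp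
    have kint2: "integrable lborel (\<lambda>z. \<integral>s. \<phi> z * k s z \<partial>lborel)"
      using lborel_pair.integrable_snd[OF \<phi>kint] by simp
    have "integral\<^sup>L lebesgue (\<lambda>z. \<phi> z * K z) = integral\<^sup>L lborel (\<lambda>z. \<phi> z * K z)"
      by (rule integral_completion) measurable
    also have "\<dots> = (\<integral>z. \<delta> * (\<phi> z * u z) - (\<integral>s. \<phi> z * k s z \<partial>lborel) \<partial>lborel)"
      by (simp add: K_def algebra_simps)
    also have "\<dots> = \<delta> * (\<integral>z. \<phi> z * u z \<partial>lborel) - (\<integral>z. (\<integral>s. \<phi> z * k s z \<partial>lborel) \<partial>lborel)"
      using uphi kint2 by simp
    also have "(\<integral>z. (\<integral>s. \<phi> z * k s z \<partial>lborel) \<partial>lborel) = (\<integral>s. (\<integral>z. \<phi> z * k s z \<partial>lborel) \<partial>lborel)"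
      by (rule lborel_pair.Fubini_integral[OF \<phi>kint])
    also have "\<dots> = (\<integral>s. (\<integral>z. m s z \<partial>lborel) \<partial>lborel)" by (simp add: inner)
    also have "\<dots> = (\<integral>z. (\<integral>s. m s z \<partial>lborel) \<partial>lborel)"
      by (rule lborel_pair.Fubini_integral[OF mint, symmetric])
    also have "\<dots> = \<delta> * (\<integral>z. \<phi> z * u z \<partial>lborel)" by (simp add: ftc mult.assoc)
    finally show "integral\<^sup>L lebesgue (\<lambda>x. bump (Suc n) a b x * K x) = 0" by (simp add: \<phi>_def)
  qed
  then show ?thesis unfolding K_def k_def by eventually_elim auto
qed

text \<open>Cauchy-Schwarz on a segment of length \<delta>, and (x + y)^2 <= 2 (x^2 + y^2).
  Enlarging the segment to the full line afterwards brings the bound into the form required by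
  \<open>nn_integral_two_lines_finite\<close>.\<close>

lemma line_square_bound:
  fixes u g :: "'a::euclidean_space \<Rightarrow> real"
  assumes [measurable]: "u \<in> borel_measurable borel" "g \<in> borel_measurable borel" and d: "0 < \<delta>"
    and eq: "\<delta> * u z = (\<integral>s. indicator {0..\<delta>} s * (u (z + s *\<^sub>R e) - (\<delta> - s) * g (z + s *\<^sub>R e)) \<partial>lborel)"
  shows "ennreal (\<delta> * (u z)^2) \<le> (\<integral>\<^sup>+s. ennreal (2 * ((u (z + s *\<^sub>R e))^2 + \<delta>^2 * (g (z + s *\<^sub>R e))^2)) \<partial>lborel)"
proof -
  define h where "h = (\<lambda>s. u (z + s *\<^sub>R e) - (\<delta> - s) * g (z + s *\<^sub>R e))"
  have [measurable]: "h \<in> borel_measurable borel" unfolding h_def by measurable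
  let ?i = "\<lambda>s. indicator {0..\<delta>} s"
  let ?X = "\<integral>\<^sup>+s. ennreal (2 * ((u (z + s *\<^sub>R e))^2 + \<delta>^2 * (g (z + s *\<^sub>R e))^2)) \<partial>lborel"
  have "ennreal (norm (\<delta> * u z)) \<le> (\<integral>\<^sup>+s. ennreal (norm (?i s * h s)) \<partial>lborel)"
  proof (cases "integrable lborel (\<lambda>s. ?i s * h s)")
    case True
    have eq': "\<delta> * u z = (\<integral>s. ?i s * h s \<partial>lborel)" using eq by (simp add: h_def)
    show ?thesis unfolding eq' using integral_norm_bound_ennreal[OF True] .
  next
    case False
    \<comment> \<open>The Bochner integral of a non-integrable function is 0 by convention, so that
      here the assumed identity forces u z = 0.\<close>
    then have "\<delta> * u z = 0" unfolding eq by (simp add: not_integrable_integral_eq h_def)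
    then show ?thesis by (metis ennreal_0 norm_zero zero_le)
  qed
  also have "\<dots> = (\<integral>\<^sup>+s. ?i s * (?i s * ennreal \<bar>h s\<bar>) \<partial>lborel)"
    by (intro nn_integral_cong) (auto simp: indicator_def)
  finally have "ennreal (norm (\<delta> * u z)) ^ 2 \<le> (\<integral>\<^sup>+s. ?i s * (?i s * ennreal \<bar>h s\<bar>) \<partial>lborel) ^ 2"
    by (rule power_mono) simp
  also have "\<dots> \<le> (\<integral>\<^sup>+s. (?i s)^2 \<partial>lborel) * (\<integral>\<^sup>+s. (?i s * ennreal \<bar>h s\<bar>)^2 \<partial>lborel)"
    by (rule Cauchy_Schwarz_nn_integral) measurable
  also have "(\<integral>\<^sup>+s. (?i s)^2 \<partial>lborel) = ennreal \<delta>"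
  proof -
    have "(\<integral>\<^sup>+s. (?i s)^2 \<partial>lborel) = (\<integral>\<^sup>+s. ?i s \<partial>lborel)"
      by (intro nn_integral_cong) (auto simp: indicator_def)
    also have "\<dots> = ennreal \<delta>" using d by simp
    finally show ?thesis .
  qed
  also have "(\<integral>\<^sup>+s. (?i s * ennreal \<bar>h s\<bar>)^2 \<partial>lborel) \<le> ?X"
  proof (intro nn_integral_mono)
    fix s
    show "(?i s * ennreal \<bar>h s\<bar>)^2 \<le> ennreal (2 * ((u (z + s *\<^sub>R e))^2 + \<delta>^2 * (g (z + s *\<^sub>R e))^2))"
    proof (cases "s \<in> {0..\<delta>}")
      case True
      have "(h s)^2 \<le> 2 * ((u (z + s *\<^sub>R e))^2 + ((\<delta> - s) * g (z + s *\<^sub>R e))^2)"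
        unfolding h_def using sum_squares_bound[of "u (z + s *\<^sub>R e)" "- ((\<delta> - s) * g (z + s *\<^sub>R e))"] by (simp add: power2_diff)
      also have "((\<delta> - s) * g (z + s *\<^sub>R e))^2 \<le> \<delta>^2 * (g (z + s *\<^sub>R e))^2"
        unfolding power_mult_distrib using True by (intro mult_right_mono power_mono) auto
      finally have le: "(h s)^2 \<le> 2 * ((u (z + s *\<^sub>R e))^2 + \<delta>^2 * (g (z + s *\<^sub>R e))^2)" by simp
      have "(?i s * ennreal \<bar>h s\<bar>)^2 = ennreal ((h s)^2)" using True by (simp add: ennreal_power)
      then show ?thesis using ennreal_leI[OF le] by simp
    qed auto
  qed
  finally have le: "ennreal (norm (\<delta> * u z)) ^ 2 \<le> ennreal \<delta> * ?X"
    by (simp add: mult_left_mono)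
  have "ennreal \<delta> * ennreal (\<delta> * (u z)^2) = ennreal ((norm (\<delta> * u z))^2)"
    using d by (subst ennreal_mult'[symmetric]) (auto simp: power2_eq_square mult_ac)
  also have "\<dots> = ennreal (norm (\<delta> * u z)) ^ 2" by (simp add: ennreal_power)
  finally have "ennreal \<delta> * ennreal (\<delta> * (u z)^2) \<le> ennreal \<delta> * ?X" using le by simp
  then show ?thesis using d by (subst (asm) ennreal_mult_le_mult_iff) auto
qed

text \<open>Multiplying the bounds along the two directions puts \<delta>^2 u^4 below a product of
  two line integrals of one and the same F; for this reason F contains both directional
  derivatives.\<close>

lemma local_L4_bound:
  fixes u g1 g2 :: "real^2 \<Rightarrow> real"
  assumes [measurable]: "u \<in> borel_measurable borel" "g1 \<in> borel_measurable borel" "g2 \<in> borel_measurable borel"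
    and sq: "integrable lborel (\<lambda>z. (u z)^2)" "integrable lborel (\<lambda>z. (g1 z)^2)" "integrable lborel (\<lambda>z. (g2 z)^2)"
    and d: "0 < \<delta>" and det: "e1 $ 1 * e2 $ 2 - e1 $ 2 * e2 $ 1 \<noteq> 0" and D: "open D"
    and id1: "AE z in lebesgue. z \<in> D \<longrightarrow> \<delta> * u z = (\<integral>s. indicator {0..\<delta>} s * (u (z + s *\<^sub>R e1) - (\<delta> - s) * g1 (z + s *\<^sub>R e1)) \<partial>lborel)"
    and id2: "AE z in lebesgue. z \<in> D \<longrightarrow> \<delta> * u z = (\<integral>s. indicator {0..\<delta>} s * (u (z + s *\<^sub>R e2) - (\<delta> - s) * g2 (z + s *\<^sub>R e2)) \<partial>lborel)"
  shows "(\<integral>\<^sup>+z. indicator D z * ennreal ((u z)^4) \<partial>lebesgue) < \<infinity>"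
proof -
  define f where "f = (\<lambda>w. 2 * ((u w)^2 + \<delta>^2 * ((g1 w)^2 + (g2 w)^2)))"
  define F where "F = (\<lambda>w. ennreal (f w))"
  have [measurable]: "F \<in> borel_measurable borel" unfolding F_def f_def by measurable
  have "integrable lborel f" unfolding f_def using sq by auto
  moreover have "f w \<ge> 0" for w unfolding f_def by simp
  ultimately have fin: "(\<integral>\<^sup>+z. F z \<partial>lborel) < \<infinity>"
    unfolding F_def by (subst nn_integral_eq_integral) auto
  let ?H1 = "\<lambda>z. \<integral>\<^sup>+s. F (z + s *\<^sub>R e1) \<partial>lborel" and ?H2 = "\<lambda>z. \<integral>\<^sup>+s. F (z + s *\<^sub>R e2) \<partial>lborel"
  have b1: "ennreal (\<delta> * (u z)^2) \<le> ?H1 z" if "\<delta> * u z = (\<integral>s. indicator {0..\<delta>} s * (u (z + s *\<^sub>R e1) - (\<delta> - s) * g1 (z + s *\<^sub>R e1)) \<partial>lborel)" for z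
  proof -
    have "ennreal (\<delta> * (u z)^2) \<le> (\<integral>\<^sup>+s. ennreal (2 * ((u (z + s *\<^sub>R e1))^2 + \<delta>^2 * (g1 (z + s *\<^sub>R e1))^2)) \<partial>lborel)"
      by (rule line_square_bound[OF _ _ d that]) measurable
    also have "\<dots> \<le> ?H1 z" unfolding F_def f_def by (intro nn_integral_mono ennreal_leI) (simp add: distrib_left)
    finally show ?thesis .
  qed
  have b2: "ennreal (\<delta> * (u z)^2) \<le> ?H2 z" if "\<delta> * u z = (\<integral>s. indicator {0..\<delta>} s * (u (z + s *\<^sub>R e2) - (\<delta> - s) * g2 (z + s *\<^sub>R e2)) \<partial>lborel)" for z
  proof -
    have "ennreal (\<delta> * (u z)^2) \<le> (\<integral>\<^sup>+s. ennreal (2 * ((u (z + s *\<^sub>R e2))^2 + \<delta>^2 * (g2 (z + s *\<^sub>R e2))^2)) \<partial>lborel)"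
      by (rule line_square_bound[OF _ _ d that]) measurable
    also have "\<dots> \<le> ?H2 z" unfolding F_def f_def by (intro nn_integral_mono ennreal_leI) (simp add: distrib_left)
    finally show ?thesis .
  qed
  have "(\<integral>\<^sup>+z. indicator D z * ennreal ((u z)^4) \<partial>lebesgue) \<le> (\<integral>\<^sup>+z. ennreal (1/\<delta>^2) * (?H1 z * ?H2 z) \<partial>lebesgue)"
  proof (rule nn_integral_mono_AE)
    show "AE z in lebesgue. indicator D z * ennreal ((u z)^4) \<le> ennreal (1/\<delta>^2) * (?H1 z * ?H2 z)"
      using id1 id2
    proof eventually_elim
      case (elim z)
      show ?case
      proof (cases "z \<in> D")
        case True
        have "indicator D z * ennreal ((u z)^4) = ennreal ((1/\<delta>^2) * ((\<delta> * (u z)^2) * (\<delta> * (u z)^2)))"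
          using True d by (simp add: power2_eq_square power4_eq_xxxx mult.assoc)
        also have "\<dots> = ennreal (1/\<delta>^2) * (ennreal (\<delta> * (u z)^2) * ennreal (\<delta> * (u z)^2))"
          using d by (subst ennreal_mult', simp, subst ennreal_mult'[of "\<delta> * (u z)^2"]) auto
        also have "\<dots> \<le> ennreal (1/\<delta>^2) * (?H1 z * ?H2 z)"
          using elim True by (intro mult_mono b1 b2) auto
        finally show ?thesis .
      qed simp
    qed
  qed
  also have "\<dots> = ennreal (1/\<delta>^2) * (\<integral>\<^sup>+z. ?H1 z * ?H2 z \<partial>lebesgue)"
    by (intro nn_integral_cmult measurable_completion) measurable
  also have "\<dots> = ennreal (1/\<delta>^2) * (\<integral>\<^sup>+z. ?H1 z * ?H2 z \<partial>lborel)"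
    by (simp add: nn_integral_completion)
  also have "\<dots> < \<infinity>"
    using nn_integral_two_lines_finite[OF _ det fin] by (simp add: ennreal_mult_less_top)
  finally show ?thesis .
qed

lemma borel_version_integral:
  fixes f f' \<psi> :: "'a::euclidean_space \<Rightarrow> real"
  assumes w: "\<omega> \<in> sets lebesgue" and [measurable]: "f' \<in> borel_measurable borel" "\<psi> \<in> borel_measurable borel"
    and ae: "AE x in lborel. indicator \<omega> x * f x = f' x" and int: "integrable (lebesgue_on \<omega>) (\<lambda>x. \<psi> x * f x)"
  shows "integrable lborel (\<lambda>x. \<psi> x * f' x)"
    "integral\<^sup>L (lebesgue_on \<omega>) (\<lambda>x. \<psi> x * f x) = integral\<^sup>L lborel (\<lambda>x. \<psi> x * f' x)"
proof -
  have i: "integrable lebesgue (\<lambda>x. indicator \<omega> x *\<^sub>R (\<psi> x * f x))"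
    using int w integrable_restrict_space[of \<omega> lebesgue "\<lambda>x. \<psi> x * f x"] by simp
  have m: "(\<lambda>x. \<psi> x * f' x) \<in> borel_measurable lebesgue" by (intro measurable_completion) measurable
  have ae': "AE x in lebesgue. indicator \<omega> x *\<^sub>R (\<psi> x * f x) = \<psi> x * f' x"
    using AE_completion[OF ae] by eventually_elim auto
  have "integrable lebesgue (\<lambda>x. \<psi> x * f' x)"
    using ae' by (intro integrable_cong_AE_imp[OF i m]) (auto elim: eventually_mono)
  then show "integrable lborel (\<lambda>x. \<psi> x * f' x)" by (subst (asm) integrable_completion) auto
  have "integral\<^sup>L (lebesgue_on \<omega>) (\<lambda>x. \<psi> x * f x) = integral\<^sup>L lebesgue (\<lambda>x. indicator \<omega> x *\<^sub>R (\<psi> x * f x))"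
    using w integral_restrict_space[of \<omega> lebesgue "\<lambda>x. \<psi> x * f x"] by simp
  also have "\<dots> = integral\<^sup>L lebesgue (\<lambda>x. \<psi> x * f' x)"
    using borel_measurable_integrable[OF i] m ae' by (rule integral_cong_AE)
  also have "\<dots> = integral\<^sup>L lborel (\<lambda>x. \<psi> x * f' x)" by (rule integral_completion) measurable
  finally show "integral\<^sup>L (lebesgue_on \<omega>) (\<lambda>x. \<psi> x * f x) = integral\<^sup>L lborel (\<lambda>x. \<psi> x * f' x)" .
qed

text \<open>Near a boundary point and up to an isometry the domain is the region below a Lipschitz
  graph. Moving along (c, -1) with L c <= 1 descends at least as fast as the graph can, so the point
  stays below it; c = 0 and c = a give two independent directions. At interior points the coordinate
  axes do.\<close>

lemma lipschitz_interior_segments: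
  assumes w: "open \<omega>" "lipschitz_domain2 \<omega>" and p: "p \<in> closure \<omega>"
  shows "\<exists>N \<delta> e1 e2. open N \<and> p \<in> N \<and> 0 < \<delta> \<and> e1 $ 1 * e2 $ 2 - e1 $ 2 * e2 $ 1 \<noteq> 0 \<and>
    (\<forall>z\<in>\<omega> \<inter> N. \<forall>s\<in>{0..\<delta>}. z + s *\<^sub>R e1 \<in> \<omega> \<and> z + s *\<^sub>R e2 \<in> \<omega>)"
proof (cases "p \<in> \<omega>")
  case True
  then obtain r where r: "r > 0" "ball p r \<subseteq> \<omega>" using w openE by blast
  have "z + s *\<^sub>R e \<in> \<omega>" if "z \<in> ball p (r/2)" "s \<in> {0..r/2}" "norm e = 1" for z s and e :: "real^2"
  proof -
    have "dist p (z + s *\<^sub>R e) \<le> dist p z + norm (s *\<^sub>R e)"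
      by (metis dist_triangle dist_norm add_diff_cancel_left' norm_minus_commute)
    also have "\<dots> < r" using that by auto
    finally show ?thesis using r by auto
  qed
  moreover have "axis 1 (1::real) $ (1::2) * axis 2 (1::real) $ (2::2) - axis 1 (1::real) $ (2::2) * axis 2 (1::real) $ (1::2) \<noteq> 0"
    by (simp add: axis_def)
  ultimately show ?thesis using r
    by (intro exI[of _ "ball p (r/2)"] exI[of _ "r/2"] exI[of _ "axis 1 1"] exI[of _ "axis 2 1"])
       (auto simp: norm_axis_1)
next
  case False
  with p w have "p \<in> frontier \<omega>" by (simp add: frontier_def interior_open)
  then obtain r R g L where r: "r > 0" and R: "orthogonal_matrix R" and g: "L-lipschitz_on UNIV g"
    and loc: "\<forall>x\<in>ball p r. x \<in> \<omega> \<longleftrightarrow> (R *v (x - p))$2 < g ((R *v (x - p))$1)"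
    using w(2) unfolding lipschitz_domain2_def by blast
  have L: "L \<ge> 0" using g by (rule lipschitz_on_nonneg)
  \<comment> \<open>Small enough for L a <= 1, and positive also when L = 0, so that the two
    directions are independent.\<close>
  define a where "a = 1 / (L + 1)"
  have a: "a > 0" "L * a \<le> 1" using L by (auto simp: a_def field_simps)
  define e1 :: "real^2" where "e1 = transpose R *v vector [0, -1]"
  define e2 :: "real^2" where "e2 = transpose R *v vector [a, -1]"
  have RR: "R ** transpose R = mat 1" using R by (simp add: orthogonal_matrix_def)
  have Re: "R *v e1 = vector [0,-1]" "R *v e2 = vector [a,-1]"
    unfolding e1_def e2_def matrix_vector_mul_assoc RR by simp_all
  have detR: "det R \<noteq> 0" using det_orthogonal_matrix[OF R] by auto
  have "e1 $ 1 * e2 $ 2 - e1 $ 2 * e2 $ 1 = det R * a"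
    by (simp add: e1_def e2_def matrix_vector_mult_def transpose_def sum_2 det_2 algebra_simps)
  then have ndet: "e1 $ 1 * e2 $ 2 - e1 $ 2 * e2 $ 1 \<noteq> 0" using detR a by simp
  define \<delta> where "\<delta> = r / (4 * (1 + norm e1 + norm e2))"
  have pos: "1 + norm e1 + norm e2 > 0" by (simp add: add_pos_nonneg)
  have d: "\<delta> > 0" using r pos by (simp add: \<delta>_def)
  have small: "s * norm e < r/2" if "s \<in> {0..\<delta>}" "e = e1 \<or> e = e2" for s e
  proof -
    have "s * norm e \<le> \<delta> * (1 + norm e1 + norm e2)" using that d by (intro mult_mono) auto
    also have "\<dots> = r/4" using pos by (simp add: \<delta>_def field_simps)
    finally show ?thesis using r by simp
  qed
  have inside: "z + s *\<^sub>R e \<in> \<omega>" if z: "z \<in> \<omega> \<inter> ball p (r/2)" and s: "s \<in> {0..\<delta>}" and e: "e = e1 \<or> e = e2" for z s e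
  proof -
    have "dist p (z + s *\<^sub>R e) \<le> dist p z + norm (s *\<^sub>R e)"
      by (metis dist_triangle dist_norm add_diff_cancel_left' norm_minus_commute)
    also have "\<dots> < r" using z small[OF s e] s by auto
    finally have b: "z + s *\<^sub>R e \<in> ball p r" by simp
    define x where "x = R *v (z - p)"
    obtain c where c: "R *v e = vector [c, -1]" "0 \<le> c" "c \<le> a" using Re e a by force
    have x': "R *v (z + s *\<^sub>R e - p) = x + s *\<^sub>R vector [c, -1]"
      by (simp add: x_def matrix_vector_right_distrib matrix_vector_mult_diff_distrib matrix_vector_mult_scaleR c)
    have "x $ 2 < g (x $ 1)" using loc z r by (auto simp: x_def)
    moreover have "\<bar>g (x $ 1 + s * c) - g (x $ 1)\<bar> \<le> L * (s * c)"
      using lipschitz_onD[OF g, of "x $ 1 + s * c" "x $ 1"] s c by (auto simp: dist_real_def abs_mult)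
    moreover have "L * (s * c) \<le> s"
    proof -
      have "L * c \<le> L * a" using L c by (intro mult_left_mono) auto
      then have "L * c \<le> 1" using a by simp
      then have "s * (L * c) \<le> s * 1" using s by (intro mult_left_mono) auto
      then show ?thesis by (simp add: mult_ac)
    qed
    ultimately have "x $ 2 - s < g (x $ 1 + s * c)" by linarith
    then show ?thesis using loc b by (auto simp: x')
  qed
  show ?thesis using inside d ndet r
    by (intro exI[of _ "ball p (r/2)"] exI[of _ \<delta>] exI[of _ e1] exI[of _ e2]) auto
qed

text \<open>The local bounds hold near each point of the closure, boundary points included, since
  the segments point inward. Compactness of the closure leaves finitely many neighbourhoods, whose
  bounds add up.\<close>

lemma sobolev_L4:
  fixes u :: "real^2 \<Rightarrow> real"
  assumes w: "open \<omega>" "bounded \<omega>" "lipschitz_domain2 \<omega>" and W: "W12 \<omega> u Du"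
  shows "integrable (lebesgue_on \<omega>) (\<lambda>x. (u x)^4)"
proof -
  have wl: "\<omega> \<in> sets lebesgue" "\<omega> \<in> lmeasurable" using w by (auto simp: lmeasurable_open)
  \<comment> \<open>Extension by zero, made Borel. Boundedness of the domain turns square
    integrability into integrability through |t| <= 1 + t^2.\<close>
  have version: "\<exists>f'. f' \<in> borel_measurable borel \<and> (AE x in lborel. indicator \<omega> x * f x = f' x) \<and> integrable lborel f' \<and> integrable lborel (\<lambda>x. (f' x)^2)"
    if f: "L2_on \<omega> f" for f :: "real^2 \<Rightarrow> real"
  proof -
    have fm: "f \<in> borel_measurable (lebesgue_on \<omega>)" and f2: "integrable (lebesgue_on \<omega>) (\<lambda>x. (f x)^2)"
      using f by (auto simp: L2_on_def)
    have "(\<lambda>x. indicator \<omega> x * f x) \<in> borel_measurable lebesgue"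
      using fm wl borel_measurable_restrict_space_iff[of \<omega> lebesgue f] by (simp add: mult.commute)
    then obtain f' where f': "f' \<in> borel_measurable lborel" "AE x in lborel. indicator \<omega> x * f x = f' x"
      using completion_ex_borel_measurable_real by blast
    have m: "f' \<in> borel_measurable borel" using f' by simp
    have ae: "AE x in lebesgue. indicator \<omega> x * f x = f' x" using AE_completion[OF f'(2)] .
    have i2: "integrable lebesgue (\<lambda>x. indicator \<omega> x *\<^sub>R (f x)^2)"
      using f2 wl integrable_restrict_space[of \<omega> lebesgue "\<lambda>x. (f x)^2"] by simp
    have "integrable lebesgue (\<lambda>x. (f' x)^2)"
    proof (rule integrable_cong_AE_imp[OF i2])
      show "(\<lambda>x. (f' x)^2) \<in> borel_measurable lebesgue" using m by (intro measurable_completion) simp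
      show "AE x in lebesgue. indicator \<omega> x *\<^sub>R (f x)^2 = (f' x)^2"
        using ae by eventually_elim (auto simp: power_mult_distrib indicator_def split: if_splits)
    qed
    then have s1: "integrable lborel (\<lambda>x. (f' x)^2)" using m by (subst (asm) integrable_completion) auto
    have "integrable lebesgue f'"
    proof (rule Bochner_Integration.integrable_bound[of _ "\<lambda>x. indicator \<omega> x + indicator \<omega> x *\<^sub>R (f x)^2"])
      show "integrable lebesgue (\<lambda>x. indicator \<omega> x + indicator \<omega> x *\<^sub>R (f x)^2)"
        using i2 wl by (intro Bochner_Integration.integrable_add) (auto simp: fmeasurable_def)
      show "f' \<in> borel_measurable lebesgue" using m by (intro measurable_completion) simp
      have b: "\<bar>t\<bar> \<le> 1 + t^2" for t :: real
        using zero_le_power2[of "\<bar>t\<bar> - 1"] zero_le_power2[of t] abs_ge_zero[of t] unfolding power2_diff power2_abs power_one by linarith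
      show "AE x in lebesgue. norm (f' x) \<le> norm (indicator \<omega> x + indicator \<omega> x *\<^sub>R (f x)^2)"
        using ae by eventually_elim (auto simp: indicator_def b split: if_splits)
    qed
    then have "integrable lborel f'" using m by (subst (asm) integrable_completion) auto
    with s1 m f' show ?thesis by blast
  qed
  have L2: "L2_on \<omega> u" "L2_on \<omega> (Du j)" and wp: "weak_partials \<omega> u Du" for j
    using W by (auto simp: W12_def)
  obtain u' where u'm[measurable]: "u' \<in> borel_measurable borel" and u'ae: "AE x in lborel. indicator \<omega> x * u x = u' x"
    and u'i: "integrable lborel u'" "integrable lborel (\<lambda>x. (u' x)^2)" using version[OF L2(1)] by blast
  have "\<forall>j. \<exists>f'. f' \<in> borel_measurable borel \<and> (AE x in lborel. indicator \<omega> x * Du j x = f' x) \<and> integrable lborel f' \<and> integrable lborel (\<lambda>x. (f' x)^2)"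
    using version L2(2) by blast
  from choice[OF this] obtain g where g: "\<forall>j. g j \<in> borel_measurable borel \<and> (AE x in lborel. indicator \<omega> x * Du j x = g j x) \<and> integrable lborel (g j) \<and> integrable lborel (\<lambda>x. (g j x)^2)"
    by (elim exE)
  have gm[measurable]: "\<And>j. g j \<in> borel_measurable borel" and gae: "\<And>j. AE x in lborel. indicator \<omega> x * Du j x = g j x"
    and gi: "\<And>j. integrable lborel (g j)" "\<And>j. integrable lborel (\<lambda>x. (g j x)^2)" using g by auto
  have li: "loc_int \<omega> u" "loc_int \<omega> (Du j)" for j using wp by (auto simp: weak_partials_def)
  \<comment> \<open>The derivative along e is the combination of the partial derivatives with the
    entries of e. Since the segments from D stay in the domain, bumps supported in D remain
    admissible test functions after translation along them.\<close>
  have avg: "AE z in lebesgue. z \<in> D \<longrightarrow> \<delta> * u' z = (\<integral>s. indicator {0..\<delta>} s * (u' (z + s *\<^sub>R e) - (\<delta> - s) * (\<Sum>j\<in>UNIV. e $ j * g j (z + s *\<^sub>R e))) \<partial>lborel)"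
    if D: "open D" "0 < \<delta>" "\<And>z s. z \<in> D \<Longrightarrow> s \<in> {0..\<delta>} \<Longrightarrow> z + s *\<^sub>R e \<in> \<omega>" for D \<delta> e
  proof (rule line_average_AE[where g = "\<lambda>z. \<Sum>j\<in>UNIV. e $ j * g j z", OF u'i(1) _ D(1,2)])
    show "integrable lborel (\<lambda>z. \<Sum>j\<in>UNIV. e $ j * g j z)" using gi by auto
    fix n s and a b :: "real^2" assume ab: "\<And>i. a $ i < b $ i" "cbox a b \<subseteq> D" and s: "0 \<le> s" "s \<le> \<delta>"
    define \<phi> where "\<phi> = bump (Suc n) (a + s *\<^sub>R e) (b + s *\<^sub>R e)"
    have \<phi>: "\<phi> = (\<lambda>z. bump (Suc n) a b (z - s *\<^sub>R e))" by (simp add: \<phi>_def bump_shift fun_eq_iff)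
    have "cbox (a + s *\<^sub>R e) (b + s *\<^sub>R e) \<subseteq> \<omega>"
    proof
      fix z assume "z \<in> cbox (a + s *\<^sub>R e) (b + s *\<^sub>R e)"
      then have "z - s *\<^sub>R e \<in> cbox a b" by (auto simp: mem_box_cart algebra_simps)
      then show "z \<in> \<omega>" using D(3)[of "z - s *\<^sub>R e" s] ab s by auto
    qed
    then have t: "test_fn \<omega> \<phi>" unfolding \<phi>_def using ab by (intro test_fn_bump) auto
    have c: "continuous_on UNIV \<phi>" "continuous_on UNIV (pd (axis j 1) \<phi>)" for j
      using test_fn_cont[OF t] by (auto simp: axis_in_Basis_iff)
    then have [measurable]: "\<phi> \<in> borel_measurable borel" "pd (axis j 1) \<phi> \<in> borel_measurable borel" for j
      by (auto intro: borel_measurable_continuous_onI)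
    have i1: "integrable (lebesgue_on \<omega>) (\<lambda>x. \<phi> x * Du j x)" "integrable (lebesgue_on \<omega>) (\<lambda>x. pd (axis j 1) \<phi> x * u x)" for j
      using test_fn_integrable[OF w(1) t li(2)] test_fn_integrable[OF w(1) t li(1)] by auto
    note v1 = borel_version_integral[OF wl(1) gm _ gae i1(1)] and v2 = borel_version_integral[OF wl(1) u'm _ u'ae i1(2)]
    have key: "(\<integral>x. \<phi> x * g j x \<partial>lborel) = - (\<integral>x. pd (axis j 1) \<phi> x * u' x \<partial>lborel)" for j
    proof -
      have "integral\<^sup>L (lebesgue_on \<omega>) (\<lambda>x. pd (axis j 1) \<phi> x *\<^sub>R u x) = - integral\<^sup>L (lebesgue_on \<omega>) (\<lambda>x. \<phi> x *\<^sub>R Du j x)"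
        using wp t unfolding weak_partials_def by blast
      then show ?thesis using v1(2)[of j] v2(2)[of j] by simp
    qed
    have pdphi: "pd (axis j 1) (bump (Suc n) a b) (z - s *\<^sub>R e) = pd (axis j 1) \<phi> z" for j z
      unfolding \<phi> by (rule pd_shift[symmetric]) (rule Cinf_on_differentiable[OF Cinf_on_bump], simp)
    have "(\<integral>z. bump (Suc n) a b (z - s *\<^sub>R e) * (\<Sum>j\<in>UNIV. e $ j * g j z) \<partial>lborel) = (\<integral>z. (\<Sum>j\<in>UNIV. e $ j * (\<phi> z * g j z)) \<partial>lborel)"
      unfolding \<phi> sum_distrib_left by (simp add: mult_ac)
    also have "\<dots> = (\<Sum>j\<in>UNIV. e $ j * (\<integral>z. \<phi> z * g j z \<partial>lborel))"
      using v1(1) by (subst Bochner_Integration.integral_sum) auto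
    also have "\<dots> = - (\<Sum>j\<in>UNIV. e $ j * (\<integral>x. pd (axis j 1) \<phi> x * u' x \<partial>lborel))"
      by (simp add: key sum_negf)
    also have "(\<Sum>j\<in>UNIV. e $ j * (\<integral>x. pd (axis j 1) \<phi> x * u' x \<partial>lborel)) = (\<integral>x. (\<Sum>j\<in>UNIV. e $ j * (pd (axis j 1) \<phi> x * u' x)) \<partial>lborel)"
      using v2(1) by (subst Bochner_Integration.integral_sum) auto
    also have "\<dots> = (\<integral>z. (\<Sum>j\<in>UNIV. e $ j * pd (axis j 1) (bump (Suc n) a b) (z - s *\<^sub>R e)) * u' z \<partial>lborel)"
      by (simp add: pdphi sum_distrib_right mult.assoc)
    finally show "(\<integral>z. bump (Suc n) a b (z - s *\<^sub>R e) * (\<Sum>j\<in>UNIV. e $ j * g j z) \<partial>lborel) =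
      - (\<integral>z. (\<Sum>j\<in>UNIV. e $ j * pd (axis j 1) (bump (Suc n) a b) (z - s *\<^sub>R e)) * u' z \<partial>lborel)" .
  qed
  have local: "\<exists>N. open N \<and> p \<in> N \<and> (\<integral>\<^sup>+z. indicator (\<omega> \<inter> N) z * ennreal ((u' z)^4) \<partial>lebesgue) < \<infinity>" if p: "p \<in> closure \<omega>" for p
  proof -
    obtain N \<delta> e1 e2 where N: "open N" "p \<in> N" "0 < \<delta>" "e1 $ 1 * e2 $ 2 - e1 $ 2 * e2 $ 1 \<noteq> 0"
      "\<forall>z\<in>\<omega> \<inter> N. \<forall>s\<in>{0..\<delta>}. z + s *\<^sub>R e1 \<in> \<omega> \<and> z + s *\<^sub>R e2 \<in> \<omega>"
      using lipschitz_interior_segments[OF w(1,3) p] by blast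
    have sq: "integrable lborel (\<lambda>z. (\<Sum>j\<in>UNIV. e $ j * g j z)^2)" for e :: "real^2"
    proof (rule Bochner_Integration.integrable_bound[of _ "\<lambda>z. 2 * ((e $ 1)^2 * (g 1 z)^2 + (e $ 2)^2 * (g 2 z)^2)"])
      have "(e $ 1 * g 1 z + e $ 2 * g 2 z)^2 \<le> 2 * ((e $ 1)^2 * (g 1 z)^2 + (e $ 2)^2 * (g 2 z)^2)" for z
        using sum_squares_bound[of "e $ 1 * g 1 z" "e $ 2 * g 2 z"] by (simp add: power2_sum power_mult_distrib)
      then show "AE z in lborel. norm ((\<Sum>j\<in>UNIV. e $ j * g j z)^2) \<le> norm (2 * ((e $ 1)^2 * (g 1 z)^2 + (e $ 2)^2 * (g 2 z)^2))"
        by (simp add: sum_2)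
    qed (use gi in auto)
    have "(\<integral>\<^sup>+z. indicator (\<omega> \<inter> N) z * ennreal ((u' z)^4) \<partial>lebesgue) < \<infinity>"
      by (rule local_L4_bound[OF u'm _ _ u'i(2) sq sq N(3,4) _ avg avg]) (use N w in auto)
    with N show ?thesis by blast
  qed
  then have "\<forall>p\<in>closure \<omega>. \<exists>N. open N \<and> p \<in> N \<and> (\<integral>\<^sup>+z. indicator (\<omega> \<inter> N) z * ennreal ((u' z)^4) \<partial>lebesgue) < \<infinity>"
    by blast
  from bchoice[OF this] obtain N where "\<forall>p\<in>closure \<omega>. open (N p) \<and> p \<in> N p \<and> (\<integral>\<^sup>+z. indicator (\<omega> \<inter> N p) z * ennreal ((u' z)^4) \<partial>lebesgue) < \<infinity>"
    by (elim exE)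
  then have N: "\<And>p. p \<in> closure \<omega> \<Longrightarrow> open (N p) \<and> p \<in> N p \<and> (\<integral>\<^sup>+z. indicator (\<omega> \<inter> N p) z * ennreal ((u' z)^4) \<partial>lebesgue) < \<infinity>"
    by blast
  have "compact (closure \<omega>)" using w by (simp add: compact_eq_bounded_closed bounded_closure)
  then obtain T where T: "T \<subseteq> closure \<omega>" "finite T" "closure \<omega> \<subseteq> (\<Union>p\<in>T. N p)"
    using N by (elim compactE_image[of _ "closure \<omega>" N]) auto
  have m4: "(\<lambda>z. ennreal ((u' z)^4)) \<in> borel_measurable lebesgue" by (intro measurable_completion) measurable
  have ml: "(\<lambda>z. indicator (\<omega> \<inter> N p) z * ennreal ((u' z)^4)) \<in> borel_measurable lebesgue" if "p \<in> T" for p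
    using N[of p] T that w by (intro borel_measurable_times_ennreal m4 borel_measurable_indicator) auto
  have "(\<integral>\<^sup>+z. indicator \<omega> z * ennreal ((u' z)^4) \<partial>lebesgue) \<le> (\<integral>\<^sup>+z. (\<Sum>p\<in>T. indicator (\<omega> \<inter> N p) z * ennreal ((u' z)^4)) \<partial>lebesgue)"
  proof (rule nn_integral_mono)
    fix z
    show "indicator \<omega> z * ennreal ((u' z)^4) \<le> (\<Sum>p\<in>T. indicator (\<omega> \<inter> N p) z * ennreal ((u' z)^4))"
    proof (cases "z \<in> \<omega>")
      case True
      then have "z \<in> (\<Union>p\<in>T. N p)" using T(3) closure_subset[of \<omega>] by (meson subsetD)
      then obtain p where p: "p \<in> T" "z \<in> N p" by blast
      have "indicator \<omega> z * ennreal ((u' z)^4) = indicator (\<omega> \<inter> N p) z * ennreal ((u' z)^4)" using True p by simp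
      also have "\<dots> \<le> (\<Sum>p\<in>T. indicator (\<omega> \<inter> N p) z * ennreal ((u' z)^4))"
        using p T(2) by (intro member_le_sum) auto
      finally show ?thesis .
    qed simp
  qed
  also have "\<dots> = (\<Sum>p\<in>T. \<integral>\<^sup>+z. indicator (\<omega> \<inter> N p) z * ennreal ((u' z)^4) \<partial>lebesgue)"
    by (rule nn_integral_sum) (rule ml)
  also have "\<dots> < \<infinity>" using N T by (auto simp: less_top intro!: ennreal_sum_less_top)
  finally have fin: "(\<integral>\<^sup>+z. indicator \<omega> z * ennreal ((u' z)^4) \<partial>lebesgue) < \<infinity>" .
  have "integrable lebesgue (\<lambda>z. indicator \<omega> z * (u' z)^4)"
  proof (rule integrableI_bounded)
    show "(\<lambda>z. indicator \<omega> z * (u' z)^4) \<in> borel_measurable lebesgue"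
      using wl by (intro borel_measurable_times borel_measurable_indicator measurable_completion) auto
    have "(\<integral>\<^sup>+z. ennreal (norm (indicator \<omega> z * (u' z)^4)) \<partial>lebesgue) = (\<integral>\<^sup>+z. indicator \<omega> z * ennreal ((u' z)^4) \<partial>lebesgue)"
      by (intro nn_integral_cong) (auto simp: indicator_def)
    with fin show "(\<integral>\<^sup>+z. ennreal (norm (indicator \<omega> z * (u' z)^4)) \<partial>lebesgue) < \<infinity>" by simp
  qed
  moreover have "AE z in lebesgue. indicator \<omega> z * (u' z)^4 = indicator \<omega> z *\<^sub>R (u z)^4"
    using AE_completion[OF u'ae] by eventually_elim (auto simp: indicator_def)
  moreover have "(\<lambda>z. indicator \<omega> z *\<^sub>R (u z)^4) \<in> borel_measurable lebesgue"
  proof -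
    have "(\<lambda>z. (u z)^4) \<in> borel_measurable (lebesgue_on \<omega>)" using L2(1) by (auto simp: L2_on_def)
    then show ?thesis using wl borel_measurable_restrict_space_iff[of \<omega> lebesgue "\<lambda>z. (u z)^4"] by simp
  qed
  ultimately have "integrable lebesgue (\<lambda>z. indicator \<omega> z *\<^sub>R (u z)^4)" using integrable_cong_AE_imp by blast
  then show ?thesis using wl integrable_restrict_space[of \<omega> lebesgue "\<lambda>z. (u z)^4"] by simp
qed

section \<open>Positive semidefinite forms and their minimisation over fibres\<close>

text \<open>Semidefinite rather than definite, since skew matrices lie in the kernel of the form
  obtained from \<open>W\<close>.\<close>

definition psd_form :: "('a::real_vector \<Rightarrow> 'a \<Rightarrow> real) \<Rightarrow> bool" where
  "psd_form B \<longleftrightarrow> bilinear B \<and> (\<forall>x y. B x y = B y x) \<and> (\<forall>x. 0 \<le> B x x)"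

lemma psd_form_simps:
  assumes "psd_form B"
  shows "B (x + y) z = B x z + B y z" "B z (x + y) = B z x + B z y" "B (c *\<^sub>R x) z = c * B x z" "B z (c *\<^sub>R x) = c * B z x"
    "B x y = B y x" "0 \<le> B x x"
  using assms by (auto simp: psd_form_def bilinear_ladd bilinear_radd bilinear_lmul bilinear_rmul)

lemma psd_formI:
  assumes "\<And>x y z. B (x + y) z = B x z + B y z" "\<And>c x z. B (c *\<^sub>R x) z = c * B x z"
    "\<And>x y. B x y = B y x" "\<And>x. 0 \<le> B x x"
  shows "psd_form B"
proof -
  have "linear (\<lambda>x. B x z)" for z using assms by (intro linearI) auto
  moreover then have "linear (B z)" for z using assms(3) by (metis (no_types, lifting) ext)
  ultimately show ?thesis using assms by (auto simp: psd_form_def bilinear_def)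
qed

text \<open>Along x + t a the form is affine in t when B a a = 0; with a nonzero slope it would
  become negative. The value of t chosen makes it equal to -1.\<close>

lemma psd_form_kernel:
  assumes B: "psd_form B" and a: "B a a = 0" shows "B x a = 0"
proof (rule ccontr)
  assume n: "B x a \<noteq> 0"
  define t where "t = - (B x x + 1) / (2 * B x a)"
  have "B (x + t *\<^sub>R a) (x + t *\<^sub>R a) = B x x + 2 * t * B x a"
    using psd_form_simps(5)[OF B, of a x] a by (simp add: psd_form_simps(1-4)[OF B] algebra_simps)
  also have "\<dots> = -1" using n by (simp add: t_def field_simps)
  finally show False using psd_form_simps(6)[OF B, of "x + t *\<^sub>R a"] by simp
qed

lemma psd_form_add_kernel:
  assumes B: "psd_form B" and a: "B a a = 0" shows "B (x + a) (x + a) = B x x"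
  using psd_form_kernel[OF assms, of x] a psd_form_simps(5)[OF B, of a x] by (simp add: psd_form_simps(1-2)[OF B])

text \<open>Minimising over one direction at a time (Schur complements) keeps the form quadratic.\<close>
lemma psd_form_min_fibre:
  assumes "psd_form B" "finite S"
  shows "\<exists>B'. psd_form B' \<and> (\<forall>x. (\<forall>n\<in>span S. B' x x \<le> B (x + n) (x + n)) \<and> (\<exists>n\<in>span S. B' x x = B (x + n) (x + n)))"
  using assms(2)
proof induction
  case empty
  then show ?case using assms(1) by (intro exI[of _ B]) auto
next
  case (insert a S)
  then obtain B1 where B1: "psd_form B1" and le: "\<And>x n. n \<in> span S \<Longrightarrow> B1 x x \<le> B (x + n) (x + n)"
    and at: "\<And>x. \<exists>n\<in>span S. B1 x x = B (x + n) (x + n)" by blast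
  note s = psd_form_simps[OF B1]
  define B' where "B' = (\<lambda>x y. B1 x y - B1 x a * B1 y a / B1 a a)"
  \<comment> \<open>The minimiser over t of the form at x + t a. If B1 a a = 0, division by zero
    gives k = 0 and B' = B1, which is right because B1 x a then vanishes as well.\<close>
  define k where "k = (\<lambda>x. - B1 x a / B1 a a)"
  have ka: "B1 (x + t *\<^sub>R a) (x + t *\<^sub>R a) = B1 x x + 2 * t * B1 x a + t^2 * B1 a a" for x t
    using s(5)[of a x] by (simp add: s(1-4) power2_eq_square algebra_simps)
  have B'eq: "B' x x = B1 (x + k x *\<^sub>R a) (x + k x *\<^sub>R a)" for x
    unfolding ka B'_def k_def using psd_form_kernel[OF B1, of a x]
    by (cases "B1 a a = 0") (auto simp: field_simps power2_eq_square)
  have B'le: "B' x x \<le> B1 (x + t *\<^sub>R a) (x + t *\<^sub>R a)" for x t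
  proof (cases "B1 a a = 0")
    case True then show ?thesis using psd_form_kernel[OF B1 True, of x] by (simp add: ka B'_def)
  next
    case False
    then have pos: "B1 a a > 0" using s(6)[of a] by simp
    have "B1 (x + t *\<^sub>R a) (x + t *\<^sub>R a) - B' x x = B1 a a * (t + B1 x a / B1 a a)^2"
      using False by (simp add: ka B'_def field_simps power2_eq_square)
    also have "\<dots> \<ge> 0" using pos by simp
    finally show ?thesis by simp
  qed
  have "psd_form B'"
  proof (rule psd_formI)
    show "0 \<le> B' x x" for x unfolding B'eq by (rule s(6))
    show "B' x y = B' y x" for x y using s(5)[of x y] by (simp add: B'_def mult.commute)
  qed (simp_all add: B'_def s(1,3) algebra_simps add_divide_distrib diff_divide_distrib)
  moreover have "B' x x \<le> B (x + n) (x + n)" if n: "n \<in> span (insert a S)" for x n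
  proof -
    obtain t where t: "n - t *\<^sub>R a \<in> span S" using n by (auto simp: span_insert)
    have "B' x x \<le> B1 (x + t *\<^sub>R a) (x + t *\<^sub>R a)" by (rule B'le)
    also have "\<dots> \<le> B (x + t *\<^sub>R a + (n - t *\<^sub>R a)) (x + t *\<^sub>R a + (n - t *\<^sub>R a))" by (rule le[OF t])
    finally show ?thesis by simp
  qed
  moreover have "\<exists>n\<in>span (insert a S). B' x x = B (x + n) (x + n)" for x
  proof -
    obtain n where n: "n \<in> span S" "B1 (x + k x *\<^sub>R a) (x + k x *\<^sub>R a) = B (x + k x *\<^sub>R a + n) (x + k x *\<^sub>R a + n)"
      using at by blast
    have "k x *\<^sub>R a + n \<in> span (insert a S)"
      using n(1) by (intro span_add span_scale) (auto intro: span_base span_mono[THEN subsetD, of S])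
    then show ?thesis using n(2) B'eq[of x] by (intro bexI[of _ "k x *\<^sub>R a + n"]) (auto simp: add.assoc)
  qed
  ultimately show ?case by blast
qed

lemma psd_form_comp:
  assumes "psd_form B" "linear h" shows "psd_form (\<lambda>x y. B (h x) (h y))"
  using psd_form_simps[OF assms(1)] by (intro psd_formI) (auto simp: linear_add[OF assms(2)] linear_scale[OF assms(2)])

lemma psd_form_Basis_expand:
  fixes B :: "'a::euclidean_space \<Rightarrow> 'a \<Rightarrow> real"
  assumes "psd_form B"
  shows "B x y = (\<Sum>b\<in>Basis. \<Sum>c\<in>Basis. (x \<bullet> b) * (y \<bullet> c) * B b c)"
proof -
  have bl: "bilinear B" using assms by (simp add: psd_form_def)
  have "B x y = B (\<Sum>b\<in>Basis. (x \<bullet> b) *\<^sub>R b) (\<Sum>c\<in>Basis. (y \<bullet> c) *\<^sub>R c)" by (simp add: euclidean_representation)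
  also have "\<dots> = (\<Sum>(b,c)\<in>Basis \<times> Basis. B ((x \<bullet> b) *\<^sub>R b) ((y \<bullet> c) *\<^sub>R c))" by (rule bilinear_sum[OF bl])
  also have "\<dots> = (\<Sum>b\<in>Basis. \<Sum>c\<in>Basis. (x \<bullet> b) * (y \<bullet> c) * B b c)"
    by (simp add: sum.cartesian_product psd_form_simps(3,4)[OF assms] mult_ac)
  finally show ?thesis .
qed

section \<open>The quadratic form of the energy density\<close>

text \<open>Polarisation of \<open>Q3\<close>, symmetrised in F and G so that symmetry of the form
  holds by construction.\<close>

definition Q3b :: "(mat3 \<Rightarrow> ennreal) \<Rightarrow> mat3 \<Rightarrow> mat3 \<Rightarrow> real" where
  "Q3b W F G = (1/2) * (\<Sum>b\<in>Basis. \<Sum>b'\<in>Basis. ((F \<bullet> b) * (G \<bullet> b') + (G \<bullet> b) * (F \<bullet> b')) * pd b (pd b' (\<lambda>G. enn2real (W G))) (mat 1))"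

lemma Q3b_diag: "Q3b W F F = Q3 W F"
  by (simp add: Q3b_def Q3_def sum_distrib_left mult.assoc)

text \<open>Rotation by the angle t in the plane of the axes i and j. The two definitions that
  follow are its first and second derivatives; at t = 0 the first one is the corresponding generator
  of the skew matrices.\<close>

definition rot :: "3 \<Rightarrow> 3 \<Rightarrow> real \<Rightarrow> mat3" where
  "rot i j t = (\<chi> a c. if a = c then (if a = i \<or> a = j then cos t else 1)
      else if a = i \<and> c = j then - sin t else if a = j \<and> c = i then sin t else 0)"

definition rot' :: "3 \<Rightarrow> 3 \<Rightarrow> real \<Rightarrow> mat3" where
  "rot' i j t = (\<chi> a c. if a = c then (if a = i \<or> a = j then - sin t else 0)
      else if a = i \<and> c = j then - cos t else if a = j \<and> c = i then cos t else 0)"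

definition rot'' :: "3 \<Rightarrow> 3 \<Rightarrow> real \<Rightarrow> mat3" where
  "rot'' i j t = (\<chi> a c. if a = c then (if a = i \<or> a = j then - cos t else 0)
      else if a = i \<and> c = j then sin t else if a = j \<and> c = i then - sin t else 0)"

lemma rot_SO3: "i \<noteq> j \<Longrightarrow> rot i j t \<in> SO3"
proof -
  have "\<forall>i j. i \<noteq> j \<longrightarrow> rot i j t \<in> SO3"
    unfolding forall_3 SO3_def rotation_matrix_def orthogonal_matrix rot_def
    by (simp add: matrix_matrix_mult_def transpose_def vec_eq_iff forall_3 sum_3 mat_def det_3 power2_eq_square[symmetric])
  then show "i \<noteq> j \<Longrightarrow> rot i j t \<in> SO3" by blast
qed

lemma has_derivative_mat3:
  fixes f :: "real \<Rightarrow> mat3"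
  assumes "\<And>a c. ((\<lambda>t. f t $ a $ c) has_real_derivative f' $ a $ c) (at t)"
  shows "(f has_derivative (\<lambda>h. h *\<^sub>R f')) (at t)"
proof (subst has_derivative_componentwise_within, intro ballI)
  fix b :: mat3 assume "b \<in> Basis"
  then obtain a c where b: "b = axis a (axis c 1)" by (auto simp: Basis_vec_def)
  have "((\<lambda>t. f t $ a $ c) has_derivative (\<lambda>h. h * f' $ a $ c)) (at t)"
    using assms[of a c] unfolding has_field_derivative_def by (simp add: mult_commute_abs)
  then show "((\<lambda>x. f x \<bullet> b) has_derivative (\<lambda>x. (x *\<^sub>R f') \<bullet> b)) (at t)" by (simp add: b inner_axis)
qed

lemma rot_deriv: "(rot i j has_derivative (\<lambda>h. h *\<^sub>R rot' i j t)) (at t)"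
proof (rule has_derivative_mat3)
  show "((\<lambda>t. rot i j t $ a $ c) has_real_derivative rot' i j t $ a $ c) (at t)" for a c
    unfolding rot_def rot'_def
    by (cases "a = c"; cases "a = i"; cases "a = j"; cases "c = i"; cases "c = j"; simp)
       (auto intro!: derivative_eq_intros)
qed

lemma rot'_deriv: "(rot' i j has_derivative (\<lambda>h. h *\<^sub>R rot'' i j t)) (at t)"
proof (rule has_derivative_mat3)
  show "((\<lambda>t. rot' i j t $ a $ c) has_real_derivative rot'' i j t $ a $ c) (at t)" for a c
    unfolding rot'_def rot''_def
    by (cases "a = c"; cases "a = i"; cases "a = j"; cases "c = i"; cases "c = j"; simp)
       (auto intro!: derivative_eq_intros)
qed

lemma rot_0: "i \<noteq> j \<Longrightarrow> rot i j 0 = mat 1"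
  by (auto simp: rot_def mat_def vec_eq_iff)

context
  fixes W :: "mat3 \<Rightarrow> ennreal" and U :: "mat3 set" and w :: "mat3 \<Rightarrow> real"
  assumes W_zero: "\<And>R. R \<in> SO3 \<Longrightarrow> W R = 0" and U: "open U" "SO3 \<subseteq> U" and C2: "Ck_on 2 U (\<lambda>F. enn2real (W F))"
  defines "w \<equiv> (\<lambda>F. enn2real (W F))"
begin

lemma w_diff: "F \<in> U \<Longrightarrow> w differentiable (at F)" and pd_w_diff: "F \<in> U \<Longrightarrow> b \<in> Basis \<Longrightarrow> pd b w differentiable (at F)"
proof -
  have *: "set bs \<subseteq> Basis \<Longrightarrow> length bs < 2 \<Longrightarrow> x \<in> U \<Longrightarrow> iter_pd bs w differentiable (at x)" for bs x
    using C2 unfolding Ck_on_def w_def by blast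
  show "F \<in> U \<Longrightarrow> w differentiable (at F)" using *[of "[]" F] by (simp add: iter_pd_Nil)
  show "F \<in> U \<Longrightarrow> b \<in> Basis \<Longrightarrow> pd b w differentiable (at F)" using *[of "[b]" F] by (simp add: iter_pd_Nil iter_pd_Cons)
qed

lemma mat1_SO3: "mat 1 \<in> SO3" using rot_SO3[of 1 2 0] rot_0[of 1 2] by simp

lemma w_nonneg: "w F \<ge> 0" and w_SO3: "R \<in> SO3 \<Longrightarrow> w R = 0"
  by (auto simp: w_def W_zero)

lemma curve_deriv:
  assumes "(\<gamma> has_derivative (\<lambda>h. h *\<^sub>R v)) (at t)" "g differentiable (at (\<gamma> t))"
  shows "((\<lambda>t. g (\<gamma> t)) has_real_derivative (\<Sum>b\<in>Basis. (v \<bullet> b) * pd b g (\<gamma> t))) (at t)"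
proof -
  have "((\<lambda>t. g (\<gamma> t)) has_derivative (\<lambda>h. \<Sum>b\<in>Basis. ((h *\<^sub>R v) \<bullet> b) *\<^sub>R pd b g (\<gamma> t))) (at t)"
    by (rule has_derivative_comp_pd[OF assms(2,1)])
  moreover have "(\<lambda>h. \<Sum>b\<in>Basis. ((h *\<^sub>R v) \<bullet> b) *\<^sub>R pd b g (\<gamma> t)) = (*) (\<Sum>b\<in>Basis. (v \<bullet> b) * pd b g (\<gamma> t))"
    by (rule ext) (simp add: sum_distrib_left mult_ac)
  ultimately show ?thesis by (simp add: has_field_derivative_def)
qed

lemma pd_w_mat1: assumes "b \<in> Basis" shows "pd b w (mat 1) = 0"
proof -
  have "((\<lambda>t. mat 1 + t *\<^sub>R b) has_derivative (\<lambda>h. h *\<^sub>R b)) (at 0)" by (auto intro!: derivative_eq_intros)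
  from curve_deriv[OF this, of w] w_diff[of "mat 1"] U mat1_SO3
  have "((\<lambda>t. w (mat 1 + t *\<^sub>R b)) has_real_derivative (\<Sum>b'\<in>Basis. (b \<bullet> b') * pd b' w (mat 1))) (at 0)" by auto
  then have "(\<Sum>b'\<in>Basis. (b \<bullet> b') * pd b' w (mat 1)) = 0"
    by (rule DERIV_local_min[where d=1]) (use w_nonneg w_SO3[OF mat1_SO3] in auto)
  then show ?thesis using assms by (simp add: inner_Basis if_distrib if_distribR sum.delta cong: if_cong)
qed

text \<open>The identity minimises w, so first derivatives vanish there. A negative second
  derivative along F would make the first derivative negative just after 0 and push w below its
  minimum 0.\<close>

lemma Q3_nonneg: "Q3 W F \<ge> 0"
proof (rule ccontr)
  assume neg: "\<not> Q3 W F \<ge> 0"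
  obtain r where r: "r > 0" "ball (mat 1) r \<subseteq> U" using U mat1_SO3 openE by blast
  define d where "d = r / (norm F + 1)"
  have nF: "norm F + 1 > 0" by (simp add: add_nonneg_pos)
  have d: "d > 0" using r nF by (simp add: d_def)
  have inU: "mat 1 + t *\<^sub>R F \<in> U" if "\<bar>t\<bar> < d" for t
  proof -
    have "\<bar>t\<bar> * norm F \<le> \<bar>t\<bar> * (norm F + 1)" by (simp add: mult_left_mono)
    also have "\<dots> < d * (norm F + 1)" using that nF by (intro mult_strict_right_mono)
    also have "\<dots> = r" using nF by (simp add: d_def)
    finally show ?thesis using r(2) by (auto simp: dist_norm)
  qed
  define g' where "g' = (\<lambda>t. \<Sum>b\<in>Basis. (F \<bullet> b) * pd b w (mat 1 + t *\<^sub>R F))"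
  have c: "((\<lambda>t. mat 1 + t *\<^sub>R F) has_derivative (\<lambda>h. h *\<^sub>R F)) (at t)" for t by (auto intro!: derivative_eq_intros)
  have g: "((\<lambda>t. w (mat 1 + t *\<^sub>R F)) has_real_derivative g' t) (at t)" if "\<bar>t\<bar> < d" for t
    unfolding g'_def using curve_deriv[OF c w_diff[OF inU[OF that]]] .
  have "(g' has_real_derivative (\<Sum>b\<in>Basis. (F \<bullet> b) * (\<Sum>b'\<in>Basis. (F \<bullet> b') * pd b' (pd b w) (mat 1 + 0 *\<^sub>R F)))) (at 0)"
    unfolding g'_def using d by (intro DERIV_sum DERIV_cmult curve_deriv c pd_w_diff inU) auto
  moreover have "(\<Sum>b\<in>Basis. (F \<bullet> b) * (\<Sum>b'\<in>Basis. (F \<bullet> b') * pd b' (pd b w) (mat 1 + 0 *\<^sub>R F))) = Q3 W F"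
    unfolding Q3_def w_def[symmetric] by (subst sum.swap) (simp add: sum_distrib_left mult_ac)
  ultimately have "(g' has_real_derivative Q3 W F) (at 0)" by simp
  then obtain e where e: "e > 0" "\<And>h. h > 0 \<Longrightarrow> h < e \<Longrightarrow> g' 0 > g' (0 + h)"
    using DERIV_neg_dec_right[of g' "Q3 W F" 0] neg by auto
  have g'0: "g' 0 = 0" by (simp add: g'_def pd_w_mat1)
  define h where "h = min d e / 2"
  have h: "0 < h" "h < d" "h < e" using d e by (auto simp: h_def)
  have "\<exists>z>0. z < h \<and> w (mat 1 + h *\<^sub>R F) - w (mat 1 + 0 *\<^sub>R F) = (h - 0) * g' z"
    by (rule MVT2[OF h(1)]) (use g h in auto)
  then obtain z where z: "0 < z" "z < h" "w (mat 1 + h *\<^sub>R F) - w (mat 1) = h * g' z" by auto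
  have "g' z < 0" using e(2)[of z] z h g'0 by simp
  then have "h * g' z < 0" using h by (simp add: mult_pos_neg)
  then show False using z(3) w_SO3[OF mat1_SO3] w_nonneg[of "mat 1 + h *\<^sub>R F"] by simp
qed

lemma psd_form_Q3b: "psd_form (Q3b W)"
proof (rule psd_formI)
  show "Q3b W (x + y) z = Q3b W x z + Q3b W y z" for x y z
    by (simp add: Q3b_def inner_add_left sum.distrib[symmetric] algebra_simps)
  show "Q3b W (c *\<^sub>R x) z = c * Q3b W x z" for c x z
    by (simp add: Q3b_def sum_distrib_left algebra_simps)
  show "Q3b W x y = Q3b W y x" for x y by (simp add: Q3b_def add.commute)
  show "0 \<le> Q3b W x x" for x by (simp add: Q3b_diag Q3_nonneg)
qed

text \<open>w is zero along the curve of rotations, hence so is its second derivative. That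
  derivative is \<open>Q3\<close> of the velocity plus the gradient of w paired with the
  acceleration, and the gradient vanishes at the identity.\<close>

lemma Q3_rot'_zero: assumes ij: "i \<noteq> j" shows "Q3 W (rot' i j 0) = 0"
proof -
  define g' where "g' = (\<lambda>t. \<Sum>b\<in>Basis. (rot' i j t \<bullet> b) * pd b w (rot i j t))"
  have inU: "rot i j t \<in> U" for t using rot_SO3[OF ij] U by auto
  have g: "((\<lambda>t. w (rot i j t)) has_real_derivative g' t) (at t)" for t
    unfolding g'_def by (rule curve_deriv[OF rot_deriv w_diff[OF inU]])
  have "(\<lambda>t. w (rot i j t)) = (\<lambda>t. 0)" using w_SO3[OF rot_SO3[OF ij]] by simp
  with g have g'0: "g' t = 0" for t using DERIV_unique[of "\<lambda>t. 0" "g' t" t 0] by simp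
  have comp: "((\<lambda>t. rot' i j t \<bullet> b) has_real_derivative rot'' i j 0 \<bullet> b) (at 0)" for b
  proof -
    have "((\<lambda>t. rot' i j t \<bullet> b) has_derivative (\<lambda>h. (h *\<^sub>R rot'' i j 0) \<bullet> b)) (at 0)"
      by (rule has_derivative_inner_left[OF rot'_deriv])
    then show ?thesis by (simp add: has_field_derivative_def mult_commute_abs)
  qed
  have "(g' has_real_derivative (\<Sum>b\<in>Basis. (rot'' i j 0 \<bullet> b) * pd b w (rot i j 0) +
      (\<Sum>b'\<in>Basis. (rot' i j 0 \<bullet> b') * pd b' (pd b w) (rot i j 0)) * (rot' i j 0 \<bullet> b))) (at 0)"
    unfolding g'_def by (intro DERIV_sum DERIV_mult comp curve_deriv[OF rot_deriv] pd_w_diff inU) auto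
  moreover have "g' = (\<lambda>t. 0)" using g'0 by auto
  then have "(g' has_real_derivative 0) (at 0)" by simp
  ultimately have "(\<Sum>b\<in>Basis. (rot'' i j 0 \<bullet> b) * pd b w (rot i j 0) +
      (\<Sum>b'\<in>Basis. (rot' i j 0 \<bullet> b') * pd b' (pd b w) (rot i j 0)) * (rot' i j 0 \<bullet> b)) = 0"
    by (rule DERIV_unique)
  then have "(\<Sum>b\<in>Basis. (\<Sum>b'\<in>Basis. (rot' i j 0 \<bullet> b') * pd b' (pd b w) (mat 1)) * (rot' i j 0 \<bullet> b)) = 0"
    by (simp add: rot_0[OF ij] pd_w_mat1 cong: sum.cong)
  then show ?thesis unfolding Q3_def w_def[symmetric]
    by (subst sum.swap) (simp add: sum_distrib_left sum_distrib_right mult_ac)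
qed

text \<open>The three generators of plane rotations span the skew matrices and lie in the kernel of
  the form, so they can be added one after the other.\<close>

lemma Q3_add_skew: assumes A: "transpose A = - A" shows "Q3 W (F + A) = Q3 W F"
proof -
  have e: "A $ a $ c = - A $ c $ a" for a c
    using arg_cong[OF A, of "\<lambda>M. M $ c $ a"] by (simp add: transpose_def)
  have eqA: "A = (A $ 2 $ 1) *\<^sub>R rot' 1 2 0 + (A $ 3 $ 1) *\<^sub>R rot' 1 3 0 + (A $ 3 $ 2) *\<^sub>R rot' 2 3 0"
    using e[of 1 1] e[of 2 2] e[of 3 3] e[of 1 2] e[of 1 3] e[of 2 3]
    by (simp add: vec_eq_iff forall_3 rot'_def)
  have z: "Q3b W (c *\<^sub>R rot' i j 0) (c *\<^sub>R rot' i j 0) = 0" if "i \<noteq> j" for i j c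
    using Q3_rot'_zero[OF that] unfolding Q3b_diag[symmetric] by (simp add: psd_form_simps(3,4)[OF psd_form_Q3b])
  have "F + A = F + (A $ 2 $ 1) *\<^sub>R rot' 1 2 0 + (A $ 3 $ 1) *\<^sub>R rot' 1 3 0 + (A $ 3 $ 2) *\<^sub>R rot' 2 3 0"
    using arg_cong[OF eqA, of "\<lambda>X. F + X"] by (simp only: add.assoc)
  then have "Q3b W (F + A) (F + A) = Q3b W (F + (A $ 2 $ 1) *\<^sub>R rot' 1 2 0 + (A $ 3 $ 1) *\<^sub>R rot' 1 3 0 + (A $ 3 $ 2) *\<^sub>R rot' 2 3 0)
      (F + (A $ 2 $ 1) *\<^sub>R rot' 1 2 0 + (A $ 3 $ 1) *\<^sub>R rot' 1 3 0 + (A $ 3 $ 2) *\<^sub>R rot' 2 3 0)"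
    by (rule arg_cong)
  also have "\<dots> = Q3b W F F"
    using z by (simp add: psd_form_add_kernel[OF psd_form_Q3b])
  finally show ?thesis unfolding Q3b_diag .
qed

end

section \<open>Square roots of positive definite matrices\<close>

lemma posdef_det_nz: "posdef A \<Longrightarrow> det A \<noteq> 0"
proof
  assume A: "posdef A" "det A = 0"
  then have "\<not> inj ((*v) A)"
    using det_nz_iff_inj[OF matrix_vector_mul_linear[of A]] by (simp add: matrix_of_matrix_vector_mul)
  then obtain v w where "A *v v = A *v w" "v \<noteq> w" by (auto simp: inj_on_def)
  then have "A *v (v - w) = 0" "v - w \<noteq> 0" by (auto simp: matrix_vector_mult_diff_distrib)
  with A show False unfolding posdef_def by (metis inner_zero_right less_irrefl)
qed

lemma symm_inner: "symm A \<Longrightarrow> (A *v v) \<bullet> w = v \<bullet> (A *v w)"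
  by (metis dot_lmul_matrix symm_def transpose_matrix_vector)

lemma posdef_lower_bound:
  assumes "posdef (A :: real^'n^'n)" shows "\<exists>c>0. \<forall>v. c * (norm v)^2 \<le> v \<bullet> (A *v v)"
proof -
  have cont: "continuous_on (sphere 0 1) (\<lambda>v. v \<bullet> (A *v v))"
    by (intro continuous_intros linear_continuous_on matrix_vector_mul_bounded_linear)
  have "(sphere 0 1 :: (real^'n) set) \<noteq> {}" by simp
  then obtain u where u: "u \<in> sphere 0 1" "\<And>v. v \<in> sphere 0 1 \<Longrightarrow> u \<bullet> (A *v u) \<le> v \<bullet> (A *v v)"
    using continuous_attains_inf[OF compact_sphere _ cont] by blast
  have "u \<bullet> (A *v u) * (norm v)^2 \<le> v \<bullet> (A *v v)" for v
  proof (cases "v = 0")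
    case False
    have "u \<bullet> (A *v u) \<le> ((1/norm v) *\<^sub>R v) \<bullet> (A *v ((1/norm v) *\<^sub>R v))" using False by (intro u) simp
    also have "\<dots> = (v \<bullet> (A *v v)) / (norm v)^2" by (simp add: matrix_vector_mult_scaleR power2_eq_square)
    finally show ?thesis using False by (simp add: field_simps)
  qed simp
  moreover have "u \<bullet> (A *v u) > 0" using assms u(1) unfolding posdef_def by (metis norm_zero mem_sphere_0 zero_neq_one)
  ultimately show ?thesis by blast
qed

text \<open>With \<open>X\<close> a symmetric contraction, \<open>I - Y\<close> is a square root of \<open>I - X\<close> when \<open>Y\<close> is the
  fixed point of \<open>Y \<mapsto> (X + Y\<^sup>2) / 2\<close>.\<close>
lemma contraction_sqrt:
  fixes X :: "real^'n^'n"
  assumes X: "symm X" and q: "0 \<le> q" "q < 1" and nX: "\<And>v. norm (X *v v) \<le> q * norm v"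
  shows "\<exists>B. posdef B \<and> B ** B = mat 1 - X"
proof -
  define x where "x = Blinfun ((*v) X)"
  have xa: "blinfun_apply x = (*v) X" unfolding x_def
    by (rule bounded_linear_Blinfun_apply) (rule matrix_vector_mul_bounded_linear)
  have nx: "norm x \<le> q" by (rule norm_blinfun_bound) (use nX q in \<open>auto simp: xa\<close>)
  \<comment> \<open>The smaller root of r = (q + r^2)/2. The ball of this radius is mapped into
    itself by the iteration, and r < 1 serves as contraction factor too.\<close>
  define r where "r = 1 - sqrt (1 - q)"
  have r: "0 \<le> r" "r < 1" "(q + r * r) / 2 = r"
  proof -
    have sq: "sqrt (1 - q) * sqrt (1 - q) = 1 - q" using q by simp
    then show "(q + r * r) / 2 = r" unfolding r_def by (simp add: field_simps)
  qed (use q in \<open>auto simp: r_def\<close>)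
  \<comment> \<open>Self-adjointness is a closed condition preserved by the iteration; building it
    into the domain makes the fixed point symmetric.\<close>
  define S where "S = {y :: (real^'n) \<Rightarrow>\<^sub>L (real^'n). norm y \<le> r \<and> (\<forall>v w. blinfun_apply y v \<bullet> w = v \<bullet> blinfun_apply y w)}"
  define T where "T = (\<lambda>y. (1/2) *\<^sub>R (x + (y o\<^sub>L y)))"
  have "closed S"
  proof -
    have "S = cball 0 r \<inter> (\<Inter>v. \<Inter>w. {y. blinfun_apply y v \<bullet> w = v \<bullet> blinfun_apply y w})" by (auto simp: S_def)
    moreover have "closed {y :: (real^'n) \<Rightarrow>\<^sub>L (real^'n). blinfun_apply y v \<bullet> w = v \<bullet> blinfun_apply y w}" for v w
      by (intro closed_Collect_eq continuous_intros)
    ultimately show ?thesis by (auto intro!: closed_Int closed_INT)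
  qed
  then have comp: "complete S" by (simp add: complete_eq_closed)
  have ne: "S \<noteq> {}" using r by (auto simp: S_def intro!: exI[of _ 0])
  have sub: "T ` S \<subseteq> S"
  proof
    fix z assume "z \<in> T ` S"
    then obtain y where y: "y \<in> S" "z = T y" by auto
    have "norm (y o\<^sub>L y) \<le> r * r"
      by (rule order_trans[OF norm_blinfun_compose mult_mono]) (use y r in \<open>auto simp: S_def\<close>)
    then have "norm (x + (y o\<^sub>L y)) \<le> q + r * r" using norm_triangle_ineq[of x "y o\<^sub>L y"] nx by linarith
    then have "norm z \<le> r" using r(3) by (simp add: y T_def)
    moreover have "blinfun_apply z v \<bullet> w = v \<bullet> blinfun_apply z w" for v w
      using y symm_inner[OF X, of v w]
      by (simp add: T_def S_def blinfun.scaleR_left blinfun.add_left xa inner_add_left inner_add_right)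
    ultimately show "z \<in> S" by (simp add: S_def)
  qed
  have lip: "dist (T y) (T z) \<le> r * dist y z" if "y \<in> S" "z \<in> S" for y z
  proof -
    have "T y - T z = (1/2) *\<^sub>R ((y o\<^sub>L (y - z)) + ((y - z) o\<^sub>L z))"
      by (rule blinfun_eqI) (simp add: T_def blinfun.scaleR_left blinfun.add_left blinfun.diff_left blinfun.diff_right algebra_simps)
    then have "norm (T y - T z) = (1/2) * norm ((y o\<^sub>L (y - z)) + ((y - z) o\<^sub>L z))" by simp
    also have "norm ((y o\<^sub>L (y - z)) + ((y - z) o\<^sub>L z)) \<le> norm y * norm (y - z) + norm (y - z) * norm z"
      by (intro norm_triangle_le add_mono norm_blinfun_compose)
    also have "\<dots> \<le> r * norm (y - z) + norm (y - z) * r"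
      using that by (intro add_mono mult_mono) (auto simp: S_def r)
    finally show ?thesis by (simp add: dist_norm)
  qed
  obtain y where y: "y \<in> S" "T y = y"
    using Banach_fix[OF comp ne r(1,2) sub] lip by blast
  define Y where "Y = matrix (blinfun_apply y)"
  have Yv: "Y *v v = y v" for v
    unfolding Y_def using matrix_vector_mul(2)[OF bounded_linear.linear[OF blinfun.bounded_linear_right[of y]]] by metis
  have fixp: "y (y v) = 2 *\<^sub>R y v - X *v v" for v
  proof -
    have "y v = T y v" using y by simp
    also have "\<dots> = (1/2) *\<^sub>R (X *v v + y (y v))" by (simp add: T_def blinfun.scaleR_left blinfun.add_left xa)
    finally have "2 *\<^sub>R y v = 2 *\<^sub>R ((1/2) *\<^sub>R (X *v v + y (y v)))" by (rule arg_cong)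
    then show ?thesis by (simp add: algebra_simps)
  qed
  define B where "B = mat 1 - Y"
  have Bv: "B *v v = v - y v" for v by (simp add: B_def matrix_vector_mult_diff_rdistrib Yv)
  have "B ** B = mat 1 - X"
  proof (subst matrix_eq, intro allI)
    fix v
    show "(B ** B) *v v = (mat 1 - X) *v v"
      by (simp add: matrix_vector_mul_assoc[symmetric] Bv matrix_vector_mult_diff_rdistrib blinfun.diff_right fixp scaleR_2)
  qed
  moreover have "posdef B" unfolding posdef_def
  proof
    have "transpose B = B"
    proof (subst matrix_eq, intro allI)
      fix v
      have "(transpose B *v v) \<bullet> w = (B *v v) \<bullet> w" for w
        using y(1) by (simp add: transpose_matrix_vector dot_lmul_matrix Bv inner_diff_left inner_diff_right S_def)
      then show "transpose B *v v = B *v v" by (metis vector_eq_rdot)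
    qed
    then show "symm B" by (simp add: symm_def)
    show "\<forall>v. v \<noteq> 0 \<longrightarrow> v \<bullet> (B *v v) > 0"
    proof (intro allI impI)
      fix v :: "real^'n" assume v: "v \<noteq> 0"
      have "v \<bullet> y v \<le> norm v * norm (y v)" by (rule norm_cauchy_schwarz)
      also have "\<dots> \<le> norm v * (norm y * norm v)" by (intro mult_left_mono norm_blinfun) auto
      also have "\<dots> \<le> norm v * (r * norm v)" using y(1) by (intro mult_left_mono mult_right_mono) (auto simp: S_def)
      also have "\<dots> < norm v * (1 * norm v)" using v r by (intro mult_strict_left_mono mult_strict_right_mono) auto
      finally show "v \<bullet> (B *v v) > 0" by (simp add: Bv inner_diff_right dot_square_norm power2_eq_square)
    qed
  qed
  ultimately show ?thesis by blast
qed

text \<open>After division by a large L, the matrix I - A/L has its quadratic form between 0 and q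
  |v|^2 with q < 1. Cauchy-Schwarz for this form upgrades the bound to the operator norm, as
  \<open>contraction_sqrt\<close> demands.\<close>

lemma posdef_sqrt_exists:
  fixes A :: "real^'n^'n" assumes A: "posdef A"
  shows "\<exists>B. posdef B \<and> B ** B = A"
proof -
  have sA: "symm A" using A by (simp add: posdef_def)
  obtain c where c: "c > 0" "\<And>v. c * (norm v)^2 \<le> v \<bullet> (A *v v)" using posdef_lower_bound[OF A] by blast
  \<comment> \<open>Above the operator norm, so that the form of I - A/L is nonnegative, and above
    c, so that q = 1 - c/L is nonnegative.\<close>
  define L where "L = max (onorm ((*v) A)) c + 1"
  have L: "L > 0" "c < L" using c by (auto simp: L_def)
  have up: "v \<bullet> (A *v v) \<le> L * (norm v)^2" for v
  proof -
    have "v \<bullet> (A *v v) \<le> norm v * norm (A *v v)" by (rule norm_cauchy_schwarz)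
    also have "\<dots> \<le> norm v * (onorm ((*v) A) * norm v)" by (intro mult_left_mono onorm matrix_vector_mul_bounded_linear) auto
    also have "\<dots> \<le> norm v * (L * norm v)" by (intro mult_left_mono mult_right_mono) (auto simp: L_def)
    finally show ?thesis by (simp add: power2_eq_square mult_ac)
  qed
  define X where "X = mat 1 - (1/L) *\<^sub>R A"
  have Xv: "X *v v = v - (1/L) *\<^sub>R (A *v v)" for v
    by (simp add: X_def matrix_vector_mult_diff_rdistrib scaleR_matrix_vector_assoc[symmetric])
  have sX: "symm X" unfolding symm_def
  proof (subst matrix_eq, intro allI)
    fix v
    have "(transpose X *v v) \<bullet> w = (X *v v) \<bullet> w" for w
      using symm_inner[OF sA, of v w] by (simp add: transpose_matrix_vector dot_lmul_matrix Xv inner_diff_left inner_diff_right)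
    then show "transpose X *v v = X *v v" by (metis vector_eq_rdot)
  qed
  define q where "q = 1 - c / L"
  have q: "0 \<le> q" "q < 1" using c L by (auto simp: q_def)
  have Xlo: "0 \<le> v \<bullet> (X *v v)" for v
    using up[of v] L by (simp add: Xv inner_diff_right dot_square_norm field_simps)
  have Xup: "v \<bullet> (X *v v) \<le> q * (norm v)^2" for v
    using c(2)[of v] L by (simp add: Xv q_def inner_diff_right dot_square_norm field_simps)
  have psd: "psd_form (\<lambda>v w. v \<bullet> (X *v w))"
  proof (rule psd_formI)
    show "v \<bullet> (X *v w) = w \<bullet> (X *v v)" for v w
      using symm_inner[OF sX, of w v] inner_commute[of v "X *v w"] by simp
  qed (simp_all add: inner_add_left Xlo)
  have CS: "(v \<bullet> (X *v w))^2 \<le> (v \<bullet> (X *v v)) * (w \<bullet> (X *v w))" for v w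
  proof (cases "w \<bullet> (X *v w) = 0")
    case True
    then show ?thesis using psd_form_kernel[OF psd True] by simp
  next
    case False
    define t where "t = - (v \<bullet> (X *v w)) / (w \<bullet> (X *v w))"
    have pos: "w \<bullet> (X *v w) > 0" using False Xlo[of w] by simp
    have sy: "w \<bullet> (X *v v) = v \<bullet> (X *v w)" using psd_form_simps(5)[OF psd] .
    have "0 \<le> (v + t *\<^sub>R w) \<bullet> (X *v (v + t *\<^sub>R w))" by (rule Xlo)
    also have "\<dots> = v \<bullet> (X *v v) + 2 * t * (v \<bullet> (X *v w)) + t^2 * (w \<bullet> (X *v w))"
      using sy by (simp add: matrix_vector_right_distrib matrix_vector_mult_scaleR inner_add_left inner_add_right power2_eq_square algebra_simps)
    also have "\<dots> = v \<bullet> (X *v v) - (v \<bullet> (X *v w))^2 / (w \<bullet> (X *v w))"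
      using False by (simp add: t_def power2_eq_square field_simps)
    finally show ?thesis using pos by (simp add: field_simps)
  qed
  have nX: "norm (X *v v) \<le> q * norm v" for v
  proof (cases "X *v v = 0")
    case False
    let ?w = "X *v v"
    \<comment> \<open>Cauchy-Schwarz for the form of X at the pair formed by X v and v.\<close>
    have "(?w \<bullet> ?w)^2 \<le> (?w \<bullet> (X *v ?w)) * (v \<bullet> (X *v v))" by (rule CS)
    also have "\<dots> \<le> (q * (norm ?w)^2) * (q * (norm v)^2)" by (intro mult_mono Xup Xlo) (use q in auto)
    finally have "(norm ?w)^2 * (norm ?w)^2 \<le> (norm ?w)^2 * (q * norm v)^2"
      by (simp add: dot_square_norm power2_eq_square mult_ac)
    moreover have "(norm ?w)^2 > 0" using False by simp
    ultimately have "(norm ?w)^2 \<le> (q * norm v)^2" by (rule mult_left_le_imp_le)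
    then show ?thesis by (rule power2_le_imp_le) (use q in auto)
  qed (use q in auto)
  obtain B where B: "posdef B" "B ** B = mat 1 - X" using contraction_sqrt[OF sX q nX] by blast
  define C where "C = sqrt L *\<^sub>R B"
  have "C ** C = L *\<^sub>R (B ** B)" using L by (simp add: C_def scalar_matrix_assoc[symmetric] matrix_scalar_ac)
  also have "\<dots> = A" using L by (simp add: B X_def)
  finally have "C ** C = A" .
  moreover have "posdef C" using B(1) L unfolding posdef_def symm_def C_def
    by (auto simp: transpose_scalar scaleR_matrix_vector_assoc[symmetric])
  ultimately show ?thesis by blast
qed

lemma inner_transpose: "transpose A \<bullet> transpose B = A \<bullet> (B :: real^'n^'m)"
  unfolding inner_vec_def transpose_def by (subst sum.swap) simp

text \<open>With X = B - C one has B^2 - C^2 = B X + X C. Pairing with X, the first term is at least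
  c |X|^2 and the second is nonnegative. Both uniqueness and continuity of the square root
  follow.\<close>

lemma posdef_sqrt_lipschitz:
  fixes B C :: "real^'n^'n"
  assumes B: "posdef B" and C: "posdef C" and c: "\<And>v. c * (norm v)^2 \<le> v \<bullet> (B *v v)"
  shows "c * norm (B - C) \<le> norm (B ** B - C ** C)"
proof (cases "B = C")
  case False
  define X where "X = B - C"
  have eq: "B ** B - C ** C = B ** X + X ** C"
    by (simp add: X_def matrix_matrix_mult_def vec_eq_iff sum_subtractf algebra_simps)
  have Bs: "transpose B = B" "transpose C = C" using B C by (auto simp: posdef_def symm_def)
  have row: "(Z ** D) $ i = transpose D *v (Z $ i)" for Z D :: "real^'n^'n" and i
    by (simp add: matrix_matrix_mult_def matrix_vector_mult_def transpose_def vec_eq_iff mult.commute)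
  have "X \<bullet> (B ** X) = transpose X \<bullet> (transpose X ** B)"
    by (metis inner_transpose matrix_transpose_mul Bs(1))
  also have "\<dots> = (\<Sum>i\<in>UNIV. transpose X $ i \<bullet> (B *v (transpose X $ i)))"
    by (subst inner_vec_def) (simp add: row Bs)
  also have "\<dots> \<ge> (\<Sum>i\<in>UNIV. c * (norm (transpose X $ i))^2)" by (intro sum_mono c)
  also have "(\<Sum>i\<in>UNIV. c * (norm (transpose X $ i))^2) = c * (transpose X \<bullet> transpose X)"
    by (subst inner_vec_def) (simp add: sum_distrib_left dot_square_norm)
  finally have "X \<bullet> (B ** X) \<ge> c * (transpose X \<bullet> transpose X)" .
  moreover have "X \<bullet> (X ** C) \<ge> 0"
  proof -
    have "X \<bullet> (X ** C) = (\<Sum>i\<in>UNIV. X $ i \<bullet> (C *v (X $ i)))" by (subst inner_vec_def) (simp add: row Bs)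
    moreover have "v \<bullet> (C *v v) \<ge> 0" for v using C unfolding posdef_def by (cases "v = 0") (auto simp: less_imp_le)
    ultimately show ?thesis by (simp add: sum_nonneg)
  qed
  ultimately have "c * (norm X)^2 \<le> X \<bullet> (B ** B - C ** C)"
    unfolding eq inner_add_right inner_transpose by (simp add: dot_square_norm)
  also have "\<dots> \<le> norm X * norm (B ** B - C ** C)" by (rule norm_cauchy_schwarz)
  finally have "norm X * (c * norm X) \<le> norm X * norm (B ** B - C ** C)" by (simp add: power2_eq_square mult_ac)
  then show ?thesis using False by (simp add: X_def)
qed simp

lemma msqrt:
  fixes A :: "real^'n^'n" assumes "posdef A"
  shows "posdef (msqrt A)" "msqrt A ** msqrt A = A"
proof -
  have "\<exists>!B. posdef B \<and> B ** B = A"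
  proof (rule ex_ex1I)
    show "\<exists>B. posdef B \<and> B ** B = A" by (rule posdef_sqrt_exists[OF assms])
    fix B C assume BC: "posdef B \<and> B ** B = A" "posdef C \<and> C ** C = A"
    obtain c where c: "c > 0" "\<And>v. c * (norm v)^2 \<le> v \<bullet> (B *v v)" using posdef_lower_bound BC by blast
    show "B = C" using posdef_sqrt_lipschitz[of B C c] BC c by (simp add: mult_le_0_iff)
  qed
  from theI'[OF this] show "posdef (msqrt A)" "msqrt A ** msqrt A = A" by (auto simp: msqrt_def)
qed

lemma continuous_on_msqrt:
  fixes A :: "'a::metric_space \<Rightarrow> real^'n^'n"
  assumes A: "continuous_on S A" "\<And>x. x \<in> S \<Longrightarrow> posdef (A x)"
  shows "continuous_on S (\<lambda>x. msqrt (A x))"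
  unfolding continuous_on_def
proof
  fix x assume x: "x \<in> S"
  obtain c where c: "c > 0" "\<And>v. c * (norm v)^2 \<le> v \<bullet> (msqrt (A x) *v v)"
    using posdef_lower_bound[OF msqrt(1)[OF A(2)[OF x]]] by blast
  have "((\<lambda>y. norm (A x - A y) / c) \<longlongrightarrow> norm (A x - A x) / c) (at x within S)"
    using A(1) x c(1) by (intro tendsto_intros) (auto simp: continuous_on_def)
  then have lim: "((\<lambda>y. norm (A x - A y) / c) \<longlongrightarrow> 0) (at x within S)" by simp
  show "((\<lambda>x. msqrt (A x)) \<longlongrightarrow> msqrt (A x)) (at x within S)"
  proof -
    have "norm (msqrt (A y) - msqrt (A x)) \<le> norm (A x - A y) / c" if y: "y \<in> S" for y
    proof -
      have "c * norm (msqrt (A x) - msqrt (A y)) \<le> norm (A x - A y)"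
        using posdef_sqrt_lipschitz[OF msqrt(1)[OF A(2)[OF x]] msqrt(1)[OF A(2)[OF y]] c(2)]
        unfolding msqrt(2)[OF A(2)[OF x]] msqrt(2)[OF A(2)[OF y]] .
      then show ?thesis using c(1) by (simp add: field_simps norm_minus_commute)
    qed
    then have "\<forall>\<^sub>F y in at x within S. norm (msqrt (A y) - msqrt (A x)) \<le> norm (A x - A y) / c"
      by (auto simp: eventually_at_filter)
    from Lim_null_comparison[OF this lim] show ?thesis by (simp add: Lim_null[of _ "msqrt (A x)"])
  qed
qed

lemma continuous_on_matrix_inv:
  fixes A :: "'a::topological_space \<Rightarrow> real^'n^'n"
  assumes A: "continuous_on S A" "\<And>x. x \<in> S \<Longrightarrow> det (A x) \<noteq> 0"
  shows "continuous_on S (\<lambda>x. matrix_inv (A x))"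
proof -
  have e: "continuous_on S (\<lambda>x. A x $ i $ j)" for i j
    by (intro continuous_on_component A)
  have det: "continuous_on S (\<lambda>x. det (M x))" if "\<And>i j. continuous_on S (\<lambda>x. M x $ i $ j)" for M :: "'a \<Rightarrow> real^'n^'n"
    unfolding det_def by (intro continuous_intros that)
  have "continuous_on S (\<lambda>x. matrix_inv (A x) $ i $ j)" for i j
  proof -
    have "continuous_on S (\<lambda>x. (\<chi> k l. if l = i then (if k = j then 1 else 0) else A x $ k $ l) $ k $ l)" for k l
      by (cases "l = i"; cases "k = j") (auto intro: e)
    then have "continuous_on S (\<lambda>x. det (\<chi> k l. if l = i then (if k = j then 1 else 0) else A x $ k $ l) / det (A x))"
      by (intro continuous_on_divide det e) (use A in auto)
    then show ?thesis by (rule continuous_on_eq) (simp add: matrix_inv_cramer A)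
  qed
  then have "continuous_on S (\<lambda>x. \<chi> i j. matrix_inv (A x) $ i $ j)" by (intro continuous_on_vec_lambda)
  then show ?thesis by simp
qed

lemma symm_matrix_inv:
  fixes A :: "real^'n^'n"
  assumes "symm A" "det A \<noteq> 0" shows "symm (matrix_inv A)"
proof -
  have "transpose (matrix_inv A) ** A = mat 1"
    using arg_cong[OF matrix_inv_mult(1)[OF assms(2)], of transpose] assms(1)
    by (simp add: matrix_transpose_mul symm_def)
  then have "transpose (matrix_inv A) ** (A ** matrix_inv A) = matrix_inv A"
    by (simp add: matrix_mul_assoc)
  then show ?thesis by (simp add: matrix_inv_mult[OF assms(2)] symm_def)
qed

section \<open>The reduced quadratic form\<close>

text \<open>A linear section of \<open>blk22\<close>: the fibre over F becomes \<open>pad3 F\<close>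
  plus the kernel of \<open>blk22\<close>.\<close>

definition pad3 :: "mat2 \<Rightarrow> mat3" where
  "pad3 F = (\<chi> i j. if i = 3 \<or> j = 3 then 0 else F $ (if i = 1 then 1 else 2) $ (if j = 1 then 1 else 2))"

lemma blk22_pad3 [simp]: "blk22 (pad3 F) = F"
  by (simp add: blk22_def pad3_def emb_def vec_eq_iff forall_2)

lemma linear_blk22: "linear blk22" and linear_pad3: "linear pad3"
  by (auto intro!: linearI simp: blk22_def pad3_def vec_eq_iff)

lemma linear_conj_mult: "linear (\<lambda>F. M ** F ** M :: real^'n^'n)"
proof (rule linearI)
  show "M ** (F + G) ** M = M ** F ** M + M ** G ** M" for F G
    by (simp add: matrix_matrix_mult_def vec_eq_iff sum.distrib distrib_left distrib_right)
qed (simp add: scalar_matrix_assoc[symmetric] matrix_scalar_ac)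

text \<open>Polarisation written through \<open>Q2\<close> itself, so that measurability and bounds
  for \<open>Q2\<close> pass directly to the bilinear form; bilinearity rests on
  \<open>Q2_is_psd_form\<close>.\<close>

definition Q2b :: "(mat3 \<Rightarrow> ennreal) \<Rightarrow> (real^2 \<Rightarrow> mat3) \<Rightarrow> real^2 \<Rightarrow> mat2 \<Rightarrow> mat2 \<Rightarrow> real" where
  "Q2b W Gbar x' F G = (Q2 W Gbar x' (F + G) - Q2 W Gbar x' (F - G)) / 4"

context
  fixes W :: "mat3 \<Rightarrow> ennreal"
  assumes psd: "psd_form (Q3b W)"
begin

text \<open>The competitors in \<open>Q2\<close> are \<open>pad3 F\<close> plus the kernel of
  \<open>blk22\<close>, so minimisation over a subspace applies. It shows at once that the infimum
  is attained and that it is quadratic in F.\<close>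

lemma Q2_is_psd_form: "\<exists>B. psd_form B \<and> (\<forall>F. Q2 W Gbar x' F = B F F)"
proof -
  define M where "M = matrix_inv (msqrt (Gbar x'))"
  define q where "q = (\<lambda>F G. Q3b W (M ** F ** M) (M ** G ** M))"
  have q: "psd_form q" unfolding q_def by (rule psd_form_comp[OF psd linear_conj_mult])
  define K where "K = {n. blk22 n = 0}"
  have "subspace K" unfolding K_def by (rule linear_subspace_kernel[OF linear_blk22])
  then obtain S where S: "finite S" "span S = K"
    using basis_exists[of K] finiteI_independent by (metis span_subspace)
  obtain B where B: "psd_form B" "\<And>x n. n \<in> K \<Longrightarrow> B x x \<le> q (x + n) (x + n)" "\<And>x. \<exists>n\<in>K. B x x = q (x + n) (x + n)"
    using psd_form_min_fibre[OF q S(1)] unfolding S(2) by blast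
  have "Q2 W Gbar x' F = B (pad3 F) (pad3 F)" for F
    unfolding Q2_def M_def[symmetric]
  proof (rule cInf_eq_minimum)
    obtain n where n: "n \<in> K" "B (pad3 F) (pad3 F) = q (pad3 F + n) (pad3 F + n)" using B(3) by blast
    have "blk22 (pad3 F + n) = F" using n by (simp add: K_def linear_add[OF linear_blk22])
    then show "B (pad3 F) (pad3 F) \<in> {Q3 W (M ** Ft ** M) |Ft. blk22 Ft = F}"
      using n(2) unfolding q_def Q3b_diag by blast
    fix x assume "x \<in> {Q3 W (M ** Ft ** M) |Ft. blk22 Ft = F}"
    then obtain Ft where Ft: "blk22 Ft = F" "x = Q3 W (M ** Ft ** M)" by blast
    have "Ft - pad3 F \<in> K" using Ft by (simp add: K_def linear_diff[OF linear_blk22])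
    from B(2)[OF this, of "pad3 F"] show "B (pad3 F) (pad3 F) \<le> x" by (simp add: q_def Q3b_diag Ft)
  qed
  then show ?thesis using psd_form_comp[OF B(1) linear_pad3] by blast
qed

lemma Q2b_form: "psd_form (Q2b W Gbar x')" and Q2b_diag: "Q2b W Gbar x' F F = Q2 W Gbar x' F"
proof -
  obtain B where B: "psd_form B" "\<And>F. Q2 W Gbar x' F = B F F" using Q2_is_psd_form by blast
  note s = psd_form_simps[OF B(1)]
  have "Q2b W Gbar x' F G = B F G" for F G
  proof -
    have "B (F - G) (F - G) = B (F + (-1) *\<^sub>R G) (F + (-1) *\<^sub>R G)" by simp
    also have "\<dots> = B F F - 2 * B F G + B G G" unfolding s(1) s(2) s(3) s(4) using s(5)[of G F] by simp
    finally have 1: "B (F - G) (F - G) = B F F - 2 * B F G + B G G" .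
    have 2: "B (F + G) (F + G) = B F F + 2 * B F G + B G G" unfolding s(1) s(2) using s(5)[of G F] by simp
    show ?thesis unfolding Q2b_def B(2) 1 2 by simp
  qed
  then have "Q2b W Gbar x' = B" by blast
  then show "psd_form (Q2b W Gbar x')" "Q2b W Gbar x' F F = Q2 W Gbar x' F" using B by auto
qed

lemma Q2_nonneg: "0 \<le> Q2 W Gbar x' F"
  using psd_form_simps(6)[OF Q2b_form] by (simp add: Q2b_diag)

lemma continuous_on_matrix_mult:
  fixes A :: "'a::topological_space \<Rightarrow> real^'n^'m" and B :: "'a \<Rightarrow> real^'k^'n"
  assumes "continuous_on S A" "continuous_on S B" shows "continuous_on S (\<lambda>x. A x ** B x)"
  unfolding matrix_matrix_mult_def
  by (intro continuous_on_vec_lambda continuous_on_sum continuous_on_mult continuous_on_component assms)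

lemma continuous_on_Q3_conj:
  fixes Gbar :: "real^2 \<Rightarrow> mat3"
  assumes "continuous_on S Gbar" "\<And>x. x \<in> S \<Longrightarrow> posdef (Gbar x)"
  shows "continuous_on S (\<lambda>x. Q3 W (matrix_inv (msqrt (Gbar x)) ** Ft ** matrix_inv (msqrt (Gbar x))))"
proof -
  have "continuous_on S (\<lambda>x. matrix_inv (msqrt (Gbar x)))"
    by (intro continuous_on_matrix_inv continuous_on_msqrt assms posdef_det_nz msqrt(1))
  then show ?thesis unfolding Q3_def by (intro continuous_intros continuous_on_matrix_mult)
qed

text \<open>An infimum of continuous functions is upper semicontinuous: its strict sublevel sets are
  unions of open sets, even over uncountably many competitors.\<close>

lemma Q2_measurable:
  assumes w: "open \<omega>" and G: "continuous_on \<omega> Gbar" "\<And>x. x \<in> \<omega> \<Longrightarrow> posdef (Gbar x)"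
  shows "(\<lambda>x'. Q2 W Gbar x' F) \<in> borel_measurable (lebesgue_on \<omega>)"
proof (rule borel_measurable_iff_less[THEN iffD2], intro allI)
  fix a
  let ?v = "\<lambda>Ft x. Q3 W (matrix_inv (msqrt (Gbar x)) ** Ft ** matrix_inv (msqrt (Gbar x)))"
  have "Q2 W Gbar x F < a \<longleftrightarrow> (\<exists>Ft. blk22 Ft = F \<and> ?v Ft x < a)" for x
  proof -
    have "{?v Ft x | Ft. blk22 Ft = F} \<noteq> {}" using blk22_pad3[of F] by blast
    moreover have "bdd_below {?v Ft x | Ft. blk22 Ft = F}"
      using psd_form_simps(6)[OF psd] by (intro bdd_belowI[of _ 0]) (auto simp: Q3b_diag)
    ultimately show ?thesis unfolding Q2_def by (subst cInf_less_iff) auto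
  qed
  then have eq: "{x \<in> space (lebesgue_on \<omega>). Q2 W Gbar x F < a} = (\<Union>Ft\<in>{Ft. blk22 Ft = F}. {x \<in> \<omega>. ?v Ft x < a})"
    by (auto simp: space_restrict_space)
  have "open {x \<in> \<omega>. ?v Ft x < a}" for Ft
  proof -
    have "open (\<omega> \<inter> ?v Ft -` {..<a})"
      using continuous_on_open_vimage[OF w, of "?v Ft"] continuous_on_Q3_conj[OF G] by (auto simp: Int_commute)
    moreover have "\<omega> \<inter> ?v Ft -` {..<a} = {x \<in> \<omega>. ?v Ft x < a}" by auto
    ultimately show ?thesis by simp
  qed
  then have "open (\<Union>Ft\<in>{Ft. blk22 Ft = F}. {x \<in> \<omega>. ?v Ft x < a})" by blast
  then show "{x \<in> space (lebesgue_on \<omega>). Q2 W Gbar x F < a} \<in> sets (lebesgue_on \<omega>)"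
    unfolding eq using w by (subst sets_restrict_space_iff) auto
qed

lemma Q2_bounded:
  assumes K: "compact K" and G: "continuous_on K Gbar" "\<And>x. x \<in> K \<Longrightarrow> posdef (Gbar x)"
  shows "\<exists>C. \<forall>x\<in>K. Q2 W Gbar x F \<le> C"
proof -
  let ?v = "\<lambda>Ft x. Q3 W (matrix_inv (msqrt (Gbar x)) ** Ft ** matrix_inv (msqrt (Gbar x)))"
  have "compact (?v (pad3 F) ` K)" by (intro compact_continuous_image continuous_on_Q3_conj G K)
  then obtain C where C: "\<And>x. x \<in> K \<Longrightarrow> \<bar>?v (pad3 F) x\<bar> \<le> C"
    using compact_imp_bounded[of "?v (pad3 F) ` K"] unfolding bounded_iff by auto
  have "Q2 W Gbar x F \<le> ?v (pad3 F) x" for x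
    unfolding Q2_def using psd_form_simps(6)[OF psd]
    by (intro cInf_lower bdd_belowI[of _ 0]) (auto simp: Q3b_diag intro!: exI[of _ "pad3 F"])
  then show ?thesis using C by (meson abs_le_D1 order_trans)
qed

text \<open>Changing F by a skew matrix changes each competitor by a padded skew matrix. Conjugation
  with the symmetric matrix M keeps it skew, so the value of \<open>Q3\<close> is unchanged; applied
  in both directions this gives equality.\<close>

lemma Q2_symp:
  assumes skew: "\<And>F A. transpose A = - A \<Longrightarrow> Q3 W (F + A) = Q3 W F" and G: "posdef (Gbar x)"
  shows "Q2 W Gbar x (symp F) = Q2 W Gbar x F"
proof -
  define M where "M = matrix_inv (msqrt (Gbar x))"
  have sM: "transpose M = M" using symm_matrix_inv[of "msqrt (Gbar x)"] msqrt(1)[OF G] posdef_det_nz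
    by (auto simp: M_def symm_def posdef_def)
  have key: "Q2 W Gbar x (F + A) \<le> Q2 W Gbar x F" if A: "transpose A = - A" for F A
    unfolding Q2_def M_def[symmetric]
  proof (rule cInf_mono)
    fix b assume "b \<in> {Q3 W (M ** Ft ** M) |Ft. blk22 Ft = F}"
    then obtain Ft where Ft: "blk22 Ft = F" "b = Q3 W (M ** Ft ** M)" by blast
    have e: "A $ i $ j = - A $ j $ i" for i j using arg_cong[OF A, of "\<lambda>M. M $ j $ i"] by (simp add: transpose_def)
    have "transpose (pad3 A) = - pad3 A"
      using e[of 1 1] e[of 2 2] e[of 1 2] by (simp add: pad3_def transpose_def vec_eq_iff forall_3)
    then have "transpose (M ** pad3 A ** M) = - (M ** pad3 A ** M)"
      using linear_neg[OF linear_conj_mult[of M], of "pad3 A"] by (simp add: matrix_transpose_mul sM matrix_mul_assoc)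
    from skew[OF this, of "M ** Ft ** M"] have "Q3 W (M ** (Ft + pad3 A) ** M) = b"
      by (simp add: Ft linear_add[OF linear_conj_mult])
    moreover have "blk22 (Ft + pad3 A) = F + A" by (simp add: linear_add[OF linear_blk22] Ft)
    ultimately show "\<exists>a\<in>{Q3 W (M ** Ft ** M) |Ft. blk22 Ft = F + A}. a \<le> b" by blast
  next
    show "{Q3 W (M ** Ft ** M) |Ft. blk22 Ft = F} \<noteq> {}" using blk22_pad3[of F] by blast
    show "bdd_below {Q3 W (M ** Ft ** M) |Ft. blk22 Ft = F + A}"
      using psd_form_simps(6)[OF psd] by (intro bdd_belowI[of _ 0]) (auto simp: Q3b_diag)
  qed
  have *: "transpose (symp F - F) = - (symp F - F)" "transpose (F - symp F) = - (F - symp F)"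
    by (auto simp: symp_def transpose_def vec_eq_iff field_simps)
  show ?thesis using key[OF *(1), of F] key[OF *(2), of "symp F"] by simp
qed

end

section \<open>Integration over the plate\<close>

lemma pt3_simps [simp]: "proj2 (pt3 z t) = z" "pt3 z t $ 1 = z $ 1" "pt3 z t $ 2 = z $ 2" "pt3 z t $ 3 = t"
  by (simp_all add: proj2_def pt3_def vec_eq_iff forall_2)

lemma pt3_proj2 [simp]: "pt3 (proj2 x) (x $ 3) = x"
  by (simp add: proj2_def pt3_def vec_eq_iff forall_3)

lemma continuous_on_pt3: "continuous_on S f \<Longrightarrow> continuous_on S g \<Longrightarrow> continuous_on S (\<lambda>x. pt3 (f x) (g x))"
  unfolding pt3_def by (intro continuous_vector3 continuous_vec_nth)

lemma continuous_on_proj2: "continuous_on S f \<Longrightarrow> continuous_on S (\<lambda>x. proj2 (f x))"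
  unfolding proj2_def by (intro continuous_vector2 continuous_vec_nth)

text \<open>The plate with its two faces: thickness integrals run over the closed interval, so
  integrands have to be controlled up to t = -1/2 and t = 1/2.\<close>

definition slab :: "(real^2) set \<Rightarrow> (real^3) set" where
  "slab \<omega> = {x. proj2 x \<in> \<omega> \<and> -1/2 \<le> x $ 3 \<and> x $ 3 \<le> 1/2}"

lemma Omega_slab: "Omega \<omega> \<subseteq> slab \<omega>" by (auto simp: Omega_def slab_def)

lemma open_Omega: assumes "open \<omega>" shows "open (Omega \<omega>)"
proof -
  have c: "continuous_on UNIV (\<lambda>x::real^3. x $ 3)" by (intro continuous_vec_nth continuous_intros)
  have "open (proj2 -` \<omega>)" using continuous_on_proj2[of UNIV "\<lambda>x. x"] assms
    by (simp add: continuous_on_open_vimage[OF open_UNIV])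
  moreover have "open {x::real^3. -1/2 < x $ 3}" "open {x::real^3. x $ 3 < 1/2}"
    by (intro open_Collect_less c continuous_intros)+
  ultimately have "open (proj2 -` \<omega> \<inter> ({x. -1/2 < x $ 3} \<inter> {x. x $ 3 < 1/2}))" by (intro open_Int)
  moreover have "proj2 -` \<omega> \<inter> ({x. -1/2 < x $ 3} \<inter> {x. x $ 3 < 1/2}) = Omega \<omega>" by (auto simp: Omega_def)
  ultimately show ?thesis by simp
qed

lemma measurable_pt3 [measurable]: "(\<lambda>(z,t). pt3 z t) \<in> borel_measurable (lborel \<Otimes>\<^sub>M lborel)"
  unfolding lborel_prod by (simp add: case_prod_unfold) (intro borel_measurable_continuous_onI continuous_on_pt3 continuous_intros)

lemma measurable_proj2 [measurable]: "proj2 \<in> borel_measurable borel"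
  using continuous_on_proj2[of UNIV "\<lambda>x. x"] by (intro borel_measurable_continuous_onI) simp

lemma lborel_vec3: "(lborel :: (real^3) measure) = distr (lborel \<Otimes>\<^sub>M lborel) borel (\<lambda>(z,t). pt3 z t)"
proof (rule lborel_eqI)
  fix l u :: "real^3" assume lu: "\<And>b. b \<in> Basis \<Longrightarrow> l \<bullet> b \<le> u \<bullet> b"
  have le: "l $ i \<le> u $ i" for i using lu[of "axis i 1"] by (simp add: inner_axis axis_in_Basis_iff)
  have "emeasure (distr (lborel \<Otimes>\<^sub>M lborel) borel (\<lambda>(z,t). pt3 z t)) (box l u) =
     emeasure (lborel \<Otimes>\<^sub>M lborel) (box (proj2 l) (proj2 u) \<times> box (l$3) (u$3))"
    by (subst emeasure_distr[OF measurable_pt3])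
       (auto simp: space_pair_measure mem_box_cart forall_2 forall_3 proj2_def intro!: arg_cong2[of _ _ _ _ emeasure])
  also have "\<dots> = emeasure lborel (box (proj2 l) (proj2 u)) * ennreal (u$3 - l$3)"
    by (subst lborel.emeasure_pair_measure_Times) (auto simp: le box_real)
  also have "emeasure lborel (box (proj2 l) (proj2 u)) = ennreal (\<Prod>b\<in>Basis. (proj2 u - proj2 l) \<bullet> b)"
  proof (rule emeasure_lborel_box)
    have "\<forall>i. proj2 l $ i \<le> proj2 u $ i" by (simp add: forall_2 proj2_def le)
    then show "proj2 l \<bullet> b \<le> proj2 u \<bullet> b" if "b \<in> Basis" for b
      using that by (auto simp: Basis_vec_def inner_axis)
  qed
  also have "(\<Prod>b\<in>Basis. (proj2 u - proj2 l) \<bullet> b) = (u$1 - l$1) * (u$2 - l$2)"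
    by (subst prod_Basis_cart) (simp add: inner_axis UNIV_2 proj2_def)
  also have "ennreal ((u$1 - l$1) * (u$2 - l$2)) * ennreal (u$3 - l$3) = ennreal (\<Prod>b\<in>Basis. (u - l) \<bullet> b)"
  proof -
    have p: "(\<Prod>b\<in>Basis. (u - l) \<bullet> b) = (u$1 - l$1) * (u$2 - l$2) * (u$3 - l$3)"
      by (subst prod_Basis_cart, unfold UNIV_3) (simp add: inner_axis)
    show ?thesis unfolding p by (rule ennreal_mult'[symmetric]) (simp add: le)
  qed
  finally show "emeasure (distr (lborel \<Otimes>\<^sub>M lborel) borel (\<lambda>(z,t). pt3 z t)) (box l u) = ennreal (\<Prod>b\<in>Basis. (u - l) \<bullet> b)" .
qed simp

text \<open>By the product structure the cylinder over a planar null set is null; this lifts Borel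
  versions of planar functions to the plate.\<close>

lemma AE_proj2:
  assumes "AE z in lborel. P z" shows "AE x in lborel. P (proj2 x)"
proof -
  obtain N where N: "{z. \<not> P z} \<subseteq> N" "N \<in> null_sets lborel"
    using assms unfolding eventually_ae_filter by auto
  have Nb: "N \<in> sets borel" using N by auto
  have m: "proj2 -` N \<in> sets borel" using measurable_sets[OF measurable_proj2 Nb] by simp
  have "emeasure lborel (proj2 -` N) = emeasure (lborel \<Otimes>\<^sub>M lborel) (N \<times> (UNIV :: real set))"
    unfolding lborel_vec3 using m
    by (subst emeasure_distr[OF measurable_pt3]) (auto simp: space_pair_measure intro!: arg_cong2[of _ _ _ _ emeasure])
  also have "\<dots> = 0" using N Nb by (subst lborel.emeasure_pair_measure_Times) auto
  finally have "proj2 -` N \<in> null_sets lborel" using m by (auto simp: null_sets_def)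
  then show ?thesis by (rule AE_I') (use N in auto)
qed

text \<open>Fubini for a merely integrable planar function times a bounded continuous weight. This
  is the only shape needed: in the energy the rough factors depend on x' alone, and the dependence
  on thickness is smooth.\<close>

lemma integral_Omega_product:
  fixes f :: "real^2 \<Rightarrow> real" and k :: "real^3 \<Rightarrow> real"
  assumes w: "open \<omega>" and f: "integrable (lebesgue_on \<omega>) f" and k: "continuous_on (slab \<omega>) k"
    and kC: "\<And>x. x \<in> slab \<omega> \<Longrightarrow> \<bar>k x\<bar> \<le> C"
  shows "integrable (lebesgue_on (Omega \<omega>)) (\<lambda>x. f (proj2 x) * k x)"
    and "integral\<^sup>L (lebesgue_on (Omega \<omega>)) (\<lambda>x. f (proj2 x) * k x) =
      integral\<^sup>L (lebesgue_on \<omega>) (\<lambda>z. f z * integral {-1/2..1/2} (\<lambda>t. k (pt3 z t)))"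
proof -
  have wl: "\<omega> \<in> sets lebesgue" "Omega \<omega> \<in> sets lebesgue" "Omega \<omega> \<in> sets borel" using w open_Omega[OF w] by auto
  have "integrable lebesgue (\<lambda>z. indicator \<omega> z *\<^sub>R f z)"
    using f wl integrable_restrict_space[of \<omega> lebesgue f] by simp
  then obtain f' where f': "integrable lborel f'" and f'ae: "AE z in lborel. indicator \<omega> z *\<^sub>R f z = f' z"
    using integrable_lebesgue_borel_version by blast
  have [measurable]: "f' \<in> borel_measurable borel" using f' by (auto dest: borel_measurable_integrable)
  define k' where "k' = (\<lambda>x. indicator (Omega \<omega>) x *\<^sub>R k x)"
  have [measurable]: "k' \<in> borel_measurable borel" unfolding k'_def
    by (rule borel_measurable_continuous_on_indicator[OF wl(3)]) (rule continuous_on_subset[OF k Omega_slab])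
  have k'b: "\<bar>k' (pt3 z t)\<bar> \<le> \<bar>C\<bar> * indicator {-1/2..1/2::real} t" for z t
    using kC[of "pt3 z t"] by (auto simp: k'_def Omega_def slab_def indicator_def)
  have m1: "(\<lambda>(z,t). f' z * k' (pt3 z t)) \<in> borel_measurable (lborel \<Otimes>\<^sub>M lborel)"
  proof -
    have "(\<lambda>p. k' ((\<lambda>(z,t). pt3 z t) p)) \<in> borel_measurable (lborel \<Otimes>\<^sub>M lborel)"
      by (rule measurable_compose[OF measurable_pt3]) simp
    then show ?thesis by (simp add: case_prod_unfold)
  qed
  have ind: "integrable lborel (\<lambda>t. c * indicator {-1/2..1/2::real} t)" for c :: real
    by (intro integrable_mult_right integrable_real_indicator) auto
  have kt: "integrable lborel (\<lambda>t. k' (pt3 z t))" for z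
  proof (rule Bochner_Integration.integrable_bound[OF ind[of "\<bar>C\<bar>"]])
    have "(\<lambda>t. pt3 z t) \<in> borel_measurable borel"
      by (intro borel_measurable_continuous_onI continuous_on_pt3 continuous_intros)
    then show "(\<lambda>t. k' (pt3 z t)) \<in> borel_measurable lborel" by measurable
  qed (use k'b in \<open>auto simp: abs_mult\<close>)
  have pint: "integrable (lborel \<Otimes>\<^sub>M lborel) (\<lambda>(z,t). f' z * k' (pt3 z t))"
  proof (rule lborel_pair.Fubini_integrable[OF m1])
    show "AE z in lborel. integrable lborel (\<lambda>t. case (z, t) of (z, t) \<Rightarrow> f' z * k' (pt3 z t))" using kt by auto
    show "integrable lborel (\<lambda>z. \<integral>t. norm (case (z, t) of (z, t) \<Rightarrow> f' z * k' (pt3 z t)) \<partial>lborel)"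
    proof (rule Bochner_Integration.integrable_bound[OF integrable_mult_right[OF f', of "\<bar>C\<bar>"]])
      show "(\<lambda>z. \<integral>t. norm (case (z, t) of (z, t) \<Rightarrow> f' z * k' (pt3 z t)) \<partial>lborel) \<in> borel_measurable lborel"
        using m1 by (intro lborel.borel_measurable_lebesgue_integral) (simp add: case_prod_unfold)
      have "(\<integral>t. \<bar>f' z * k' (pt3 z t)\<bar> \<partial>lborel) \<le> \<bar>C\<bar> * \<bar>f' z\<bar>" for z
      proof -
        have "(\<integral>t. \<bar>f' z * k' (pt3 z t)\<bar> \<partial>lborel) \<le> (\<integral>t. (\<bar>f' z\<bar> * \<bar>C\<bar>) * indicator {-1/2..1/2::real} t \<partial>lborel)"
        proof (rule integral_mono)
          show "\<bar>f' z * k' (pt3 z t)\<bar> \<le> (\<bar>f' z\<bar> * \<bar>C\<bar>) * indicator {-1/2..1/2::real} t" for t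
            using mult_left_mono[OF k'b, of "\<bar>f' z\<bar>" z t] by (simp add: abs_mult mult.assoc)
        qed (use kt ind in auto)
        then show ?thesis by (simp add: mult.commute)
      qed
      then show "AE z in lborel. norm (\<integral>t. norm (case (z, t) of (z, t) \<Rightarrow> f' z * k' (pt3 z t)) \<partial>lborel) \<le> norm (\<bar>C\<bar> * f' z)"
        by (auto simp: abs_mult)
    qed
  qed
  have m3: "(\<lambda>x. f' (proj2 x) * k' x) \<in> borel_measurable borel" by measurable
  have int3: "integrable lborel (\<lambda>x. f' (proj2 x) * k' x)"
    unfolding lborel_vec3 using pint by (subst integrable_distr_eq[OF measurable_pt3]) (auto simp: case_prod_unfold m3)
  have val3: "integral\<^sup>L lborel (\<lambda>x. f' (proj2 x) * k' x) = (\<integral>z. f' z * (\<integral>t. k' (pt3 z t) \<partial>lborel) \<partial>lborel)"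
  proof -
    have "integral\<^sup>L lborel (\<lambda>x. f' (proj2 x) * k' x) = integral\<^sup>L (lborel \<Otimes>\<^sub>M lborel) (\<lambda>(z,t). f' z * k' (pt3 z t))"
      unfolding lborel_vec3 by (subst integral_distr[OF measurable_pt3]) (auto simp: case_prod_unfold m3)
    also have "\<dots> = (\<integral>z. (\<integral>t. f' z * k' (pt3 z t) \<partial>lborel) \<partial>lborel)"
      using lborel_pair.integral_fst'[OF pint] by simp
    finally show ?thesis by simp
  qed
  have ae3: "AE x in lebesgue. indicator (Omega \<omega>) x *\<^sub>R (f (proj2 x) * k x) = f' (proj2 x) * k' x"
    using AE_completion[OF AE_proj2[OF f'ae]] by eventually_elim (auto simp: k'_def Omega_def indicator_def)
  have i3: "integrable lebesgue (\<lambda>x. f' (proj2 x) * k' x)" using int3 m3 by (subst integrable_completion) auto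
  have fm: "(\<lambda>x. indicator (Omega \<omega>) x *\<^sub>R (f (proj2 x) * k x)) \<in> borel_measurable lebesgue"
    by (rule borel_measurable_AE[OF borel_measurable_integrable[OF i3]]) (use ae3 in \<open>auto elim: eventually_mono\<close>)
  have "integrable lebesgue (\<lambda>x. indicator (Omega \<omega>) x *\<^sub>R (f (proj2 x) * k x))"
    by (rule integrable_cong_AE_imp[OF i3 fm]) (use ae3 in \<open>auto elim: eventually_mono\<close>)
  then show "integrable (lebesgue_on (Omega \<omega>)) (\<lambda>x. f (proj2 x) * k x)"
    using wl integrable_restrict_space[of "Omega \<omega>" lebesgue "\<lambda>x. f (proj2 x) * k x"] by simp
  have J: "(\<integral>t. k' (pt3 z t) \<partial>lborel) = integral {-1/2..1/2} (\<lambda>t. k (pt3 z t))" if z: "z \<in> \<omega>" for z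
  proof -
    have eq: "(\<lambda>t. k' (pt3 z t)) = (\<lambda>t. indicator {-1/2<..<1/2} t *\<^sub>R k (pt3 z t))"
      using z by (auto simp: k'_def Omega_def indicator_def)
    have si: "set_integrable lborel {-1/2<..<1/2} (\<lambda>t. k (pt3 z t))"
      using kt[of z] unfolding eq set_integrable_def .
    have "(\<integral>t. k' (pt3 z t) \<partial>lborel) = integral {-1/2<..<1/2} (\<lambda>t. k (pt3 z t))"
      unfolding eq using set_borel_integral_eq_integral(2)[OF si] by (simp add: set_lebesgue_integral_def)
    then show ?thesis by (simp add: integral_open_interval_real)
  qed
  have "integral\<^sup>L (lebesgue_on (Omega \<omega>)) (\<lambda>x. f (proj2 x) * k x) = integral\<^sup>L lebesgue (\<lambda>x. indicator (Omega \<omega>) x *\<^sub>R (f (proj2 x) * k x))"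
    using wl integral_restrict_space[of "Omega \<omega>" lebesgue "\<lambda>x. f (proj2 x) * k x"] by simp
  also have "\<dots> = integral\<^sup>L lebesgue (\<lambda>x. f' (proj2 x) * k' x)"
    using fm borel_measurable_integrable[OF i3] ae3 by (rule integral_cong_AE)
  also have "\<dots> = integral\<^sup>L lborel (\<lambda>x. f' (proj2 x) * k' x)" by (rule integral_completion) (simp add: m3)
  also have "\<dots> = (\<integral>z. f' z * (\<integral>t. k' (pt3 z t) \<partial>lborel) \<partial>lborel)" by (rule val3)
  also have "\<dots> = (\<integral>z. f' z * (\<integral>t. k' (pt3 z t) \<partial>lborel) \<partial>lebesgue)"
    using lborel_pair.integrable_fst'[OF pint] by (subst integral_completion) (auto dest: borel_measurable_integrable)
  also have "\<dots> = (\<integral>z. indicator \<omega> z *\<^sub>R (f z * integral {-1/2..1/2} (\<lambda>t. k (pt3 z t))) \<partial>lebesgue)"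
  proof (rule integral_cong_AE)
    show m: "(\<lambda>z. f' z * (\<integral>t. k' (pt3 z t) \<partial>lborel)) \<in> borel_measurable lebesgue"
      using lborel_pair.integrable_fst'[OF pint] by (intro measurable_completion) (auto dest: borel_measurable_integrable)
    show ae: "AE z in lebesgue. f' z * (\<integral>t. k' (pt3 z t) \<partial>lborel) = indicator \<omega> z *\<^sub>R (f z * integral {-1/2..1/2} (\<lambda>t. k (pt3 z t)))"
      using AE_completion[OF f'ae] by eventually_elim (auto simp: indicator_def J split: if_splits)
    show "(\<lambda>z. indicator \<omega> z *\<^sub>R (f z * integral {-1/2..1/2} (\<lambda>t. k (pt3 z t)))) \<in> borel_measurable lebesgue"
      by (rule borel_measurable_AE[OF m ae])
  qed
  also have "\<dots> = integral\<^sup>L (lebesgue_on \<omega>) (\<lambda>z. f z * integral {-1/2..1/2} (\<lambda>t. k (pt3 z t)))"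
    using wl integral_restrict_space[of \<omega> lebesgue "\<lambda>z. f z * integral {-1/2..1/2} (\<lambda>t. k (pt3 z t))"] by simp
  finally show "integral\<^sup>L (lebesgue_on (Omega \<omega>)) (\<lambda>x. f (proj2 x) * k x) =
      integral\<^sup>L (lebesgue_on \<omega>) (\<lambda>z. f z * integral {-1/2..1/2} (\<lambda>t. k (pt3 z t)))" .
qed

section \<open>Square integrable fields\<close>

lemma L2_on_iff_components:
  fixes A :: "real^'n \<Rightarrow> 'b::euclidean_space"
  shows "L2_on \<omega> A \<longleftrightarrow> (\<forall>b\<in>Basis. L2_on \<omega> (\<lambda>z. A z \<bullet> b))"
proof
  assume A: "L2_on \<omega> A"
  show "\<forall>b\<in>Basis. L2_on \<omega> (\<lambda>z. A z \<bullet> b)"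
  proof
    fix b :: 'b assume b: "b \<in> Basis"
    have Am: "A \<in> borel_measurable (lebesgue_on \<omega>)" and A2: "integrable (lebesgue_on \<omega>) (\<lambda>z. norm (A z) ^ 2)"
      using A by (auto simp: L2_on_def)
    have m: "(\<lambda>z. A z \<bullet> b) \<in> borel_measurable (lebesgue_on \<omega>)" using Am by measurable
    have "integrable (lebesgue_on \<omega>) (\<lambda>z. norm (A z \<bullet> b) ^ 2)"
    proof (rule Bochner_Integration.integrable_bound[OF A2])
      have "\<bar>A z \<bullet> b\<bar>^2 \<le> (norm (A z))^2" for z using Basis_le_norm[OF b, of "A z"] by (intro power_mono) auto
      then show "AE z in lebesgue_on \<omega>. norm (norm (A z \<bullet> b) ^ 2) \<le> norm (norm (A z) ^ 2)" by simp
    qed (use m in measurable)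
    with m show "L2_on \<omega> (\<lambda>z. A z \<bullet> b)" by (simp add: L2_on_def)
  qed
next
  assume R: "\<forall>b\<in>Basis. L2_on \<omega> (\<lambda>z. A z \<bullet> b)"
  then have m: "A \<in> borel_measurable (lebesgue_on \<omega>)"
    by (subst borel_measurable_euclidean_space) (simp add: L2_on_def)
  have eq: "(\<lambda>z. norm (A z) ^ 2) = (\<lambda>z. \<Sum>b\<in>Basis. norm (A z \<bullet> b) ^ 2)"
  proof
    fix z
    have "norm (A z) ^ 2 = A z \<bullet> A z" by (simp add: power2_norm_eq_inner)
    also have "\<dots> = (\<Sum>b\<in>Basis. norm (A z \<bullet> b) ^ 2)" by (subst euclidean_inner) (simp add: power2_eq_square)
    finally show "norm (A z) ^ 2 = (\<Sum>b\<in>Basis. norm (A z \<bullet> b) ^ 2)" .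
  qed
  have "integrable (lebesgue_on \<omega>) (\<lambda>z. norm (A z) ^ 2)"
    unfolding eq using R by (intro Bochner_Integration.integrable_sum) (auto simp: L2_on_def)
  with m show "L2_on \<omega> A" by (simp add: L2_on_def)
qed

lemma L2_on_vec_iff:
  fixes A :: "real^'n \<Rightarrow> ('b::euclidean_space)^'m"
  shows "L2_on \<omega> A \<longleftrightarrow> (\<forall>i. L2_on \<omega> (\<lambda>z. A z $ i))"
proof -
  have "L2_on \<omega> A \<longleftrightarrow> (\<forall>i. \<forall>c\<in>Basis. L2_on \<omega> (\<lambda>x. A x $ i \<bullet> c))"
    by (subst L2_on_iff_components) (auto simp: Basis_vec_def inner_axis)
  also have "\<dots> \<longleftrightarrow> (\<forall>i. L2_on \<omega> (\<lambda>x. A x $ i))"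
    using L2_on_iff_components[of \<omega> "\<lambda>x. A x $ i" for i] by simp
  finally show ?thesis .
qed

lemma L2_on_product_integrable:
  fixes f g :: "real^'n \<Rightarrow> real"
  assumes "L2_on \<omega> f" "L2_on \<omega> g" shows "integrable (lebesgue_on \<omega>) (\<lambda>z. f z * g z)"
proof (rule Bochner_Integration.integrable_bound[of _ "\<lambda>z. (f z)^2 + (g z)^2"])
  have "\<bar>a * b\<bar> \<le> a^2 + b^2" for a b :: real
    using sum_squares_bound[of "\<bar>a\<bar>" "\<bar>b\<bar>"] mult_nonneg_nonneg[OF abs_ge_zero[of a] abs_ge_zero[of b]] unfolding abs_mult power2_abs by linarith
  then show "AE z in lebesgue_on \<omega>. norm (f z * g z) \<le> norm ((f z)^2 + (g z)^2)" by simp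
qed (use assms in \<open>auto simp: L2_on_def\<close>)

lemma L2_on_add:
  fixes f g :: "real^'n \<Rightarrow> 'b::euclidean_space"
  assumes f: "L2_on \<omega> f" and g: "L2_on \<omega> g" shows "L2_on \<omega> (\<lambda>z. f z + g z)"
proof -
  have m: "f \<in> borel_measurable (lebesgue_on \<omega>)" "g \<in> borel_measurable (lebesgue_on \<omega>)"
    using f g by (auto simp: L2_on_def)
  have "integrable (lebesgue_on \<omega>) (\<lambda>z. norm (f z + g z) ^ 2)"
  proof (rule Bochner_Integration.integrable_bound[of _ "\<lambda>z. 2 * (norm (f z) ^ 2 + norm (g z) ^ 2)"])
    have "norm (a + b) ^ 2 \<le> 2 * (norm a ^ 2 + norm b ^ 2)" for a b :: 'b
    proof -
      have "norm (a + b) ^ 2 \<le> (norm a + norm b)^2" by (intro power_mono norm_triangle_ineq) simp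
      also have "\<dots> \<le> 2 * (norm a ^ 2 + norm b ^ 2)" using sum_squares_bound[of "norm a" "norm b"] by (simp add: power2_sum)
      finally show ?thesis .
    qed
    then show "AE z in lebesgue_on \<omega>. norm (norm (f z + g z) ^ 2) \<le> norm (2 * (norm (f z) ^ 2 + norm (g z) ^ 2))" by simp
    show "(\<lambda>z. norm (f z + g z) ^ 2) \<in> borel_measurable (lebesgue_on \<omega>)" using m by measurable
  qed (use f g in \<open>auto simp: L2_on_def\<close>)
  then show ?thesis using m by (simp add: L2_on_def)
qed

lemma L2_on_scaleR:
  fixes f :: "real^'n \<Rightarrow> 'b::euclidean_space"
  shows "L2_on \<omega> f \<Longrightarrow> L2_on \<omega> (\<lambda>z. c *\<^sub>R f z)"
  by (auto simp: L2_on_def power_mult_distrib)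

lemma L2_on_diff:
  fixes f g :: "real^'n \<Rightarrow> 'b::euclidean_space"
  assumes f: "L2_on \<omega> f" and g: "L2_on \<omega> g" shows "L2_on \<omega> (\<lambda>z. f z - g z)"
  using L2_on_add[OF f L2_on_scaleR[OF g, of "-1"]] by simp

lemma L2_on_sum:
  fixes f :: "'i \<Rightarrow> real^'n \<Rightarrow> 'b::euclidean_space"
  assumes "finite I" "\<And>i. i \<in> I \<Longrightarrow> L2_on \<omega> (f i)" shows "L2_on \<omega> (\<lambda>z. \<Sum>i\<in>I. f i z)"
  using assms by induction (auto simp: L2_on_add, simp add: L2_on_def)

lemma L2_on_bounded_mult:
  fixes f T :: "real^'n \<Rightarrow> real"
  assumes f: "L2_on \<omega> f" and T: "T \<in> borel_measurable (lebesgue_on \<omega>)" "\<And>z. z \<in> \<omega> \<Longrightarrow> \<bar>T z\<bar> \<le> C"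
  shows "L2_on \<omega> (\<lambda>z. T z * f z)"
proof -
  have m: "f \<in> borel_measurable (lebesgue_on \<omega>)" using f by (auto simp: L2_on_def)
  have "integrable (lebesgue_on \<omega>) (\<lambda>z. norm (T z * f z) ^ 2)"
  proof (rule Bochner_Integration.integrable_bound[of _ "\<lambda>z. C^2 * norm (f z) ^ 2"])
    have "\<bar>T z\<bar>^2 * norm (f z) ^ 2 \<le> C^2 * norm (f z) ^ 2" if "z \<in> \<omega>" for z
      using T(2)[OF that] by (intro mult_right_mono power_mono) auto
    then show "AE z in lebesgue_on \<omega>. norm (norm (T z * f z) ^ 2) \<le> norm (C^2 * norm (f z) ^ 2)"
      by (intro AE_I2) (auto simp: space_restrict_space power_mult_distrib abs_mult)
    show "(\<lambda>z. norm (T z * f z) ^ 2) \<in> borel_measurable (lebesgue_on \<omega>)" using m T by measurable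
  qed (use f in \<open>auto simp: L2_on_def\<close>)
  then show ?thesis using m T by (simp add: L2_on_def)
qed

lemma L2_on_bounded:
  fixes f :: "real^'n \<Rightarrow> 'b::euclidean_space"
  assumes w: "\<omega> \<in> lmeasurable" and f: "f \<in> borel_measurable (lebesgue_on \<omega>)" "\<And>z. z \<in> \<omega> \<Longrightarrow> norm (f z) \<le> C"
  shows "L2_on \<omega> f"
proof -
  have c: "integrable (lebesgue_on \<omega>) (\<lambda>z. C^2)" using w by (intro integrable_const_ivl finite_measure.integrable_const)
     (simp add: finite_measure_lebesgue_on)
  have "integrable (lebesgue_on \<omega>) (\<lambda>z. norm (f z) ^ 2)"
  proof (rule Bochner_Integration.integrable_bound[OF c])
    have "norm (f z) ^ 2 \<le> C^2" if "z \<in> \<omega>" for z using f(2)[OF that] by (intro power_mono) auto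
    then show "AE z in lebesgue_on \<omega>. norm (norm (f z) ^ 2) \<le> norm (C^2)"
      by (intro AE_I2) (auto simp: space_restrict_space)
  qed (use f in measurable)
  with f show ?thesis by (simp add: L2_on_def)
qed

section \<open>Orthogonal decomposition in the thickness variable\<close>

text \<open>Scaled to be orthogonal on [-1/2, 1/2]. The quadratic one is normalised to match the
  weight in \<open>Gb2_22\<close>; its primitive 2 t^3 - t/2 is the weight in
  \<open>Gb1\<close>.\<close>

definition leg :: "nat \<Rightarrow> real \<Rightarrow> real" where
  "leg i t = (if i = 0 then 1 else if i = 1 then t else 6 * t^2 - 1/2)"

definition leg_sq :: "nat \<Rightarrow> real" where
  "leg_sq i = (if i = 0 then 1 else if i = 1 then 1/12 else 1/5)"

lemma integral_poly: "integral {-1/2..1/2::real} (\<lambda>t. t ^ n) = (if odd n then 0 else (1/2)^n / real (n + 1))"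
proof -
  have "((\<lambda>t. t ^ n) has_integral ((1/2)^(n+1) / real (n+1) - (-1/2)^(n+1) / real (n+1))) {-1/2..1/2::real}"
  proof (rule fundamental_theorem_of_calculus)
    show "((\<lambda>t. t^(n+1) / real (n+1)) has_vector_derivative t ^ n) (at t within {-1/2..1/2})" for t :: real
      using DERIV_cdivide[OF DERIV_pow[of "n+1" t], of "real (n+1)"]
      by (auto simp: has_real_derivative_iff_has_vector_derivative[symmetric] intro: has_field_derivative_at_within)
  qed simp
  then have "integral {-1/2..1/2::real} (\<lambda>t. t ^ n) = (1/2)^(n+1) / real (n+1) - (-1/2)^(n+1) / real (n+1)"
    by (rule integral_unique)
  also have "\<dots> = (if odd n then 0 else (1/2)^n / real (n + 1))"
  proof -
    have "(-1/2::real)^(n+1) = (if odd n then (1/2)^(n+1) else - ((1/2)^(n+1)))" by (simp add: power_divide)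
    then show ?thesis by (simp add: divide_simps)
  qed
  finally show ?thesis .
qed

lemma leg_orth:
  assumes "i < 3" "j < 3"
  shows "integral {-1/2..1/2} (\<lambda>t. leg i t * leg j t) = (if i = j then leg_sq i else 0)"
proof -
  have p: "((\<lambda>t. t ^ n) has_integral integral {-1/2..1/2::real} (\<lambda>t. t ^ n)) {-1/2..1/2::real}" for n
    by (intro integrable_integral integrable_continuous_interval continuous_intros)
  have comb: "integral {-1/2..1/2::real} (\<lambda>t. a * t^0 + b * t^1 + c * t^2 + d * t^3 + e * t^4) = a + c/12 + e/80" for a b c d e :: real
  proof -
    have "((\<lambda>t. a * t^0 + b * t^1 + c * t^2 + d * t^3 + e * t^4) has_integral
       (a * integral {-1/2..1/2::real} (\<lambda>t. t ^ 0) + b * integral {-1/2..1/2::real} (\<lambda>t. t ^ 1) + c * integral {-1/2..1/2::real} (\<lambda>t. t ^ 2)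
        + d * integral {-1/2..1/2::real} (\<lambda>t. t ^ 3) + e * integral {-1/2..1/2::real} (\<lambda>t. t ^ 4))) {-1/2..1/2::real}"
      by (intro has_integral_add has_integral_mult_right p)
    then show ?thesis unfolding integral_poly by (subst integral_unique) (auto simp: power2_eq_square power4_eq_xxxx)
  qed
  have "i \<in> {0,1,2}" "j \<in> {0,1,2}" using assms by auto
  then show ?thesis
    using comb[of 1 0 0 0 0] comb[of 0 1 0 0 0] comb[of 0 0 1 0 0] comb[of "-1/2" 0 6 0 0] comb[of 0 "-1/2" 0 6 0] comb[of "1/4" 0 "-6" 0 36]
    by (auto simp: leg_def leg_sq_def algebra_simps power2_eq_square power3_eq_cube power4_eq_xxxx)
qed

text \<open>Measurability and boundedness are asked for fixed arguments F and G only; expansion in a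
  basis of matrices extends them to square integrable arguments.\<close>

locale plate_form =
  fixes \<omega> :: "(real^2) set" and B :: "real^2 \<Rightarrow> mat2 \<Rightarrow> mat2 \<Rightarrow> real"
  assumes w: "open \<omega>" "bounded \<omega>" and psd: "\<And>z. psd_form (B z)"
    and meas: "\<And>F G. (\<lambda>z. B z F G) \<in> borel_measurable (lebesgue_on \<omega>)"
    and bdd: "\<And>F G. \<exists>C. \<forall>z\<in>\<omega>. \<bar>B z F G\<bar> \<le> C"
begin

lemma wl: "\<omega> \<in> sets lebesgue" "\<omega> \<in> lmeasurable" using w by (auto simp: lmeasurable_open)

lemma L2_one: "L2_on \<omega> (\<lambda>z. 1 :: real)" by (rule L2_on_bounded[OF wl(2), of _ 1]) auto

lemma coeff_L2: assumes "L2_on \<omega> f" shows "L2_on \<omega> (\<lambda>z. B z F G * f z)"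
proof -
  obtain C where "\<And>z. z \<in> \<omega> \<Longrightarrow> \<bar>B z F G\<bar> \<le> C" using bdd[of F G] by blast
  then show ?thesis by (rule L2_on_bounded_mult[OF assms meas])
qed

lemma L2_integrable: "L2_on \<omega> f \<Longrightarrow> integrable (lebesgue_on \<omega>) (f :: real^2 \<Rightarrow> real)"
  using L2_on_product_integrable[OF _ L2_one, of f] by simp

lemma comp_L2: "L2_on \<omega> A \<Longrightarrow> b \<in> Basis \<Longrightarrow> L2_on \<omega> (\<lambda>z. A z \<bullet> b)" for A :: "real^2 \<Rightarrow> mat2"
  using L2_on_iff_components by blast

lemma form_integrable:
  assumes "L2_on \<omega> A" "L2_on \<omega> A'" shows "integrable (lebesgue_on \<omega>) (\<lambda>z. B z (A z) (A' z))"
proof -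
  have eq: "(\<lambda>z. B z (A z) (A' z)) = (\<lambda>z. \<Sum>b\<in>Basis. \<Sum>c\<in>Basis. (B z b c * (A z \<bullet> b)) * (A' z \<bullet> c))"
    by (rule ext) (subst psd_form_Basis_expand[OF psd], simp add: mult_ac)
  show ?thesis unfolding eq
    by (intro Bochner_Integration.integrable_sum L2_on_product_integrable coeff_L2 comp_L2 assms)
qed

definition adm :: "(real^3 \<Rightarrow> real) \<Rightarrow> bool" where
  "adm k \<longleftrightarrow> continuous_on (slab \<omega>) k \<and> (\<exists>C. \<forall>x\<in>slab \<omega>. \<bar>k x\<bar> \<le> C)"

lemma adm_mult: "adm k \<Longrightarrow> adm l \<Longrightarrow> adm (\<lambda>x. k x * l x)"
proof -
  assume a: "adm k" "adm l"
  then obtain C D where "\<forall>x\<in>slab \<omega>. \<bar>k x\<bar> \<le> C" "\<forall>x\<in>slab \<omega>. \<bar>l x\<bar> \<le> D" by (auto simp: adm_def)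
  then have "\<bar>k x * l x\<bar> \<le> C * D" if "x \<in> slab \<omega>" for x
    using that unfolding abs_mult by (intro mult_mono) (auto intro: order_trans[OF abs_ge_zero])
  then show ?thesis using a unfolding adm_def by (blast intro: continuous_on_mult)
qed

lemma adm_const: "adm (\<lambda>x. c)" unfolding adm_def by auto

lemma adm_x3: "adm (\<lambda>x. x $ 3)"
  unfolding adm_def by (auto simp: slab_def intro!: continuous_vec_nth continuous_intros exI[of _ "1/2"])

lemma adm_add: "adm k \<Longrightarrow> adm l \<Longrightarrow> adm (\<lambda>x. k x + l x)"
proof -
  assume a: "adm k" "adm l"
  then obtain C D where "\<forall>x\<in>slab \<omega>. \<bar>k x\<bar> \<le> C" "\<forall>x\<in>slab \<omega>. \<bar>l x\<bar> \<le> D" by (auto simp: adm_def)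
  then have "\<bar>k x + l x\<bar> \<le> C + D" if "x \<in> slab \<omega>" for x
    using that abs_triangle_ineq[of "k x" "l x"] by fastforce
  then show ?thesis using a unfolding adm_def by (blast intro: continuous_on_add)
qed

lemma product_integral:
  assumes "integrable (lebesgue_on \<omega>) f" "adm k"
  shows "integrable (lebesgue_on (Omega \<omega>)) (\<lambda>x. f (proj2 x) * k x)"
    and "integral\<^sup>L (lebesgue_on (Omega \<omega>)) (\<lambda>x. f (proj2 x) * k x) =
      integral\<^sup>L (lebesgue_on \<omega>) (\<lambda>z. f z * integral {-1/2..1/2} (\<lambda>t. k (pt3 z t)))"
  using integral_Omega_product[OF w(1) assms(1)] assms(2) unfolding adm_def by blast+

lemma adm_leg: "adm (\<lambda>x. leg i (x $ 3))"
proof -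
  have "adm (\<lambda>x. 6 * (x $ 3 * x $ 3) + (- 1/2))" by (intro adm_add adm_mult adm_const adm_x3)
  then show ?thesis using adm_const[of 1] adm_x3
    by (cases "i = 0"; cases "i = 1") (simp_all add: leg_def power2_eq_square)
qed

text \<open>Orthogonality to the quadratic polynomials at every x' and for every matrix entry; being
  entrywise, it is orthogonality for all the forms B z simultaneously.\<close>

definition orth :: "(real^3 \<Rightarrow> mat2) \<Rightarrow> bool" where
  "orth N \<longleftrightarrow> (\<forall>b\<in>Basis. adm (\<lambda>x. N x \<bullet> b)) \<and>
     (\<forall>i<3. \<forall>z\<in>\<omega>. \<forall>b\<in>Basis. integral {-1/2..1/2} (\<lambda>t. leg i t * (N (pt3 z t) \<bullet> b)) = 0)"

text \<open>In basis coordinates each cross term is a planar integrable function times a thickness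
  integral of two Legendre polynomials, or of one of them and an entry of N. These vanish off the
  diagonal and by \<open>orth\<close>.\<close>

lemma orthogonal_expansion:
  assumes A: "\<And>i. i < 3 \<Longrightarrow> L2_on \<omega> (A i)" and N: "orth N"
  defines "F \<equiv> (\<lambda>x. (\<Sum>i<3. leg i (x $ 3) *\<^sub>R A i (proj2 x)) + N x)"
  shows "integral\<^sup>L (lebesgue_on (Omega \<omega>)) (\<lambda>x. B (proj2 x) (F x) (F x)) =
     (\<Sum>i<3. leg_sq i * integral\<^sup>L (lebesgue_on \<omega>) (\<lambda>z. B z (A i z) (A i z)))
     + integral\<^sup>L (lebesgue_on (Omega \<omega>)) (\<lambda>x. B (proj2 x) (N x) (N x))"
proof -
  let ?L = "lebesgue_on (Omega \<omega>)"
  note s = psd_form_simps[OF psd]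
  have sumL: "B z (\<Sum>i<3. c i *\<^sub>R X i) Y = (\<Sum>i<3. c i * B z (X i) Y)" for z c Y and X :: "nat \<Rightarrow> mat2"
    by (simp add: eval_nat_numeral s(1,3))
  have expand: "B (proj2 x) (F x) (F x) = (\<Sum>i<3. \<Sum>j<3. B (proj2 x) (A i (proj2 x)) (A j (proj2 x)) * (leg i (x $ 3) * leg j (x $ 3)))
     + 2 * (\<Sum>i<3. leg i (x $ 3) * B (proj2 x) (A i (proj2 x)) (N x)) + B (proj2 x) (N x) (N x)" for x
  proof -
    let ?S = "\<Sum>i<3. leg i (x $ 3) *\<^sub>R A i (proj2 x)"
    have "B (proj2 x) (F x) (F x) = B (proj2 x) ?S ?S + 2 * B (proj2 x) ?S (N x) + B (proj2 x) (N x) (N x)"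
      unfolding F_def s(1) s(2) using s(5)[of "proj2 x" "N x" ?S] by simp
    moreover have "B (proj2 x) ?S ?S = (\<Sum>i<3. \<Sum>j<3. B (proj2 x) (A i (proj2 x)) (A j (proj2 x)) * (leg i (x $ 3) * leg j (x $ 3)))"
      unfolding sumL s(5)[of "proj2 x" "A _ (proj2 x)" ?S]
      by (simp add: sumL s(5)[of "proj2 x" "A _ (proj2 x)" "A _ (proj2 x)"] sum_distrib_left mult_ac)
    ultimately show ?thesis by (simp add: sumL)
  qed
  have i1: "integrable ?L (\<lambda>x. B (proj2 x) (A i (proj2 x)) (A j (proj2 x)) * (leg i (x $ 3) * leg j (x $ 3)))"
    "integral\<^sup>L ?L (\<lambda>x. B (proj2 x) (A i (proj2 x)) (A j (proj2 x)) * (leg i (x $ 3) * leg j (x $ 3))) =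
       (if i = j then leg_sq i * integral\<^sup>L (lebesgue_on \<omega>) (\<lambda>z. B z (A i z) (A i z)) else 0)" if ij: "i < 3" "j < 3" for i j
    using product_integral[OF form_integrable[OF A[OF ij(1)] A[OF ij(2)]] adm_mult[OF adm_leg[of i] adm_leg[of j]]] leg_orth[OF ij]
    by (auto simp: mult.commute)
  have Nadm: "adm (\<lambda>x. N x \<bullet> b)" if "b \<in> Basis" for b using N that by (simp add: orth_def)
  have i2: "integrable ?L (\<lambda>x. leg i (x $ 3) * B (proj2 x) (A i (proj2 x)) (N x))"
    "integral\<^sup>L ?L (\<lambda>x. leg i (x $ 3) * B (proj2 x) (A i (proj2 x)) (N x)) = 0" if i: "i < 3" for i
  proof -
    have eq: "(\<lambda>x. leg i (x $ 3) * B (proj2 x) (A i (proj2 x)) (N x)) =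
       (\<lambda>x. \<Sum>b\<in>Basis. \<Sum>c\<in>Basis. (B (proj2 x) b c * (A i (proj2 x) \<bullet> b)) * (leg i (x $ 3) * (N x \<bullet> c)))"
      by (rule ext) (subst psd_form_Basis_expand[OF psd], simp add: sum_distrib_left mult_ac)
    have f: "integrable (lebesgue_on \<omega>) (\<lambda>z. B z b c * (A i z \<bullet> b))" if "b \<in> Basis" for b c
      by (intro L2_integrable coeff_L2 comp_L2 A i that)
    have each: "integrable ?L (\<lambda>x. (B (proj2 x) b c * (A i (proj2 x) \<bullet> b)) * (leg i (x $ 3) * (N x \<bullet> c)))"
      "integral\<^sup>L ?L (\<lambda>x. (B (proj2 x) b c * (A i (proj2 x) \<bullet> b)) * (leg i (x $ 3) * (N x \<bullet> c))) = 0"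
      if bc: "b \<in> Basis" "c \<in> Basis" for b c
    proof -
      note p = product_integral[OF f[OF bc(1), of c] adm_mult[OF adm_leg[of i] Nadm[OF bc(2)]]]
      show "integrable ?L (\<lambda>x. (B (proj2 x) b c * (A i (proj2 x) \<bullet> b)) * (leg i (x $ 3) * (N x \<bullet> c)))" by (rule p(1))
      have "integral\<^sup>L ?L (\<lambda>x. (B (proj2 x) b c * (A i (proj2 x) \<bullet> b)) * (leg i (x $ 3) * (N x \<bullet> c))) =
        integral\<^sup>L (lebesgue_on \<omega>) (\<lambda>z. 0)"
        unfolding p(2) using N i bc by (intro Bochner_Integration.integral_cong) (auto simp: orth_def space_restrict_space)
      then show "integral\<^sup>L ?L (\<lambda>x. (B (proj2 x) b c * (A i (proj2 x) \<bullet> b)) * (leg i (x $ 3) * (N x \<bullet> c))) = 0" by simp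
    qed
    show "integrable ?L (\<lambda>x. leg i (x $ 3) * B (proj2 x) (A i (proj2 x)) (N x))"
      unfolding eq by (intro Bochner_Integration.integrable_sum each)
    show "integral\<^sup>L ?L (\<lambda>x. leg i (x $ 3) * B (proj2 x) (A i (proj2 x)) (N x)) = 0"
      unfolding eq by (simp add: each Bochner_Integration.integral_sum Bochner_Integration.integrable_sum cong: sum.cong)
  qed
  have i3: "integrable ?L (\<lambda>x. B (proj2 x) (N x) (N x))"
  proof -
    have eq: "(\<lambda>x. B (proj2 x) (N x) (N x)) = (\<lambda>x. \<Sum>b\<in>Basis. \<Sum>c\<in>Basis. B (proj2 x) b c * ((N x \<bullet> b) * (N x \<bullet> c)))"
      by (rule ext) (subst psd_form_Basis_expand[OF psd], simp add: mult_ac)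
    have "integrable (lebesgue_on \<omega>) (\<lambda>z. B z b c)" for b c using L2_integrable[OF coeff_L2[OF L2_one, of b c]] by simp
    then show ?thesis unfolding eq by (intro Bochner_Integration.integrable_sum product_integral(1) adm_mult Nadm)
  qed
  have "integral\<^sup>L ?L (\<lambda>x. B (proj2 x) (F x) (F x)) =
    integral\<^sup>L ?L (\<lambda>x. \<Sum>i<3. \<Sum>j<3. B (proj2 x) (A i (proj2 x)) (A j (proj2 x)) * (leg i (x $ 3) * leg j (x $ 3)))
    + integral\<^sup>L ?L (\<lambda>x. 2 * (\<Sum>i<3. leg i (x $ 3) * B (proj2 x) (A i (proj2 x)) (N x)))
    + integral\<^sup>L ?L (\<lambda>x. B (proj2 x) (N x) (N x))"
    unfolding expand
    by (subst Bochner_Integration.integral_add, (intro Bochner_Integration.integrable_add Bochner_Integration.integrable_sum integrable_mult_right i1 i2 i3; simp)+)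
       (subst Bochner_Integration.integral_add, (intro Bochner_Integration.integrable_sum integrable_mult_right i1 i2 i3; simp)+, rule refl)
  also have "integral\<^sup>L ?L (\<lambda>x. \<Sum>i<3. \<Sum>j<3. B (proj2 x) (A i (proj2 x)) (A j (proj2 x)) * (leg i (x $ 3) * leg j (x $ 3)))
     = (\<Sum>i<3. leg_sq i * integral\<^sup>L (lebesgue_on \<omega>) (\<lambda>z. B z (A i z) (A i z)))"
    by (subst Bochner_Integration.integral_sum, (intro Bochner_Integration.integrable_sum i1; simp))
       (intro sum.cong refl, subst Bochner_Integration.integral_sum, (intro i1; simp), simp add: i1 sum.delta)
  also have "integral\<^sup>L ?L (\<lambda>x. 2 * (\<Sum>i<3. leg i (x $ 3) * B (proj2 x) (A i (proj2 x)) (N x))) = 0"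
    by (simp add: Bochner_Integration.integral_sum i2)
  finally show ?thesis by simp
qed

lemma form_integral_nonneg: "0 \<le> integral\<^sup>L M (\<lambda>x. B (p x) (N x) (N x))"
  by (intro Bochner_Integration.integral_nonneg) (rule psd_form_simps(6)[OF psd])

end

section \<open>The distance to fields quadratic in the thickness variable\<close>

text \<open>Subtracting a competitor alters only the three Legendre coefficients and leaves N
  untouched. By Pythagoras the squared norm is the part of N plus nonnegative terms, and the
  competitor with the coefficients of H itself makes these zero.\<close>

lemma distQ2_orthogonal:
  assumes pf: "plate_form \<omega> (Q2b W Gbar)" and dg: "\<And>z F. Q2b W Gbar z F F = Q2 W Gbar z F"
    and M: "\<And>i. i < 3 \<Longrightarrow> L2_on \<omega> (M i)" "\<And>i z. i < 3 \<Longrightarrow> z \<in> \<omega> \<Longrightarrow> symm (M i z)" and N: "plate_form.orth \<omega> N"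
    and H: "\<And>x. x \<in> Omega \<omega> \<Longrightarrow> H x = (\<Sum>i<3. leg i (x $ 3) *\<^sub>R M i (proj2 x)) + N x"
  shows "(distQ2 W Gbar \<omega> H)^2 = integral\<^sup>L (lebesgue_on (Omega \<omega>)) (\<lambda>x. Q2 W Gbar (proj2 x) (N x))"
proof -
  interpret plate_form \<omega> "Q2b W Gbar" by (rule pf)
  let ?I = "integral\<^sup>L (lebesgue_on (Omega \<omega>)) (\<lambda>x. Q2 W Gbar (proj2 x) (N x))"
  have val: "integral\<^sup>L (lebesgue_on (Omega \<omega>)) (\<lambda>x. Q2 W Gbar (proj2 x) (H x - E x)) =
      (\<Sum>i<3. leg_sq i * integral\<^sup>L (lebesgue_on \<omega>) (\<lambda>z. Q2 W Gbar z (A i z))) + ?I"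
    if F: "L2_on \<omega> F0" "L2_on \<omega> F1" "L2_on \<omega> F2" and E: "E = (\<lambda>x. (x$3)^2 *\<^sub>R F2 (proj2 x) + (x$3) *\<^sub>R F1 (proj2 x) + F0 (proj2 x))"
      and A: "A = (\<lambda>i z. if i = 0 then M 0 z - F0 z - (1/12) *\<^sub>R F2 z else if i = 1 then M 1 z - F1 z else M 2 z - (1/6) *\<^sub>R F2 z)"
    for E F0 F1 F2 and A :: "nat \<Rightarrow> real^2 \<Rightarrow> mat2"
  proof -
    have L: "L2_on \<omega> (A i)" if "i < 3" for i
    proof -
      have "i \<in> {0,1,2}" using that by auto
      then show ?thesis unfolding A using M(1)[of 0] M(1)[of 1] M(1)[of 2] F
        by (auto intro!: L2_on_diff L2_on_scaleR)
    qed
    have "H x - E x = (\<Sum>i<3. leg i (x $ 3) *\<^sub>R A i (proj2 x)) + N x" if "x \<in> Omega \<omega>" for x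
    proof -
      have three: "{..<3::nat} = {0,1,2}" by auto
      have "(x$3)^2 *\<^sub>R F2 (proj2 x) = leg 2 (x$3) *\<^sub>R ((1/6) *\<^sub>R F2 (proj2 x)) + (1/12) *\<^sub>R F2 (proj2 x)"
        by (simp add: leg_def vec_eq_iff field_simps)
      then show ?thesis unfolding H[OF that] E A three by (simp add: leg_def algebra_simps)
    qed
    then have "integral\<^sup>L (lebesgue_on (Omega \<omega>)) (\<lambda>x. Q2 W Gbar (proj2 x) (H x - E x)) =
      integral\<^sup>L (lebesgue_on (Omega \<omega>)) (\<lambda>x. Q2b W Gbar (proj2 x) ((\<Sum>i<3. leg i (x $ 3) *\<^sub>R A i (proj2 x)) + N x) ((\<Sum>i<3. leg i (x $ 3) *\<^sub>R A i (proj2 x)) + N x))"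
      by (intro Bochner_Integration.integral_cong) (auto simp: dg space_restrict_space)
    then show ?thesis using orthogonal_expansion[OF L N] by (simp add: dg)
  qed
  have nonneg: "0 \<le> integral\<^sup>L K (\<lambda>x. Q2 W Gbar (p x) (G x))" for K p G
    using form_integral_nonneg[of K p G] by (simp add: dg)
  have "distQ2 W Gbar \<omega> H = sqrt ?I"
    unfolding distQ2_def
  proof (rule cInf_eq_minimum)
    \<comment> \<open>The constant term of leg 2 t M 2 is moved here: in powers of t the best
      competitor is 6 t^2 M 2 + t M 1 + (M 0 - M 2 / 2).\<close>
    define F0 where "F0 = (\<lambda>z. M 0 z - (1/2) *\<^sub>R M 2 z)"
    define E where "E = (\<lambda>x::real^3. (x$3)^2 *\<^sub>R (6 *\<^sub>R M 2 (proj2 x)) + (x$3) *\<^sub>R M 1 (proj2 x) + F0 (proj2 x))"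
    have L: "L2_on \<omega> F0" "L2_on \<omega> (M 1)" "L2_on \<omega> (\<lambda>z. 6 *\<^sub>R M 2 z)"
      using M(1) unfolding F0_def by (auto intro!: L2_on_diff L2_on_scaleR)
    have "symm (F0 z)" "symm (M 1 z)" "symm (6 *\<^sub>R M 2 z)" if "z \<in> \<omega>" for z
      using M(2)[of 0 z] M(2)[of 1 z] M(2)[of 2 z] that by (auto simp: symm_def F0_def transpose_def vec_eq_iff)
    then have "E \<in> E2 \<omega>" unfolding E2_def E_def using L
      by (intro CollectI exI[of _ F0] exI[of _ "M 1"] exI[of _ "\<lambda>z. 6 *\<^sub>R M 2 z"]) auto
    moreover have "normQ2 W Gbar \<omega> (\<lambda>x. H x - E x) = sqrt ?I"
    proof -
      have Q0: "Q2 W Gbar z 0 = 0" for z using psd_form_simps(3)[OF psd, of z 0 0 0] by (simp add: dg)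
      show ?thesis unfolding normQ2_def val[OF L E_def refl] by (simp add: F0_def Q0 eval_nat_numeral)
    qed
    ultimately show "sqrt ?I \<in> (\<lambda>E. normQ2 W Gbar \<omega> (\<lambda>x. H x - E x)) ` E2 \<omega>"
      by (intro image_eqI[where x = E]) simp_all
    fix y assume "y \<in> (\<lambda>E. normQ2 W Gbar \<omega> (\<lambda>x. H x - E x)) ` E2 \<omega>"
    then obtain E F0 F1 F2 where F: "L2_on \<omega> F0" "L2_on \<omega> F1" "L2_on \<omega> F2"
      and E: "E = (\<lambda>x. (x$3)^2 *\<^sub>R F2 (proj2 x) + (x$3) *\<^sub>R F1 (proj2 x) + F0 (proj2 x))"
      and y: "y = normQ2 W Gbar \<omega> (\<lambda>x. H x - E x)" by (auto simp: E2_def)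
    show "sqrt ?I \<le> y" unfolding y normQ2_def val[OF F E refl]
      by (intro real_sqrt_le_mono add_increasing order_refl sum_nonneg mult_nonneg_nonneg nonneg) (auto simp: leg_sq_def)
  qed
  then show ?thesis using nonneg by simp
qed

text \<open>\<open>E2\<close> is a vector space, so a shift by one of its members permutes the
  competitors.\<close>

lemma distQ2_cong_E2:
  assumes "E0 \<in> E2 \<omega>" "\<And>x. x \<in> Omega \<omega> \<Longrightarrow> H x = H' x + E0 x"
  shows "distQ2 W Gbar \<omega> H = distQ2 W Gbar \<omega> H'"
proof -
  have add: "(\<lambda>x. E x + c *\<^sub>R E' x) \<in> E2 \<omega>" if "E \<in> E2 \<omega>" "E' \<in> E2 \<omega>" for E E' c
  proof -
    obtain F0 F1 F2 where F: "\<forall>F\<in>{F0,F1,F2}. L2_on \<omega> F \<and> (\<forall>x\<in>\<omega>. symm (F x))"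
      "E = (\<lambda>x. (x$3)^2 *\<^sub>R F2 (proj2 x) + (x$3) *\<^sub>R F1 (proj2 x) + F0 (proj2 x))" using \<open>E \<in> E2 \<omega>\<close> by (auto simp: E2_def)
    obtain G0 G1 G2 where G: "\<forall>F\<in>{G0,G1,G2}. L2_on \<omega> F \<and> (\<forall>x\<in>\<omega>. symm (F x))"
      "E' = (\<lambda>x. (x$3)^2 *\<^sub>R G2 (proj2 x) + (x$3) *\<^sub>R G1 (proj2 x) + G0 (proj2 x))" using \<open>E' \<in> E2 \<omega>\<close> by (auto simp: E2_def)
    have lin: "L2_on \<omega> (\<lambda>z. F z + c *\<^sub>R G z) \<and> (\<forall>x\<in>\<omega>. symm (F x + c *\<^sub>R G x))"
      if "L2_on \<omega> F \<and> (\<forall>x\<in>\<omega>. symm (F x))" "L2_on \<omega> G \<and> (\<forall>x\<in>\<omega>. symm (G x))" for F G :: "real^2 \<Rightarrow> mat2"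
      using that by (auto intro!: L2_on_add L2_on_scaleR simp: symm_def transpose_def vec_eq_iff)
    show ?thesis unfolding E2_def
      by (intro CollectI exI[of _ "\<lambda>z. F0 z + c *\<^sub>R G0 z"] exI[of _ "\<lambda>z. F1 z + c *\<^sub>R G1 z"] exI[of _ "\<lambda>z. F2 z + c *\<^sub>R G2 z"])
         (use F G lin in \<open>auto simp: algebra_simps\<close>)
  qed
  have nm: "normQ2 W Gbar \<omega> K = normQ2 W Gbar \<omega> K'" if "\<And>x. x \<in> Omega \<omega> \<Longrightarrow> K x = K' x" for K K'
    unfolding normQ2_def using that
    by (intro arg_cong[of _ _ sqrt] Bochner_Integration.integral_cong) (auto simp: space_restrict_space)
  have "(\<lambda>E. normQ2 W Gbar \<omega> (\<lambda>x. H x - E x)) ` E2 \<omega> = (\<lambda>E. normQ2 W Gbar \<omega> (\<lambda>x. H' x - E x)) ` E2 \<omega>"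
  proof (intro equalityI image_subsetI)
    fix E assume E: "E \<in> E2 \<omega>"
    have "normQ2 W Gbar \<omega> (\<lambda>x. H x - E x) = normQ2 W Gbar \<omega> (\<lambda>x. H' x - (E x + (-1) *\<^sub>R E0 x))"
      by (rule nm) (simp add: assms(2))
    then show "normQ2 W Gbar \<omega> (\<lambda>x. H x - E x) \<in> (\<lambda>E. normQ2 W Gbar \<omega> (\<lambda>x. H' x - E x)) ` E2 \<omega>"
      using add[OF E assms(1), of "-1"] by (intro image_eqI[of _ _ "\<lambda>x. E x + (-1) *\<^sub>R E0 x"])
  next
    fix E assume E: "E \<in> E2 \<omega>"
    have "normQ2 W Gbar \<omega> (\<lambda>x. H' x - E x) = normQ2 W Gbar \<omega> (\<lambda>x. H x - (E x + 1 *\<^sub>R E0 x))"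
      by (rule nm) (simp add: assms(2))
    then show "normQ2 W Gbar \<omega> (\<lambda>x. H' x - E x) \<in> (\<lambda>E. normQ2 W Gbar \<omega> (\<lambda>x. H x - E x)) ` E2 \<omega>"
      using add[OF E assms(1), of 1] by (intro image_eqI[of _ _ "\<lambda>x. E x + 1 *\<^sub>R E0 x"])
  qed
  then show ?thesis by (simp add: distQ2_def)
qed

section \<open>Smooth data near the mid-plate\<close>

lemma pt3_slab_closure:
  assumes "z \<in> closure \<omega>" "-1/2 \<le> t" "t \<le> 1/2" shows "pt3 z t \<in> closure (Omega \<omega>)"
proof -
  have "continuous_on (closure (\<omega> \<times> {-1/2<..<1/2})) (\<lambda>p. pt3 (fst p) (snd p))"
    by (intro continuous_on_pt3 continuous_intros)
  then have "(\<lambda>p. pt3 (fst p) (snd p)) ` closure (\<omega> \<times> {-1/2<..<1/2}) \<subseteq> closure (Omega \<omega>)"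
    by (rule image_closure_subset) (auto simp: Omega_def intro!: closure_subset[THEN subsetD])
  moreover have "(z, t) \<in> closure (\<omega> \<times> {-1/2<..<1/2})" using assms by (simp add: closure_Times)
  ultimately show ?thesis by fastforce
qed

lemma slab_closure: "slab (closure \<omega>) \<subseteq> closure (Omega \<omega>)"
  using pt3_slab_closure[of "proj2 x" \<omega> "x $ 3" for x] by (auto simp: slab_def)

lemma compact_slab: assumes "compact K" shows "compact (slab K)"
proof -
  have "compact ((\<lambda>p. pt3 (fst p) (snd p)) ` (K \<times> {-1/2..1/2}))"
    by (intro compact_continuous_image continuous_on_pt3 continuous_intros compact_Times assms) auto
  moreover have "(\<lambda>p. pt3 (fst p) (snd p)) ` (K \<times> {-1/2..1/2}) = slab K"
  proof
    show "slab K \<subseteq> (\<lambda>p. pt3 (fst p) (snd p)) ` (K \<times> {-1/2..1/2})"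
    proof
      fix x assume "x \<in> slab K"
      then show "x \<in> (\<lambda>p. pt3 (fst p) (snd p)) ` (K \<times> {-1/2..1/2})"
        by (intro image_eqI[of _ _ "(proj2 x, x $ 3)"]) (auto simp: slab_def)
    qed
  qed (auto simp: slab_def)
  ultimately show ?thesis by simp
qed

lemma dist_pt3: "dist (pt3 z t) (pt3 c s) \<le> dist z c + \<bar>t - s\<bar>"
proof -
  have "(norm (pt3 z t - pt3 c s))^2 = (norm (z - c))^2 + (t - s)^2"
    unfolding power2_norm_eq_inner by (simp add: inner_vec_def sum_2 sum_3 power2_eq_square)
  also have "\<dots> \<le> (norm (z - c) + \<bar>t - s\<bar>)^2" by (simp add: power2_sum)
  finally show ?thesis unfolding dist_norm by (rule power2_le_imp_le) simp
qed

text \<open>A product neighbourhood of the plate. With \<rho> > 1/2 it contains the faces in its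
  interior, and every vertical segment between two of its points stays inside, as primitives in the
  thickness variable require.\<close>

definition thick :: "(real^2) set \<Rightarrow> real \<Rightarrow> (real^3) set" where
  "thick N \<rho> = {x. proj2 x \<in> N \<and> \<bar>x $ 3\<bar> < \<rho>}"

lemma open_thick: assumes "open N" shows "open (thick N \<rho>)"
proof -
  have "open (proj2 -` N)" using continuous_on_proj2[of UNIV "\<lambda>x. x"] assms
    by (simp add: continuous_on_open_vimage[OF open_UNIV])
  moreover have "open {x::real^3. \<bar>x $ 3\<bar> < \<rho>}"
    by (intro open_Collect_less continuous_intros continuous_vec_nth)
  ultimately have "open (proj2 -` N \<inter> {x. \<bar>x $ 3\<bar> < \<rho>})" by (intro open_Int)
  moreover have "proj2 -` N \<inter> {x. \<bar>x $ 3\<bar> < \<rho>} = thick N \<rho>" by (auto simp: thick_def)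
  ultimately show ?thesis by simp
qed

lemma slab_thick: "\<omega> \<subseteq> N \<Longrightarrow> 1/2 < \<rho> \<Longrightarrow> slab \<omega> \<subseteq> thick N \<rho>"
  by (auto simp: slab_def thick_def)

text \<open>The closed slab is compact, so a uniform e-neighbourhood of it fits into V. Half of e is
  spent horizontally and half vertically.\<close>

lemma thick_neighbourhood:
  assumes w: "bounded \<omega>" and V: "open V" "closure (Omega \<omega>) \<subseteq> V"
  obtains N \<rho> where "open N" "closure \<omega> \<subseteq> N" "1/2 < \<rho>" "thick N \<rho> \<subseteq> V"
proof -
  have K: "compact (slab (closure \<omega>))" using w by (intro compact_slab) (simp add: compact_eq_bounded_closed bounded_closure)
  have "slab (closure \<omega>) \<subseteq> V" using slab_closure V(2) by blast
  then obtain e where e: "e > 0" "(\<Union>x\<in>slab (closure \<omega>). ball x e) \<subseteq> V"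
    using compact_subset_open_imp_ball_epsilon_subset[OF K V(1)] by blast
  define N where "N = (\<Union>c\<in>closure \<omega>. ball c (e/2))"
  have "thick N (1/2 + e/2) \<subseteq> V"
  proof
    fix x assume x: "x \<in> thick N (1/2 + e/2)"
    then obtain c where c: "c \<in> closure \<omega>" "dist c (proj2 x) < e/2" by (auto simp: thick_def N_def)
    \<comment> \<open>The height of x truncated to [-1/2, 1/2].\<close>
    define s where "s = max (-1/2) (min (1/2) (x $ 3))"
    have s: "-1/2 \<le> s" "s \<le> 1/2" "\<bar>s - x $ 3\<bar> \<le> e/2"
      using x e by (auto simp: s_def thick_def max_def min_def abs_if split: if_splits)
    have "dist (pt3 c s) (pt3 (proj2 x) (x $ 3)) \<le> dist c (proj2 x) + \<bar>s - x $ 3\<bar>" by (rule dist_pt3)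
    also have "\<dots> < e" using c s by linarith
    finally have "x \<in> ball (pt3 c s) e" by simp
    moreover have "pt3 c s \<in> slab (closure \<omega>)" using c s by (simp add: slab_def)
    ultimately show "x \<in> V" using e by blast
  qed
  moreover have "closure \<omega> \<subseteq> N" using e by (force simp: N_def)
  moreover have "open N" unfolding N_def by blast
  ultimately show ?thesis using that[of N "1/2 + e/2"] e by simp
qed

subsection \<open>Integrals in the thickness variable\<close>

lemma bounded_linear_pt3_0: "bounded_linear (\<lambda>h. pt3 h 0)"
  by (intro linear_conv_bounded_linear[THEN iffD1] linearI) (simp_all add: vec_eq_iff forall_3)

lemma has_derivative_pt3: "((\<lambda>z. pt3 z t) has_derivative (\<lambda>h. pt3 h 0)) (at z)"
proof -
  have "((\<lambda>z. pt3 z 0 + t *\<^sub>R axis 3 1) has_derivative (\<lambda>h. pt3 h 0 + 0)) (at z)"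
    by (intro has_derivative_add has_derivative_const bounded_linear_imp_has_derivative bounded_linear_pt3_0)
  moreover have "(\<lambda>z. pt3 z 0 + t *\<^sub>R axis 3 1) = (\<lambda>z. pt3 z t)"
    by (simp add: fun_eq_iff vec_eq_iff forall_3 axis_def)
  ultimately show ?thesis by simp
qed

lemma pt3_axis: "pt3 (axis j 1) 0 = axis (emb j) 1"
  using exhaust_2[of j] by (auto simp: vec_eq_iff forall_3 axis_def emb_def)

lemma pd_slice:
  assumes "f differentiable (at (pt3 z t))" shows "pd (axis j 1) (\<lambda>z. f (pt3 z t)) z = pd (axis (emb j) 1) f (pt3 z t)"
  using pd_eqI[OF has_derivative_compose[OF has_derivative_pt3 pd_works[OF assms]], of "axis j 1"] by (simp add: pt3_axis)

context
  fixes N :: "(real^2) set" and \<rho> :: real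
  assumes N: "open N" and rho: "1/2 < \<rho>"
begin

lemma integral_pt3_hyps:
  shows "\<And>x t. x \<in> N \<Longrightarrow> t \<in> {-1/2..1/2} \<Longrightarrow> pt3 x t \<in> thick N \<rho>"
    and "\<And>x t. x \<in> N \<Longrightarrow> t \<in> {-1/2..1/2} \<Longrightarrow> ((\<lambda>z. pt3 z t) has_derivative (\<lambda>h. pt3 h 0)) (at x)"
    and "continuous_on (N \<times> {-1/2..1/2}) (\<lambda>(x,t). pt3 x t)"
    and "\<And>b c. b \<in> Basis \<Longrightarrow> c \<in> Basis \<Longrightarrow> continuous_on {-1/2..1/2} (\<lambda>t::real. pt3 b 0 \<bullet> c)"
  using rho by (auto simp: thick_def case_prod_unfold has_derivative_pt3 intro!: continuous_on_pt3 continuous_intros)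

lemma Cinf_on_thickness_integral:
  fixes f :: "real^3 \<Rightarrow> real"
  assumes "continuous_on {-1/2..1/2} k" "Cinf_on (thick N \<rho>) f"
  shows "Cinf_on N (\<lambda>z. integral {-1/2..1/2} (\<lambda>t. k t * f (pt3 z t)))"
  by (rule Cinf_on_param_integral[OF N open_thick[OF N] integral_pt3_hyps assms])

lemma pd_thickness_integral:
  fixes f :: "real^3 \<Rightarrow> real"
  assumes k: "continuous_on {-1/2..1/2} k" and f: "Cinf_on (thick N \<rho>) f" and z: "z \<in> N"
  shows "pd (axis j 1) (\<lambda>z. integral {-1/2..1/2} (\<lambda>t. k t * f (pt3 z t))) z = integral {-1/2..1/2} (\<lambda>t. k t * pd (axis (emb j) 1) f (pt3 z t))"
proof -
  have ax: "axis j (1::real) \<in> Basis" by (simp add: axis_in_Basis_iff)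
  have axe: "axis (emb j) (1::real) \<in> Basis" by (simp add: axis_in_Basis_iff)
  have "pd (axis j 1) (\<lambda>z. integral {-1/2..1/2} (\<lambda>t. k t * f (pt3 z t))) z =
    (\<Sum>c\<in>Basis. integral {-1/2..1/2} (\<lambda>t. (k t * (pt3 (axis j 1) 0 \<bullet> c)) * pd c f (pt3 z t)))"
    by (rule pd_param_integral[OF N open_thick[OF N] integral_pt3_hyps k f z ax])
  also have "\<dots> = (\<Sum>c\<in>Basis. if c = axis (emb j) 1 then integral {-1/2..1/2} (\<lambda>t. k t * pd c f (pt3 z t)) else 0)"
    by (intro sum.cong refl) (auto simp: pt3_axis inner_Basis axe)
  also have "\<dots> = integral {-1/2..1/2} (\<lambda>t. k t * pd (axis (emb j) 1) f (pt3 z t))"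
    using axe by (simp add: sum.delta')
  finally show ?thesis .
qed

text \<open>Rescaling to [0, 1] absorbs the sign convention of \<open>oint\<close> and fixes the
  interval of integration, so that dependence on the upper limit becomes dependence on a
  parameter.\<close>

lemma oint_eq_unit_integral:
  fixes f :: "real \<Rightarrow> real"
  assumes "continuous_on {min 0 s..max 0 s} f"
  shows "oint 0 s f = s * integral {0..1} (\<lambda>\<theta>. f (s * \<theta>))"
proof (cases "s = 0")
  case False
  let ?J = "{min 0 s..max 0 s}"
  have "(f has_integral integral ?J f) ?J" using assms by (intro integrable_integral integrable_continuous_interval)
  from has_integral_stretch_real[OF this False]
  have "((\<lambda>x. f (s * x)) has_integral (1 / \<bar>s\<bar>) * integral ?J f) ((\<lambda>x. x / s) ` ?J)" by simp
  moreover have "(\<lambda>x. x / s) ` ?J = {0..1}"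
  proof
    show "{0..1} \<subseteq> (\<lambda>x. x / s) ` ?J"
    proof
      fix x :: real assume "x \<in> {0..1}"
      then show "x \<in> (\<lambda>x. x / s) ` ?J" using False
        by (intro image_eqI[of _ _ "x * s"]) (auto simp: min_def max_def mult_left_le_one_le mult_le_0_iff zero_le_mult_iff mult_le_cancel_right1 mult_le_cancel_right2)
    qed
  qed (use False in \<open>auto simp: min_def max_def field_simps split: if_splits\<close>)
  ultimately have "integral {0..1} (\<lambda>\<theta>. f (s * \<theta>)) = (1 / \<bar>s\<bar>) * integral ?J f" by (simp add: integral_unique)
  then show ?thesis using False by (auto simp: oint_def min_def max_def abs_if)
qed (simp add: oint_def)

lemma Cinf_on_oint:
  fixes f :: "real^3 \<Rightarrow> real"
  assumes f: "Cinf_on (thick N \<rho>) f"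
  shows "Cinf_on (thick N \<rho>) (\<lambda>x. oint 0 (x $ 3) (\<lambda>t. f (pt3 (proj2 x) t)))"
proof -
  \<comment> \<open>Linear in x for each parameter, as the parameter integral requires; since the
    factor lies in [0, 1], the point stays in the thick neighbourhood.\<close>
  define \<alpha> where "\<alpha> = (\<lambda>\<theta> x. pt3 (proj2 x) (\<theta> * x $ 3))"
  have lin: "bounded_linear (\<alpha> \<theta>)" for \<theta>
    unfolding \<alpha>_def by (intro linear_conv_bounded_linear[THEN iffD1] linearI)
      (simp_all add: vec_eq_iff forall_3 proj2_def algebra_simps)
  have 1: "\<alpha> \<theta> x \<in> thick N \<rho>" if "x \<in> thick N \<rho>" "\<theta> \<in> {0..1}" for x \<theta>
  proof -
    have "\<bar>\<theta> * x $ 3\<bar> \<le> \<bar>x $ 3\<bar>" using that by (simp add: abs_mult mult_left_le_one_le)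
    then show ?thesis using that by (auto simp: \<alpha>_def thick_def)
  qed
  have 2: "(\<alpha> \<theta> has_derivative \<alpha> \<theta>) (at x)" for \<theta> x by (rule bounded_linear_imp_has_derivative[OF lin])
  have 3: "continuous_on (thick N \<rho> \<times> {0..1}) (\<lambda>(x,\<theta>). \<alpha> \<theta> x)"
    unfolding \<alpha>_def case_prod_unfold by (intro continuous_on_pt3 continuous_on_proj2 continuous_intros continuous_vec_nth)
  have 4: "continuous_on {0..1} (\<lambda>\<theta>. \<alpha> \<theta> b \<bullet> c)" for b c
    unfolding \<alpha>_def by (intro continuous_on_inner continuous_on_pt3 continuous_intros)
  have "Cinf_on (thick N \<rho>) (\<lambda>x. integral {0..1} (\<lambda>\<theta>. 1 * f (\<alpha> \<theta> x)))"
    using 1 2 3 4 by (rule Cinf_on_param_integral[OF open_thick[OF N] open_thick[OF N]]) (auto intro: f)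
  then have sm: "Cinf_on (thick N \<rho>) (\<lambda>x. x $ 3 * integral {0..1} (\<lambda>\<theta>. f (\<alpha> \<theta> x)))"
    by (intro Cinf_on_mult[OF open_thick[OF N] Cinf_on_linear[OF open_thick[OF N] bounded_linear_vec_nth]]) simp
  show ?thesis
  proof (rule Cinf_on_cong[OF open_thick[OF N] _ sm])
    fix x assume x: "x \<in> thick N \<rho>"
    have "continuous_on {min 0 (x $ 3)..max 0 (x $ 3)} (\<lambda>t. f (pt3 (proj2 x) t))"
      by (rule continuous_on_compose2[OF Cinf_on_continuous[OF f]])
         (use x in \<open>auto simp: thick_def abs_less_iff min_def max_def split: if_splits intro!: continuous_on_pt3 continuous_intros\<close>)
    from oint_eq_unit_integral[OF this]
    show "x $ 3 * integral {0..1} (\<lambda>\<theta>. f (\<alpha> \<theta> x)) = oint 0 (x $ 3) (\<lambda>t. f (pt3 (proj2 x) t))"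
      by (simp add: \<alpha>_def mult.commute)
  qed
qed

end

section \<open>Geometry of the effective metric\<close>

lemma Cinf_on_mvec:
  fixes A :: "'a::euclidean_space \<Rightarrow> real^'n^'m"
  assumes U: "open U" and "\<And>i j. Cinf_on U (\<lambda>x. A x $ i $ j)" "\<And>j. Cinf_on U (\<lambda>x. v x $ j)"
  shows "Cinf_on U (\<lambda>x. (A x *v v x) $ i)"
  unfolding matrix_vector_mult_def vec_lambda_beta by (intro Cinf_on_sum Cinf_on_mult U assms)

lemma mult_vec_nth: "(A *v v) $ i = (\<Sum>j\<in>UNIV. A $ i $ j * v $ j)"
  by (simp add: matrix_vector_mult_def)

lemma transpose_jac_mult:
  "(transpose (jac f z) ** jac g z) $ i $ j = pd (axis i 1) f z \<bullet> pd (axis j 1) g z"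
  by (simp add: matrix_matrix_mult_def transpose_def jac_def inner_vec_def)

text \<open>Smoothness and nondegeneracy are demanded on the neighbourhood N, so that
  \<open>b0\<close> and the inverse of \<open>Q0\<close> are smooth up to the boundary. The
  geometric identities hold on the open set \<omega>, where they may be differentiated.\<close>

locale plate_geom =
  fixes \<omega> N :: "(real^2) set" and \<rho> :: real and Gbar :: "real^2 \<Rightarrow> mat3" and G1 G2 :: "real^3 \<Rightarrow> mat3"
    and Gb2 :: "real^2 \<Rightarrow> mat3" and y0 :: "real^2 \<Rightarrow> real^3"
  assumes w: "open \<omega>" "bounded \<omega>" and N: "open N" "closure \<omega> \<subseteq> N" and rho: "1/2 < \<rho>"
    and smooth: "Cinf_on N Gbar" "Cinf_on N Gb2" "Cinf_on N y0" "Cinf_on (thick N \<rho>) G1" "Cinf_on (thick N \<rho>) G2"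
    and detG: "\<And>z. z \<in> N \<Longrightarrow> det (Gbar z) > 0" "\<And>z. z \<in> N \<Longrightarrow> det (blk22 (Gbar z)) > 0"
    and cross: "\<And>z. z \<in> N \<Longrightarrow> cross3 (pd (axis 1 1) y0 z) (pd (axis 2 1) y0 z) \<noteq> 0"
    and Gsymm: "\<And>z. z \<in> \<omega> \<Longrightarrow> symm (Gbar z)" "\<And>x. x \<in> slab \<omega> \<Longrightarrow> symm (G1 x)" "\<And>x. x \<in> slab \<omega> \<Longrightarrow> symm (G2 x)"
    and mean: "\<And>z. z \<in> \<omega> \<Longrightarrow> integral {-1/2..1/2} (\<lambda>t. G1 (pt3 z t)) = 0"
    and Gb2: "\<And>z. z \<in> \<omega> \<Longrightarrow> symm (Gb2 z)" "\<And>z. z \<in> \<omega> \<Longrightarrow> blk22 (Gb2 z) = Gb2_22 G2 z"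
    and isom: "\<And>z. z \<in> \<omega> \<Longrightarrow> transpose (jac y0 z) ** jac y0 z = blk22 (Gbar z)"
    and y0_b0: "\<And>z. z \<in> \<omega> \<Longrightarrow> symp (transpose (jac y0 z) ** jac (b0 y0 Gbar) z) = (1/2) *\<^sub>R blk22 (Gb1 G1 z)"
begin

section \<open>The frame \<open>Q0\<close> and its Gram matrix\<close>

abbreviation "b \<equiv> b0 y0 Gbar"
abbreviation "pa \<equiv> \<lambda>j. pd (axis j (1::real) :: real^2)"
abbreviation "V \<equiv> thick N \<rho>"
abbreviation "Gf \<equiv> Geff Gbar G1 Gb2"

lemma wN: "z \<in> \<omega> \<Longrightarrow> z \<in> N" using N closure_subset by blast

lemma ax: "axis j (1::real) \<in> Basis" by (simp add: axis_in_Basis_iff)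

lemma oV: "open V" by (rule open_thick[OF N(1)])

lemma sm_Gbar: "Cinf_on N (\<lambda>z. Gbar z $ i $ j)" and sm_G1: "Cinf_on V (\<lambda>x. G1 x $ i $ j)" and sm_G2: "Cinf_on V (\<lambda>x. G2 x $ i $ j)"
  and sm_dy: "Cinf_on N (\<lambda>z. pa l y0 z $ k)" and sm_dyv: "Cinf_on N (pa l y0)"
  using smooth N(1) oV Cinf_on_pd[OF smooth(3) ax] by (auto intro!: Cinf_on_nth)

lemma sm_blk: "Cinf_on N (\<lambda>z. blk22 (Gbar z) $ i $ j)" by (simp add: blk22_def sm_Gbar)

lemma sm_b: "Cinf_on N (\<lambda>z. b z $ k)"
proof -
  define c where "c = (\<lambda>z. cross3 (pa 1 y0 z) (pa 2 y0 z))"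
  have c: "Cinf_on N (\<lambda>z. c z $ k)" for k
    using exhaust_3[of k] unfolding c_def cross3_def
    by (auto intro!: Cinf_on_diff Cinf_on_mult N sm_dy)
  have cn: "norm (c z) = sqrt (\<Sum>i\<in>UNIV. c z $ i * c z $ i)" for z
    by (simp add: norm_eq_sqrt_inner inner_vec_def)
  have cpos: "(\<Sum>i\<in>UNIV. c z $ i * c z $ i) > 0" if "z \<in> N" for z
  proof -
    have "c z \<bullet> c z > 0" using cross[OF that] by (simp add: c_def)
    then show ?thesis by (simp add: inner_vec_def)
  qed
  have nc: "Cinf_on N (\<lambda>z. norm (c z))" unfolding cn
    by (intro Cinf_on_sqrt Cinf_on_sum Cinf_on_mult N c cpos)
  have jc: "Cinf_on N (\<lambda>z. jac y0 z $ i $ j)" for i j by (simp add: jac_def sm_dy)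
  have vc: "Cinf_on N (\<lambda>z. (vector [Gbar z $ 1 $ 3, Gbar z $ 2 $ 3] :: real^2) $ l)" for l
    using exhaust_2[of l] by (auto intro: sm_Gbar)
  have eq: "b z $ k = (jac y0 z *v (matrix_inv (blk22 (Gbar z)) *v vector [Gbar z $ 1 $ 3, Gbar z $ 2 $ 3])) $ k
      + sqrt (det (Gbar z) / det (blk22 (Gbar z))) * (1 / norm (c z) * c z $ k)" for z
    by (simp add: b0_def Let_def c_def)
  show ?thesis unfolding eq
    by (intro Cinf_on_add Cinf_on_mvec Cinf_on_mult Cinf_on_sqrt Cinf_on_divide Cinf_on_const Cinf_on_matrix_inv Cinf_on_det N jc vc sm_blk sm_Gbar c nc)
       (use detG cross in \<open>auto simp: c_def less_imp_neq[symmetric] intro!: less_imp_neq[symmetric] divide_pos_pos\<close>)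
qed

lemma sm_bv: "Cinf_on N b" using sm_b by (simp add: Cinf_on_vec_iff[OF N(1)])

lemma sm_db: "Cinf_on N (\<lambda>z. pa l b z $ k)"
  using Cinf_on_pd[OF sm_bv ax] N(1) by (auto intro: Cinf_on_nth)

text \<open>The determinant is the triple product of the tangent vectors with \<open>b0\<close>. The
  tangential part of \<open>b0\<close> drops out, leaving a positive multiple of the norm of the
  cross product.\<close>

lemma det_Q0: assumes "z \<in> N" shows "det (Q0 y0 Gbar z) \<noteq> 0"
proof -
  let ?d1 = "pa 1 y0 z" and ?d2 = "pa 2 y0 z"
  let ?c = "cross3 ?d1 ?d2"
  have "det (Q0 y0 Gbar z) = ?c \<bullet> b z"
    by (simp add: det_3 Q0_def cross3_def inner_vec_def sum_3 algebra_simps)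
  also have "\<dots> = ?c \<bullet> (jac y0 z *v (matrix_inv (blk22 (Gbar z)) *v vector [Gbar z $ 1 $ 3, Gbar z $ 2 $ 3]))
      + sqrt (det (Gbar z) / det (blk22 (Gbar z))) * (?c \<bullet> ?c / norm ?c)"
    by (simp add: b0_def Let_def inner_add_right)
  also have "?c \<bullet> (jac y0 z *v v) = 0" for v
    by (simp add: mult_vec_nth jac_def cross3_def inner_vec_def sum_3 sum_2 algebra_simps)
  also have "?c \<bullet> ?c / norm ?c = norm ?c" by (simp add: dot_square_norm power2_eq_square)
  finally show ?thesis using detG[OF assms] cross[OF assms] by simp
qed

lemma sm_Q0mT: "Cinf_on N (\<lambda>z. Q0mT y0 Gbar z $ i $ j)"
  unfolding Q0mT_def
proof (rule Cinf_on_matrix_inv[OF N(1)])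
  show "Cinf_on N (\<lambda>z. transpose (Q0 y0 Gbar z) $ i $ j)" for i j
    by (simp add: transpose_def Q0_def) (cases "i = 1"; cases "i = 2"; simp add: sm_dy sm_b)
qed (simp add: det_Q0)

definition q :: "3 \<Rightarrow> real^2 \<Rightarrow> real^3" where
  "q i z = (if i = 1 then pa 1 y0 z else if i = 2 then pa 2 y0 z else b z)"

lemma q_simps: "q (emb i) = pa i y0" "q 3 = b" "q 1 = pa 1 y0" "q 2 = pa 2 y0"
  using exhaust_2[of i] by (auto simp: q_def emb_def fun_eq_iff)

lemma Q0_transpose_mult: "(transpose (Q0 y0 Gbar z) *v v) $ i = q i z \<bullet> v"
  using exhaust_3[of i] by (auto simp: mult_vec_nth transpose_def Q0_def q_def inner_vec_def)

lemma q_Q0mT: assumes "z \<in> N" shows "q i z \<bullet> (Q0mT y0 Gbar z *v v) = v $ i"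
proof -
  have "transpose (Q0 y0 Gbar z) *v (Q0mT y0 Gbar z *v v) = v"
    unfolding Q0mT_def matrix_vector_mul_assoc using det_Q0[OF assms] by (subst matrix_inv_mult(1)) auto
  then show ?thesis by (metis Q0_transpose_mult)
qed

lemma q_eqI: assumes z: "z \<in> N" and "\<And>i. q i z \<bullet> v = q i z \<bullet> u" shows "v = u"
proof -
  have "transpose (Q0 y0 Gbar z) *v v = transpose (Q0 y0 Gbar z) *v u"
    using assms(2) by (simp add: vec_eq_iff Q0_transpose_mult del: transpose_matrix_vector)
  then have "matrix_inv (transpose (Q0 y0 Gbar z)) ** transpose (Q0 y0 Gbar z) *v v = matrix_inv (transpose (Q0 y0 Gbar z)) ** transpose (Q0 y0 Gbar z) *v u"
    by (metis matrix_vector_mul_assoc)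
  then show ?thesis using matrix_inv_mult(2)[of "transpose (Q0 y0 Gbar z)"] det_Q0[OF z] by simp
qed

text \<open>This is what \<open>b0\<close> is made for. Its tangential part solves the linear system
  prescribing the products with the tangent vectors, and its normal part adds det G / det G_22 to
  the squared length, which by the Schur complement formula for the determinant gives G_33.\<close>

lemma gram: assumes z: "z \<in> \<omega>" shows "q i z \<bullet> q j z = Gbar z $ i $ j"
proof -
  note zN = wN[OF z]
  let ?G = "Gbar z"
  have sy: "?G $ i $ j = ?G $ j $ i" for i j
    using arg_cong[OF Gsymm(1)[OF z, unfolded symm_def], of "\<lambda>M. M $ j $ i"] by (simp add: transpose_def)
  have tt: "pa i y0 z \<bullet> pa j y0 z = ?G $ emb i $ emb j" for i j
    using arg_cong[OF isom[OF z], of "\<lambda>M. M $ i $ j"] by (simp add: transpose_jac_mult blk22_def)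
  define a where "a = matrix_inv (blk22 ?G) *v vector [?G $ 1 $ 3, ?G $ 2 $ 3]"
  have "blk22 ?G *v a = vector [?G $ 1 $ 3, ?G $ 2 $ 3]"
    unfolding a_def matrix_vector_mul_assoc using detG(2)[OF zN] by (subst matrix_inv_mult(1)) auto
  then have a: "?G$1$1 * a$1 + ?G$1$2 * a$2 = ?G$1$3" "?G$2$1 * a$1 + ?G$2$2 * a$2 = ?G$2$3"
    by (simp_all add: vec_eq_iff forall_2 mult_vec_nth sum_2 blk22_def emb_def)
  define c where "c = cross3 (pa 1 y0 z) (pa 2 y0 z)"
  define s where "s = sqrt (det ?G / det (blk22 ?G))"
  have T: "jac y0 z *v a = a$1 *\<^sub>R pa 1 y0 z + a$2 *\<^sub>R pa 2 y0 z"
    by (simp add: vec_eq_iff mult_vec_nth sum_2 jac_def mult.commute)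
  have bz: "b z = (a$1 *\<^sub>R pa 1 y0 z + a$2 *\<^sub>R pa 2 y0 z) + (s / norm c) *\<^sub>R c"
    unfolding T[symmetric] by (simp add: b0_def Let_def a_def s_def c_def)
  have co: "pa 1 y0 z \<bullet> c = 0" "pa 2 y0 z \<bullet> c = 0" "c \<bullet> pa 1 y0 z = 0" "c \<bullet> pa 2 y0 z = 0"
    unfolding c_def by (simp_all add: dot_cross_self)
  have t11: "pa 1 y0 z \<bullet> pa 1 y0 z = ?G$1$1" "pa 1 y0 z \<bullet> pa 2 y0 z = ?G$1$2" "pa 2 y0 z \<bullet> pa 1 y0 z = ?G$2$1" "pa 2 y0 z \<bullet> pa 2 y0 z = ?G$2$2"
    using tt by (simp_all add: emb_def)
  have b1: "pa 1 y0 z \<bullet> b z = ?G$1$3" "pa 2 y0 z \<bullet> b z = ?G$2$3"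
    unfolding bz using a by (simp_all add: inner_add_right co t11 mult.commute)
  have cc: "c \<bullet> c \<noteq> 0" using cross[OF zN] by (simp add: c_def)
  have s2: "s^2 = det ?G / det (blk22 ?G)" unfolding s_def using detG[OF zN] by simp
  have "b z \<bullet> b z = a$1 * (pa 1 y0 z \<bullet> b z) + a$2 * (pa 2 y0 z \<bullet> b z) + (s / norm c) * (c \<bullet> b z)"
    by (subst (1) bz) (simp add: inner_add_left)
  also have "c \<bullet> b z = (s / norm c) * (c \<bullet> c)" unfolding bz by (simp add: inner_add_right co)
  also have "(s / norm c) * ((s / norm c) * (c \<bullet> c)) = s^2"
    using cc by (simp add: dot_square_norm power2_eq_square)
  finally have bb: "b z \<bullet> b z = a$1 * ?G$1$3 + a$2 * ?G$2$3 + det ?G / det (blk22 ?G)" by (simp add: b1 s2)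
  \<comment> \<open>Schur complement of the tangential block, with the inverse already applied
    through the coefficients a.\<close>
  have "det ?G = det (blk22 ?G) * (?G$3$3 - (a$1 * ?G$1$3 + a$2 * ?G$2$3))"
    unfolding det_3 det_2 blk22_def vec_lambda_beta emb_def sy[of 2 1] sy[of 3 1] sy[of 3 2]
    by (simp add: a[symmetric] sy[of 2 1] algebra_simps)
  then have bb': "b z \<bullet> b z = ?G$3$3" unfolding bb using detG(2)[OF zN] by simp
  have b2: "b z \<bullet> pa 1 y0 z = ?G$3$1" "b z \<bullet> pa 2 y0 z = ?G$3$2"
    using b1 sy[of 3 1] sy[of 3 2] by (simp_all add: inner_commute)
  show ?thesis using exhaust_3[of i] exhaust_3[of j]
    by (elim disjE) (simp_all add: q_def b1 b2 bb' t11)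
qed

lemma cases_3: assumes "\<And>r. P (emb r)" "P 3" shows "P m"
proof -
  have "m = emb 1 \<or> m = emb 2 \<or> m = 3" using exhaust_3[of m] by (simp add: emb_def)
  then show ?thesis using assms by auto
qed

section \<open>Derivatives of the effective metric at mid-plate\<close>

lemma sm_Gb1: "Cinf_on N (\<lambda>z. Gb1 G1 z $ i $ j)"
proof -
  have k: "continuous_on {-1/2..1/2} (\<lambda>t::real. t)" "continuous_on {-1/2..1/2} (\<lambda>t::real. 2*t^3 - t/2)"
    by (intro continuous_intros; simp)+
  have 1: "Cinf_on N (\<lambda>z. 12 * integral {-1/2..1/2} (\<lambda>t. t * G1 (pt3 z t) $ i $ j))"
    by (intro Cinf_on_mult Cinf_on_const N Cinf_on_thickness_integral[OF N(1) rho k(1)] sm_G1)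
  have 2: "Cinf_on N (\<lambda>z. -60 * integral {-1/2..1/2} (\<lambda>t. (2*t^3 - t/2) * G1 (pt3 z t) $ l $ 3))" for l
    by (intro Cinf_on_mult Cinf_on_const N Cinf_on_thickness_integral[OF N(1) rho k(2)] sm_G1)
  show ?thesis unfolding Gb1_def vec_lambda_beta using 1 2[of i] 2[of j]
    by (cases "i = 3"; cases "j = 3") simp_all
qed

lemma sm_Gb1v: "Cinf_on N (Gb1 G1)" using sm_Gb1 by (simp add: Cinf_on_vec_iff[OF N(1)])

lemma symm_nth: assumes "symm A" shows "A $ i $ j = A $ j $ i"
  using arg_cong[OF assms[unfolded symm_def], of "\<lambda>M. M $ j $ i"] by (simp add: transpose_def)

lemma Gb1_symm: assumes z: "z \<in> \<omega>" shows "Gb1 G1 z $ i $ j = Gb1 G1 z $ j $ i"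
proof -
  have "G1 (pt3 z t) $ i $ j = G1 (pt3 z t) $ j $ i" if "t \<in> {-1/2..1/2}" for t i j
    using that z by (intro symm_nth Gsymm(2)) (auto simp: slab_def)
  then have "integral {-1/2..1/2} (\<lambda>t. t * G1 (pt3 z t) $ i $ j) = integral {-1/2..1/2} (\<lambda>t. t * G1 (pt3 z t) $ j $ i)" for i j
    by (intro integral_cong) simp
  then show ?thesis by (simp add: Gb1_def)
qed

text \<open>A Taylor polynomial in the thickness variable with planar coefficients: differentiating
  in x_3 shifts the coefficients (A, B, C) to (B, C, 0), and planar derivatives act coefficientwise.
  All derivatives of the effective metric at x_3 = 0 are read off from this.\<close>

definition layer :: "(real^2 \<Rightarrow> mat3) \<Rightarrow> (real^2 \<Rightarrow> mat3) \<Rightarrow> (real^2 \<Rightarrow> mat3) \<Rightarrow> real^3 \<Rightarrow> mat3" where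
  "layer A B C x = A (proj2 x) + (x$3) *\<^sub>R B (proj2 x) + ((x$3)^2/2) *\<^sub>R C (proj2 x)"

lemma Geff_layer: "Gf = layer Gbar (Gb1 G1) Gb2"
  by (simp add: fun_eq_iff Geff_def layer_def)

lemma layer_0: "layer A B C (pt3 z 0) = A z" by (simp add: layer_def)

lemma proj2_linear: "bounded_linear proj2"
  by (intro linear_conv_bounded_linear[THEN iffD1] linearI) (simp_all add: proj2_def vec_eq_iff forall_2)

lemma proj2_axis: "proj2 (axis 3 1) = 0" "proj2 (axis (emb j) 1) = axis j 1" "axis (emb j) (1::real) $ 3 = 0" "axis 3 (1::real) $ (3::3) = 1"
  using exhaust_2[of j] by (auto simp: proj2_def vec_eq_iff forall_2 axis_def emb_def)

lemma pd_zero: "f differentiable (at x) \<Longrightarrow> pd 0 f x = 0"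
  using linear_0[OF has_derivative_linear[OF pd_works]] .

lemma pd_layer:
  assumes A: "Cinf_on N A" and B: "Cinf_on N B" and C: "Cinf_on N C" and x: "proj2 x \<in> N"
  shows "pd (axis 3 1) (layer A B C) x = layer B C (\<lambda>_. 0) x"
    "pd (axis (emb j) 1) (layer A B C) x = layer (pa j A) (pa j B) (pa j C) x"
proof -
  have p: "((\<lambda>x. F (proj2 x)) has_derivative (\<lambda>h. pd (proj2 h) F (proj2 x))) (at x)" if "Cinf_on N F" for F :: "real^2 \<Rightarrow> mat3"
    by (rule has_derivative_compose[OF bounded_linear_imp_has_derivative[OF proj2_linear] pd_works[OF Cinf_on_differentiable[OF that x]]])
  have x3: "((\<lambda>x. x $ 3) has_derivative (\<lambda>h. h $ 3)) (at x)"
    by (rule bounded_linear_imp_has_derivative[OF bounded_linear_vec_nth])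
  have x32: "((\<lambda>x. (x $ 3)^2/2) has_derivative (\<lambda>h. x $ 3 * h $ 3)) (at x)"
    by (auto intro!: derivative_eq_intros x3)
  have "(layer A B C has_derivative (\<lambda>h. pd (proj2 h) A (proj2 x) + (x$3 *\<^sub>R pd (proj2 h) B (proj2 x) + h$3 *\<^sub>R B (proj2 x))
     + (((x$3)^2/2) *\<^sub>R pd (proj2 h) C (proj2 x) + (x$3 * h$3) *\<^sub>R C (proj2 x)))) (at x)"
    unfolding layer_def by (intro has_derivative_add has_derivative_scaleR p x3 x32 A B C)
  note D = pd_eqI[OF this]
  have z: "pd 0 F (proj2 x) = 0" if "Cinf_on N F" for F :: "real^2 \<Rightarrow> mat3"
    by (rule pd_zero[OF Cinf_on_differentiable[OF that x]])
  show "pd (axis 3 1) (layer A B C) x = layer B C (\<lambda>_. 0) x"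
    unfolding D by (simp add: proj2_axis z A B C layer_def)
  show "pd (axis (emb j) 1) (layer A B C) x = layer (pa j A) (pa j B) (pa j C) x"
    unfolding D by (simp add: proj2_axis layer_def)
qed

lemma open_cyl: "open {x. proj2 x \<in> N}"
  using continuous_on_proj2[of UNIV "\<lambda>x. x"] N(1) continuous_on_open_vimage[OF open_UNIV, of proj2] by (simp add: vimage_def)

lemma pd_pd_layer:
  assumes A: "Cinf_on N A" and B: "Cinf_on N B" and C: "Cinf_on N C" and z: "z \<in> N"
  shows "pd (axis 3 1) (pd (axis 3 1) (layer A B C)) (pt3 z 0) = C z"
    "pd (axis (emb i) 1) (pd (axis 3 1) (layer A B C)) (pt3 z 0) = pa i B z"
    "pd (axis 3 1) (pd (axis (emb j) 1) (layer A B C)) (pt3 z 0) = pa j B z"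
    "pd (axis (emb i) 1) (pd (axis (emb j) 1) (layer A B C)) (pt3 z 0) = pa i (pa j A) z"
proof -
  have z3: "pt3 z 0 \<in> {x. proj2 x \<in> N}" using z by simp
  have c0: "Cinf_on N (\<lambda>_. 0 :: mat3)" by (rule Cinf_on_const[OF N(1)])
  have e3: "pd b (pd (axis 3 1) (layer A B C)) (pt3 z 0) = pd b (layer B C (\<lambda>_. 0)) (pt3 z 0)" for b
    by (rule pd_cong_open[OF open_cyl z3]) (simp add: pd_layer A B C)
  have ej: "pd b (pd (axis (emb j) 1) (layer A B C)) (pt3 z 0) = pd b (layer (pa j A) (pa j B) (pa j C)) (pt3 z 0)" for b
    by (rule pd_cong_open[OF open_cyl z3]) (simp add: pd_layer A B C)
  note P = Cinf_on_pd[OF A ax[of j]] Cinf_on_pd[OF B ax[of j]] Cinf_on_pd[OF C ax[of j]]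
  show "pd (axis 3 1) (pd (axis 3 1) (layer A B C)) (pt3 z 0) = C z"
    "pd (axis (emb i) 1) (pd (axis 3 1) (layer A B C)) (pt3 z 0) = pa i B z"
    using z3 unfolding e3 by (simp_all add: pd_layer[OF B C c0] layer_0)
  show "pd (axis 3 1) (pd (axis (emb j) 1) (layer A B C)) (pt3 z 0) = pa j B z"
    "pd (axis (emb i) 1) (pd (axis (emb j) 1) (layer A B C)) (pt3 z 0) = pa i (pa j A) z"
    using z3 unfolding ej by (simp_all add: pd_layer[OF P] layer_0)
qed

lemma dGf:
  assumes z: "z \<in> N"
  shows "dG Gf (emb j) (pt3 z 0) = pa j Gbar z" "dG Gf 3 (pt3 z 0) = Gb1 G1 z"
    "dG (dG Gf 3) 3 (pt3 z 0) = Gb2 z" "dG (dG Gf 3) (emb i) (pt3 z 0) = pa i (Gb1 G1) z"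
    "dG (dG Gf (emb j)) 3 (pt3 z 0) = pa j (Gb1 G1) z" "dG (dG Gf (emb j)) (emb i) (pt3 z 0) = pa i (pa j Gbar) z"
  unfolding dG_def Geff_layer
  using z pd_layer[OF smooth(1) sm_Gb1v smooth(2), of "pt3 z 0"] pd_pd_layer[OF smooth(1) sm_Gb1v smooth(2) z]
  by (simp_all add: layer_0)

lemma sm_q: "Cinf_on N (q m)"
  using exhaust_3[of m] sm_dyv sm_bv by (auto simp: q_simps)

lemma q_diff: "z \<in> N \<Longrightarrow> q m differentiable (at z)" using Cinf_on_differentiable[OF sm_q] .

section \<open>Christoffel symbols as coordinates in the frame\<close>

lemma pd_inner:
  fixes f g :: "'a::euclidean_space \<Rightarrow> 'b::real_inner"
  assumes "f differentiable (at x)" "g differentiable (at x)"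
  shows "pd c (\<lambda>x. f x \<bullet> g x) x = pd c f x \<bullet> g x + f x \<bullet> pd c g x"
  using pd_eqI[OF has_derivative_inner[OF pd_works[OF assms(1)] pd_works[OF assms(2)]]] by simp

lemma pd_Gbar: assumes z: "z \<in> \<omega>" shows "pa l Gbar z $ m $ n = pa l (q m) z \<bullet> q n z + q m z \<bullet> pa l (q n) z"
proof -
  have d: "Gbar differentiable (at z)" using Cinf_on_differentiable[OF smooth(1) wN[OF z]] .
  then have d': "(\<lambda>z. Gbar z $ m) differentiable (at z)"
    using Cinf_on_differentiable[OF Cinf_on_nth[OF N(1) smooth(1)] wN[OF z]] by simp
  have "pa l Gbar z $ m $ n = pa l (\<lambda>z. Gbar z $ m $ n) z" by (simp add: pd_nth[OF d] pd_nth[OF d'])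
  also have "\<dots> = pa l (\<lambda>z. q m z \<bullet> q n z) z" by (rule pd_cong_open[OF w(1) z]) (simp add: gram)
  also have "\<dots> = pa l (q m) z \<bullet> q n z + q m z \<bullet> pa l (q n) z"
    by (rule pd_inner) (rule q_diff[OF wN[OF z]])+
  finally show ?thesis .
qed

lemma pd_commute:
  fixes f :: "real^2 \<Rightarrow> real^3"
  assumes f: "Cinf_on N f" and z: "z \<in> N" shows "pa i (pa j f) z = pa j (pa i f) z"
proof -
  have "pa i (pa j f) z $ k = pa j (pa i f) z $ k" for k
  proof -
    have e: "pa i (pa j f) z $ k = pa i (pa j (\<lambda>z. f z $ k)) z" for i j
    proof -
      have "pa i (pa j f) z $ k = pa i (\<lambda>z. pa j f z $ k) z"
        by (rule pd_nth[OF Cinf_on_differentiable[OF Cinf_on_pd[OF f ax] z], symmetric])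
      also have "\<dots> = pa i (pa j (\<lambda>z. f z $ k)) z"
        by (rule pd_cong_open[OF N(1) z]) (rule pd_nth[OF Cinf_on_differentiable[OF f], symmetric])
      finally show ?thesis .
    qed
    show ?thesis unfolding e by (rule pd_commute_real[OF N(1) z Cinf_on_nth[OF N(1) f] ax ax])
  qed
  then show ?thesis by (simp add: vec_eq_iff)
qed

lemmas D2_commute = pd_commute[OF smooth(3)]

lemma Gb1_tangential: assumes z: "z \<in> \<omega>"
  shows "Gb1 G1 z $ emb i $ emb j = pa i y0 z \<bullet> pa j b z + pa j y0 z \<bullet> pa i b z"
proof -
  have "symp (transpose (jac y0 z) ** jac b z) $ i $ j = (1/2) * (pa i y0 z \<bullet> pa j b z + pa j y0 z \<bullet> pa i b z)"
    by (simp add: symp_def transpose_def[of "_ ** _"] transpose_jac_mult)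
  then show ?thesis using arg_cong[OF y0_b0[OF z], of "\<lambda>M. M $ i $ j"] by (simp add: blk22_def)
qed

text \<open>The hypothesis says that the products of v with the frame are the Christoffel symbols of
  the first kind. Raising the index by the inverse of the Gram matrix turns products with the frame
  into coordinates in it.\<close>

lemma Chr_frame:
  assumes z: "z \<in> \<omega>" and low: "\<And>m. q m z \<bullet> v = (1/2) * (dG Gf l (pt3 z 0) $ m $ k + dG Gf k (pt3 z 0) $ m $ l - dG Gf m (pt3 z 0) $ k $ l)"
  shows "(\<Sum>i\<in>UNIV. Chr Gf i k l (pt3 z 0) *\<^sub>R q i z) = v"
proof (rule q_eqI[OF wN[OF z]])
  fix m
  have G0: "Gf (pt3 z 0) = Gbar z" by (simp add: Geff_layer layer_0)
  have inv: "(\<Sum>i\<in>UNIV. Gbar z $ m $ i * matrix_inv (Gbar z) $ i $ n) = (if m = n then 1 else 0)" for n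
    using arg_cong[OF matrix_inv_mult(1)[of "Gbar z"], of "\<lambda>M. M $ m $ n"] detG(1)[OF wN[OF z]]
    by (simp add: matrix_matrix_mult_def mat_def)
  have "q m z \<bullet> (\<Sum>i\<in>UNIV. Chr Gf i k l (pt3 z 0) *\<^sub>R q i z) = (\<Sum>i\<in>UNIV. Chr Gf i k l (pt3 z 0) * Gbar z $ m $ i)"
    by (simp add: inner_sum_right gram[OF z])
  also have "\<dots> = (\<Sum>i\<in>UNIV. \<Sum>n\<in>UNIV. (Gbar z $ m $ i * matrix_inv (Gbar z) $ i $ n) * (q n z \<bullet> v))"
    unfolding Chr_def G0 low by (simp add: sum_distrib_left sum_distrib_right mult_ac)
  also have "\<dots> = (\<Sum>n\<in>UNIV. (\<Sum>i\<in>UNIV. Gbar z $ m $ i * matrix_inv (Gbar z) $ i $ n) * (q n z \<bullet> v))"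
    by (subst sum.swap) (simp add: sum_distrib_right)
  also have "\<dots> = q m z \<bullet> v" unfolding inv by (simp add: if_distrib if_distribR cong: if_cong)
  finally show "q m z \<bullet> (\<Sum>i\<in>UNIV. Chr Gf i k l (pt3 z 0) *\<^sub>R q i z) = q m z \<bullet> v" .
qed

text \<open>For tangential m the Gram identity and the symmetry of second derivatives give the
  Koszul formula of a surface. For m = 3 the x_3-derivative of the metric enters; its tangential
  block is the symmetric part of the pairing of the tangent vectors with the derivatives of b, by
  the condition on \<open>y0\<close>.\<close>

lemma Chr_tangential: assumes z: "z \<in> \<omega>"
  shows "(\<Sum>k\<in>UNIV. Chr Gf k (emb i) (emb j) (pt3 z 0) *\<^sub>R q k z) = pa j (pa i y0) z"
proof (rule Chr_frame[OF z])
  note D = D2_commute[OF wN[OF z]]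
  fix m
  show "q m z \<bullet> pa j (pa i y0) z = (1/2) * (dG Gf (emb j) (pt3 z 0) $ m $ emb i + dG Gf (emb i) (pt3 z 0) $ m $ emb j - dG Gf m (pt3 z 0) $ emb i $ emb j)"
  proof (rule cases_3[of _ m])
    fix r
    show "q (emb r) z \<bullet> pa j (pa i y0) z = (1/2) * (dG Gf (emb j) (pt3 z 0) $ emb r $ emb i + dG Gf (emb i) (pt3 z 0) $ emb r $ emb j - dG Gf (emb r) (pt3 z 0) $ emb i $ emb j)"
      using D[of j r] D[of i r] D[of j i] inner_commute[of "pa i y0 z" "pa r (pa j y0) z"]
        inner_commute[of "pa r (pa i y0) z" "pa j y0 z"] inner_commute[of "pa r (pa j y0) z" "pa i y0 z"]
      by (simp add: dGf[OF wN[OF z]] pd_Gbar[OF z] q_simps)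
  next
    show "q 3 z \<bullet> pa j (pa i y0) z = (1/2) * (dG Gf (emb j) (pt3 z 0) $ 3 $ emb i + dG Gf (emb i) (pt3 z 0) $ 3 $ emb j - dG Gf 3 (pt3 z 0) $ emb i $ emb j)"
      using D[of j i] by (simp add: dGf[OF wN[OF z]] pd_Gbar[OF z] q_simps Gb1_tangential[OF z] inner_commute)
  qed
qed

text \<open>Paired with tangent vectors, the derivative of b has its symmetric part given by
  \<open>Gb1\<close> and its antisymmetric part by the curl of the entries G_r3. Its product with b
  is half the derivative of G_33.\<close>

lemma Chr_mixed: assumes z: "z \<in> \<omega>"
  shows "(\<Sum>k\<in>UNIV. Chr Gf k (emb i) 3 (pt3 z 0) *\<^sub>R q k z) = pa i b z"
proof (rule Chr_frame[OF z])
  note D = D2_commute[OF wN[OF z]]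
  fix m
  show "q m z \<bullet> pa i b z = (1/2) * (dG Gf 3 (pt3 z 0) $ m $ emb i + dG Gf (emb i) (pt3 z 0) $ m $ 3 - dG Gf m (pt3 z 0) $ emb i $ 3)"
  proof (rule cases_3[of _ m])
    fix r
    show "q (emb r) z \<bullet> pa i b z = (1/2) * (dG Gf 3 (pt3 z 0) $ emb r $ emb i + dG Gf (emb i) (pt3 z 0) $ emb r $ 3 - dG Gf (emb r) (pt3 z 0) $ emb i $ 3)"
      using D[of i r] by (simp add: dGf[OF wN[OF z]] pd_Gbar[OF z] q_simps Gb1_tangential[OF z])
  next
    show "q 3 z \<bullet> pa i b z = (1/2) * (dG Gf 3 (pt3 z 0) $ 3 $ emb i + dG Gf (emb i) (pt3 z 0) $ 3 $ 3 - dG Gf 3 (pt3 z 0) $ emb i $ 3)"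
      using Gb1_symm[OF z, of 3 "emb i"] by (simp add: dGf[OF wN[OF z]] pd_Gbar[OF z] q_simps inner_commute)
  qed
qed

lemma dGf_symm: assumes z: "z \<in> \<omega>" shows "dG Gf m (pt3 z 0) $ k $ l = dG Gf m (pt3 z 0) $ l $ k"
  by (rule cases_3[of _ m]) (simp_all add: dGf[OF wN[OF z]] pd_Gbar[OF z] Gb1_symm[OF z, of k l] inner_commute)

lemma Chr_commute: assumes z: "z \<in> \<omega>" shows "Chr Gf i k l (pt3 z 0) = Chr Gf i l k (pt3 z 0)"
  unfolding Chr_def using dGf_symm[OF z, of _ k l] by (simp add: add.commute)

lemma ext3_nth: "ext3 v $ emb r = v $ r" "ext3 v $ 3 = 0"
  using exhaust_2[of r] by (auto simp: ext3_def emb_def)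

lemma beta_nth: "(transpose (jac b z) *v b z) $ r = pa r b z \<bullet> b z"
  by (simp add: mult_vec_nth transpose_def jac_def inner_vec_def)

lemma axis3: "axis 3 (1::real) $ emb r = 0" using exhaust_2[of r] by (auto simp: axis_def emb_def)

text \<open>\<open>dt0\<close> is defined by its products with the frame; the term with
  \<open>ext3\<close> accounts for half the tangential derivative of G_33, the squared length of
  b.\<close>

lemma Chr_normal: assumes z: "z \<in> \<omega>"
  shows "(\<Sum>k\<in>UNIV. Chr Gf k 3 3 (pt3 z 0) *\<^sub>R q k z) = dt0 y0 Gbar G1 z"
proof (rule Chr_frame[OF z])
  fix m
  show "q m z \<bullet> dt0 y0 Gbar G1 z = (1/2) * (dG Gf 3 (pt3 z 0) $ m $ 3 + dG Gf 3 (pt3 z 0) $ m $ 3 - dG Gf m (pt3 z 0) $ 3 $ 3)"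
    unfolding dt0_def q_Q0mT[OF wN[OF z]]
    by (rule cases_3[of _ m])
       (simp_all add: dGf[OF wN[OF z]] pd_Gbar[OF z] q_simps col3_def ext3_nth beta_nth axis3 inner_commute del: transpose_matrix_vector)
qed

lemma Chr_metric:
  assumes z: "z \<in> \<omega>"
  shows "(\<Sum>n\<in>UNIV. \<Sum>p\<in>UNIV. Gbar z $ n $ p * (A n * B p)) = (\<Sum>n\<in>UNIV. A n *\<^sub>R q n z) \<bullet> (\<Sum>p\<in>UNIV. B p *\<^sub>R q p z)"
  by (subst sum.swap) (simp add: inner_sum_left inner_sum_right gram[OF z, symmetric] sum_distrib_left mult_ac)

lemma GamPair_eq:
  assumes z: "z \<in> \<omega>" shows "GamPair Gf v z $ i $ j = pa j (pa i y0) z \<bullet> (Q0mT y0 Gbar z *v v)"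
proof -
  have "GamPair Gf v z $ i $ j = (\<Sum>k\<in>UNIV. Chr Gf k (emb i) (emb j) (pt3 z 0) * v $ k)"
    by (simp add: GamPair_def Gvec_def inner_vec_def mult.commute)
  also have "\<dots> = (\<Sum>k\<in>UNIV. Chr Gf k (emb i) (emb j) (pt3 z 0) *\<^sub>R q k z) \<bullet> (Q0mT y0 Gbar z *v v)"
    by (simp add: inner_sum_left q_Q0mT[OF wN[OF z]])
  finally show ?thesis by (simp add: Chr_tangential[OF z])
qed

text \<open>Differentiating \<open>\<langle>\<partial>\<^sub>i y\<^sub>0, Q\<^sub>0\<^sup>-\<^sup>T v\<rangle> = v\<^sub>i\<close> produces the covariant derivative of \<open>v\<close>.\<close>
lemma jac_frame:
  assumes z: "z \<in> \<omega>" and v: "Cinf_on N v"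
  shows "transpose (jac y0 z) ** jac (\<lambda>z. Q0mT y0 Gbar z *v v z) z = grad2 v z - GamPair Gf (v z) z"
proof -
  note zN = wN[OF z]
  let ?W = "\<lambda>z. Q0mT y0 Gbar z *v v z"
  have sW: "Cinf_on N ?W"
    unfolding Cinf_on_vec_iff[OF N(1)] by (intro allI Cinf_on_mvec N sm_Q0mT Cinf_on_nth[OF N(1) v])
  have "pa i y0 z \<bullet> pa j ?W z = pa j v z $ emb i - pa j (pa i y0) z \<bullet> ?W z" for i j
  proof -
    have "pa j (\<lambda>z. pa i y0 z \<bullet> ?W z) z = pa j (\<lambda>z. v z $ emb i) z"
      by (rule pd_cong_open[OF N(1) zN]) (use q_Q0mT[of _ "emb i"] in \<open>simp add: q_simps\<close>)
    moreover have "pa j (\<lambda>z. v z $ emb i) z = pa j v z $ emb i" by (rule pd_nth[OF Cinf_on_differentiable[OF v zN]])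
    moreover have "pa j (\<lambda>z. pa i y0 z \<bullet> ?W z) z = pa j (pa i y0) z \<bullet> ?W z + pa i y0 z \<bullet> pa j ?W z"
      by (rule pd_inner[OF Cinf_on_differentiable[OF sm_dyv zN] Cinf_on_differentiable[OF sW zN]])
    ultimately show ?thesis by simp
  qed
  then show ?thesis by (simp add: vec_eq_iff transpose_jac_mult grad2_def GamPair_eq[OF z])
qed

end

section \<open>The curvature term and planar derivatives of \<open>d0\<close>\<close>

context plate_geom begin

text \<open>Half the gradient of the squared length of b.\<close>

definition beta :: "real^2 \<Rightarrow> real^2" where "beta z = transpose (jac b z) *v b z"

lemma beta: "beta z $ r = pa r b z \<bullet> b z" by (simp only: beta_def beta_nth)

lemma sm_beta: "Cinf_on N (\<lambda>z. beta z $ r)" unfolding beta by (intro Cinf_on_inner N sm_db sm_b)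

lemma pd_beta: assumes "z \<in> N" shows "pa j (\<lambda>z. beta z $ r) z = pa j (pa r b) z \<bullet> b z + pa r b z \<bullet> pa j b z"
  unfolding beta by (rule pd_inner) (rule Cinf_on_differentiable[OF _ assms] sm_bv Cinf_on_pd[OF sm_bv ax])+

lemma pd_beta_commute: assumes "z \<in> N" shows "pa j (\<lambda>z. beta z $ r) z = pa r (\<lambda>z. beta z $ j) z"
  unfolding pd_beta[OF assms] using pd_commute[OF sm_bv assms, of j r] by (simp add: inner_commute)

definition vt :: "real^2 \<Rightarrow> real^3" where
  "vt z = col3 (Gb1 G1 z) - ((1/2) * Gb1 G1 z $ 3 $ 3) *\<^sub>R axis 3 1 - ext3 (beta z)"

lemma dt0_vt: "dt0 y0 Gbar G1 = (\<lambda>z. Q0mT y0 Gbar z *v vt z)"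
  by (rule ext) (simp only: dt0_def vt_def beta_def)

lemma vt_nth: "vt z $ emb i = Gb1 G1 z $ emb i $ 3 - beta z $ i" "vt z $ 3 = Gb1 G1 z $ 3 $ 3 / 2"
  by (simp_all add: vt_def col3_def axis3 ext3_nth proj2_axis)

lemma sm_vt: "Cinf_on N vt"
  unfolding Cinf_on_vec_iff[OF N(1)]
proof
  show "Cinf_on N (\<lambda>z. vt z $ m)" for m
    by (rule cases_3[of _ m]) (unfold vt_nth, intro Cinf_on_diff N sm_Gb1 sm_beta, intro Cinf_on_divide N sm_Gb1 Cinf_on_const, simp)
qed

lemma grad2_nth: "f differentiable (at z) \<Longrightarrow> grad2 f z $ i $ j = pa j (\<lambda>z. f z $ emb i) z"
  by (simp add: grad2_def pd_nth)

lemma symp_nth: "symp A $ i $ j = (A $ i $ j + A $ j $ i) / 2"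
  by (simp add: symp_def transpose_def)

text \<open>The quadratic part of the Riemann tensor becomes inner products of derivatives of b, and
  of \<open>dt0\<close> with second derivatives of \<open>y0\<close>, through the frame
  representation. The second derivatives of the metric match the covariant derivative in
  \<open>jac_frame\<close>, applied to the components of \<open>dt0\<close>. Only the symmetric part
  agrees, since the gradient of \<open>dt0\<close> alone need not be symmetric.\<close>

lemma curvature:
  assumes z: "z \<in> \<omega>"
  shows "symp (transpose (jac b z) ** jac b z + transpose (jac y0 z) ** jac (dt0 y0 Gbar G1) z - (1/2) *\<^sub>R Gb2_22 G2 z) = Rmat Gf z"
proof -
  note zN = wN[OF z]
  have G0: "Gf (pt3 z 0) = Gbar z" by (simp add: Geff_layer layer_0)
  have dd: "(transpose (jac y0 z) ** jac (dt0 y0 Gbar G1) z) $ i $ j = pa j (Gb1 G1) z $ emb i $ 3 - pa j (\<lambda>z. beta z $ i) z - pa j (pa i y0) z \<bullet> dt0 y0 Gbar G1 z" for i j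
  proof -
    have dG1: "Gb1 G1 differentiable (at z)" "(\<lambda>z. Gb1 G1 z $ emb i) differentiable (at z)"
      using Cinf_on_differentiable[OF sm_Gb1v zN] Cinf_on_differentiable[OF Cinf_on_nth[OF N(1) sm_Gb1v] zN] by auto
    have "grad2 vt z $ i $ j = pa j (\<lambda>z. Gb1 G1 z $ emb i $ 3 - beta z $ i) z"
      by (simp add: grad2_nth[OF Cinf_on_differentiable[OF sm_vt zN]] vt_nth)
    also have "\<dots> = pa j (\<lambda>z. Gb1 G1 z $ emb i $ 3) z - pa j (\<lambda>z. beta z $ i) z"
      by (rule pd_eqI[OF has_derivative_diff]) (intro pd_works Cinf_on_differentiable[OF _ zN] sm_Gb1 sm_beta)+
    also have "pa j (\<lambda>z. Gb1 G1 z $ emb i $ 3) z = pa j (Gb1 G1) z $ emb i $ 3" by (simp add: pd_nth dG1)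
    finally show ?thesis using arg_cong[OF jac_frame[OF z sm_vt], of "\<lambda>M. M $ i $ j"]
      by (simp add: dt0_vt GamPair_eq[OF z])
  qed
  have dsy: "pa i (Gb1 G1) z $ 3 $ emb j = pa i (Gb1 G1) z $ emb j $ 3" for i j
  proof -
    have dG1: "Gb1 G1 differentiable (at z)" "(\<lambda>z. Gb1 G1 z $ m) differentiable (at z)" for m
      using Cinf_on_differentiable[OF sm_Gb1v zN] Cinf_on_differentiable[OF Cinf_on_nth[OF N(1) sm_Gb1v] zN] by auto
    have "pa i (\<lambda>z. Gb1 G1 z $ 3 $ emb j) z = pa i (\<lambda>z. Gb1 G1 z $ emb j $ 3) z"
      by (rule pd_cong_open[OF w(1) z]) (rule Gb1_symm)
    then show ?thesis by (simp add: pd_nth dG1)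
  qed
  \<comment> \<open>G_33 is the squared length of b on \<omega>, so its gradient is twice
    \<open>beta\<close>.\<close>
  have d33: "pa i (pa j Gbar) z $ 3 $ 3 = 2 * pa i (\<lambda>z. beta z $ j) z" for i j
  proof -
    have d: "pa j Gbar differentiable (at z)" "(\<lambda>z. pa j Gbar z $ 3) differentiable (at z)"
      using Cinf_on_differentiable[OF Cinf_on_pd[OF smooth(1) ax] zN] Cinf_on_differentiable[OF Cinf_on_nth[OF N(1) Cinf_on_pd[OF smooth(1) ax]] zN] by auto
    have "pa i (pa j Gbar) z $ 3 $ 3 = pa i (\<lambda>z. pa j Gbar z $ 3 $ 3) z" by (simp add: pd_nth d)
    also have "\<dots> = pa i (\<lambda>z. 2 * beta z $ j) z"
      by (rule pd_cong_open[OF w(1) z]) (simp add: pd_Gbar q_simps beta inner_commute)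
    also have "\<dots> = 2 * pa i (\<lambda>z. beta z $ j) z"
      by (rule pd_eqI[OF has_derivative_mult_right]) (intro pd_works Cinf_on_differentiable[OF _ zN] sm_beta)
    finally show ?thesis .
  qed
  have Gbb: "Gb2 z $ emb i $ emb j = Gb2_22 G2 z $ i $ j" for i j
    using arg_cong[OF Gb2(2)[OF z], of "\<lambda>M. M $ i $ j"] by (simp add: blk22_def)
  have gs: "Gb2_22 G2 z $ j $ i = Gb2_22 G2 z $ i $ j" for i j
    using symm_nth[OF Gb2(1)[OF z], of "emb j" "emb i"] by (simp add: Gbb)
  have R: "Rmat Gf z $ i $ j = (1/2) * (pa j (Gb1 G1) z $ emb i $ 3 + pa i (Gb1 G1) z $ emb j $ 3 - Gb2_22 G2 z $ i $ j - 2 * pa i (\<lambda>z. beta z $ j) z)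
     + (pa j b z \<bullet> pa i b z - dt0 y0 Gbar G1 z \<bullet> pa j (pa i y0) z)" for i j
  proof -
    have "(\<Sum>n\<in>UNIV. \<Sum>p\<in>UNIV. Gbar z $ n $ p * (Chr Gf n 3 (emb j) (pt3 z 0) * Chr Gf p (emb i) 3 (pt3 z 0) - Chr Gf n 3 3 (pt3 z 0) * Chr Gf p (emb i) (emb j) (pt3 z 0)))
      = (\<Sum>n\<in>UNIV. \<Sum>p\<in>UNIV. Gbar z $ n $ p * (Chr Gf n (emb j) 3 (pt3 z 0) * Chr Gf p (emb i) 3 (pt3 z 0)))
       - (\<Sum>n\<in>UNIV. \<Sum>p\<in>UNIV. Gbar z $ n $ p * (Chr Gf n 3 3 (pt3 z 0) * Chr Gf p (emb i) (emb j) (pt3 z 0)))"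
      unfolding Chr_commute[OF z, of _ 3 "emb j"] by (simp add: right_diff_distrib sum_subtractf)
    also have "\<dots> = pa j b z \<bullet> pa i b z - dt0 y0 Gbar G1 z \<bullet> pa j (pa i y0) z"
      unfolding Chr_metric[OF z] Chr_mixed[OF z] Chr_normal[OF z] Chr_tangential[OF z] ..
    finally show ?thesis unfolding Rmat_def Riem_def vec_lambda_beta G0 by (simp add: dGf[OF zN] dsy d33 Gbb)
  qed
  show ?thesis unfolding vec_eq_iff
  proof (intro allI)
    fix i j
    show "symp (transpose (jac b z) ** jac b z + transpose (jac y0 z) ** jac (dt0 y0 Gbar G1) z - (1/2) *\<^sub>R Gb2_22 G2 z) $ i $ j = Rmat Gf z $ i $ j"
      unfolding symp_nth vector_add_component vector_minus_component vector_scaleR_component R transpose_jac_mult dd[unfolded transpose_jac_mult]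
      using D2_commute[OF zN, of i j] pd_beta_commute[OF zN, of i j] gs[of j i]
      by (simp add: inner_commute[of "pa j b z" "pa i b z"] inner_commute[of "dt0 y0 Gbar G1 z"])
  qed
qed

lemma B0_Chr:
  assumes z: "z \<in> \<omega>"
  shows "transpose (jac b z) ** jac b z = (\<chi> i j. \<Sum>n\<in>UNIV. \<Sum>p\<in>UNIV. Gbar z $ n $ p * Chr Gf n (emb i) 3 (pt3 z 0) * Chr Gf p (emb j) 3 (pt3 z 0))"
  unfolding vec_eq_iff vec_lambda_beta transpose_jac_mult mult.assoc Chr_metric[OF z] Chr_mixed[OF z] by simp

lemma integral_vec_nth:
  fixes f :: "real \<Rightarrow> ('b::euclidean_space)^'n" assumes "f integrable_on S" shows "integral S f $ i = integral S (\<lambda>t. f t $ i)"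
  using integral_linear[OF assms bounded_linear_vec_nth, of i] by (simp add: o_def)

definition hvec :: "real^3 \<Rightarrow> real^3" where
  "hvec x = oint 0 (x $ 3) (\<lambda>t. col3 (G1 (pt3 (proj2 x) t)))"

definition h33 :: "real^3 \<Rightarrow> real" where
  "h33 x = oint 0 (x $ 3) (\<lambda>t. G1 (pt3 (proj2 x) t) $ 3 $ 3)"

lemma cont_G1: assumes "z \<in> N" "\<And>t. t \<in> S \<Longrightarrow> \<bar>t\<bar> < \<rho>" shows "continuous_on S (\<lambda>t. G1 (pt3 z t) $ i $ j)"
  by (rule continuous_on_compose2[OF Cinf_on_continuous[OF sm_G1]])
     (use assms in \<open>auto simp: thick_def intro!: continuous_on_pt3 continuous_intros\<close>)

lemma cont_col3: assumes "z \<in> N" "\<And>t. t \<in> S \<Longrightarrow> \<bar>t\<bar> < \<rho>" shows "continuous_on S (\<lambda>t. col3 (G1 (pt3 z t)))"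
  unfolding col3_def by (intro continuous_on_vec_lambda cont_G1 assms)

lemma hvec_nth: assumes "x \<in> V" shows "hvec x $ i = oint 0 (x $ 3) (\<lambda>t. G1 (pt3 (proj2 x) t) $ i $ 3)"
proof -
  have "(\<lambda>t. col3 (G1 (pt3 (proj2 x) t))) integrable_on {0..x $ 3}" "(\<lambda>t. col3 (G1 (pt3 (proj2 x) t))) integrable_on {x $ 3..0}"
    using assms by (auto intro!: integrable_continuous_interval cont_col3 simp: thick_def)
  from integral_vec_nth[OF this(1), of i] integral_vec_nth[OF this(2), of i]
  show ?thesis unfolding hvec_def oint_def by (simp add: col3_def)
qed

lemma sm_hvec: "Cinf_on V (\<lambda>x. hvec x $ i)"
  by (rule Cinf_on_cong[OF oV hvec_nth[symmetric] Cinf_on_oint[OF N(1) rho sm_G1]])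

lemma sm_h33: "Cinf_on V h33" unfolding h33_def by (rule Cinf_on_oint[OF N(1) rho sm_G1])

text \<open>The products of \<open>d0\<close> with the frame, that is, \<open>d0\<close> before the
  inverse transpose of \<open>Q0\<close> is applied.\<close>

definition vv :: "real^3 \<Rightarrow> real^3" where
  "vv x = hvec x - ((1/2) * h33 x) *\<^sub>R axis 3 1 - ((x$3)^2/2) *\<^sub>R ext3 (beta (proj2 x))"

lemma d0_vv: "d0 y0 Gbar G1 x = Q0mT y0 Gbar (proj2 x) *v vv x"
  unfolding d0_def Let_def vv_def hvec_def h33_def beta_def by (simp only:)

lemma vv_nth: "vv x $ emb i = hvec x $ emb i - (x$3)^2/2 * beta (proj2 x) $ i" "vv x $ 3 = hvec x $ 3 - h33 x / 2"
  by (simp_all add: vv_def axis3 ext3_nth proj2_axis)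

lemma sm_proj: "Cinf_on N f \<Longrightarrow> Cinf_on V (\<lambda>x. f (proj2 x))" for f :: "real^2 \<Rightarrow> 'b::euclidean_space"
  by (rule Cinf_on_compose[OF oV N(1) Cinf_on_linear[OF oV proj2_linear]]) (auto simp: thick_def)

lemma sm_x3: "Cinf_on V (\<lambda>x. x $ 3)" by (rule Cinf_on_linear[OF oV bounded_linear_vec_nth])

lemma sm_vv: "Cinf_on V (\<lambda>x. vv x $ m)"
proof (rule cases_3[of _ m])
  show "Cinf_on V (\<lambda>x. vv x $ emb r)" for r unfolding vv_nth
    by (intro Cinf_on_diff Cinf_on_mult Cinf_on_divide Cinf_on_power Cinf_on_const oV sm_hvec sm_x3 sm_proj[OF sm_beta]) simp
  show "Cinf_on V (\<lambda>x. vv x $ 3)" unfolding vv_nth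
    by (intro Cinf_on_diff Cinf_on_divide Cinf_on_const oV sm_hvec sm_h33) simp
qed

lemma sm_d0: "Cinf_on V (\<lambda>x. d0 y0 Gbar G1 x $ k)"
  unfolding d0_vv by (intro Cinf_on_mvec oV sm_vv sm_proj[OF sm_Q0mT])

lemma sm_d0v: "Cinf_on V (d0 y0 Gbar G1)" using sm_d0 by (simp add: Cinf_on_vec_iff[OF oV])

lemma sm_slice:
  fixes f :: "real^3 \<Rightarrow> 'b::euclidean_space"
  assumes f: "Cinf_on V f" and s: "\<bar>s\<bar> < \<rho>" shows "Cinf_on N (\<lambda>z. f (pt3 z s))"
proof (rule Cinf_on_compose[OF N(1) oV _ _ f])
  have "Cinf_on N (\<lambda>z. pt3 z s $ m)" for m
    using exhaust_3[of m] by (auto intro: Cinf_on_const[OF N(1)] Cinf_on_linear[OF N(1) bounded_linear_vec_nth])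
  then show "Cinf_on N (\<lambda>z. pt3 z s)" by (simp add: Cinf_on_vec_iff[OF N(1)])
qed (use s in \<open>auto simp: thick_def\<close>)

lemma GamPair_lin: "GamPair G (u + v) z = GamPair G u z + GamPair G v z" "GamPair G (u - v) z = GamPair G u z - GamPair G v z"
  "GamPair G (c *\<^sub>R u) z = c *\<^sub>R GamPair G u z" "GamPair G (- u) z = - GamPair G u z" "GamPair G (axis 3 1) z = Gam3 G z"
  by (simp_all add: GamPair_def Gam3_def vec_eq_iff inner_add_left inner_diff_left inner_axis' Gvec_def)

text \<open>\<open>jac_frame\<close> for \<open>vv\<close> at fixed height. The component along e_3
  carries no tangential gradient and contributes only through the symbols with upper index 3, which
  is why the primitive of the 33 entry appears with \<open>Gam3\<close> alone.\<close>

lemma jac_d0: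
  assumes z: "z \<in> \<omega>" and s: "\<bar>s\<bar> < \<rho>"
  shows "transpose (jac y0 z) ** jac (\<lambda>z. d0 y0 Gbar G1 (pt3 z s)) z =
    grad2 (\<lambda>z. oint 0 s (\<lambda>t. col3 (G1 (pt3 z t)))) z - (s^2/2) *\<^sub>R grad2 (\<lambda>z. ext3 (beta z)) z
    - GamPair Gf (oint 0 s (\<lambda>t. col3 (G1 (pt3 z t)))) z + ((1/2) * oint 0 s (\<lambda>t. G1 (pt3 z t) $ 3 $ 3)) *\<^sub>R Gam3 Gf z
    + (s^2/2) *\<^sub>R GamPair Gf (ext3 (beta z)) z"
proof -
  note zN = wN[OF z]
  have sv: "Cinf_on N (\<lambda>z. vv (pt3 z s))"
    using sm_vv by (intro sm_slice s) (simp add: Cinf_on_vec_iff[OF oV])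
  have sh: "Cinf_on N (\<lambda>z. hvec (pt3 z s))"
    using sm_hvec by (intro sm_slice s) (simp add: Cinf_on_vec_iff[OF oV])
  have se: "Cinf_on N (\<lambda>z. ext3 (beta z))" unfolding Cinf_on_vec_iff[OF N(1)]
  proof
    show "Cinf_on N (\<lambda>z. ext3 (beta z) $ m)" for m
      by (rule cases_3[of _ m]) (simp_all add: ext3_nth sm_beta Cinf_on_const[OF N(1)])
  qed
  have h: "oint 0 s (\<lambda>t. col3 (G1 (pt3 z t))) = hvec (pt3 z s)" "oint 0 s (\<lambda>t. G1 (pt3 z t) $ 3 $ 3) = h33 (pt3 z s)" for z
    by (simp_all add: hvec_def h33_def)
  have g: "grad2 (\<lambda>z. vv (pt3 z s)) z = grad2 (\<lambda>z. hvec (pt3 z s)) z - (s^2/2) *\<^sub>R grad2 (\<lambda>z. ext3 (beta z)) z"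
  proof -
    have "grad2 (\<lambda>z. vv (pt3 z s)) z $ i $ j = (grad2 (\<lambda>z. hvec (pt3 z s)) z - (s^2/2) *\<^sub>R grad2 (\<lambda>z. ext3 (beta z)) z) $ i $ j" for i j
    proof -
      have "grad2 (\<lambda>z. vv (pt3 z s)) z $ i $ j = pa j (\<lambda>z. hvec (pt3 z s) $ emb i - s^2/2 * beta z $ i) z"
        by (simp add: grad2_nth[OF Cinf_on_differentiable[OF sv zN]] vv_nth)
      also have "\<dots> = pa j (\<lambda>z. hvec (pt3 z s) $ emb i) z - s^2/2 * pa j (\<lambda>z. beta z $ i) z"
        by (rule pd_eqI[OF has_derivative_diff[OF _ has_derivative_mult_right]])
           (intro pd_works Cinf_on_differentiable[OF _ zN] sm_beta Cinf_on_nth[OF N(1) sh])+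
      finally show ?thesis
        by (simp add: grad2_nth[OF Cinf_on_differentiable[OF sh zN]] grad2_nth[OF Cinf_on_differentiable[OF se zN]] ext3_nth)
    qed
    then show ?thesis by (simp add: vec_eq_iff)
  qed
  have "transpose (jac y0 z) ** jac (\<lambda>z. d0 y0 Gbar G1 (pt3 z s)) z = grad2 (\<lambda>z. vv (pt3 z s)) z - GamPair Gf (vv (pt3 z s)) z"
    unfolding d0_vv pt3_simps by (rule jac_frame[OF z sv])
  then show ?thesis unfolding g h by (simp add: vv_def GamPair_lin)
qed

end

section \<open>Moments of the second-order strain\<close>

text \<open>Integration by parts with a primitive K of the weight. The boundary term K(1/2) times
  the integral of g vanishes in two ways: for the quadratic weight K is zero at the faces, and for
  the weight t the function g has mean zero.\<close>

lemma moment_oint: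
  fixes g k K :: "real \<Rightarrow> real"
  assumes g: "continuous_on {-1/2..1/2} g" and k: "continuous_on {-1/2..1/2} k"
    and K: "\<And>t. (K has_real_derivative k t) (at t)" and KK: "K (1/2) = K (-1/2)"
    and zero: "K (1/2) = 0 \<or> integral {-1/2..1/2} g = 0"
  shows "integral {-1/2..1/2} (\<lambda>t. k t * oint 0 t g) = - integral {-1/2..1/2} (\<lambda>t. K t * g t)"
proof -
  \<comment> \<open>The same primitive written with base point -1/2, which avoids the case
    distinction on the sign of t.\<close>
  define H where "H = (\<lambda>t. integral {-1/2..t} g - integral {-1/2..0} g)"
  have gi: "g integrable_on {-1/2..1/2}" using g by (rule integrable_continuous_interval)
  have H: "oint 0 t g = H t" if "t \<in> {-1/2..1/2}" for t
  proof (cases "0 \<le> t")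
    case True
    have "integral {-1/2..0} g + integral {0..t} g = integral {-1/2..t} g"
      by (rule Henstock_Kurzweil_Integration.integral_combine) (use True that in \<open>auto intro: integrable_subinterval_real[OF gi]\<close>)
    then show ?thesis using True by (simp add: oint_def H_def)
  next
    case False
    have "integral {-1/2..t} g + integral {t..0} g = integral {-1/2..0} g"
      by (rule Henstock_Kurzweil_Integration.integral_combine) (use False that in \<open>auto intro: integrable_subinterval_real[OF gi]\<close>)
    then show ?thesis using False by (simp add: oint_def H_def)
  qed
  have dH: "(H has_real_derivative g t) (at t within {-1/2..1/2})" if "t \<in> {-1/2..1/2}" for t
    unfolding H_def using integral_has_real_derivative[OF g that] by (auto intro!: derivative_eq_intros)
  have Hc: "continuous_on {-1/2..1/2} H"
    by (rule DERIV_continuous_on[OF dH])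
  have Kc: "continuous_on {-1/2..1/2} K" by (rule DERIV_continuous_on) (rule DERIV_subset[OF K], simp)
  have "((\<lambda>t. k t * H t + K t * g t) has_integral K (1/2) * H (1/2) - K (-1/2) * H (-1/2)) {-1/2..1/2}"
  proof (rule fundamental_theorem_of_calculus)
    fix t :: real assume t: "t \<in> {-1/2..1/2}"
    have "((\<lambda>t. K t * H t) has_real_derivative k t * H t + K t * g t) (at t within {-1/2..1/2})"
      using DERIV_mult[OF has_field_derivative_at_within[OF K] dH[OF t]] by (simp add: mult.commute add.commute)
    then show "((\<lambda>t. K t * H t) has_vector_derivative k t * H t + K t * g t) (at t within {-1/2..1/2})"
      by (simp add: has_real_derivative_iff_has_vector_derivative)
  qed simp
  moreover have "K (1/2) * H (1/2) - K (-1/2) * H (-1/2) = K (1/2) * integral {-1/2..1/2} g"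
    unfolding KK[symmetric] by (simp add: H_def algebra_simps)
  moreover have "K (1/2) * integral {-1/2..1/2} g = 0" using zero by auto
  ultimately have "integral {-1/2..1/2} (\<lambda>t. k t * H t + K t * g t) = 0" by (simp add: integral_unique)
  moreover have "integral {-1/2..1/2} (\<lambda>t. k t * H t + K t * g t) =
      integral {-1/2..1/2} (\<lambda>t. k t * H t) + integral {-1/2..1/2} (\<lambda>t. K t * g t)"
    by (rule Henstock_Kurzweil_Integration.integral_add) (intro integrable_continuous_interval continuous_intros g k Hc Kc)+
  moreover have "integral {-1/2..1/2} (\<lambda>t. k t * oint 0 t g) = integral {-1/2..1/2} (\<lambda>t. k t * H t)"
    by (rule Henstock_Kurzweil_Integration.integral_cong) (simp add: H)
  ultimately show ?thesis by linarith
qed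

lemma cont_leg: "continuous_on S (leg i)"
proof -
  have "leg i = (if i = 0 then (\<lambda>t. 1) else if i = 1 then (\<lambda>t. t) else (\<lambda>t. 6 * t^2 - 1/2))" by (auto simp: leg_def)
  then show ?thesis by (auto intro!: continuous_intros)
qed

lemma leg_moment: "integral {-1/2..1/2} (\<lambda>t. leg i t * (t^2/2)) = (if i = 0 then 1/24 else if i = 1 then 0 else 1/60)"
proof -
  have p: "((\<lambda>t::real. t ^ n) has_integral (if odd n then 0 else (1/2)^n / real (n + 1))) {-1/2..1/2}" for n
  proof -
    have "(\<lambda>t::real. t ^ n) integrable_on {-1/2..1/2}" by (intro integrable_continuous_interval continuous_intros)
    from integrable_integral[OF this] show ?thesis unfolding integral_poly .
  qed
  have "((\<lambda>t::real. (1/2) * t^2) has_integral 1/24) {-1/2..1/2}"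
    using has_integral_mult_right[OF p[of 2], of "1/2"] by (simp add: power2_eq_square)
  moreover have "((\<lambda>t::real. (1/2) * t^3) has_integral 0) {-1/2..1/2}"
    using has_integral_mult_right[OF p[of 3], of "1/2"] by simp
  moreover have "((\<lambda>t::real. 3 * t^4 - (1/4) * t^2) has_integral 1/60) {-1/2..1/2}"
    using has_integral_diff[OF has_integral_mult_right[OF p[of 4], of 3] has_integral_mult_right[OF p[of 2], of "1/4"]]
    by (simp add: power_divide)
  moreover have "(\<lambda>t. leg i t * (t^2/2)) = (if i = 0 then (\<lambda>t. (1/2) * t^2) else if i = 1 then (\<lambda>t. (1/2) * t^3) else (\<lambda>t. 3 * t^4 - (1/4) * t^2))"
    by (auto simp: leg_def power2_eq_square power3_eq_cube power4_eq_xxxx algebra_simps diff_divide_distrib)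
  ultimately show ?thesis by (auto simp: integral_unique)
qed

lemma symm_iff: "symm A \<longleftrightarrow> (\<forall>i j. A $ i $ j = A $ j $ i)"
  by (auto simp: symm_def transpose_def vec_eq_iff)

context plate_geom begin

lemma GamPair_symm: "z \<in> \<omega> \<Longrightarrow> symm (GamPair Gf v z)"
  using D2_commute[OF wN] by (simp add: symm_iff GamPair_eq)

lemma Gam3_symm: "z \<in> \<omega> \<Longrightarrow> symm (Gam3 Gf z)"
  using GamPair_symm[of z "axis 3 1"] by (simp add: GamPair_lin)

definition dk :: "(real \<Rightarrow> real) \<Rightarrow> real^2 \<Rightarrow> real^3" where
  "dk k z = integral {-1/2..1/2} (\<lambda>t. k t *\<^sub>R d0 y0 Gbar G1 (pt3 z t))"

lemma pt3_V: "z \<in> N \<Longrightarrow> t \<in> {-1/2..1/2} \<Longrightarrow> pt3 z t \<in> V" using rho by (auto simp: thick_def abs_less_iff)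

lemma cont_slice:
  fixes f :: "real^3 \<Rightarrow> 'b::euclidean_space"
  assumes "Cinf_on V f" "z \<in> N" shows "continuous_on {-1/2..1/2} (\<lambda>t. f (pt3 z t))"
  by (rule continuous_on_compose2[OF Cinf_on_continuous[OF assms(1)]])
     (use pt3_V[OF assms(2)] in \<open>auto intro!: continuous_on_pt3 continuous_intros\<close>)

context
  fixes k :: "real \<Rightarrow> real" assumes k: "continuous_on {-1/2..1/2} k"
begin

lemma slice_int:
  fixes f :: "real^3 \<Rightarrow> real"
  assumes "Cinf_on V f" "z \<in> N" shows "(\<lambda>t. k t * f (pt3 z t)) integrable_on {-1/2..1/2}"
  by (intro integrable_continuous_interval continuous_intros k cont_slice assms)

lemma dk_nth: assumes "z \<in> N" shows "dk k z $ m = integral {-1/2..1/2} (\<lambda>t. k t * d0 y0 Gbar G1 (pt3 z t) $ m)"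
proof -
  have "(\<lambda>t. k t *\<^sub>R d0 y0 Gbar G1 (pt3 z t)) integrable_on {-1/2..1/2}"
    by (intro integrable_continuous_interval continuous_intros k cont_slice[OF sm_d0v assms])
  from integral_vec_nth[OF this, of m] show ?thesis by (simp add: dk_def)
qed

lemma sm_dk: "Cinf_on N (\<lambda>z. dk k z $ m)"
  by (rule Cinf_on_cong[OF N(1) dk_nth[symmetric] Cinf_on_thickness_integral[OF N(1) rho k sm_d0]])

lemma sm_dkv: "Cinf_on N (dk k)" using sm_dk by (simp add: Cinf_on_vec_iff[OF N(1)])

lemma pd_dk: assumes z: "z \<in> N"
  shows "pa j (dk k) z $ m = integral {-1/2..1/2} (\<lambda>t. k t * pd (axis (emb j) 1) (\<lambda>x. d0 y0 Gbar G1 x $ m) (pt3 z t))"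
proof -
  have "pa j (dk k) z $ m = pa j (\<lambda>z. dk k z $ m) z" by (rule pd_nth[OF Cinf_on_differentiable[OF sm_dkv z], symmetric])
  also have "\<dots> = pa j (\<lambda>z. integral {-1/2..1/2} (\<lambda>t. k t * d0 y0 Gbar G1 (pt3 z t) $ m)) z"
    by (rule pd_cong_open[OF N(1) z dk_nth])
  also have "\<dots> = integral {-1/2..1/2} (\<lambda>t. k t * pd (axis (emb j) 1) (\<lambda>x. d0 y0 Gbar G1 x $ m) (pt3 z t))"
    by (rule pd_thickness_integral[OF N(1) rho k sm_d0 z])
  finally show ?thesis .
qed

lemma dk_vv: assumes z: "z \<in> N"
  shows "dk k z = Q0mT y0 Gbar z *v (\<chi> j. integral {-1/2..1/2} (\<lambda>t. k t * vv (pt3 z t) $ j))"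
proof -
  have "dk k z $ m = (\<Sum>j\<in>UNIV. Q0mT y0 Gbar z $ m $ j * integral {-1/2..1/2} (\<lambda>t. k t * vv (pt3 z t) $ j))" for m
  proof -
    have "((\<lambda>t. \<Sum>j\<in>UNIV. Q0mT y0 Gbar z $ m $ j * (k t * vv (pt3 z t) $ j)) has_integral
        (\<Sum>j\<in>UNIV. Q0mT y0 Gbar z $ m $ j * integral {-1/2..1/2} (\<lambda>t. k t * vv (pt3 z t) $ j))) {-1/2..1/2}"
      by (intro has_integral_sum finite has_integral_mult_right integrable_integral slice_int[OF sm_vv z])
    then show ?thesis unfolding dk_nth[OF z] d0_vv
      by (intro integral_unique) (simp add: mult_vec_nth sum_distrib_left mult_ac)
  qed
  then show ?thesis by (simp add: vec_eq_iff mult_vec_nth)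
qed

lemma vv_moment:
  assumes z: "z \<in> N"
  shows "integral {-1/2..1/2} (\<lambda>t. k t * vv (pt3 z t) $ emb r) =
      integral {-1/2..1/2} (\<lambda>t. k t * oint 0 t (\<lambda>t. G1 (pt3 z t) $ emb r $ 3)) - integral {-1/2..1/2} (\<lambda>t. k t * (t^2/2)) * beta z $ r" (is ?A)
    and "integral {-1/2..1/2} (\<lambda>t. k t * vv (pt3 z t) $ 3) =
      integral {-1/2..1/2} (\<lambda>t. k t * oint 0 t (\<lambda>t. G1 (pt3 z t) $ 3 $ 3)) / 2" (is ?B)
proof -
  have h: "hvec (pt3 z t) $ i = oint 0 t (\<lambda>t. G1 (pt3 z t) $ i $ 3)" if "t \<in> {-1/2..1/2}" for t i
    using hvec_nth[OF pt3_V[OF z that]] by simp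
  have "integral {-1/2..1/2} (\<lambda>t. k t * vv (pt3 z t) $ emb r) = integral {-1/2..1/2} (\<lambda>t. k t * hvec (pt3 z t) $ emb r - k t * (t^2/2) * beta z $ r)"
    by (simp add: vv_nth algebra_simps)
  also have "\<dots> = integral {-1/2..1/2} (\<lambda>t. k t * hvec (pt3 z t) $ emb r) - integral {-1/2..1/2} (\<lambda>t. k t * (t^2/2)) * beta z $ r"
    unfolding integral_mult_left[symmetric]
    by (rule Henstock_Kurzweil_Integration.integral_diff[OF slice_int[OF sm_hvec z]]) (intro integrable_continuous_interval continuous_intros k, simp)
  also have "integral {-1/2..1/2} (\<lambda>t. k t * hvec (pt3 z t) $ emb r) = integral {-1/2..1/2} (\<lambda>t. k t * oint 0 t (\<lambda>t. G1 (pt3 z t) $ emb r $ 3))"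
    by (rule Henstock_Kurzweil_Integration.integral_cong) (simp add: h)
  finally show ?A .
  have "integral {-1/2..1/2} (\<lambda>t. k t * vv (pt3 z t) $ 3) = integral {-1/2..1/2} (\<lambda>t. k t * oint 0 t (\<lambda>t. G1 (pt3 z t) $ 3 $ 3) / 2)"
    by (rule Henstock_Kurzweil_Integration.integral_cong) (simp add: vv_nth h h33_def)
  then show ?B by simp
qed

end

lemma cont_G1_slice: "z \<in> N \<Longrightarrow> continuous_on {-1/2..1/2} (\<lambda>t. G1 (pt3 z t) $ i $ j)"
  by (rule cont_slice[OF sm_G1])

text \<open>By parts, the weight becomes 2 t^3 - t/2, the one in \<open>Gb1\<close>. The factor 60
  there is the reciprocal of the moment 1/60 of t^2/2, so that the \<open>G1\<close> terms and the
  \<open>beta\<close> term scale alike.\<close>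

lemma dk_leg2: assumes z: "z \<in> N" shows "dk (leg 2) z = (1/60) *\<^sub>R dt0 y0 Gbar G1 z"
proof -
  have o: "integral {-1/2..1/2} (\<lambda>t. leg 2 t * oint 0 t (\<lambda>t. G1 (pt3 z t) $ i $ 3)) = Gb1 G1 z $ i $ 3 / 60" for i
  proof -
    have "integral {-1/2..1/2} (\<lambda>t. leg 2 t * oint 0 t (\<lambda>t. G1 (pt3 z t) $ i $ 3)) =
        - integral {-1/2..1/2} (\<lambda>t. (2*t^3 - t/2) * G1 (pt3 z t) $ i $ 3)"
      by (rule moment_oint[OF cont_G1_slice[OF z] cont_leg])
         (auto simp: leg_def power2_eq_square power3_eq_cube intro!: derivative_eq_intros)
    then show ?thesis by (simp add: Gb1_def)
  qed
  have "(\<chi> j. integral {-1/2..1/2} (\<lambda>t. leg 2 t * vv (pt3 z t) $ j)) $ m = ((1/60) *\<^sub>R vt z) $ m" for m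
    by (rule cases_3[of _ m]) (unfold vec_lambda_beta vv_moment[OF cont_leg z] o leg_moment, simp_all add: vt_nth diff_divide_distrib)
  then have "(\<chi> j. integral {-1/2..1/2} (\<lambda>t. leg 2 t * vv (pt3 z t) $ j)) = (1/60) *\<^sub>R vt z" by (simp only: vec_eq_iff simp_thms)
  then show ?thesis unfolding dk_vv[OF cont_leg z] dt0_vt by (simp add: matrix_vector_mult_scaleR)
qed

definition mu :: "real^2 \<Rightarrow> real" where "mu z = integral {-1/2..1/2} (\<lambda>t. (t^2/2) * G1 (pt3 z t) $ 3 $ 3)"

lemma cont_sq: "continuous_on S (\<lambda>t::real. t^2/2)" by (intro continuous_intros) simp

lemma mvec_nth: assumes z: "z \<in> N" shows "mvec G1 z $ i = integral {-1/2..1/2} (\<lambda>t. (t^2/2) * G1 (pt3 z t) $ i $ 3)"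
proof -
  have "continuous_on {-1/2..1/2} (\<lambda>t. col3 (G1 (pt3 z t)))"
    unfolding col3_def by (intro continuous_on_vec_lambda cont_G1_slice z)
  then have "(\<lambda>t. (t^2/2) *\<^sub>R col3 (G1 (pt3 z t))) integrable_on {-1/2..1/2}"
    by (intro integrable_continuous_interval continuous_on_scaleR cont_sq)
  from integral_vec_nth[OF this, of i] show ?thesis by (simp add: mvec_def col3_def)
qed

lemma sm_mvec: "Cinf_on N (\<lambda>z. mvec G1 z $ i)"
  by (rule Cinf_on_cong[OF N(1) mvec_nth[symmetric] Cinf_on_thickness_integral[OF N(1) rho cont_sq sm_G1]])

lemma sm_mu: "Cinf_on N mu" unfolding mu_def by (rule Cinf_on_thickness_integral[OF N(1) rho cont_sq sm_G1])

lemma mean_nth: assumes z: "z \<in> \<omega>" shows "integral {-1/2..1/2} (\<lambda>t. G1 (pt3 z t) $ i $ j) = 0"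
proof -
  have c: "(\<lambda>t. G1 (pt3 z t)) integrable_on {-1/2..1/2}" "(\<lambda>t. G1 (pt3 z t) $ i) integrable_on {-1/2..1/2}"
    using cont_slice[OF smooth(4) wN[OF z]] cont_slice[OF Cinf_on_nth[OF oV smooth(4)] wN[OF z]]
    by (auto intro: integrable_continuous_interval)
  have "integral {-1/2..1/2} (\<lambda>t. G1 (pt3 z t)) $ i $ j = 0" by (simp only: mean[OF z] zero_index)
  then show ?thesis by (simp only: integral_vec_nth[OF c(1)] integral_vec_nth[OF c(2)])
qed

definition vm :: "real^2 \<Rightarrow> real^3" where "vm z = (mu z / 2) *\<^sub>R axis 3 1 - mvec G1 z"

lemma sm_vm: "Cinf_on N vm"
  unfolding Cinf_on_vec_iff[OF N(1)]
proof
  show "Cinf_on N (\<lambda>z. vm z $ m)" for m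
    by (rule cases_3[of _ m]; simp add: vm_def axis3; intro Cinf_on_diff Cinf_on_divide Cinf_on_uminus Cinf_on_const sm_mu sm_mvec N; simp)
qed

text \<open>By parts, the weight t becomes t^2/2 and produces -m; the mean-zero condition on
  \<open>G1\<close> disposes of the boundary values. The \<open>beta\<close> term has an odd
  integrand and drops out.\<close>

lemma dk_leg1: assumes z: "z \<in> \<omega>" shows "dk (\<lambda>t. t) z = Q0mT y0 Gbar z *v vm z"
proof -
  note zN = wN[OF z]
  have o: "integral {-1/2..1/2} (\<lambda>t. t * oint 0 t (\<lambda>t. G1 (pt3 z t) $ i $ 3)) = - mvec G1 z $ i" for i
    unfolding mvec_nth[OF zN]
    by (rule moment_oint[OF cont_G1_slice[OF zN] continuous_on_id _ _ disjI2[OF mean_nth[OF z]]])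
       (auto simp: power2_eq_square intro!: derivative_eq_intros)
  have b: "integral {-1/2..1/2} (\<lambda>t::real. t * (t^2/2)) = 0" using leg_moment[of 1] by (simp add: leg_def)
  have mu3: "mu z = mvec G1 z $ 3" by (simp only: mu_def mvec_nth[OF zN])
  have "(\<chi> j. integral {-1/2..1/2} (\<lambda>t. t * vv (pt3 z t) $ j)) $ m = vm z $ m" for m
  proof (rule cases_3[of _ m])
    show "(\<chi> j. integral {-1/2..1/2} (\<lambda>t. t * vv (pt3 z t) $ j)) $ emb r = vm z $ emb r" for r
      unfolding vec_lambda_beta vv_moment(1)[OF continuous_on_id zN] o b by (simp add: vm_def axis3)
    show "(\<chi> j. integral {-1/2..1/2} (\<lambda>t. t * vv (pt3 z t) $ j)) $ 3 = vm z $ 3"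
      unfolding vec_lambda_beta vv_moment(2)[OF continuous_on_id zN] o by (simp add: vm_def mu3)
  qed
  then have "(\<chi> j. integral {-1/2..1/2} (\<lambda>t. t * vv (pt3 z t) $ j)) = vm z" by (simp only: vec_eq_iff simp_thms)
  then show ?thesis unfolding dk_vv[OF continuous_on_id zN] by simp
qed

text \<open>The first moment of \<open>d0\<close> is the frame image of \<open>vm\<close>, to which
  \<open>jac_frame\<close> applies. \<open>vm\<close> differs from -m only along e_3, invisible to
  \<open>grad2\<close> but picked up by \<open>GamPair\<close> as the \<open>Gam3\<close>
  term.\<close>

lemma B1_Chr: assumes z: "z \<in> \<omega>"
  shows "B1 y0 Gbar G1 G2 z = - grad2 (mvec G1) z + GamPair Gf (mvec G1 z) z
       - ((1/2) * integral {-1/2..1/2} (\<lambda>t. (t^2/2) * G1 (pt3 z t) $ 3 $ 3)) *\<^sub>R Gam3 Gf z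
       - (1/4) *\<^sub>R integral {-1/2..1/2} (\<lambda>t. t *\<^sub>R blk22 (G2 (pt3 z t)))"
proof -
  note zN = wN[OF z]
  have smv: "Cinf_on N (mvec G1)" using sm_mvec by (simp add: Cinf_on_vec_iff[OF N(1)])
  have dkj: "dk (\<lambda>t. t) = (\<lambda>z. integral {-1/2..1/2} (\<lambda>t. t *\<^sub>R d0 y0 Gbar G1 (pt3 z t)))" by (rule ext) (simp only: dk_def)
  have "jac (dk (\<lambda>t. t)) z = jac (\<lambda>z. Q0mT y0 Gbar z *v vm z) z"
    unfolding jac_def by (simp add: pd_cong_open[OF w(1) z dk_leg1])
  then have "transpose (jac y0 z) ** jac (dk (\<lambda>t. t)) z = grad2 vm z - GamPair Gf (vm z) z"
    using jac_frame[OF z sm_vm] by simp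
  moreover have "grad2 vm z = - grad2 (mvec G1) z"
  proof -
    have "grad2 vm z $ i $ j = - grad2 (mvec G1) z $ i $ j" for i j
    proof -
      have "grad2 vm z $ i $ j = pa j (\<lambda>z. - mvec G1 z $ emb i) z"
        by (simp add: grad2_nth[OF Cinf_on_differentiable[OF sm_vm zN]] vm_def axis3)
      also have "\<dots> = - pa j (\<lambda>z. mvec G1 z $ emb i) z"
        by (rule pd_eqI[OF has_derivative_minus]) (intro pd_works Cinf_on_differentiable[OF sm_mvec zN])
      finally show ?thesis by (simp add: grad2_nth[OF Cinf_on_differentiable[OF smv zN]])
    qed
    then show ?thesis by (simp add: vec_eq_iff)
  qed
  ultimately show ?thesis
    unfolding B1_def dkj[symmetric] mu_def[symmetric] by (simp add: vm_def GamPair_lin)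
qed

text \<open>The field II as it stands in the energy, before symmetrisation.\<close>

definition IIm :: "real^3 \<Rightarrow> mat2" where
  "IIm x = ((x$3)^2/2) *\<^sub>R (transpose (jac b (proj2 x)) ** jac b (proj2 x))
      + transpose (jac y0 (proj2 x)) ** jac (\<lambda>z. d0 y0 Gbar G1 (pt3 z (x$3))) (proj2 x)
      - (1/4) *\<^sub>R blk22 (G2 x)"

lemma II_sym_IIm: "II_sym y0 Gbar G1 G2 x = symp (IIm x)" by (simp add: II_sym_def IIm_def)

lemma IIm_nth: assumes x: "x \<in> V"
  shows "IIm x $ i $ j = (x$3)^2/2 * (pa i b (proj2 x) \<bullet> pa j b (proj2 x))
    + (\<Sum>m\<in>UNIV. pa i y0 (proj2 x) $ m * pd (axis (emb j) 1) (\<lambda>x. d0 y0 Gbar G1 x $ m) x) - G2 x $ emb i $ emb j / 4"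
proof -
  have d: "d0 y0 Gbar G1 differentiable (at x)" by (rule Cinf_on_differentiable[OF sm_d0v x])
  have "pa j (\<lambda>z. d0 y0 Gbar G1 (pt3 z (x $ 3))) (proj2 x) = pd (axis (emb j) 1) (d0 y0 Gbar G1) x"
    using pd_slice[of "d0 y0 Gbar G1" "proj2 x" "x $ 3" j] d by simp
  then show ?thesis by (simp add: IIm_def transpose_jac_mult blk22_def inner_vec_def pd_nth[OF d])
qed

lemma sm_IIm: "Cinf_on V (\<lambda>x. IIm x $ i $ j)"
proof (rule Cinf_on_cong[OF oV IIm_nth[symmetric]])
  have ae: "axis (emb j) (1::real) \<in> Basis" by (simp add: axis_in_Basis_iff)
  show "Cinf_on V (\<lambda>x. (x$3)^2/2 * (pa i b (proj2 x) \<bullet> pa j b (proj2 x))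
    + (\<Sum>m\<in>UNIV. pa i y0 (proj2 x) $ m * pd (axis (emb j) 1) (\<lambda>x. d0 y0 Gbar G1 x $ m) x) - G2 x $ emb i $ emb j / 4)"
    by (intro Cinf_on_diff Cinf_on_add Cinf_on_mult Cinf_on_sum Cinf_on_divide Cinf_on_power Cinf_on_const oV sm_x3 Cinf_on_inner sm_G2
        sm_proj[OF sm_db] sm_proj[OF sm_dy] Cinf_on_pd[OF sm_d0 ae]) simp_all
qed

definition Mom :: "(real \<Rightarrow> real) \<Rightarrow> real^2 \<Rightarrow> mat2" where
  "Mom k z = (\<chi> i j. integral {-1/2..1/2} (\<lambda>t. k t * IIm (pt3 z t) $ i $ j))"

lemma sm_Mom: "continuous_on {-1/2..1/2} k \<Longrightarrow> Cinf_on N (\<lambda>z. Mom k z $ i $ j)"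
  unfolding Mom_def vec_lambda_beta by (rule Cinf_on_thickness_integral[OF N(1) rho _ sm_IIm])

lemma integral_blk22:
  assumes k: "continuous_on {-1/2..1/2} k" and z: "z \<in> N"
  shows "integral {-1/2..1/2} (\<lambda>t. k t *\<^sub>R blk22 (G2 (pt3 z t))) $ i $ j = integral {-1/2..1/2} (\<lambda>t. k t * G2 (pt3 z t) $ emb i $ emb j)"
proof -
  have "continuous_on {-1/2..1/2} (\<lambda>t. blk22 (G2 (pt3 z t)))"
    unfolding blk22_def by (intro continuous_on_vec_lambda cont_slice[OF sm_G2 z])
  then have c: "continuous_on {-1/2..1/2} (\<lambda>t. k t *\<^sub>R blk22 (G2 (pt3 z t)))" by (intro continuous_on_scaleR k)
  have "integral {-1/2..1/2} (\<lambda>t. k t *\<^sub>R blk22 (G2 (pt3 z t))) $ i $ j = integral {-1/2..1/2} (\<lambda>t. (k t *\<^sub>R blk22 (G2 (pt3 z t))) $ i) $ j"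
    by (simp only: integral_vec_nth[OF integrable_continuous_interval[OF c]])
  also have "\<dots> = integral {-1/2..1/2} (\<lambda>t. (k t *\<^sub>R blk22 (G2 (pt3 z t))) $ i $ j)"
    by (rule integral_vec_nth, rule integrable_continuous_interval) (rule bounded_linear.continuous_on[OF bounded_linear_vec_nth c])
  finally show ?thesis by (simp add: blk22_def)
qed

text \<open>Taking thickness moments commutes with planar derivatives, so the moment of the gradient
  of \<open>d0\<close> is the gradient of the moment \<open>dk\<close>.\<close>

lemma Mom_eq:
  assumes k: "continuous_on {-1/2..1/2} k" and z: "z \<in> N"
  shows "Mom k z = integral {-1/2..1/2} (\<lambda>t. k t * (t^2/2)) *\<^sub>R (transpose (jac b z) ** jac b z)
     + transpose (jac y0 z) ** jac (dk k) z - (1/4) *\<^sub>R integral {-1/2..1/2} (\<lambda>t. k t *\<^sub>R blk22 (G2 (pt3 z t)))"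
proof -
  have M: "Mom k z $ i $ j = integral {-1/2..1/2} (\<lambda>t. k t * (t^2/2)) * (pa i b z \<bullet> pa j b z)
     + (\<Sum>m\<in>UNIV. pa i y0 z $ m * pa j (dk k) z $ m) - (1/4) * integral {-1/2..1/2} (\<lambda>t. k t * G2 (pt3 z t) $ emb i $ emb j)" for i j
  proof -
    have ae: "axis (emb j) (1::real) \<in> Basis" by (simp add: axis_in_Basis_iff)
    have "((\<lambda>t. k t * (t^2/2) * (pa i b z \<bullet> pa j b z)
        + (\<Sum>m\<in>UNIV. pa i y0 z $ m * (k t * pd (axis (emb j) 1) (\<lambda>x. d0 y0 Gbar G1 x $ m) (pt3 z t))) - (1/4) * (k t * G2 (pt3 z t) $ emb i $ emb j))
      has_integral integral {-1/2..1/2} (\<lambda>t. k t * (t^2/2)) * (pa i b z \<bullet> pa j b z)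
     + (\<Sum>m\<in>UNIV. pa i y0 z $ m * pa j (dk k) z $ m) - (1/4) * integral {-1/2..1/2} (\<lambda>t. k t * G2 (pt3 z t) $ emb i $ emb j)) {-1/2..1/2}"
      unfolding pd_dk[OF k z]
      by (intro has_integral_diff has_integral_add has_integral_sum finite has_integral_mult_right has_integral_mult_left integrable_integral
          slice_int[OF k sm_G2 z] slice_int[OF k Cinf_on_pd[OF sm_d0 ae] z] integrable_continuous_interval continuous_on_mult k cont_sq)
    moreover have "integral {-1/2..1/2} (\<lambda>t. k t * IIm (pt3 z t) $ i $ j) = integral {-1/2..1/2} (\<lambda>t. k t * (t^2/2) * (pa i b z \<bullet> pa j b z)
        + (\<Sum>m\<in>UNIV. pa i y0 z $ m * (k t * pd (axis (emb j) 1) (\<lambda>x. d0 y0 Gbar G1 x $ m) (pt3 z t))) - (1/4) * (k t * G2 (pt3 z t) $ emb i $ emb j))"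
      by (rule Henstock_Kurzweil_Integration.integral_cong) (simp add: IIm_nth[OF pt3_V[OF z]] algebra_simps sum_distrib_left)
    ultimately show ?thesis unfolding Mom_def vec_lambda_beta by (simp only: integral_unique)
  qed
  show ?thesis unfolding vec_eq_iff M vector_minus_component vector_add_component vector_scaleR_component transpose_jac_mult integral_blk22[OF k z]
    by (simp add: inner_vec_def)
qed

text \<open>The extra gradient of the mean of \<open>d0\<close> is exactly what the term I of the
  energy subtracts; the two cancel in \<open>I4O_eq\<close>.\<close>

lemma Mom_0: assumes z: "z \<in> N"
  shows "Mom (leg 0) z = B0 y0 Gbar G2 z + transpose (jac y0 z) ** jac (\<lambda>z. integral {-1/2..1/2} (\<lambda>t. d0 y0 Gbar G1 (pt3 z t))) z"
  unfolding Mom_eq[OF cont_leg z] leg_moment dk_def by (simp add: leg_def B0_def)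

lemma Mom_1: assumes z: "z \<in> N" shows "Mom (leg 1) z = B1 y0 Gbar G1 G2 z"
  unfolding Mom_eq[OF cont_leg z] leg_moment dk_def by (simp add: leg_def B1_def)

text \<open>All three parts carry the factor 1/60: the first by the moment of t^2/2, the second by
  \<open>dk_leg2\<close>, the third because 1/4 of the moment of \<open>G2\<close> is
  \<open>Gb2_22\<close> divided by 120.\<close>

lemma Mom_2: assumes z: "z \<in> N"
  shows "Mom (leg 2) z = (1/60) *\<^sub>R (transpose (jac b z) ** jac b z + transpose (jac y0 z) ** jac (dt0 y0 Gbar G1) z - (1/2) *\<^sub>R Gb2_22 G2 z)"
proof -
  have sd: "dt0 y0 Gbar G1 differentiable (at z)"
  proof (rule Cinf_on_differentiable[OF _ z])
    show "Cinf_on N (dt0 y0 Gbar G1)" unfolding dt0_vt Cinf_on_vec_iff[OF N(1)]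
      by (intro allI Cinf_on_mvec N sm_Q0mT Cinf_on_nth[OF N(1) sm_vt])
  qed
  have d: "pa j (dk (leg 2)) z = (1/60) *\<^sub>R pa j (dt0 y0 Gbar G1) z" for j
  proof -
    have "pa j (dk (leg 2)) z = pa j (\<lambda>z. (1/60) *\<^sub>R dt0 y0 Gbar G1 z) z" by (rule pd_cong_open[OF N(1) z dk_leg2])
    also have "\<dots> = (1/60) *\<^sub>R pa j (dt0 y0 Gbar G1) z" by (rule pd_eqI[OF has_derivative_scaleR_right]) (intro pd_works sd)
    finally show ?thesis .
  qed
  have g: "Gb2_22 G2 z = 30 *\<^sub>R integral {-1/2..1/2} (\<lambda>t. leg 2 t *\<^sub>R blk22 (G2 (pt3 z t)))"
    unfolding Gb2_22_def integral_cmul[symmetric] by (simp add: leg_def)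
  show ?thesis unfolding Mom_eq[OF cont_leg z] leg_moment g
    by (simp add: vec_eq_iff transpose_jac_mult d algebra_simps)
qed

end

section \<open>The limiting energy\<close>

lemma L2_on_AE_cong:
  fixes f g :: "real^'n \<Rightarrow> real"
  assumes S: "S \<in> sets lebesgue" and f: "L2_on S f" and ae: "AE x in lebesgue. x \<in> S \<longrightarrow> f x = g x"
  shows "L2_on S g"
proof -
  have m: "f \<in> borel_measurable (lebesgue_on S)" using f by (simp add: L2_on_def)
  have "(\<lambda>x. if x \<in> S then g x else 0) \<in> borel_measurable lebesgue"
  proof (rule borel_measurable_AE)
    show "(\<lambda>x. if x \<in> S then f x else 0) \<in> borel_measurable lebesgue" using m S by (simp add: borel_measurable_if)
    show "AE x in lebesgue. (if x \<in> S then f x else 0) = (if x \<in> S then g x else 0)" using ae by eventually_elim auto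
  qed
  then have g: "g \<in> borel_measurable (lebesgue_on S)" using S by (simp add: borel_measurable_if)
  have "AE x in lebesgue_on S. norm (f x) ^ 2 = norm (g x) ^ 2"
    using ae S by (subst AE_restrict_space_iff) (auto elim: eventually_mono)
  from integrable_cong_AE_imp[OF _ _ this] show ?thesis using f g by (simp add: L2_on_def)
qed

lemma L2_on_mat_iff:
  fixes A :: "real^'k \<Rightarrow> real^'n^'m"
  shows "L2_on S A \<longleftrightarrow> (\<forall>i j. L2_on S (\<lambda>z. A z $ i $ j))"
  by (simp add: L2_on_vec_iff L2_on_vec_iff[of S "\<lambda>z. A z $ i" for i])

lemma L2_on_product:
  fixes f g :: "real^'n \<Rightarrow> real"
  assumes m: "f \<in> borel_measurable (lebesgue_on S)" "g \<in> borel_measurable (lebesgue_on S)"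
    and i: "integrable (lebesgue_on S) (\<lambda>x. f x ^ 4)" "integrable (lebesgue_on S) (\<lambda>x. g x ^ 4)"
  shows "L2_on S (\<lambda>x. f x * g x)"
proof -
  have "integrable (lebesgue_on S) (\<lambda>x. norm (f x * g x) ^ 2)"
  proof (rule Bochner_Integration.integrable_bound)
    show "integrable (lebesgue_on S) (\<lambda>x. f x ^ 4 + g x ^ 4)" using i by simp
    have "(f x * g x)^2 \<le> f x ^ 4 + g x ^ 4" for x
    proof -
      have "2 * (f x * g x)^2 \<le> f x ^ 4 + g x ^ 4"
        using sum_squares_bound[of "f x ^ 2" "g x ^ 2"] by (simp add: power_mult_distrib)
      then show ?thesis using zero_le_power2[of "f x * g x"] by linarith
    qed
    then show "AE x in lebesgue_on S. norm (norm (f x * g x) ^ 2) \<le> norm (f x ^ 4 + g x ^ 4)" by simp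
  qed (use m in simp)
  then show ?thesis using m by (simp add: L2_on_def)
qed

lemma W12_nth:
  fixes u :: "real^'n \<Rightarrow> real^'m"
  assumes "open U" "W12 U u Du" shows "W12 U (\<lambda>x. u x $ l) (\<lambda>j x. Du j x $ l)"
  using assms weak_partials_linear[OF assms(1) _ bounded_linear_vec_nth, of u Du l] unfolding W12_def
  by (simp add: L2_on_vec_iff)

lemma symm_symp: "symm (symp A)" by (simp add: symm_iff symp_def transpose_def add.commute)

lemma symp_add: "symp (A + B) = symp A + symp B" and symp_diff: "symp (A - B) = symp A - symp B"
  and symp_scaleR: "symp (c *\<^sub>R A) = c *\<^sub>R symp A" and symp_sum: "symp (\<Sum>i\<in>I. F i) = (\<Sum>i\<in>I. symp (F i))"
  by (simp_all add: vec_eq_iff symp_def transpose_def algebra_simps sum.distrib sum_divide_distrib add_divide_distrib)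

lemma symp_eq: "symm A \<Longrightarrow> symp A = A" by (simp add: symp_def symm_def scaleR_2[symmetric])

lemma Basis_mat: assumes "e \<in> (Basis :: (real^'n^'m) set)" shows "\<exists>i j. \<forall>A. A \<bullet> e = A $ i $ j"
proof -
  obtain i j where "e = axis i (axis j 1)" using assms by (auto simp: Basis_vec_def)
  then have "\<forall>A. A \<bullet> e = A $ i $ j" by (simp add: inner_axis)
  then show ?thesis by blast
qed

lemma sum_less_3: "(\<Sum>i<3. f i) = f 0 + f 1 + f (2::nat)" by (simp add: numeral_3_eq_3 numeral_2_eq_2)

text \<open>Joins the geometry with the reduced form. Of \<open>W\<close> it retains that
  \<open>Q2\<close> is the diagonal of a plate form and is blind to skew parts.\<close>

locale plate_energy = plate_geom \<omega> N \<rho> Gbar G1 G2 Gb2 y0 + pf: plate_form \<omega> "Q2b W Gbar"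
  for \<omega> N \<rho> Gbar G1 G2 Gb2 y0 and W :: "mat3 \<Rightarrow> ennreal" +
  assumes dg: "\<And>z F. Q2b W Gbar z F F = Q2 W Gbar z F"
    and sy: "\<And>z F. z \<in> \<omega> \<Longrightarrow> Q2 W Gbar z (symp F) = Q2 W Gbar z F"
    and lip: "lipschitz_domain2 \<omega>"
begin

lemma N_bdd:
  fixes f :: "real^2 \<Rightarrow> real"
  assumes "Cinf_on N f" shows "f \<in> borel_measurable (lebesgue_on \<omega>)" "\<exists>C. \<forall>z\<in>\<omega>. \<bar>f z\<bar> \<le> C"
proof -
  have c: "continuous_on (closure \<omega>) f" by (rule continuous_on_subset[OF Cinf_on_continuous[OF assms] N(2)])
  show "f \<in> borel_measurable (lebesgue_on \<omega>)"
    by (rule continuous_imp_measurable_on_sets_lebesgue[OF continuous_on_subset[OF c closure_subset] pf.wl(1)])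
  have "compact (closure \<omega>)" using w by simp
  then have "bounded (f ` closure \<omega>)" using c by (intro compact_imp_bounded compact_continuous_image)
  then obtain C where "\<forall>y\<in>f ` closure \<omega>. norm y \<le> C" unfolding bounded_iff by blast
  then have "\<forall>z\<in>\<omega>. \<bar>f z\<bar> \<le> C" using closure_subset[of \<omega>] by auto
  then show "\<exists>C. \<forall>z\<in>\<omega>. \<bar>f z\<bar> \<le> C" ..
qed

lemma N_L2: fixes f :: "real^2 \<Rightarrow> real" assumes "Cinf_on N f" shows "L2_on \<omega> f"
proof -
  obtain C where "\<forall>z\<in>\<omega>. \<bar>f z\<bar> \<le> C" using N_bdd(2)[OF assms] by blast
  then show ?thesis by (intro L2_on_bounded[OF pf.wl(2) N_bdd(1)[OF assms], of C]) auto
qed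

lemma N_mult_L2: fixes f T :: "real^2 \<Rightarrow> real" assumes T: "Cinf_on N T" and f: "L2_on \<omega> f" shows "L2_on \<omega> (\<lambda>z. T z * f z)"
proof -
  obtain C where "\<forall>z\<in>\<omega>. \<bar>T z\<bar> \<le> C" using N_bdd(2)[OF T] by blast
  then show ?thesis by (intro L2_on_bounded_mult[OF f N_bdd(1)[OF T], of C]) auto
qed

lemma V_adm:
  assumes "Cinf_on V f" shows "pf.adm f"
proof -
  have cl: "slab (closure \<omega>) \<subseteq> V" by (rule slab_thick[OF N(2) rho])
  have c: "continuous_on (slab (closure \<omega>)) f" by (rule continuous_on_subset[OF Cinf_on_continuous[OF assms] cl])
  have "compact (closure \<omega>)" using w by simp
  then have "bounded (f ` slab (closure \<omega>))" using c by (intro compact_imp_bounded compact_continuous_image compact_slab)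
  then obtain C where C: "\<forall>y\<in>f ` slab (closure \<omega>). norm y \<le> C" unfolding bounded_iff by blast
  have s: "slab \<omega> \<subseteq> slab (closure \<omega>)" using closure_subset[of \<omega>] by (auto simp: slab_def)
  then have "\<forall>x\<in>slab \<omega>. \<bar>f x\<bar> \<le> C" using C by auto
  then show ?thesis using continuous_on_subset[OF c s] unfolding pf.adm_def by blast
qed

section \<open>The orthogonal remainder of II and the distance term\<close>

lemma orthI:
  assumes sm: "\<And>i j. Cinf_on V (\<lambda>x. F x $ i $ j)"
    and z: "\<And>l z i j. l < 3 \<Longrightarrow> z \<in> \<omega> \<Longrightarrow> integral {-1/2..1/2} (\<lambda>t. leg l t * F (pt3 z t) $ i $ j) = 0"
  shows "pf.orth F"
  unfolding pf.orth_def
proof (intro conjI ballI allI impI)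
  fix e :: mat2 assume "e \<in> Basis"
  then obtain i j where e: "\<And>A::mat2. A \<bullet> e = A $ i $ j" using Basis_mat by blast
  show "pf.adm (\<lambda>x. F x \<bullet> e)" unfolding e by (rule V_adm[OF sm])
  fix l z assume "l < (3::nat)" "z \<in> \<omega>"
  then show "integral {-1/2..1/2} (\<lambda>t. leg l t * (F (pt3 z t) \<bullet> e)) = 0" unfolding e by (rule z)
qed

text \<open>What remains of II after removing its Legendre projection, whose coefficients are the
  moments divided by \<open>leg_sq\<close>.\<close>

definition Rem :: "real^3 \<Rightarrow> mat2" where
  "Rem x = IIm x - (\<Sum>i<3. (leg i (x $ 3) / leg_sq i) *\<^sub>R Mom (leg i) (proj2 x))"

lemma sm_leg: "Cinf_on V (\<lambda>x. leg i (x $ 3))"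
proof -
  have "(\<lambda>x::real^3. leg i (x $ 3)) = (if i = 0 then (\<lambda>x. 1) else if i = 1 then (\<lambda>x. x $ 3) else (\<lambda>x. 6 * (x $ 3)^2 - 1/2))"
    by (auto simp: leg_def)
  then show ?thesis by (auto intro!: Cinf_on_const Cinf_on_diff Cinf_on_mult Cinf_on_power oV sm_x3)
qed

lemma Rem_nth: "Rem x $ i $ j = IIm x $ i $ j - (\<Sum>l<3. leg l (x $ 3) / leg_sq l * Mom (leg l) (proj2 x) $ i $ j)"
  by (simp add: Rem_def sum_component)

lemma leg_sq_nz: "leg_sq i \<noteq> 0" by (simp add: leg_sq_def)

lemma sm_Rem: "Cinf_on V (\<lambda>x. Rem x $ i $ j)"
  unfolding Rem_nth
  by (intro Cinf_on_diff Cinf_on_sum Cinf_on_mult Cinf_on_divide Cinf_on_const oV sm_IIm sm_leg sm_proj[OF sm_Mom] cont_leg) (simp_all add: leg_sq_nz)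

lemma Rem_moment:
  assumes l: "l < 3" and z: "z \<in> N" shows "integral {-1/2..1/2} (\<lambda>t. leg l t * Rem (pt3 z t) $ i $ j) = 0"
proof -
  have "((\<lambda>t. leg l t * IIm (pt3 z t) $ i $ j - (\<Sum>k<3. leg l t * leg k t * (Mom (leg k) z $ i $ j / leg_sq k))) has_integral
     Mom (leg l) z $ i $ j - (\<Sum>k<3. integral {-1/2..1/2} (\<lambda>t. leg l t * leg k t) * (Mom (leg k) z $ i $ j / leg_sq k))) {-1/2..1/2}"
    unfolding Mom_def vec_lambda_beta
    by (intro has_integral_diff has_integral_sum finite_lessThan has_integral_mult_left integrable_integral slice_int[OF cont_leg sm_IIm z]
        integrable_continuous_interval continuous_on_mult cont_leg)
  moreover have "(\<Sum>k<3. integral {-1/2..1/2} (\<lambda>t. leg l t * leg k t) * (Mom (leg k) z $ i $ j / leg_sq k)) =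
     (\<Sum>k<3. if l = k then Mom (leg k) z $ i $ j else 0)"
    by (rule sum.cong) (auto simp: leg_orth[OF l] leg_sq_nz simp del: divide_minus_left)
  moreover have "\<dots> = Mom (leg l) z $ i $ j" using l by (simp add: sum.delta)
  moreover have "(\<lambda>t. leg l t * Rem (pt3 z t) $ i $ j) =
     (\<lambda>t. leg l t * IIm (pt3 z t) $ i $ j - (\<Sum>k<3. leg l t * leg k t * (Mom (leg k) z $ i $ j / leg_sq k)))"
    by (simp add: Rem_nth right_diff_distrib sum_distrib_left mult_ac)
  ultimately show ?thesis by (simp only: integral_unique diff_self)
qed

lemma orth_Rem: "pf.orth Rem" by (rule orthI[OF sm_Rem Rem_moment[OF _ wN]])

lemma orth_symp_Rem: "pf.orth (\<lambda>x. symp (Rem x))"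
proof (rule orthI)
  show "Cinf_on V (\<lambda>x. symp (Rem x) $ i $ j)" for i j unfolding symp_nth
    by (intro Cinf_on_divide Cinf_on_add Cinf_on_const oV sm_Rem) simp
  fix l z i j assume l: "l < (3::nat)" and z: "z \<in> \<omega>"
  note zN = wN[OF z]
  have "integral {-1/2..1/2} (\<lambda>t. leg l t * symp (Rem (pt3 z t)) $ i $ j) =
     integral {-1/2..1/2} (\<lambda>t. (leg l t * Rem (pt3 z t) $ i $ j + leg l t * Rem (pt3 z t) $ j $ i) / 2)"
    by (simp add: symp_nth algebra_simps)
  also have "\<dots> = (integral {-1/2..1/2} (\<lambda>t. leg l t * Rem (pt3 z t) $ i $ j) + integral {-1/2..1/2} (\<lambda>t. leg l t * Rem (pt3 z t) $ j $ i)) / 2"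
    unfolding integral_divide
    by (subst Henstock_Kurzweil_Integration.integral_add[OF slice_int[OF cont_leg sm_Rem zN] slice_int[OF cont_leg sm_Rem zN]]) (rule refl)
  finally show "integral {-1/2..1/2} (\<lambda>t. leg l t * symp (Rem (pt3 z t)) $ i $ j) = 0" unfolding Rem_moment[OF l zN] by simp
qed

lemma Mom_L2: "L2_on \<omega> (Mom (leg i))"
  unfolding L2_on_mat_iff by (intro allI N_L2 sm_Mom cont_leg)

lemma Om: "x \<in> Omega \<omega> \<Longrightarrow> proj2 x \<in> \<omega>" by (simp add: Omega_def)

lemma integral_Om_cong: "(\<And>x. x \<in> Omega \<omega> \<Longrightarrow> f x = g x) \<Longrightarrow> integral\<^sup>L (lebesgue_on (Omega \<omega>)) f = integral\<^sup>L (lebesgue_on (Omega \<omega>)) g"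
  for f g :: "real^3 \<Rightarrow> real"
  by (rule Bochner_Integration.integral_cong) auto

lemma integral_w_cong: "(\<And>x. x \<in> \<omega> \<Longrightarrow> f x = g x) \<Longrightarrow> integral\<^sup>L (lebesgue_on \<omega>) f = integral\<^sup>L (lebesgue_on \<omega>) g"
  for f g :: "real^2 \<Rightarrow> real"
  by (rule Bochner_Integration.integral_cong) auto

text \<open>Competitors in \<open>E2\<close> are symmetric, so the distance is computed from the
  symmetrised expansion; \<open>Q2_symp\<close>, in the form of \<open>sy\<close>, then allows the
  unsymmetrised remainder that occurs in the energy.\<close>

lemma dist_Rem: "(distQ2 W Gbar \<omega> (II_sym y0 Gbar G1 G2))^2 = integral\<^sup>L (lebesgue_on (Omega \<omega>)) (\<lambda>x. Q2 W Gbar (proj2 x) (Rem x))"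
proof -
  define M where "M = (\<lambda>i z. (1 / leg_sq i) *\<^sub>R symp (Mom (leg i) z))"
  have "L2_on \<omega> (\<lambda>z. symp (Mom (leg i) z))" for i
    unfolding L2_on_mat_iff symp_nth by (intro allI N_L2 Cinf_on_divide Cinf_on_add Cinf_on_const N sm_Mom cont_leg) simp
  then have M1: "L2_on \<omega> (M i)" for i unfolding M_def by (rule L2_on_scaleR)
  have M2: "symm (M i z)" for i z using symm_symp[of "Mom (leg i) z"] by (simp add: M_def symm_iff)
  have M3: "II_sym y0 Gbar G1 G2 x = (\<Sum>i<3. leg i (x $ 3) *\<^sub>R M i (proj2 x)) + symp (Rem x)" for x
    by (simp add: II_sym_IIm Rem_def symp_diff symp_sum symp_scaleR M_def)
  have "(distQ2 W Gbar \<omega> (II_sym y0 Gbar G1 G2))^2 = integral\<^sup>L (lebesgue_on (Omega \<omega>)) (\<lambda>x. Q2 W Gbar (proj2 x) (symp (Rem x)))"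
    by (rule distQ2_orthogonal[OF pf.plate_form_axioms dg M1 M2 orth_symp_Rem M3])
  also have "\<dots> = integral\<^sup>L (lebesgue_on (Omega \<omega>)) (\<lambda>x. Q2 W Gbar (proj2 x) (Rem x))"
    by (rule integral_Om_cong) (simp add: sy Om)
  finally show ?thesis .
qed

text \<open>The parts of II coming from the gradient of b and from \<open>beta\<close> are x_3^2
  times a planar field. Their symmetric part lies in \<open>E2\<close> and does not affect the
  distance; the rest of II is the stated Christoffel expression.\<close>

lemma dist_Chr:
  "distQ2 W Gbar \<omega> (II_sym y0 Gbar G1 G2) = distQ2 W Gbar \<omega> (\<lambda>x.
          symp (grad2 (\<lambda>z. oint 0 (x$3) (\<lambda>t. col3 (G1 (pt3 z t)))) (proj2 x))
          - GamPair Gf (oint 0 (x$3) (\<lambda>t. col3 (G1 (pt3 (proj2 x) t)))) (proj2 x)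
          + ((1/2) * oint 0 (x$3) (\<lambda>t. G1 (pt3 (proj2 x) t) $ 3 $ 3)) *\<^sub>R Gam3 Gf (proj2 x)
          - (1/4) *\<^sub>R blk22 (G2 x))" (is "_ = distQ2 W Gbar \<omega> ?H")
proof (rule distQ2_cong_E2)
  define X :: "real^2 \<Rightarrow> mat2" where "X z = (\<chi> i j. pa i b z \<bullet> pa j b z - pa j (\<lambda>z. beta z $ i) z + pa j (pa i y0) z \<bullet> (Q0mT y0 Gbar z *v ext3 (beta z)))" for z
  define F2 where "F2 z = (1/2) *\<^sub>R symp (X z)" for z
  define E0 where "E0 = (\<lambda>x::real^3. (x$3)^2 *\<^sub>R F2 (proj2 x) + (x$3) *\<^sub>R (\<lambda>z. 0) (proj2 x) + (\<lambda>z. 0) (proj2 x))"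
  have se: "Cinf_on N (\<lambda>z. ext3 (beta z) $ m)" for m
    by (rule cases_3[of _ m]) (simp_all add: ext3_nth sm_beta Cinf_on_const[OF N(1)])
  have "Cinf_on N (\<lambda>z. X z $ i $ j)" for i j unfolding X_def vec_lambda_beta
    by (intro Cinf_on_add Cinf_on_diff Cinf_on_inner Cinf_on_mvec N sm_db Cinf_on_pd[OF sm_beta ax] se sm_Q0mT Cinf_on_nth[OF N(1) Cinf_on_pd[OF sm_dyv ax]])
  then have "L2_on \<omega> (\<lambda>z. symp (X z))" unfolding L2_on_mat_iff symp_nth
    by (intro allI N_L2 Cinf_on_divide Cinf_on_add Cinf_on_const N) simp_all
  then have "L2_on \<omega> F2" unfolding F2_def by (rule L2_on_scaleR)
  moreover have "symm (F2 z)" for z using symm_symp[of "X z"] by (simp add: F2_def symm_iff)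
  moreover have "L2_on \<omega> (\<lambda>z. 0 :: mat2)" by (simp add: L2_on_def)
  moreover have "symm (0 :: mat2)" by (simp add: symm_iff)
  ultimately have "(\<forall>F\<in>{\<lambda>z. 0, \<lambda>z. 0, F2}. L2_on \<omega> F \<and> (\<forall>x\<in>\<omega>. symm (F x)))" by simp
  then show "E0 \<in> E2 \<omega>" unfolding E2_def E0_def by blast
  fix x assume x: "x \<in> Omega \<omega>"
  then have z: "proj2 x \<in> \<omega>" and s: "\<bar>x $ 3\<bar> < \<rho>" using rho by (auto simp: Omega_def abs_less_iff)
  note zN = wN[OF z]
  have "symm (G2 x)" using Gsymm(3) Omega_slab x by blast
  then have "symm (blk22 (G2 x))" by (simp add: symm_iff blk22_def)
  then have sb: "symp (blk22 (G2 x)) = blk22 (G2 x)" by (rule symp_eq)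
  have sev: "Cinf_on N (\<lambda>z. ext3 (beta z))" using se by (simp add: Cinf_on_vec_iff[OF N(1)])
  have "X (proj2 x) = transpose (jac b (proj2 x)) ** jac b (proj2 x) - grad2 (\<lambda>z. ext3 (beta z)) (proj2 x) + GamPair Gf (ext3 (beta (proj2 x))) (proj2 x)"
    by (simp add: vec_eq_iff X_def transpose_jac_mult grad2_nth[OF Cinf_on_differentiable[OF sev zN]] ext3_nth GamPair_eq[OF z])
  then have F2: "F2 (proj2 x) = (1/2) *\<^sub>R (symp (transpose (jac b (proj2 x)) ** jac b (proj2 x)) - symp (grad2 (\<lambda>z. ext3 (beta z)) (proj2 x)) + GamPair Gf (ext3 (beta (proj2 x))) (proj2 x))"
    by (simp add: F2_def symp_add symp_diff symp_eq[OF GamPair_symm[OF z]])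
  show "II_sym y0 Gbar G1 G2 x = ?H x + E0 x"
    unfolding II_sym_IIm IIm_def jac_d0[OF z s] E0_def F2 symp_add symp_diff symp_scaleR symp_eq[OF GamPair_symm[OF z]] symp_eq[OF Gam3_symm[OF z]] sb
    by (simp add: algebra_simps)
qed

end

section \<open>Square integrability of the strains and the splitting of the energy\<close>

lemma wgrad_mult_nth: "(transpose (wgrad A z) ** wgrad B z) $ i $ j = A i z \<bullet> B j z"
  by (simp add: matrix_matrix_mult_def transpose_def wgrad_def inner_vec_def)

lemma jac_wgrad_nth: "(transpose (jac f z) ** wgrad B z) $ i $ j = pd (axis i 1) f z \<bullet> B j z"
  "(transpose (wgrad B z) ** jac f z) $ i $ j = B i z \<bullet> pd (axis j 1) f z"
  by (simp_all add: matrix_matrix_mult_def transpose_def wgrad_def jac_def inner_vec_def)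

lemma symp_minus: "symp (- A) = - symp A" using symp_scaleR[of "-1" A] by simp

context plate_energy begin

context
  fixes Vd :: "real^2 \<Rightarrow> real^3" and DV :: "2 \<Rightarrow> real^2 \<Rightarrow> real^3"
  assumes W22: "W22 \<omega> Vd DV"
begin

lemma DV_L2: "L2_on \<omega> (\<lambda>z. DV i z $ l)"
  using W22 by (auto simp: W22_def W12_def L2_on_vec_iff)

lemma strain_L2: "L2_on \<omega> (\<lambda>z. transpose (wgrad DV z) ** wgrad DV z)"
proof -
  obtain D2V where D: "\<And>i. W12 \<omega> (DV i) (D2V i)" using W22 unfolding W22_def by blast
  have "L2_on \<omega> (\<lambda>z. DV i z $ l * DV j z $ l)" for i j l
  proof (rule L2_on_product)
    show "(\<lambda>z. DV i z $ l) \<in> borel_measurable (lebesgue_on \<omega>)" "(\<lambda>z. DV j z $ l) \<in> borel_measurable (lebesgue_on \<omega>)"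
      using DV_L2 by (auto simp: L2_on_def)
  qed (rule sobolev_L4[OF w lip W12_nth[OF w(1) D]])+
  then show ?thesis unfolding L2_on_mat_iff wgrad_mult_nth inner_vec_def inner_real_def by (intro allI L2_on_sum finite)
qed

lemma pvec_nth: "pvec y0 Gbar DV z $ k = (\<Sum>i\<in>UNIV. \<Sum>l\<in>UNIV. - (Q0mT y0 Gbar z $ k $ emb i * b z $ l) * DV i z $ l)"
proof -
  have u: "(transpose (wgrad DV z) *v b z) $ i = DV i z \<bullet> b z" for i
    by (simp add: mult_vec_nth transpose_def wgrad_def inner_vec_def)
  have "(\<Sum>m\<in>UNIV. Q0mT y0 Gbar z $ k $ m * ext3 v $ m) = (\<Sum>i\<in>UNIV. Q0mT y0 Gbar z $ k $ emb i * v $ i)" for v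
    by (simp add: sum_3 sum_2 emb_def ext3_def)
  then have "pvec y0 Gbar DV z $ k = - (\<Sum>i\<in>UNIV. Q0mT y0 Gbar z $ k $ emb i * (DV i z \<bullet> b z))"
    unfolding pvec_def vector_uminus_component mult_vec_nth[of "Q0mT y0 Gbar z"] by (simp only: u)
  then show ?thesis by (simp add: inner_vec_def sum_distrib_left sum_negf mult_ac)
qed

text \<open>A weak gradient is assumed only locally integrable. Square integrability comes from the
  product rule for \<open>pvec\<close>, whose coefficients are smooth up to the boundary, together
  with uniqueness of weak derivatives.\<close>

lemma P_L2:
  assumes P: "weak_partials \<omega> (pvec y0 Gbar DV) P" shows "L2_on \<omega> (\<lambda>z. P j z $ k)"
proof -
  obtain D2V where D: "\<And>i. W12 \<omega> (DV i) (D2V i)" using W22 unfolding W22_def by blast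
  define T where "T i l z = - (Q0mT y0 Gbar z $ k $ emb i * b z $ l)" for i l z
  have sT: "Cinf_on N (T i l)" for i l unfolding T_def by (intro Cinf_on_uminus Cinf_on_mult N sm_Q0mT sm_b)
  have sTw: "Cinf_on \<omega> (T i l)" for i l using sT wN by (intro Cinf_on_subset[OF sT]) auto
  let ?D = "\<lambda>j z. \<Sum>i\<in>UNIV. \<Sum>l\<in>UNIV. pa j (T i l) z * DV i z $ l + T i l z * D2V i j z $ l"
  have c: "W12 \<omega> (\<lambda>z. DV i z $ l) (\<lambda>j z. D2V i j z $ l)" for i l by (rule W12_nth[OF w(1) D])
  have "weak_partials \<omega> (\<lambda>z. \<Sum>i\<in>UNIV. \<Sum>l\<in>UNIV. T i l z * DV i z $ l) ?D"
    using c by (intro weak_partials_sum weak_partials_mult w finite sTw) (simp add: W12_def)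
  then have a: "weak_partials \<omega> (\<lambda>z. pvec y0 Gbar DV z $ k) ?D" unfolding pvec_nth T_def .
  have "weak_partials \<omega> (\<lambda>z. pvec y0 Gbar DV z $ k) (\<lambda>j z. P j z $ k)"
    by (rule weak_partials_linear[OF w(1) P bounded_linear_vec_nth])
  from weak_partials_unique[OF w(1) a this, of j]
  have ae: "AE z in lebesgue. z \<in> \<omega> \<longrightarrow> ?D j z = P j z $ k" .
  show ?thesis
  proof (rule L2_on_AE_cong[OF pf.wl(1) _ ae])
    show "L2_on \<omega> (?D j)"
      using c by (intro L2_on_sum finite L2_on_add N_mult_L2 sT Cinf_on_pd[OF sT ax] DV_L2) (simp add: W12_def)
  qed
qed

lemma I4O_eq:
  assumes P: "weak_partials \<omega> (pvec y0 Gbar DV) P" and S: "L2_on \<omega> S"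
  shows "I4O W \<omega> y0 Gbar G1 G2 DV P S =
         (1/2) * integral\<^sup>L (lebesgue_on \<omega>) (\<lambda>x'. Q2 W Gbar x'
              (S x' + (1/2) *\<^sub>R (transpose (wgrad DV x') ** wgrad DV x') + B0 y0 Gbar G2 x'))
       + (1/24) * integral\<^sup>L (lebesgue_on \<omega>) (\<lambda>x'. Q2 W Gbar x'
              (transpose (wgrad DV x') ** jac (b0 y0 Gbar) x' + transpose (jac y0 x') ** wgrad P x'
               + 12 *\<^sub>R B1 y0 Gbar G1 G2 x'))
       + (1/1440) * integral\<^sup>L (lebesgue_on \<omega>) (\<lambda>x'. Q2 W Gbar x'
              (transpose (jac (b0 y0 Gbar) x') ** jac (b0 y0 Gbar) x' + transpose (jac y0 x') ** jac (dt0 y0 Gbar G1) x'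
               - (1/2) *\<^sub>R Gb2_22 G2 x'))
       + (1/2) * (distQ2 W Gbar \<omega> (II_sym y0 Gbar G1 G2))^2"
proof -
  define T where "T z = transpose (jac y0 z) ** jac (\<lambda>z. integral {-1/2..1/2} (\<lambda>t. d0 y0 Gbar G1 (pt3 z t))) z" for z
  define St where "St z = S z + (1/2) *\<^sub>R (transpose (wgrad DV z) ** wgrad DV z)" for z
  define Be where "Be z = transpose (wgrad DV z) ** jac b z + transpose (jac y0 z) ** wgrad P z" for z
  define X3 where "X3 z = transpose (jac b z) ** jac b z + transpose (jac y0 z) ** jac (dt0 y0 Gbar G1) z - (1/2) *\<^sub>R Gb2_22 G2 z" for z
  \<comment> \<open>Legendre coefficients of I + x_3 III + II. I and III enter in degrees 0 and 1
    alone, and the factors 12 and 5 are the reciprocals of the squared norms.\<close>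
  define A where "A i = (if i = 0 then (\<lambda>z. St z + (Mom (leg 0) z - T z)) else if i = 1 then (\<lambda>z. Be z + 12 *\<^sub>R Mom (leg 1) z)
     else (\<lambda>z. 5 *\<^sub>R Mom (leg 2) z))" for i :: nat
  have dk1: "(\<lambda>z. integral {-1/2..1/2} (\<lambda>t. d0 y0 Gbar G1 (pt3 z t))) = dk (\<lambda>t. 1)" by (rule ext) (simp add: dk_def)
  have TL: "L2_on \<omega> T" unfolding L2_on_mat_iff T_def transpose_jac_mult dk1
    by (intro allI N_L2 Cinf_on_inner N sm_dy Cinf_on_nth[OF N(1) Cinf_on_pd[OF sm_dkv ax]]) (rule continuous_on_const)
  have StL: "L2_on \<omega> St" unfolding St_def by (intro L2_on_add L2_on_scaleR S strain_L2)
  have m: "L2_on \<omega> (\<lambda>z. DV i z $ l * pa j b z $ l)" for i j l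
    using N_mult_L2[OF sm_db DV_L2, of j l i l] by (simp add: mult.commute)
  have "L2_on \<omega> (\<lambda>z. Be z $ i $ j)" for i j
    unfolding Be_def vector_add_component jac_wgrad_nth inner_vec_def inner_real_def
    by (intro L2_on_add L2_on_sum finite m N_mult_L2 sm_dy P_L2[OF P])
  then have BeL: "L2_on \<omega> Be" by (simp add: L2_on_mat_iff)
  have AL: "L2_on \<omega> (A i)" for i
    unfolding A_def using TL StL BeL by (auto intro!: L2_on_add L2_on_diff L2_on_scaleR Mom_L2)
  have I: "I4O W \<omega> y0 Gbar G1 G2 DV P S = (1/2) * integral\<^sup>L (lebesgue_on (Omega \<omega>)) (\<lambda>x. Q2 W Gbar (proj2 x)
     ((\<Sum>i<3. leg i (x $ 3) *\<^sub>R A i (proj2 x)) + Rem x))"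
  proof -
    have I0: "I4O W \<omega> y0 Gbar G1 G2 DV P S = (1/2) * integral\<^sup>L (lebesgue_on (Omega \<omega>)) (\<lambda>x. Q2 W Gbar (proj2 x)
     ((St (proj2 x) - T (proj2 x)) + (x $ 3) *\<^sub>R Be (proj2 x) + IIm x))"
      unfolding I4O_def Let_def St_def T_def Be_def IIm_def by (simp only: add.commute[of "transpose (wgrad DV _) ** _"])
    have e: "(St (proj2 x) - T (proj2 x)) + (x $ 3) *\<^sub>R Be (proj2 x) + IIm x = (\<Sum>i<3. leg i (x $ 3) *\<^sub>R A i (proj2 x)) + Rem x" for x
      unfolding Rem_def sum_less_3 by (simp add: A_def leg_def leg_sq_def algebra_simps)
    show ?thesis using I0 unfolding e .
  qed
  have A0: "integral\<^sup>L (lebesgue_on \<omega>) (\<lambda>z. Q2 W Gbar z (A 0 z)) = integral\<^sup>L (lebesgue_on \<omega>) (\<lambda>z. Q2 W Gbar z (St z + B0 y0 Gbar G2 z))"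
    by (rule integral_w_cong) (simp add: A_def Mom_0[OF wN] T_def)
  have A1: "integral\<^sup>L (lebesgue_on \<omega>) (\<lambda>z. Q2 W Gbar z (A 1 z)) = integral\<^sup>L (lebesgue_on \<omega>) (\<lambda>z. Q2 W Gbar z (Be z + 12 *\<^sub>R B1 y0 Gbar G1 G2 z))"
    using Mom_1[OF wN] by (intro integral_w_cong) (simp add: A_def)
  have "integral\<^sup>L (lebesgue_on \<omega>) (\<lambda>z. Q2 W Gbar z (A 2 z)) = integral\<^sup>L (lebesgue_on \<omega>) (\<lambda>z. (1/144) * Q2 W Gbar z (X3 z))"
  proof (rule integral_w_cong)
    fix z assume z: "z \<in> \<omega>"
    have "A 2 z = (1/12) *\<^sub>R X3 z" by (simp add: A_def Mom_2[OF wN[OF z]] X3_def)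
    then show "Q2 W Gbar z (A 2 z) = (1/144) * Q2 W Gbar z (X3 z)"
      by (simp add: dg[symmetric] psd_form_simps(3,4)[OF pf.psd])
  qed
  then have A2: "integral\<^sup>L (lebesgue_on \<omega>) (\<lambda>z. Q2 W Gbar z (A 2 z)) = (1/144) * integral\<^sup>L (lebesgue_on \<omega>) (\<lambda>z. Q2 W Gbar z (X3 z))"
    by simp
  have "integral\<^sup>L (lebesgue_on (Omega \<omega>)) (\<lambda>x. Q2 W Gbar (proj2 x) ((\<Sum>i<3. leg i (x $ 3) *\<^sub>R A i (proj2 x)) + Rem x)) =
    (\<Sum>i<3. leg_sq i * integral\<^sup>L (lebesgue_on \<omega>) (\<lambda>z. Q2 W Gbar z (A i z))) + (distQ2 W Gbar \<omega> (II_sym y0 Gbar G1 G2))^2"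
    unfolding dist_Rem using pf.orthogonal_expansion[OF AL orth_Rem] unfolding dg .
  then show ?thesis unfolding I sum_less_3 A0 A1 A2 St_def[symmetric] Be_def[symmetric] X3_def[symmetric]
    by (simp add: leg_sq_def)
qed

end

section \<open>Curvature form of the third term and the special case\<close>

lemma third_curvature:
  "integral\<^sup>L (lebesgue_on \<omega>) (\<lambda>x'. Q2 W Gbar x' (transpose (jac b x') ** jac b x' + transpose (jac y0 x') ** jac (dt0 y0 Gbar G1) x'
          - (1/2) *\<^sub>R Gb2_22 G2 x')) = integral\<^sup>L (lebesgue_on \<omega>) (\<lambda>x'. Q2 W Gbar x' (Rmat Gf x'))"
proof (rule integral_w_cong)
  fix z assume z: "z \<in> \<omega>"
  show "Q2 W Gbar z (transpose (jac b z) ** jac b z + transpose (jac y0 z) ** jac (dt0 y0 Gbar G1) z - (1/2) *\<^sub>R Gb2_22 G2 z) = Q2 W Gbar z (Rmat Gf z)"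
    unfolding curvature[OF z, symmetric] sy[OF z] ..
qed

text \<open>Since 15 t^2 - 9/4 = (5/2)(6 t^2 - 1/2) - 1, the hypothesis says that the mean of
  \<open>G2\<close> is 5/2 times its quadratic moment, that is, one twelfth of
  \<open>Gb2_22\<close>.\<close>

lemma B0_special:
  assumes z: "z \<in> \<omega>" and h: "integral {-1/2..1/2} (\<lambda>t. (15*t^2 - 9/4) *\<^sub>R blk22 (G2 (pt3 z t))) = 0"
  shows "B0 y0 Gbar G2 z = (1/24) *\<^sub>R (transpose (jac b z) ** jac b z) - (1/48) *\<^sub>R Gb2_22 G2 z"
proof -
  note zN = wN[OF z]
  let ?g = "\<lambda>t. blk22 (G2 (pt3 z t))"
  have c: "continuous_on {-1/2..1/2} ?g"
    unfolding blk22_def by (intro continuous_on_vec_lambda cont_slice[OF sm_G2 zN])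
  have "((\<lambda>t. (5/2) *\<^sub>R (leg 2 t *\<^sub>R ?g t) - ?g t) has_integral (5/2) *\<^sub>R integral {-1/2..1/2} (\<lambda>t. leg 2 t *\<^sub>R ?g t) - integral {-1/2..1/2} ?g) {-1/2..1/2}"
    by (intro has_integral_diff has_integral_cmul integrable_integral integrable_continuous_interval continuous_on_scaleR cont_leg c)
  moreover have "(\<lambda>t. (5/2) *\<^sub>R (leg 2 t *\<^sub>R ?g t) - ?g t) = (\<lambda>t. (15*t^2 - 9/4) *\<^sub>R ?g t)"
    by (rule ext) (simp add: leg_def vec_eq_iff algebra_simps)
  ultimately have "(5/2) *\<^sub>R integral {-1/2..1/2} (\<lambda>t. leg 2 t *\<^sub>R ?g t) - integral {-1/2..1/2} ?g = 0"
    using h by (simp only: integral_unique)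
  moreover have g: "Gb2_22 G2 z = 30 *\<^sub>R integral {-1/2..1/2} (\<lambda>t. leg 2 t *\<^sub>R ?g t)"
    unfolding Gb2_22_def integral_cmul[symmetric] by (simp add: leg_def)
  ultimately have "integral {-1/2..1/2} ?g = (1/12) *\<^sub>R Gb2_22 G2 z" by (simp add: vec_eq_iff)
  then show ?thesis unfolding B0_def by simp
qed

text \<open>By \<open>B1_Chr\<close> the hypothesis states that the symmetric part of
  \<open>B1\<close> is zero, and the form ignores the skew rest.\<close>

lemma B1_special:
  assumes z: "z \<in> \<omega>" and h: "(1/4) *\<^sub>R integral {-1/2..1/2} (\<lambda>t. t *\<^sub>R blk22 (G2 (pt3 z t)))
          + symp (grad2 (mvec G1) z) - GamPair Gf (mvec G1 z) z
          + ((1/2) * integral {-1/2..1/2} (\<lambda>t. (t^2/2) * G1 (pt3 z t) $ 3 $ 3)) *\<^sub>R Gam3 Gf z = 0"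
  shows "Q2 W Gbar z (F + 12 *\<^sub>R B1 y0 Gbar G1 G2 z) = Q2 W Gbar z F"
proof -
  have "symm (integral {-1/2..1/2} (\<lambda>t. t *\<^sub>R blk22 (G2 (pt3 z t))))"
    unfolding symm_iff integral_blk22[OF continuous_on_id wN[OF z]]
  proof (intro allI Henstock_Kurzweil_Integration.integral_cong)
    fix i j and t :: real assume "t \<in> {-1/2..1/2}"
    then have "pt3 z t \<in> slab \<omega>" using z by (auto simp: slab_def)
    from symm_nth[OF Gsymm(3)[OF this], of "emb i" "emb j"]
    show "t * G2 (pt3 z t) $ emb i $ emb j = t * G2 (pt3 z t) $ emb j $ emb i" by simp
  qed
  then have "symp (B1 y0 Gbar G1 G2 z) = 0 - ((1/4) *\<^sub>R integral {-1/2..1/2} (\<lambda>t. t *\<^sub>R blk22 (G2 (pt3 z t)))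
          + symp (grad2 (mvec G1) z) - GamPair Gf (mvec G1 z) z
          + ((1/2) * integral {-1/2..1/2} (\<lambda>t. (t^2/2) * G1 (pt3 z t) $ 3 $ 3)) *\<^sub>R Gam3 Gf z)"
    unfolding B1_Chr[OF z] symp_add symp_diff symp_scaleR symp_eq[OF GamPair_symm[OF z]] symp_eq[OF Gam3_symm[OF z]]
    by (simp add: symp_eq symp_minus del: divide_minus_left)
  then have "symp (B1 y0 Gbar G1 G2 z) = 0" unfolding h by simp
  then have "symp (F + 12 *\<^sub>R B1 y0 Gbar G1 G2 z) = symp F" by (simp add: symp_add symp_scaleR)
  then show ?thesis using sy[OF z] by metis
qed

lemma three_terms_special:
  assumes h0: "\<forall>x'\<in>\<omega>. integral {-1/2..1/2} (\<lambda>t. (15*t^2 - 9/4) *\<^sub>R blk22 (G2 (pt3 x' t))) = 0"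
    and h1: "\<forall>x'\<in>\<omega>. (1/4) *\<^sub>R integral {-1/2..1/2} (\<lambda>t. t *\<^sub>R blk22 (G2 (pt3 x' t)))
          + symp (grad2 (mvec G1) x') - GamPair Gf (mvec G1 x') x'
          + ((1/2) * integral {-1/2..1/2} (\<lambda>t. (t^2/2) * G1 (pt3 x' t) $ 3 $ 3)) *\<^sub>R Gam3 Gf x' = 0"
  shows "integral\<^sup>L (lebesgue_on \<omega>) (\<lambda>x'. Q2 W Gbar x' (F x' + B0 y0 Gbar G2 x')) =
       integral\<^sup>L (lebesgue_on \<omega>) (\<lambda>x'. Q2 W Gbar x' (F x' + (1/24) *\<^sub>R (transpose (jac b x') ** jac b x') - (1/48) *\<^sub>R Gb2_22 G2 x'))"
    and "integral\<^sup>L (lebesgue_on \<omega>) (\<lambda>x'. Q2 W Gbar x' (A x' + C x' + 12 *\<^sub>R B1 y0 Gbar G1 G2 x')) =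
       integral\<^sup>L (lebesgue_on \<omega>) (\<lambda>x'. Q2 W Gbar x' (C x' + A x'))"
proof -
  show "integral\<^sup>L (lebesgue_on \<omega>) (\<lambda>x'. Q2 W Gbar x' (F x' + B0 y0 Gbar G2 x')) =
       integral\<^sup>L (lebesgue_on \<omega>) (\<lambda>x'. Q2 W Gbar x' (F x' + (1/24) *\<^sub>R (transpose (jac b x') ** jac b x') - (1/48) *\<^sub>R Gb2_22 G2 x'))"
    by (rule integral_w_cong) (simp only: B0_special bspec[OF h0] add_diff_eq)
  show "integral\<^sup>L (lebesgue_on \<omega>) (\<lambda>x'. Q2 W Gbar x' (A x' + C x' + 12 *\<^sub>R B1 y0 Gbar G1 G2 x')) =
       integral\<^sup>L (lebesgue_on \<omega>) (\<lambda>x'. Q2 W Gbar x' (C x' + A x'))"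
  proof (rule integral_w_cong)
    fix z assume z: "z \<in> \<omega>"
    show "Q2 W Gbar z (A z + C z + 12 *\<^sub>R B1 y0 Gbar G1 G2 z) = Q2 W Gbar z (C z + A z)"
      unfolding B1_special[OF z bspec[OF h1 z]] by (simp add: add.commute)
  qed
qed

end

section \<open>Admissible data\<close>

lemma posdef_det_pos: fixes A :: "real^'n^'n" assumes "posdef A" shows "det A > 0"
proof -
  have "det A = (det (msqrt A))^2" using msqrt(2)[OF assms] by (metis det_mul power2_eq_square)
  then show ?thesis using posdef_det_nz[OF msqrt(1)[OF assms]] by simp
qed

lemma posdef_blk22: assumes "posdef A" shows "posdef (blk22 A)"
proof -
  have "v \<bullet> (blk22 A *v v) > 0" if "v \<noteq> 0" for v
  proof -
    have "ext3 v \<noteq> 0" using that by (auto simp: vec_eq_iff forall_2 forall_3 ext3_def)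
    then have "0 < ext3 v \<bullet> (A *v ext3 v)" using assms by (simp add: posdef_def)
    also have "\<dots> = v \<bullet> (blk22 A *v v)"
      by (simp add: inner_vec_def mult_vec_nth sum_3 sum_2 ext3_def blk22_def emb_def)
    finally show ?thesis .
  qed
  then show ?thesis using assms by (simp add: posdef_def symm_iff blk22_def)
qed

text \<open>Lagrange's identity. It converts positivity of the Gram determinant, which persists near
  the closure, into independence of the tangent vectors.\<close>

lemma gram_det_cross:
  "det (transpose (jac y z) ** jac y z) = (norm (cross3 (pd (axis 1 1) y z) (pd (axis 2 1) y z)))^2"
  for y :: "real^2 \<Rightarrow> real^3"
  using norm_cross_dot[of "pd (axis 1 1) y z" "pd (axis 2 1) y z"]
  by (simp add: det_2 transpose_jac_mult power_mult_distrib power2_norm_eq_inner inner_commute) (simp add: power2_eq_square)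

text \<open>The separate smoothness domains are intersected and then cut down to where three
  determinants are positive: those of the metric, of its tangential block, and of the Gram matrix of
  \<open>y0\<close>.\<close>

lemma plate_geom_neighbourhood:
  assumes w: "open \<omega>" "bounded \<omega>"
    and Gbar: "Cinf_closure \<omega> Gbar" "\<forall>x'\<in>closure \<omega>. posdef (Gbar x')"
    and G1: "Cinf_closure (Omega \<omega>) G1" "\<forall>x\<in>closure (Omega \<omega>). symm (G1 x)"
    and G2: "Cinf_closure (Omega \<omega>) G2" "\<forall>x\<in>closure (Omega \<omega>). symm (G2 x)"
    and mean: "\<forall>x'\<in>closure \<omega>. integral {-1/2..1/2} (\<lambda>t. G1 (pt3 x' t)) = 0"
    and Gb2: "Cinf_closure \<omega> Gb2" "\<forall>x'\<in>closure \<omega>. symm (Gb2 x') \<and> blk22 (Gb2 x') = Gb2_22 G2 x'"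
    and y0: "Cinf_closure \<omega> y0" "\<forall>x'\<in>\<omega>. transpose (jac y0 x') ** jac y0 x' = blk22 (Gbar x')"
      "\<forall>x'\<in>\<omega>. symp (transpose (jac y0 x') ** jac (b0 y0 Gbar) x') = (1/2) *\<^sub>R blk22 (Gb1 G1 x')"
  shows "\<exists>N \<rho>. plate_geom \<omega> N \<rho> Gbar G1 G2 Gb2 y0"
proof -
  obtain U1 where U1: "open U1" "closure \<omega> \<subseteq> U1" "Cinf_on U1 Gbar" using Gbar(1) by (auto simp: Cinf_closure_def)
  obtain U2 where U2: "open U2" "closure \<omega> \<subseteq> U2" "Cinf_on U2 Gb2" using Gb2(1) by (auto simp: Cinf_closure_def)
  obtain U3 where U3: "open U3" "closure \<omega> \<subseteq> U3" "Cinf_on U3 y0" using y0(1) by (auto simp: Cinf_closure_def)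
  obtain V1 where V1: "open V1" "closure (Omega \<omega>) \<subseteq> V1" "Cinf_on V1 G1" using G1(1) by (auto simp: Cinf_closure_def)
  obtain V2 where V2: "open V2" "closure (Omega \<omega>) \<subseteq> V2" "Cinf_on V2 G2" using G2(1) by (auto simp: Cinf_closure_def)
  have "open (V1 \<inter> V2)" "closure (Omega \<omega>) \<subseteq> V1 \<inter> V2" using V1 V2 by auto
  from thick_neighbourhood[OF w(2) this] obtain N1 \<rho> where N1: "open N1" "closure \<omega> \<subseteq> N1" "1/2 < \<rho>" "thick N1 \<rho> \<subseteq> V1 \<inter> V2" .
  define M where "M = N1 \<inter> U1 \<inter> U2 \<inter> U3"
  have M: "open M" "closure \<omega> \<subseteq> M" using U1 U2 U3 N1 by (auto simp: M_def)
  have sM: "Cinf_on M Gbar" "Cinf_on M Gb2" "Cinf_on M y0"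
    using U1(3) U2(3) U3(3) by (auto simp: M_def intro: Cinf_on_subset)
  have sg: "Cinf_on M (\<lambda>z. Gbar z $ i $ j)" for i j by (rule Cinf_on_nth[OF M(1) Cinf_on_nth[OF M(1) sM(1)]])
  have ax: "axis i (1::real) \<in> (Basis :: (real^2) set)" for i by (simp add: axis_in_Basis_iff)
  define f1 where "f1 z = det (Gbar z)" for z
  define f2 where "f2 z = det (blk22 (Gbar z))" for z
  define f3 where "f3 z = det (transpose (jac y0 z) ** jac y0 z)" for z
  have c1: "continuous_on M f1" unfolding f1_def by (rule Cinf_on_continuous[OF Cinf_on_det[OF M(1) sg]])
  have c2: "continuous_on M f2" unfolding f2_def by (rule Cinf_on_continuous[OF Cinf_on_det[OF M(1)]]) (simp add: blk22_def sg)
  have c3: "continuous_on M f3" unfolding f3_def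
  proof (rule Cinf_on_continuous[OF Cinf_on_det[OF M(1)]])
    show "Cinf_on M (\<lambda>z. (transpose (jac y0 z) ** jac y0 z) $ i $ j)" for i j unfolding transpose_jac_mult
      by (intro Cinf_on_inner M Cinf_on_nth[OF M(1) Cinf_on_pd[OF sM(3) ax]])
  qed
  have f12: "f1 z > 0" "f2 z > 0" if "z \<in> closure \<omega>" for z
    unfolding f1_def f2_def using that Gbar(2) by (auto intro!: posdef_det_pos posdef_blk22)
  \<comment> \<open>The isometry condition is given on \<omega>; by continuity of both determinants
    it carries over to the closure, where the tangential block is positive definite.\<close>
  have f3: "f3 z > 0" if "z \<in> closure \<omega>" for z
  proof -
    have "(\<lambda>z. f3 z - f2 z) z = 0"
    proof (rule continuous_constant_on_closure[OF _ _ that])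
      show "continuous_on (closure \<omega>) (\<lambda>z. f3 z - f2 z)"
        by (intro continuous_on_diff continuous_on_subset[OF c3 M(2)] continuous_on_subset[OF c2 M(2)])
    qed (use y0(2) in \<open>simp add: f2_def f3_def\<close>)
    then show ?thesis using f12(2)[OF that] by simp
  qed
  define N where "N = (M \<inter> f1 -` {0<..}) \<inter> (M \<inter> f2 -` {0<..}) \<inter> (M \<inter> f3 -` {0<..})"
  have oN: "open N" unfolding N_def
    by (intro open_Int continuous_open_preimage[OF c1 M(1) open_greaterThan] continuous_open_preimage[OF c2 M(1) open_greaterThan] continuous_open_preimage[OF c3 M(1) open_greaterThan])
  have clN: "closure \<omega> \<subseteq> N" unfolding N_def using M(2) f12 f3 by auto
  have NM: "N \<subseteq> M" by (auto simp: N_def)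
  have tV: "thick N \<rho> \<subseteq> V1 \<inter> V2" using NM N1(4) by (auto simp: thick_def M_def)
  have slab: "slab \<omega> \<subseteq> closure (Omega \<omega>)"
    using slab_closure[of \<omega>] closure_subset[of \<omega>] by (auto simp: slab_def)
  have wc: "\<omega> \<subseteq> closure \<omega>" by (rule closure_subset)
  have "plate_geom \<omega> N \<rho> Gbar G1 G2 Gb2 y0"
  proof
    show "Cinf_on N Gbar" "Cinf_on N Gb2" "Cinf_on N y0" using sM NM by (auto intro: Cinf_on_subset)
    show "Cinf_on (thick N \<rho>) G1" "Cinf_on (thick N \<rho>) G2" using V1(3) V2(3) tV by (auto intro: Cinf_on_subset)
    show "cross3 (pd (axis 1 1) y0 z) (pd (axis 2 1) y0 z) \<noteq> 0" if "z \<in> N" for z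
    proof
      assume "cross3 (pd (axis 1 1) y0 z) (pd (axis 2 1) y0 z) = 0"
      then have "f3 z = 0" unfolding f3_def gram_det_cross by simp
      then show False using that by (simp add: N_def)
    qed
    show "symm (Gbar z)" if "z \<in> \<omega>" for z using Gbar(2) wc that by (auto simp: posdef_def)
    show "symm (G1 x)" "symm (G2 x)" if "x \<in> slab \<omega>" for x using G1(2) G2(2) slab that by auto
    show "integral {-1/2..1/2} (\<lambda>t. G1 (pt3 z t)) = 0" if "z \<in> \<omega>" for z using mean wc that by blast
    show "symm (Gb2 z)" "blk22 (Gb2 z) = Gb2_22 G2 z" if "z \<in> \<omega>" for z using Gb2(2) wc that by auto
  qed (use w oN clN N1(3) y0(2,3) in \<open>auto simp: N_def f1_def f2_def\<close>)
  then show ?thesis by blast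
qed

lemma plate_form_Q2b:
  assumes w: "open \<omega>" "bounded \<omega>" and psd: "psd_form (Q3b W)"
    and G: "continuous_on (closure \<omega>) Gbar" "\<And>x. x \<in> closure \<omega> \<Longrightarrow> posdef (Gbar x)"
  shows "plate_form \<omega> (Q2b W Gbar)"
proof
  have Gw: "continuous_on \<omega> Gbar" "\<And>x. x \<in> \<omega> \<Longrightarrow> posdef (Gbar x)"
    using G closure_subset by (auto intro: continuous_on_subset)
  show "(\<lambda>z. Q2b W Gbar z F H) \<in> borel_measurable (lebesgue_on \<omega>)" for F H
    unfolding Q2b_def using Q2_measurable[OF psd w(1) Gw] by measurable
  show "\<exists>C. \<forall>z\<in>\<omega>. \<bar>Q2b W Gbar z F H\<bar> \<le> C" for F H
  proof -
    have K: "compact (closure \<omega>)" using w by simp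
    obtain C where C: "\<And>z. z \<in> closure \<omega> \<Longrightarrow> Q2 W Gbar z (F + H) \<le> C" using Q2_bounded[OF psd K G] by blast
    obtain D where D: "\<And>z. z \<in> closure \<omega> \<Longrightarrow> Q2 W Gbar z (F - H) \<le> D" using Q2_bounded[OF psd K G] by blast
    have "\<bar>Q2b W Gbar z F H\<bar> \<le> C + D" if "z \<in> \<omega>" for z
    proof -
      have "z \<in> closure \<omega>" using that closure_subset by auto
      from C[OF this] D[OF this] show ?thesis
        using Q2_nonneg[OF psd, of Gbar z "F + H"] Q2_nonneg[OF psd, of Gbar z "F - H"] by (simp add: Q2b_def)
    qed
    then show ?thesis by blast
  qed
qed (use w Q2b_form[OF psd] in auto)

theorem theorem7p5:
  fixes \<omega> :: "(real^2) set"
    and W :: "mat3 \<Rightarrow> ennreal" and c :: real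
    and Gh :: "real \<Rightarrow> real^3 \<Rightarrow> mat3"
    and Gbar :: "real^2 \<Rightarrow> mat3" and G1 G2 :: "real^3 \<Rightarrow> mat3"
    and Gb2 :: "real^2 \<Rightarrow> mat3"
    and y0 :: "real^2 \<Rightarrow> real^3"
  assumes dom: "open \<omega>" "bounded \<omega>" "connected \<omega>" "lipschitz_domain2 \<omega>"
    and W_borel: "W \<in> borel_measurable borel"
    and W_frame: "\<And>R F. R \<in> SO3 \<Longrightarrow> W (R ** F) = W F"
    and W_zero: "\<And>R. R \<in> SO3 \<Longrightarrow> W R = 0"
    and c_pos: "c > 0"
    and W_coerc: "\<And>F. W F \<ge> ennreal (c * (infdist F SO3)^2)"
    and W_reg: "\<exists>U. open U \<and> SO3 \<subseteq> U \<and> (\<forall>F\<in>U. W F < \<infinity>) \<and> Ck_on 2 U (\<lambda>F. enn2real (W F))"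
    and O_Gh: "\<And>h. h > 0 \<Longrightarrow> Cinf_closure (Omega \<omega>) (Gh h) \<and> (\<forall>x\<in>closure (Omega \<omega>). posdef (Gh h x))"
    and O_Gbar: "Cinf_closure \<omega> Gbar" "\<forall>x'\<in>closure \<omega>. posdef (Gbar x')"
    and O_G1: "Cinf_closure (Omega \<omega>) G1" "\<forall>x\<in>closure (Omega \<omega>). symm (G1 x)"
    and O_G2: "Cinf_closure (Omega \<omega>) G2" "\<forall>x\<in>closure (Omega \<omega>). symm (G2 x)"
    and O_exp: "\<forall>\<epsilon>>0. \<forall>\<^sub>F h in at_right 0. \<forall>x\<in>closure (Omega \<omega>).
        norm (Gh h x - Gbar (proj2 x) - h *\<^sub>R G1 x - (h^2/2) *\<^sub>R G2 x) \<le> \<epsilon> * h^2"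
    and O_G1_mean: "\<forall>x'\<in>closure \<omega>. integral {-1/2..1/2} (\<lambda>t. G1 (pt3 x' t)) = 0"
    and Gb2_def: "Cinf_closure \<omega> Gb2" "\<forall>x'\<in>closure \<omega>. symm (Gb2 x') \<and> blk22 (Gb2 x') = Gb2_22 G2 x'"
    and lim0: "((\<lambda>h. inf_energy W Gh \<omega> h / ennreal (h^2)) \<longlongrightarrow> 0) (at_right 0)"
    and y0_smooth: "Cinf_closure \<omega> y0"
    and y0_isom: "\<forall>x'\<in>\<omega>. transpose (jac y0 x') ** jac y0 x' = blk22 (Gbar x')"
    and y0_b0: "\<forall>x'\<in>\<omega>. symp (transpose (jac y0 x') ** jac (b0 y0 Gbar) x') = (1/2) *\<^sub>R blk22 (Gb1 G1 x')"
  shows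
   "(\<forall>x'\<in>\<omega>. B0 y0 Gbar G2 x' =
       (1/24) *\<^sub>R (\<chi> i j. \<Sum>n\<in>UNIV. \<Sum>p\<in>UNIV. Gbar x' $ n $ p
            * Chr (Geff Gbar G1 Gb2) n (emb i) 3 (pt3 x' 0) * Chr (Geff Gbar G1 Gb2) p (emb j) 3 (pt3 x' 0))
       - (1/4) *\<^sub>R integral {-1/2..1/2} (\<lambda>t. blk22 (G2 (pt3 x' t))))
  \<and> (\<forall>x'\<in>\<omega>. B1 y0 Gbar G1 G2 x' =
       - grad2 (mvec G1) x' + GamPair (Geff Gbar G1 Gb2) (mvec G1 x') x'
       - ((1/2) * integral {-1/2..1/2} (\<lambda>t. (t^2/2) * G1 (pt3 x' t) $ 3 $ 3)) *\<^sub>R Gam3 (Geff Gbar G1 Gb2) x'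
       - (1/4) *\<^sub>R integral {-1/2..1/2} (\<lambda>t. t *\<^sub>R blk22 (G2 (pt3 x' t))))
  \<and> (distQ2 W Gbar \<omega> (II_sym y0 Gbar G1 G2))^2 =
       (distQ2 W Gbar \<omega> (\<lambda>x.
          symp (grad2 (\<lambda>z. oint 0 (x$3) (\<lambda>t. col3 (G1 (pt3 z t)))) (proj2 x))
          - GamPair (Geff Gbar G1 Gb2) (oint 0 (x$3) (\<lambda>t. col3 (G1 (pt3 (proj2 x) t)))) (proj2 x)
          + ((1/2) * oint 0 (x$3) (\<lambda>t. G1 (pt3 (proj2 x) t) $ 3 $ 3)) *\<^sub>R Gam3 (Geff Gbar G1 Gb2) (proj2 x)
          - (1/4) *\<^sub>R blk22 (G2 x)))^2
  \<and> (1/1440) * integral\<^sup>L (lebesgue_on \<omega>) (\<lambda>x'. Q2 W Gbar x'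
         (transpose (jac (b0 y0 Gbar) x') ** jac (b0 y0 Gbar) x' + transpose (jac y0 x') ** jac (dt0 y0 Gbar G1) x'
          - (1/2) *\<^sub>R Gb2_22 G2 x'))
     = (1/1440) * integral\<^sup>L (lebesgue_on \<omega>) (\<lambda>x'. Q2 W Gbar x' (Rmat (Geff Gbar G1 Gb2) x'))
  \<and> (\<forall>V DV P S. W22 \<omega> V DV \<and> weak_partials \<omega> (pvec y0 Gbar DV) P
        \<and> L2_on \<omega> S \<and> (\<forall>x'\<in>\<omega>. symm (S x')) \<longrightarrow>
       I4O W \<omega> y0 Gbar G1 G2 DV P S =
         (1/2) * integral\<^sup>L (lebesgue_on \<omega>) (\<lambda>x'. Q2 W Gbar x'
              (S x' + (1/2) *\<^sub>R (transpose (wgrad DV x') ** wgrad DV x') + B0 y0 Gbar G2 x'))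
       + (1/24) * integral\<^sup>L (lebesgue_on \<omega>) (\<lambda>x'. Q2 W Gbar x'
              (transpose (wgrad DV x') ** jac (b0 y0 Gbar) x' + transpose (jac y0 x') ** wgrad P x'
               + 12 *\<^sub>R B1 y0 Gbar G1 G2 x'))
       + (1/1440) * integral\<^sup>L (lebesgue_on \<omega>) (\<lambda>x'. Q2 W Gbar x'
              (transpose (jac (b0 y0 Gbar) x') ** jac (b0 y0 Gbar) x' + transpose (jac y0 x') ** jac (dt0 y0 Gbar G1) x'
               - (1/2) *\<^sub>R Gb2_22 G2 x'))
       + (1/2) * (distQ2 W Gbar \<omega> (II_sym y0 Gbar G1 G2))^2)
  \<and> ((\<forall>x'\<in>\<omega>. integral {-1/2..1/2} (\<lambda>t. (15*t^2 - 9/4) *\<^sub>R blk22 (G2 (pt3 x' t))) = 0)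
     \<and> (\<forall>x'\<in>\<omega>. (1/4) *\<^sub>R integral {-1/2..1/2} (\<lambda>t. t *\<^sub>R blk22 (G2 (pt3 x' t)))
          + symp (grad2 (mvec G1) x') - GamPair (Geff Gbar G1 Gb2) (mvec G1 x') x'
          + ((1/2) * integral {-1/2..1/2} (\<lambda>t. (t^2/2) * G1 (pt3 x' t) $ 3 $ 3)) *\<^sub>R Gam3 (Geff Gbar G1 Gb2) x' = 0)
     \<longrightarrow> (\<forall>V DV P S. W22 \<omega> V DV \<and> weak_partials \<omega> (pvec y0 Gbar DV) P
        \<and> L2_on \<omega> S \<and> (\<forall>x'\<in>\<omega>. symm (S x')) \<longrightarrow>
         (1/2) * integral\<^sup>L (lebesgue_on \<omega>) (\<lambda>x'. Q2 W Gbar x'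
              (S x' + (1/2) *\<^sub>R (transpose (wgrad DV x') ** wgrad DV x') + B0 y0 Gbar G2 x'))
       + (1/24) * integral\<^sup>L (lebesgue_on \<omega>) (\<lambda>x'. Q2 W Gbar x'
              (transpose (wgrad DV x') ** jac (b0 y0 Gbar) x' + transpose (jac y0 x') ** wgrad P x'
               + 12 *\<^sub>R B1 y0 Gbar G1 G2 x'))
       + (1/1440) * integral\<^sup>L (lebesgue_on \<omega>) (\<lambda>x'. Q2 W Gbar x'
              (transpose (jac (b0 y0 Gbar) x') ** jac (b0 y0 Gbar) x' + transpose (jac y0 x') ** jac (dt0 y0 Gbar G1) x'
               - (1/2) *\<^sub>R Gb2_22 G2 x'))
       = (1/2) * integral\<^sup>L (lebesgue_on \<omega>) (\<lambda>x'. Q2 W Gbar x'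
              (S x' + (1/2) *\<^sub>R (transpose (wgrad DV x') ** wgrad DV x')
               + (1/24) *\<^sub>R (transpose (jac (b0 y0 Gbar) x') ** jac (b0 y0 Gbar) x') - (1/48) *\<^sub>R Gb2_22 G2 x'))
       + (1/24) * integral\<^sup>L (lebesgue_on \<omega>) (\<lambda>x'. Q2 W Gbar x'
              (transpose (jac y0 x') ** wgrad P x' + transpose (wgrad DV x') ** jac (b0 y0 Gbar) x'))
       + (1/1440) * integral\<^sup>L (lebesgue_on \<omega>) (\<lambda>x'. Q2 W Gbar x' (Rmat (Geff Gbar G1 Gb2) x'))))"
proof -
  obtain U where U: "open U" "SO3 \<subseteq> U" "Ck_on 2 U (\<lambda>F. enn2real (W F))" using W_reg by blast
  have psd: "psd_form (Q3b W)" by (rule psd_form_Q3b[OF W_zero U])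
  obtain N \<rho> where geom: "plate_geom \<omega> N \<rho> Gbar G1 G2 Gb2 y0"
    using plate_geom_neighbourhood[OF dom(1,2) O_Gbar O_G1 O_G2 O_G1_mean Gb2_def y0_smooth y0_isom y0_b0] by blast
  have "Cinf_on N Gbar" "closure \<omega> \<subseteq> N" using geom by (auto simp: plate_geom_def)
  then have "continuous_on (closure \<omega>) Gbar" by (blast intro: continuous_on_subset Cinf_on_continuous)
  then have form: "plate_form \<omega> (Q2b W Gbar)"
    by (rule plate_form_Q2b[OF dom(1,2) psd]) (use O_Gbar(2) in blast)
  interpret plate_energy \<omega> N \<rho> Gbar G1 G2 Gb2 y0 W
  proof (intro plate_energy.intro geom form plate_energy_axioms.intro)
    show "Q2b W Gbar z F F = Q2 W Gbar z F" for z F by (rule Q2b_diag[OF psd])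
    show "Q2 W Gbar z (symp F) = Q2 W Gbar z F" if "z \<in> \<omega>" for z F
      by (rule Q2_symp[where W=W, OF psd Q3_add_skew[OF W_zero U]]) (use that O_Gbar(2) closure_subset in auto)
  qed (rule dom(4))
  show ?thesis
  proof (intro conjI)
    show "\<forall>x'\<in>\<omega>. B0 y0 Gbar G2 x' =
       (1/24) *\<^sub>R (\<chi> i j. \<Sum>n\<in>UNIV. \<Sum>p\<in>UNIV. Gbar x' $ n $ p
            * Chr (Geff Gbar G1 Gb2) n (emb i) 3 (pt3 x' 0) * Chr (Geff Gbar G1 Gb2) p (emb j) 3 (pt3 x' 0))
       - (1/4) *\<^sub>R integral {-1/2..1/2} (\<lambda>t. blk22 (G2 (pt3 x' t)))"
      unfolding B0_def by (intro ballI) (simp only: B0_Chr)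
  next
    show "\<forall>x'\<in>\<omega>. B1 y0 Gbar G1 G2 x' =
       - grad2 (mvec G1) x' + GamPair (Geff Gbar G1 Gb2) (mvec G1 x') x'
       - ((1/2) * integral {-1/2..1/2} (\<lambda>t. (t^2/2) * G1 (pt3 x' t) $ 3 $ 3)) *\<^sub>R Gam3 (Geff Gbar G1 Gb2) x'
       - (1/4) *\<^sub>R integral {-1/2..1/2} (\<lambda>t. t *\<^sub>R blk22 (G2 (pt3 x' t)))"
      by (intro ballI B1_Chr)
  next
    show "\<forall>V DV P S. W22 \<omega> V DV \<and> weak_partials \<omega> (pvec y0 Gbar DV) P
        \<and> L2_on \<omega> S \<and> (\<forall>x'\<in>\<omega>. symm (S x')) \<longrightarrow>
       I4O W \<omega> y0 Gbar G1 G2 DV P S =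
         (1/2) * integral\<^sup>L (lebesgue_on \<omega>) (\<lambda>x'. Q2 W Gbar x'
              (S x' + (1/2) *\<^sub>R (transpose (wgrad DV x') ** wgrad DV x') + B0 y0 Gbar G2 x'))
       + (1/24) * integral\<^sup>L (lebesgue_on \<omega>) (\<lambda>x'. Q2 W Gbar x'
              (transpose (wgrad DV x') ** jac (b0 y0 Gbar) x' + transpose (jac y0 x') ** wgrad P x'
               + 12 *\<^sub>R B1 y0 Gbar G1 G2 x'))
       + (1/1440) * integral\<^sup>L (lebesgue_on \<omega>) (\<lambda>x'. Q2 W Gbar x'
              (transpose (jac (b0 y0 Gbar) x') ** jac (b0 y0 Gbar) x' + transpose (jac y0 x') ** jac (dt0 y0 Gbar G1) x'
               - (1/2) *\<^sub>R Gb2_22 G2 x'))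
       + (1/2) * (distQ2 W Gbar \<omega> (II_sym y0 Gbar G1 G2))^2"
      by (intro allI impI) (elim conjE, rule I4O_eq)
  next
    show "(distQ2 W Gbar \<omega> (II_sym y0 Gbar G1 G2))^2 =
       (distQ2 W Gbar \<omega> (\<lambda>x.
          symp (grad2 (\<lambda>z. oint 0 (x$3) (\<lambda>t. col3 (G1 (pt3 z t)))) (proj2 x))
          - GamPair (Geff Gbar G1 Gb2) (oint 0 (x$3) (\<lambda>t. col3 (G1 (pt3 (proj2 x) t)))) (proj2 x)
          + ((1/2) * oint 0 (x$3) (\<lambda>t. G1 (pt3 (proj2 x) t) $ 3 $ 3)) *\<^sub>R Gam3 (Geff Gbar G1 Gb2) (proj2 x)
          - (1/4) *\<^sub>R blk22 (G2 x)))^2"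
      by (simp only: dist_Chr)
  qed (auto simp only: third_curvature three_terms_special)
qed

end
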